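(* Let $P=P(n,m)$ be a uniformly random planar graph on vertex set $[n]$ with $m$ edges, let $L$ be the largest component of $P$ and $S=P\setminus L$ the union of the other components. Assume $m=n/2+s$ with $s=s(n)>0$, $s=o(n)$ and $s^3n^{-2}\to\infty$. Let $r$ be a uniformly random vertex of $P$, $r_L$ a uniformly random vertex of $L$, and $r_S$ a uniformly random vertex of $S$ (in each case first sample $P$, then choose the vertex uniformly from the respective vertex set). Then, in the local weak sense, (i) $(L,r_L)\to \mathcal S$; (ii) $(S,r_S)\to T(1)$; (iii) $(P,r)\to T(1)$.
   Context: Local weak convergence of random rooted graphs $G_n\to G_0$: for every fixed finite rooted graph $(H,r_H)$ and every $\ell\in\mathbb N$, $\Pr[B_\ell(G_n)\cong(H,r_H)]\to\Pr[B_\ell(G_0)\cong(H,r_H)]$, where $B_\ell(H,r)$ is the subgraph induced on vertices at distance at most $\ell$ from the root, rooted at $r$, and $\cong$ is root-preserving isomorphism. $T(c)$ is the Galton–Watson tree with Poisson$(c)$ offspring. The Skeleton tree $\mathcal S$ is obtained by taking independent copies $T_1,T_2,\dots$ of $T(1)$ with roots $r_1,r_2,\dots$, adding the edges $r_1r_2,r_2r_3,\dots$, and rooting at $r_1$. *)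

theory Defs
  imports "HOL-Analysis.Analysis" "HOL-Probability.Probability"
begin

type_synonym 'a rgraph = "'a set \<times> 'a set set \<times> 'a"

definition simple_graph :: "'a set \<Rightarrow> 'a set set \<Rightarrow> bool" where
  "simple_graph V E \<longleftrightarrow> (\<forall>e\<in>E. \<exists>u v. e = {u, v} \<and> u \<noteq> v \<and> u \<in> V \<and> v \<in> V)"

definition finite_rooted_graph :: "'a rgraph \<Rightarrow> bool" where
  "finite_rooted_graph G \<longleftrightarrow> (case G of (V, E, r) \<Rightarrow> finite V \<and> simple_graph V E \<and> r \<in> V)"

definition rooted_iso :: "'a rgraph \<Rightarrow> 'b rgraph \<Rightarrow> bool" where
  "rooted_iso G H \<longleftrightarrow> (case G of (V1, E1, r1) \<Rightarrow> case H of (V2, E2, r2) \<Rightarrow>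
     (\<exists>f. bij_betw f V1 V2 \<and> f r1 = r2 \<and>
          (\<forall>u\<in>V1. \<forall>v\<in>V1. {u, v} \<in> E1 \<longleftrightarrow> {f u, f v} \<in> E2)))"

fun dist_ball :: "'a set \<Rightarrow> 'a set set \<Rightarrow> nat \<Rightarrow> 'a \<Rightarrow> 'a set" where
  "dist_ball V E 0 r = {r} \<inter> V"
| "dist_ball V E (Suc l) r =
     dist_ball V E l r \<union> {v\<in>V. \<exists>u\<in>dist_ball V E l r. {u, v} \<in> E}"

definition induced :: "'a set \<Rightarrow> 'a set set \<Rightarrow> 'a set set" where
  "induced U E = {e\<in>E. e \<subseteq> U}"

definition ball :: "nat \<Rightarrow> 'a rgraph \<Rightarrow> 'a rgraph" where
  "ball l G = (case G of (V, E, r) \<Rightarrow>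
      (dist_ball V E l r, induced (dist_ball V E l r) E, r))"

definition component :: "'a set \<Rightarrow> 'a set set \<Rightarrow> 'a \<Rightarrow> 'a set" where
  "component V E v = {u\<in>V. (v, u) \<in> {(x, y). x \<in> V \<and> y \<in> V \<and> {x, y} \<in> E}\<^sup>*}"

text \<open>Vertex set of the largest component; ties are broken in favour of the component
  containing the smallest vertex (a convention; the largest component is whp unique).\<close>
definition largest_comp :: "nat set \<Rightarrow> nat set set \<Rightarrow> nat set" where
  "largest_comp V E =
     (let M = Max ((\<lambda>v. card (component V E v)) ` V);
          r = Min {v\<in>V. card (component V E v) = M}
      in component V E r)"

definition planar :: "'a set \<Rightarrow> 'a set set \<Rightarrow> bool" where
  "planar V E \<longleftrightarrow>
     (\<exists>(pos :: 'a \<Rightarrow> complex) (\<gamma> :: 'a set \<Rightarrow> real \<Rightarrow> complex).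
        inj_on pos V \<and>
        (\<forall>e\<in>E. arc (\<gamma> e) \<and> {pathstart (\<gamma> e), pathfinish (\<gamma> e)} = pos ` e \<and>
                 path_image (\<gamma> e) \<inter> pos ` V = pos ` e) \<and>
        (\<forall>e\<in>E. \<forall>e'\<in>E. e \<noteq> e' \<longrightarrow>
                 path_image (\<gamma> e) \<inter> path_image (\<gamma> e') \<subseteq> pos ` (e \<inter> e')))"

definition planar_graphs :: "nat \<Rightarrow> nat \<Rightarrow> nat set set set" where
  "planar_graphs n m = {E. simple_graph {1..n} E \<and> card E = m \<and> planar {1..n} E}"

definition prob_P :: "nat \<Rightarrow> nat \<Rightarrow> nat \<Rightarrow> 'b rgraph \<Rightarrow> real" where
  "prob_P n m l H = (1 / real (card (planar_graphs n m))) *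
     (\<Sum>E\<in>planar_graphs n m.
        real (card {v\<in>{1..n}. rooted_iso (ball l ({1..n}, E, v)) H}) / real n)"

definition prob_L :: "nat \<Rightarrow> nat \<Rightarrow> nat \<Rightarrow> 'b rgraph \<Rightarrow> real" where
  "prob_L n m l H = (1 / real (card (planar_graphs n m))) *
     (\<Sum>E\<in>planar_graphs n m.
        (let L = largest_comp {1..n} E in
         real (card {v\<in>L. rooted_iso (ball l (L, induced L E, v)) H}) / real (card L)))"

definition prob_S :: "nat \<Rightarrow> nat \<Rightarrow> nat \<Rightarrow> 'b rgraph \<Rightarrow> real" where
  "prob_S n m l H = (1 / real (card (planar_graphs n m))) *
     (\<Sum>E\<in>planar_graphs n m.
        (let S = {1..n} - largest_comp {1..n} E in
         real (card {v\<in>S. rooted_iso (ball l (S, induced S E, v)) H}) / real (card S)))"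

text \<open>Trees are encoded as Ulam--Harris address sets (sets of nat lists); the root is [],
  the address i # w denotes the vertex w in the subtree of the i-th child of the root,
  so the parent of a non-root address w is butlast w.
  gw_trunc c d is the Poisson(c) Galton--Watson tree T(c) truncated at depth d (the
  first d generations), generated generation by generation.\<close>
fun gw_trunc :: "real \<Rightarrow> nat \<Rightarrow> nat list set pmf" where
  "gw_trunc c 0 = return_pmf {[]}"
| "gw_trunc c (Suc d) =
     do { k \<leftarrow> poisson_pmf c;
          ts \<leftarrow> replicate_pmf k (gw_trunc c d);
          return_pmf (insert [] (\<Union>i<k. (\<lambda>w. i # w) ` (ts ! i))) }"

definition tree_edges :: "nat list set \<Rightarrow> nat list set set" where
  "tree_edges U = {{w, butlast w} | w. w \<in> U \<and> w \<noteq> []}"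

definition gw_ball :: "real \<Rightarrow> nat \<Rightarrow> nat list rgraph pmf" where
  "gw_ball c l = map_pmf (\<lambda>U. ball l (U, tree_edges U, [])) (gw_trunc c l)"

text \<open>Skeleton tree: vertex (i, w) is vertex w of the tree T_(i+1), whose root (i, [])
  is r_(i+1); spine edges join (i, []) and (i+1, []).  The ball of radius l around r_1
  only involves T_1, ..., T_(l+1), each up to depth l, so we take the ball of radius l
  in the finite subgraph spanned by these truncations.\<close>
definition skel_graph :: "nat list set list \<Rightarrow> (nat \<times> nat list) rgraph" where
  "skel_graph Ts =
     ((\<Union>i<length Ts. (\<lambda>w. (i, w)) ` (Ts ! i)),
      (\<Union>i<length Ts. (\<lambda>e. (\<lambda>w. (i, w)) ` e) ` tree_edges (Ts ! i))
        \<union> {{(i, []), (Suc i, [])} | i. Suc i < length Ts},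
      (0, []))"

definition skel_ball :: "nat \<Rightarrow> (nat \<times> nat list) rgraph pmf" where
  "skel_ball l = map_pmf (\<lambda>Ts. ball l (skel_graph Ts)) (replicate_pmf (Suc l) (gw_trunc 1 l))"

end

theory Submission imports Defs begin

text \<open>Throughout, 2m/n tends to 1. Words listing the endpoints of all edges bound the number of planar
graphs with a prescribed degree pattern from above, counting forests bounds it from below, up to a factor
exp(o(n)); so the degrees are close to Poisson(1) with exponentially small error probabilities, and counting
isolated vertices and leaves yields the limits of the ratios of the numbers of planar graphs with neighbouring
parameters. These bound the number of occurrences of each finite tree type from above by its Galton--Watson
probability, which suffices since the limit is a probability distribution (Scheffe). As T(1) is finite, the
largest component L has o(n) vertices, so S behaves like P. For L, a first moment computation shows that its
core contains only few of its vertices; given the core, L is a uniform random forest rooted at the core, which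
Cayley's formula makes explicit: the parents of a random vertex form the spine of the skeleton tree.\<close>

text \<open>A count that is known only up to exp(o(n)) cannot give a ratio such as
  \<open>pc n (m - 1)\<close> to \<open>pc n m\<close> directly. The way out is to prescribe the
  degree of linearly many vertices at once: against (exp(-1)/d!)^(c n) a factor exp(o(n)) is
  negligible, so degree d exceeds its Poisson share only in a negligible class of graphs, and the
  ratios are read off from degrees 0 and 1. Planarity enters only as closure under deletion,
  relabelling, adding isolated vertices and adding leaves; hence forests are planar and hanging
  trees may be rearranged freely. The growth argument for forests works only for 2m/n strictly below
  1, so at the critical density linearly many leaves are hung on a slightly sparser forest. For L,
  everything except the trees hanging from its core is conditioned upon; beyond this, only three
  facts about L enter: its size is unbounded, it is o(n), and the core is a small part of
  it.\<close>

section \<open>Drawings: deleting, relabelling, adding leaves and isolated vertices\<close>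

text \<open>Cut the arc at its last point in the closed disc and start with a radius instead: beyond
  that point the arc stays outside, so the new arc meets the disc in a single radius. This clears
  the disc around a vertex to which a leaf is to be attached.\<close>

lemma arc_redraw_radius:
 fixes g :: "real => complex"
 assumes g: "arc g" and z: "pathstart g = z" and r: "r > 0" and far: "dist z (pathfinish g) > r"
 obtains h q where "arc h" "pathstart h = z" "pathfinish h = pathfinish g" "dist z q = r"
  "q \<in> path_image g" "path_image h \<subseteq> closed_segment z q \<union> (path_image g - cball z r)"
proof -
 define S where "S = {t\<in>{0..1}. dist z (g t) <= r}"
 have cg: "continuous_on {0..1} g" using g arc_imp_path path_def by blast
 have cd: "continuous_on {0..1} (%t. dist z (g t))" by (intro continuous_intros cg)
 have "closed S" unfolding S_def
  by (rule continuous_on_closed_Collect_le[OF cd continuous_on_const closed_atLeastAtMost])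
 moreover have "bounded S" by (rule bounded_subset[of "{0..1}"]) (auto simp: S_def)
 ultimately have "compact S" by (simp add: compact_eq_bounded_closed)
 moreover have g0: "g 0 = z" using z by (simp add: pathstart_def)
 then have "0 \<in> S" using r by (auto simp: S_def)
 ultimately obtain t where t: "t \<in> S" "\<And>s. s \<in> S ==> s <= t" using compact_attains_sup[of S] by blast
 have out: "dist z (g s) > r" if "s \<in> {t<..1}" for s
  using t(2)[of s] that t(1) by (force simp: S_def)
 have t01: "0 <= t" "t <= 1" using t(1) by (auto simp: S_def)
 have t1: "t < 1" using t(1) far t01 by (cases "t = 1") (auto simp: S_def pathfinish_def)
 have dt: "dist z (g t) = r"
 proof (rule ccontr)
  assume "dist z (g t) ~= r"
  then have lt: "dist z (g t) < r" using t(1) by (auto simp: S_def)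
  have "\<exists>s\<ge>t. s <= 1 \<and> dist z (g s) = r"
   by (rule IVT') (use lt far t01 in \<open>auto intro!: continuous_on_subset[OF cd] simp: pathfinish_def less_imp_le\<close>)
  then obtain s where s: "t <= s" "s <= 1" "dist z (g s) = r" by blast
  then have "s \<in> S" using t01 by (auto simp: S_def)
  then have "s = t" using t(2) s by force
  then show False using lt s by simp
 qed
 have t0: "t ~= 0" using dt g0 r by auto
 define q where "q = g t"
 define h where "h = linepath z q +++ subpath t 1 g"
 have qz: "q ~= z" using dt r by (auto simp: q_def)
 have img: "path_image (subpath t 1 g) = insert q (g ` {t<..1})"
 proof -
  have "path_image (subpath t 1 g) = g ` {t..1}" using t1 by (simp add: path_image_subpath)
  moreover have "{t..1} = insert t {t<..1}" using t1 by auto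
  ultimately show ?thesis by (simp add: q_def)
 qed
 have tail: "g ` {t<..1} \<subseteq> path_image g - cball z r"
  using out t01 by (force simp: path_image_def)
 have seg: "closed_segment z q \<subseteq> cball z r"
  using dt r by (intro closed_segment_subset) (auto simp: q_def)
 have arch: "arc h" unfolding h_def
 proof (rule arc_join)
  show "arc (linepath z q)" using qz by simp
  show "arc (subpath t 1 g)" using g t01 t1 by (intro arc_subpath_arc) auto
  show "pathfinish (linepath z q) = pathstart (subpath t 1 g)" by (simp add: q_def)
  show "path_image (linepath z q) \<inter> path_image (subpath t 1 g) \<subseteq> {pathstart (subpath t 1 g)}"
   using img tail seg by (auto simp: q_def)
 qed
 show ?thesis
 proof (rule that[of h q])
  show "path_image h \<subseteq> closed_segment z q \<union> (path_image g - cball z r)"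
  proof -
   have "path_image h = closed_segment z q \<union> path_image (subpath t 1 g)"
    unfolding h_def by (subst path_image_join) (auto simp: q_def)
   then show ?thesis using img tail by auto
  qed
  show "q \<in> path_image g" using t01 by (auto simp: q_def path_image_def)
 qed (use arch dt in \<open>auto simp: h_def q_def pathfinish_def subpath_def joinpaths_def pathstart_def linepath_def\<close>)
qed

lemma radii_Int:
 fixes z :: complex
 assumes "dist z y = r" "dist z q = r" "r > 0" "y ~= q"
 shows "closed_segment z y \<inter> closed_segment z q \<subseteq> {z}"
proof
 fix p assume "p \<in> closed_segment z y \<inter> closed_segment z q"
 then obtain a b where a: "0 <= a" "p = (1 - a) *\<^sub>R z + a *\<^sub>R y" and b: "0 <= b" "p = (1 - b) *\<^sub>R z + b *\<^sub>R q"
  by (auto simp: in_segment)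
 have pa: "p - z = a *\<^sub>R (y - z)" using a by (simp add: algebra_simps)
 have pb: "p - z = b *\<^sub>R (q - z)" using b by (simp add: algebra_simps)
 have "a * r = norm (p - z)" using pa assms a by (simp add: dist_norm norm_minus_commute)
 moreover have "b * r = norm (p - z)" using pb assms b by (simp add: dist_norm norm_minus_commute)
 ultimately have "a = b" using assms(3) by (metis less_irrefl mult_right_cancel)
 then have "a *\<^sub>R (y - z) = a *\<^sub>R (q - z)" using pa pb by metis
 then have "a *\<^sub>R ((y - z) - (q - z)) = 0" by (simp only: scaleR_diff_right) simp
 then have "a = 0 \<or> (y - z) - (q - z) = 0" by (rule scaleR_eq_0_iff[THEN iffD1])
 then have "a = 0" using assms(4) by auto
 then show "p \<in> {z}" using pa by simp
qed

lemma simple_graphD: "simple_graph V E ==> e \<in> E ==> \<exists>u v. e = {u, v} \<and> u ~= v \<and> u \<in> V \<and> v \<in> V"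
 by (auto simp: simple_graph_def)

lemma simple_graph_edgeD: "simple_graph V E ==> {u, v} \<in> E ==> u ~= v \<and> u \<in> V \<and> v \<in> V"
 by (drule (1) simple_graphD) (auto simp: doubleton_eq_iff)

lemma simple_graph_subset: "simple_graph V E ==> e \<in> E ==> e \<subseteq> V"
 by (auto dest!: simple_graphD)

lemma simple_graph_finite: "simple_graph V E ==> finite V ==> finite E"
 by (rule finite_subset[of _ "Pow V"]) (auto dest: simple_graph_subset)

lemma simple_graph_other: "simple_graph V E ==> e \<in> E ==> v \<in> e ==> \<exists>w. e = {v, w} \<and> w ~= v \<and> w \<in> V"
 by (drule (1) simple_graphD) auto

definition drawing :: "'a set => 'a set set => ('a => complex) => ('a set => real => complex) => bool" where
 "drawing V E pos c \<longleftrightarrow> inj_on pos V \<and>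
  (\<forall>e\<in>E. arc (c e) \<and> {pathstart (c e), pathfinish (c e)} = pos ` e \<and>
    path_image (c e) \<inter> pos ` V = pos ` e) \<and>
  (\<forall>e\<in>E. \<forall>e'\<in>E. e ~= e' --> path_image (c e) \<inter> path_image (c e') \<subseteq> pos ` (e \<inter> e'))"

lemma planar_drawing: "planar V E \<longleftrightarrow> (\<exists>pos c. drawing V E pos c)"
 by (simp add: planar_def drawing_def)

text \<open>Around v take a disc that misses all vertices except v and possibly x, and all edges not
  at v; redraw the edges at v as radii inside it. Finitely many radii leave a free point y on the
  circle; x moves to y, and the radius to y is the new edge.\<close>

lemma planar_insert_leaf:
 assumes pl: "planar V E" and sg: "simple_graph V E" and fin: "finite V"
  and x: "x \<in> V" "\<forall>e\<in>E. x \<notin> e" and v: "v \<in> V" "x ~= v"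
 shows "planar V (insert {x, v} E)"
proof -
 from pl obtain pos c where "drawing V E pos c" unfolding planar_drawing by blast
 then have inj: "inj_on pos V"
  and ed: "\<And>e. e\<in>E ==> arc (c e) \<and> {pathstart (c e), pathfinish (c e)} = pos ` e \<and>
         path_image (c e) \<inter> pos ` V = pos ` e"
  and cr: "\<And>e e'. e\<in>E ==> e'\<in>E ==> e ~= e' ==>
         path_image (c e) \<inter> path_image (c e') \<subseteq> pos ` (e \<inter> e')"
  unfolding drawing_def by (blast, blast, metis)
 have finE: "finite E" using sg fin by (rule simple_graph_finite)
 define z where "z = pos v"
 define I where "I = {e\<in>E. v \<in> e}"
 \<comment> \<open>The old position of x is left out: x is isolated and will be moved, so it may lie
   inside the disc.\<close>
 define C where "C = pos ` (V - {x, v}) \<union> (\<Union>e\<in>E - I. path_image (c e))"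
 have "compact (\<Union>e\<in>E - I. path_image (c e))"
  by (rule compact_UN) (use finE ed compact_arc_image in auto)
 then have "compact C" unfolding C_def using fin by (intro compact_Un) (auto intro: finite_imp_compact)
 then have "open (- C)" by (simp add: compact_imp_closed open_Compl)
 moreover have "z \<notin> C"
 proof
  assume "z \<in> C"
  then consider u where "u \<in> V - {x, v}" "z = pos u" | e where "e \<in> E - I" "z \<in> path_image (c e)"
   by (auto simp: C_def)
  then show False
  proof cases
   case 1 then show ?thesis using inj v by (auto simp: z_def inj_on_def)
  next
   case 2
   then have "z \<in> pos ` e" using ed[of e] v by (auto simp: z_def)
   then have "v \<in> e" using inj v simple_graph_subset[OF sg, of e] 2 by (auto simp: z_def inj_on_def)
   then show False using 2 by (auto simp: I_def)
  qed
 qed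
 ultimately obtain r where r: "r > 0" "cball z r \<subseteq> - C" by (meson ComplI open_contains_cball)
 have "\<exists>h q. arc h \<and> pathstart h = z \<and> {pathstart h, pathfinish h} = pos ` e \<and> dist z q = r \<and>
   q \<in> path_image (c e) \<and> path_image h \<subseteq> closed_segment z q \<union> (path_image (c e) - cball z r)" if e: "e \<in> I" for e
 proof -
  obtain w where w: "e = {v, w}" "w ~= v" "w \<in> V" using simple_graph_other[OF sg, of e v] e by (auto simp: I_def)
  \<comment> \<open>Orients the edge away from v.\<close>
  define g where "g = (if pathstart (c e) = z then c e else reversepath (c e))"
  have ee: "e \<in> E" using e by (auto simp: I_def)
  note E = ed[OF ee]
  have g: "arc g" "pathstart g = z" "pathfinish g = pos w" "path_image g = path_image (c e)"
   using E w by (auto simp: g_def arc_reversepath z_def doubleton_eq_iff)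
  have "w ~= x" using x(2) ee w by auto
  then have "pos w \<in> C" using w by (auto simp: C_def)
  then have "dist z (pathfinish g) > r" using r(2) g(3) by force
  from arc_redraw_radius[OF g(1,2) r(1) this] obtain h q where "arc h" "pathstart h = z" "pathfinish h = pathfinish g" "dist z q = r"
  "q \<in> path_image g" "path_image h \<subseteq> closed_segment z q \<union> (path_image g - cball z r)" .
  then show ?thesis using g w E by (intro exI[of _ h] exI[of _ q]) (auto simp: z_def)
 qed
 then obtain h q where hq: "\<And>e. e \<in> I ==> arc (h e) \<and> pathstart (h e) = z \<and> {pathstart (h e), pathfinish (h e)} = pos ` e \<and> dist z (q e) = r \<and>
   q e \<in> path_image (c e) \<and> path_image (h e) \<subseteq> closed_segment z (q e) \<union> (path_image (c e) - cball z r)" by metis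
 \<comment> \<open>A connected set with two different points is infinite.\<close>
 have "infinite (sphere z r)"
 proof
  assume "finite (sphere z r)"
  moreover have "connected (sphere z r)" by (rule connected_sphere) auto
  moreover have "z + of_real r \<in> sphere z r" "z - of_real r \<in> sphere z r" using r by (auto simp: dist_norm)
  ultimately obtain a where "sphere z r = {a}" by (auto simp: connected_finite_iff_sing)
  then have "z + of_real r = z - of_real r" using \<open>z + of_real r \<in> sphere z r\<close> \<open>z - of_real r \<in> sphere z r\<close> by auto
  then have "of_real r + of_real r = (0::complex)" by (simp add: algebra_simps)
  then show False using r by (metis add_eq_0_iff add_pos_pos less_irrefl of_real_add of_real_eq_0_iff)
 qed
 moreover have "finite (q ` I)" using finE by (auto simp: I_def)
 ultimately obtain y where y: "dist z y = r" "y \<notin> q ` I"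
  by (meson mem_sphere finite_subset subsetI)
 define pos' where "pos' = pos(x := y)"
 define c' where "c' = (%e. if e = {x, v} then linepath z y else if e \<in> I then h e else c e)"
 have xvE: "{x, v} \<notin> E" using x by auto
 have pos'E: "pos' ` e = pos ` e" "pos' ` (e \<inter> f) = pos ` (e \<inter> f)" "pos' ` (f \<inter> e) = pos ` (f \<inter> e)" if "e \<in> E" for e f
  using x(2) that by (auto simp: pos'_def)
 \<comment> \<open>Distinct edges at v meet only in z, which does not lie on the circle.\<close>
 have qd: "q e ~= q e'" if "e \<in> I" "e' \<in> I" "e ~= e'" for e e'
 proof
  assume "q e = q e'"
  then have "q e \<in> path_image (c e) \<inter> path_image (c e')" using hq[OF that(1)] hq[OF that(2)] by auto
  then have "q e \<in> pos ` (e \<inter> e')" using that cr[of e e'] by (auto simp: I_def)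
  moreover have "e \<inter> e' \<subseteq> {v}"
   using that simple_graph_other[OF sg, of e v] simple_graph_other[OF sg, of e' v] by (auto simp: I_def)
  ultimately have "q e = z" by (auto simp: z_def)
  then show False using hq[of e] that r by auto
 qed
 have segc: "closed_segment z p \<subseteq> cball z r" if "dist z p = r" for p
  using that r by (intro closed_segment_subset) auto
 have outI: "path_image (c e) \<inter> cball z r = {}" if "e \<in> E" "e \<notin> I" for e
  using r(2) that by (auto simp: C_def)
 have imI: "path_image (c' e) \<subseteq> closed_segment z (q e) \<union> (path_image (c e) - cball z r)" if "e \<in> I" for e
  using hq[OF that] xvE that by (auto simp: c'_def I_def)
 have imO: "path_image (c' e) = path_image (c e)" if "e \<in> E" "e \<notin> I" for e
  using xvE that by (auto simp: c'_def)
 have imN: "path_image (c' {x, v}) = closed_segment z y" by (simp add: c'_def)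
 have zz: "z \<in> pos ` (e \<inter> e')" if "e \<in> I" "e' \<in> I" for e e' using that by (auto simp: I_def z_def)
 have cr1: "path_image (c' {x, v}) \<inter> path_image (c' e) \<subseteq> pos' ` ({x, v} \<inter> e)" if e: "e \<in> E" for e
 proof (cases "e \<in> I")
  case True
  have "closed_segment z y \<inter> closed_segment z (q e) \<subseteq> {z}"
   using radii_Int[of z y r "q e"] y hq[OF True] r True by blast
  then have "path_image (c' {x, v}) \<inter> path_image (c' e) \<subseteq> {z}"
   using imN imI[OF True] segc[OF y(1)] by blast
  moreover have "z \<in> pos' ` ({x, v} \<inter> e)" using True v by (auto simp: I_def z_def pos'_def image_iff)
  ultimately show ?thesis by blast
 next
  case False
  then show ?thesis using imN imO[OF e False] outI[OF e False] segc[OF y(1)] by blast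
 qed
 have cr2: "path_image (c' e) \<inter> path_image (c' e') \<subseteq> pos ` (e \<inter> e')" if e: "e \<in> E" "e' \<in> E" "e ~= e'" "e \<in> I" for e e'
 proof (cases "e' \<in> I")
  case True
  have a: "closed_segment z (q e) \<inter> closed_segment z (q e') \<subseteq> {z}"
   using radii_Int[of z "q e" r "q e'"] hq[OF True] hq[OF e(4)] r qd[OF e(4) True e(3)] by blast
  have b: "closed_segment z (q e) \<subseteq> cball z r" "closed_segment z (q e') \<subseteq> cball z r"
   using segc hq True e by auto
  show ?thesis using a b cr[OF e(1-3)] zz[OF e(4) True] imI[OF True] imI[OF e(4)] by blast
 next
  case False
  have b: "closed_segment z (q e) \<subseteq> cball z r" using segc hq e by auto
  show ?thesis using b cr[OF e(1-3)] imO[OF e(2) False] outI[OF e(2) False] imI[OF e(4)] by blast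
 qed
 have yC: "pos u ~= y" if "u \<in> V" "u ~= x" for u
  using that y(1) r by (cases "u = v") (auto simp: z_def C_def)
 show ?thesis unfolding planar_def
 proof (intro exI[of _ pos'] exI[of _ c'] conjI ballI impI)
  show "inj_on pos' V" using inj yC by (auto simp: inj_on_def pos'_def)
 next
  fix e assume e: "e \<in> insert {x, v} E"
  show "arc (c' e)"
   using e hq ed y r by (auto simp: c'_def)
 next
  fix e assume e: "e \<in> insert {x, v} E"
  show "{pathstart (c' e), pathfinish (c' e)} = pos' ` e"
  proof (cases "e = {x, v}")
   case True then show ?thesis using v by (auto simp: c'_def pos'_def z_def)
  next
   case False
   then have "e \<in> E" using e by simp
   then show ?thesis using hq[of e] ed[of e] pos'E[of e] False by (auto simp: c'_def)
  qed
  then have sub: "pos' ` e \<subseteq> path_image (c' e)" by (metis empty_subsetI insert_subset pathfinish_in_path_image pathstart_in_path_image)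
  have "e \<subseteq> V" using e x v simple_graph_subset[OF sg] by auto
  show "path_image (c' e) \<inter> pos' ` V = pos' ` e"
  proof
   show "pos' ` e \<subseteq> path_image (c' e) \<inter> pos' ` V" using sub \<open>e \<subseteq> V\<close> by auto
   show "path_image (c' e) \<inter> pos' ` V \<subseteq> pos' ` e"
   proof
    fix p assume p: "p \<in> path_image (c' e) \<inter> pos' ` V"
    then obtain u where u: "u \<in> V" "p = pos' u" by auto
    have uC: "pos u \<notin> cball z r" if "u ~= x" "u ~= v" using u that r(2) by (auto simp: C_def)
    consider "e = {x, v}" | "e \<in> E" "e \<in> I" | "e \<in> E" "e \<notin> I" using e by auto
    then show "p \<in> pos' ` e"
    proof cases
     case 1
     then have "p \<in> cball z r" using imN p segc[OF y(1)] by auto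
     then have "u = x \<or> u = v" using u uC by (auto simp: pos'_def split: if_splits)
     then show ?thesis using u 1 by auto
    next
     case 2
     show ?thesis
     proof (cases "u = x")
      case True
      then have "p = y" using u by (simp add: pos'_def)
      then have "y \<in> closed_segment z (q e)" using imI[OF 2(2)] p y(1) by auto
      then have "y \<in> {z}" using radii_Int[of z y r "q e"] y hq[OF 2(2)] r 2 by blast
      then show ?thesis using y r by auto
     next
      case False
      then have pu: "p = pos u" using u by (simp add: pos'_def)
      show ?thesis
      proof (cases "u = v")
       case True then show ?thesis using 2 u by (auto simp: I_def)
      next
       case F: False
       then have "p \<in> path_image (c e)" using uC[OF False F] pu imI[OF 2(2)] p segc hq[OF 2(2)] by blast
       then have "p \<in> pos ` e" using ed[OF 2(1)] pu u by auto
       then show ?thesis using pos'E[OF 2(1)] by simp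
      qed
     qed
    next
     case 3
     then have "p \<notin> cball z r" using imO[OF 3] outI[OF 3] p by blast
     then have "u ~= x" using u y by (auto simp: pos'_def)
     then have "p \<in> pos ` e" using ed[OF 3(1)] imO[OF 3] p u by (auto simp: pos'_def)
     then show ?thesis using pos'E[OF 3(1)] by simp
    qed
   qed
  qed
 next
  fix e e' assume e: "e \<in> insert {x, v} E" "e' \<in> insert {x, v} E" "e ~= e'"
  consider "e = {x, v}" "e' \<in> E" | "e' = {x, v}" "e \<in> E" | "e \<in> E" "e' \<in> E" "e \<in> I" | "e \<in> E" "e' \<in> E" "e' \<in> I"
   | "e \<in> E" "e' \<in> E" "e \<notin> I" "e' \<notin> I" using e by auto
  then show "path_image (c' e) \<inter> path_image (c' e') \<subseteq> pos' ` (e \<inter> e')"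
  proof cases
   case 1 then show ?thesis using cr1 by simp
  next
   case 2 then show ?thesis using cr1[of e] by (simp add: Int_commute)
  next
   case 3 then show ?thesis using cr2[of e e'] e pos'E[of e] by simp
  next
   case 4 then show ?thesis using cr2[of e' e] e pos'E[of e] by (simp add: Int_commute)
  next
   case 5 then show ?thesis using cr[of e e'] e pos'E[of e] imO by simp
  qed
 qed
qed

lemma planar_mono:
 assumes "planar V E" "V' \<subseteq> V" "E' \<subseteq> E" "simple_graph V' E'"
 shows "planar V' E'"
proof -
 from assms(1) obtain pos c where "drawing V E pos c" unfolding planar_drawing by blast
 then have inj: "inj_on pos V"
  and ed: "\<And>e. e\<in>E ==> arc (c e) \<and> {pathstart (c e), pathfinish (c e)} = pos ` e \<and>
         path_image (c e) \<inter> pos ` V = pos ` e"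
  and cr: "\<And>e e'. e\<in>E ==> e'\<in>E ==> e ~= e' ==>
         path_image (c e) \<inter> path_image (c e') \<subseteq> pos ` (e \<inter> e')"
  unfolding drawing_def by (blast, blast, metis)
 have "path_image (c e) \<inter> pos ` V' = pos ` e" if "e \<in> E'" for e
 proof -
  have "e \<subseteq> V'" using that assms simple_graph_subset by blast
  then show ?thesis using ed[of e] that assms by blast
 qed
 then have "drawing V' E' pos c" unfolding drawing_def
  using inj_on_subset[OF inj assms(2)] ed cr assms(3) by (meson subsetD)
 then show ?thesis unfolding planar_drawing by blast
qed

text \<open>The old drawing is compact, hence does not fill the plane; the new vertex goes to any
  free point.\<close>

lemma planar_insert_isolated:
 assumes pl: "planar V E" and sg: "simple_graph V E" and fin: "finite V" and y: "y \<notin> V"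
 shows "planar (insert y V) E"
proof -
 from pl obtain pos c where "drawing V E pos c" unfolding planar_drawing by blast
 then have inj: "inj_on pos V"
  and ed: "\<And>e. e\<in>E ==> arc (c e) \<and> {pathstart (c e), pathfinish (c e)} = pos ` e \<and>
         path_image (c e) \<inter> pos ` V = pos ` e"
  and cr: "\<And>e e'. e\<in>E ==> e'\<in>E ==> e ~= e' ==>
         path_image (c e) \<inter> path_image (c e') \<subseteq> pos ` (e \<inter> e')"
  unfolding drawing_def by (blast, blast, metis)
 define C where "C = pos ` V \<union> (\<Union>e\<in>E. path_image (c e))"
 have "compact (\<Union>e\<in>E. path_image (c e))"
  by (rule compact_UN) (use simple_graph_finite[OF sg fin] ed compact_arc_image in auto)
 then have "compact C" unfolding C_def using fin by (intro compact_Un) (auto intro: finite_imp_compact)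
 then have "bounded C" by (rule compact_imp_bounded)
 then have "C ~= UNIV" using not_bounded_UNIV by metis
 then obtain p where p: "p \<notin> C" by blast
 have ne: "e \<subseteq> V" if "e \<in> E" for e using that sg simple_graph_subset by blast
 have im: "(pos(y := p)) ` e = pos ` e" if "e \<subseteq> V" for e using that y by auto
 show ?thesis unfolding planar_def
 proof (intro exI[of _ "pos(y := p)"] exI[of _ c] conjI ballI impI)
  show "inj_on (pos(y := p)) (insert y V)" using inj p y by (auto simp: inj_on_def C_def)
  fix e assume e: "e \<in> E"
  show "arc (c e)" "{pathstart (c e), pathfinish (c e)} = (pos(y := p)) ` e" using ed[OF e] im[OF ne[OF e]] by auto
  have "(pos(y := p)) ` insert y V = insert p (pos ` V)" using y by (auto simp: image_iff)
  then show "path_image (c e) \<inter> (pos(y := p)) ` insert y V = (pos(y := p)) ` e"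
   using ed[OF e] im[OF ne[OF e]] p e by (auto simp: C_def)
  fix e' assume "e' \<in> E" "e ~= e'"
  then show "path_image (c e) \<inter> path_image (c e') \<subseteq> (pos(y := p)) ` (e \<inter> e')"
   using cr[of e e'] e im[of "e \<inter> e'"] ne[OF e] by (metis le_infI1)
 qed
qed

lemma planar_relabel:
 assumes pl: "planar V E" and sg: "simple_graph V E" and f: "inj_on f V"
 shows "planar (f ` V) ((`) f ` E)"
proof -
 from pl obtain pos c where "drawing V E pos c" unfolding planar_drawing by blast
 then have inj: "inj_on pos V"
  and ed: "\<And>e. e\<in>E ==> arc (c e) \<and> {pathstart (c e), pathfinish (c e)} = pos ` e \<and>
         path_image (c e) \<inter> pos ` V = pos ` e"
  and cr: "\<And>e e'. e\<in>E ==> e'\<in>E ==> e ~= e' ==>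
         path_image (c e) \<inter> path_image (c e') \<subseteq> pos ` (e \<inter> e')"
  unfolding drawing_def by (blast, blast, metis)
 define g where "g = inv_into V f"
 have gf: "g (f u) = u" if "u \<in> V" for u using that f by (simp add: g_def)
 have ne: "e \<subseteq> V" if "e \<in> E" for e using that sg simple_graph_subset by blast
 have gfe: "g ` f ` e = e" if "e \<subseteq> V" for e using that gf by (force simp: image_iff)
 have im: "(pos \<circ> g) ` f ` e = pos ` e" if "e \<subseteq> V" for e using gfe[OF that] by (metis image_comp)
 show ?thesis unfolding planar_def
 proof (intro exI[of _ "pos \<circ> g"] exI[of _ "%e. c (g ` e)"] conjI ballI impI)
  show "inj_on (pos \<circ> g) (f ` V)" using inj gf by (auto simp: inj_on_def)
  fix e assume "e \<in> (`) f ` E"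
  then obtain a where a: "a \<in> E" "e = f ` a" by auto
  show "arc (c (g ` e))" "{pathstart (c (g ` e)), pathfinish (c (g ` e))} = (pos \<circ> g) ` e"
   "path_image (c (g ` e)) \<inter> (pos \<circ> g) ` f ` V = (pos \<circ> g) ` e"
   unfolding a(2) gfe[OF ne[OF a(1)]] im[OF ne[OF a(1)]] im[OF order_refl] using ed[OF a(1)] by auto
  fix e' assume "e' \<in> (`) f ` E" "e ~= e'"
  then obtain b where b: "b \<in> E" "e' = f ` b" "a ~= b" using a by auto
  have "f ` a \<inter> f ` b = f ` (a \<inter> b)" using inj_on_image_Int[OF f, of a b] ne a b by simp
  then show "path_image (c (g ` e)) \<inter> path_image (c (g ` e')) \<subseteq> (pos \<circ> g) ` (e \<inter> e')"
   unfolding a(2) b(2) gfe[OF ne[OF a(1)]] gfe[OF ne[OF b(1)]]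
   using cr[OF a(1) b(1,3)] im[of "a \<inter> b"] ne[OF a(1)] by (metis le_infI1)
 qed
qed

lemma planar_empty: "finite V ==> planar V {}"
proof -
 assume "finite V"
 then obtain f :: "'a => nat" where f: "inj_on f V" using finite_imp_inj_to_nat_seg by blast
 then have "inj_on (%x. of_nat (f x) :: complex) V" by (auto simp: inj_on_def)
 then show ?thesis unfolding planar_def by blast
qed

section \<open>Planar graphs with given numbers of vertices and edges\<close>

text \<open>The vertex set is arbitrary because deleting vertices from {1..n} leaves other sets; by
  \<open>card_pl\<close> only its size matters for counting.\<close>

definition pl :: "'a set => nat => 'a set set set" where
 "pl V m = {E. simple_graph V E \<and> card E = m \<and> planar V E}"

definition pc :: "nat => nat => nat" where
 "pc n m = card (planar_graphs n m)"

definition deg :: "'a set set => 'a => nat" where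
 "deg E x = card {e\<in>E. x \<in> e}"

lemma planar_graphs_pl: "planar_graphs n m = pl {1..n} m"
 by (simp add: planar_graphs_def pl_def)

lemma simple_graph_subsetE: "simple_graph V E ==> F \<subseteq> E ==> simple_graph V F"
 by (auto simp: simple_graph_def)

lemma simple_graph_restrict: "simple_graph V E ==> (\<And>e. e \<in> F ==> e \<in> E \<and> e \<subseteq> W) ==> simple_graph W F"
 unfolding simple_graph_def by (metis insert_subset)

lemma simple_graph_mono: "simple_graph V E ==> V \<subseteq> W ==> simple_graph W E"
 by (rule simple_graph_restrict) (auto dest: simple_graph_subset)

lemma simple_graph_insert: "simple_graph V E ==> x \<in> V ==> y \<in> V ==> x ~= y ==> simple_graph V (insert {x, y} E)"
 unfolding simple_graph_def by blast

lemma finite_simple_graphs: "finite V ==> finite {E. simple_graph V E}"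
 by (rule finite_subset[of _ "Pow (Pow V)"]) (auto dest: simple_graph_subset)

lemma finite_pl: "finite V ==> finite (pl V m)"
 by (rule finite_subset[OF _ finite_simple_graphs[of V]]) (auto simp: pl_def)

lemma finite_plE: "E \<in> pl V m ==> finite V ==> finite E"
 by (auto simp: pl_def intro: simple_graph_finite)

lemma simple_graph_image: "simple_graph V E ==> inj_on f V ==> simple_graph (f ` V) ((`) f ` E)"
 unfolding simple_graph_def
proof (intro ballI)
 fix e assume a: "\<forall>e\<in>E. \<exists>u v. e = {u, v} \<and> u ~= v \<and> u \<in> V \<and> v \<in> V" "inj_on f V" "e \<in> (`) f ` E"
 then obtain u v where "e = f ` {u, v}" "u ~= v" "u \<in> V" "v \<in> V" by fast
 then show "\<exists>u v. e = {u, v} \<and> u ~= v \<and> u \<in> f ` V \<and> v \<in> f ` V"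
  using a(2) by (intro exI[of _ "f u"] exI[of _ "f v"]) (auto dest: inj_onD)
qed

lemma inj_on_image_edges: "inj_on f V ==> simple_graph V E ==> inj_on ((`) f) E"
 by (rule inj_on_subset[OF inj_on_image_Pow]) (auto dest: simple_graph_subset)

lemma pl_image: "inj_on f V ==> E \<in> pl V m ==> (`) f ` E \<in> pl (f ` V) m"
 by (auto simp: pl_def simple_graph_image planar_relabel card_image inj_on_image_edges)

lemma card_pl_le:
 assumes "finite V" "finite W" "card V = card W"
 shows "card (pl V m) <= card (pl W m)"
proof -
 obtain f where f: "bij_betw f V W" using assms by (metis finite_same_card_bij)
 then have i: "inj_on f V" "f ` V = W" by (auto simp: bij_betw_def)
 have "inj_on ((`) ((`) f)) (pl V m)"
  by (rule inj_on_subset[OF inj_on_image_Pow[OF inj_on_image_Pow[OF i(1)]]])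
   (auto simp: pl_def dest: simple_graph_subset)
 moreover have "(`) ((`) f) ` pl V m \<subseteq> pl W m" using pl_image[OF i(1)] i(2) by auto
 ultimately show ?thesis using finite_pl[OF assms(2)] by (metis card_inj_on_le)
qed

lemma card_pl: "finite V ==> card (pl V m) = pc (card V) m"
 unfolding pc_def planar_graphs_pl by (intro antisym card_pl_le) auto

lemma pl_delete:
 assumes "E \<in> pl V m" "F \<subseteq> E" "finite V"
 shows "E - F \<in> pl V (m - card F)"
proof -
 have "finite E" using assms finite_plE by blast
 then show ?thesis using assms
  by (auto simp: pl_def card_Diff_subset finite_subset intro: simple_graph_subsetE planar_mono)
qed

text \<open>Deleting F is injective on the graphs that contain it. The first moment bounds for paths
  and for dense spots rest on this.\<close>

lemma card_pl_superset:
 assumes "finite V"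
 shows "card {E\<in>pl V m. F \<subseteq> E} <= pc (card V) (m - card F)"
proof -
 have "inj_on (%E. E - F) {E\<in>pl V m. F \<subseteq> E}" by (auto simp: inj_on_def)
 moreover have "(%E. E - F) ` {E\<in>pl V m. F \<subseteq> E} \<subseteq> pl V (m - card F)" using pl_delete assms by auto
 ultimately have "card {E\<in>pl V m. F \<subseteq> E} <= card (pl V (m - card F))"
  using finite_pl[OF assms] by (metis card_inj_on_le)
 then show ?thesis using card_pl[OF assms] by simp
qed

lemma pl_remove_vertices:
 assumes "E \<in> pl V m" "finite V"
 shows "{e\<in>E. e \<inter> X = {}} \<in> pl (V - X) (m - card {e\<in>E. e \<inter> X ~= {}})"
proof -
 have fE: "finite E" using assms finite_plE by blast
 have sgE: "simple_graph V E" using assms(1) by (simp add: pl_def)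
 have sg: "simple_graph (V - X) {e\<in>E. e \<inter> X = {}}"
  by (rule simple_graph_restrict[OF sgE]) (use simple_graph_subset[OF sgE] in blast)
 moreover have "planar (V - X) {e\<in>E. e \<inter> X = {}}"
  by (rule planar_mono[of V E, OF _ _ _ sg]) (use assms(1) in \<open>auto simp: pl_def\<close>)
 moreover have "card {e\<in>E. e \<inter> X = {}} = m - card {e\<in>E. e \<inter> X ~= {}}"
 proof -
  have "{e\<in>E. e \<inter> X = {}} = E - {e\<in>E. e \<inter> X ~= {}}" by auto
  then have "card {e\<in>E. e \<inter> X = {}} = card (E - {e\<in>E. e \<inter> X ~= {}})" by (rule arg_cong)
  also have "... = card E - card {e\<in>E. e \<inter> X ~= {}}" by (rule card_Diff_subset) (use fE in auto)
  finally show ?thesis using assms(1) by (simp add: pl_def)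
 qed
 ultimately show ?thesis by (simp add: pl_def)
qed

lemma pl_isolated:
 assumes "finite V" "x \<in> V"
 shows "{E\<in>pl V m. \<forall>e\<in>E. x \<notin> e} = pl (V - {x}) m"
proof (intro equalityI subsetI)
 fix E assume E: "E \<in> {E\<in>pl V m. \<forall>e\<in>E. x \<notin> e}"
 then have sgE: "simple_graph V E" by (simp add: pl_def)
 have s: "simple_graph (V - {x}) E"
  by (rule simple_graph_restrict[OF sgE]) (use simple_graph_subset[OF sgE] E in blast)
 have "planar (V - {x}) E" by (rule planar_mono[of V E, OF _ _ _ s]) (use E in \<open>auto simp: pl_def\<close>)
 then show "E \<in> pl (V - {x}) m" using E s by (simp add: pl_def)
next
 fix E assume E: "E \<in> pl (V - {x}) m"
 then have "planar (insert x (V - {x})) E" using assms by (intro planar_insert_isolated) (auto simp: pl_def)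
 moreover have "insert x (V - {x}) = V" using assms by auto
 ultimately show "E \<in> {E\<in>pl V m. \<forall>e\<in>E. x \<notin> e}"
  using E by (auto simp: pl_def dest: simple_graph_subset intro: simple_graph_mono)
qed

lemma deg_0_iff: "finite E ==> deg E x = 0 \<longleftrightarrow> (\<forall>e\<in>E. x \<notin> e)"
 by (auto simp: deg_def)

lemma card_isolated:
 assumes "finite V" "x \<in> V"
 shows "card {E\<in>pl V m. deg E x = 0} = pc (card V - 1) m"
proof -
 have "{E\<in>pl V m. deg E x = 0} = {E\<in>pl V m. \<forall>e\<in>E. x \<notin> e}"
  using deg_0_iff[OF finite_plE[OF _ assms(1)]] by blast
 then show ?thesis using pl_isolated[OF assms, of m] card_pl[of "V - {x}" m] assms by simp
qed

lemma pl_insert_leaf: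
 assumes "finite V" "x \<in> V" "y \<in> V" "y ~= x" "E \<in> pl V m" "\<forall>e\<in>E. x \<notin> e"
 shows "insert {x, y} E \<in> pl V (Suc m)"
proof -
 have "{x, y} \<notin> E" using assms by auto
 then have "card (insert {x, y} E) = Suc m" using assms finite_plE[OF assms(5)] by (simp add: pl_def)
 then show ?thesis using assms planar_insert_leaf[of V E x y] simple_graph_insert[of V E x y]
  by (auto simp: pl_def)
qed

text \<open>A graph on V - {x} may receive x as a leaf at any of its vertices, and the result
  determines both the neighbour and the graph.\<close>

lemma card_leaf:
 assumes "finite V" "x \<in> V"
 shows "(card V - 1) * pc (card V - 1) m <= card {E\<in>pl V (Suc m). deg E x = 1}"
proof -
 let ?D = "(V - {x}) \<times> pl (V - {x}) m"
 let ?f = "%(y, E). insert {x, y} E"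
 have nx: "\<forall>e\<in>E. x \<notin> e" if "E \<in> pl (V - {x}) m" for E
  using that by (auto simp: pl_def dest: simple_graph_subset)
 have "inj_on ?f ?D"
 proof (rule inj_onI)
  fix p q assume pq: "p \<in> ?D" "q \<in> ?D" "?f p = ?f q"
  obtain y E z F where [simp]: "p = (y, E)" "q = (z, F)" by (cases p, cases q)
  have a: "y \<in> V" "z \<in> V" "y ~= x" "z ~= x" "E \<in> pl (V - {x}) m" "F \<in> pl (V - {x}) m"
   and eq: "insert {x, y} E = insert {x, z} F" using pq by auto
  have "{x, y} \<in> insert {x, z} F" using eq by blast
  then have "y = z" using nx[OF a(6)] a by (auto simp: doubleton_eq_iff)
  moreover have "E = F" using eq nx[OF a(5)] nx[OF a(6)] calculation by (metis Diff_insert_absorb insertI1)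
  ultimately show "p = q" by simp
 qed
 moreover have "?f ` ?D \<subseteq> {E\<in>pl V (Suc m). deg E x = 1}"
 proof
  fix G assume "G \<in> ?f ` ?D"
  then obtain y E where G: "G = insert {x, y} E" and a: "y \<in> V" "y ~= x" "E \<in> pl (V - {x}) m" by auto
  have "E \<in> pl V m" using pl_isolated[OF assms, of m] a by auto
  moreover have "{e \<in> insert {x, y} E. x \<in> e} = {{x, y}}" using nx[OF a(3)] by auto
  ultimately show "G \<in> {E\<in>pl V (Suc m). deg E x = 1}" unfolding G
   using pl_insert_leaf[of V x y E m] assms a nx[OF a(3)] by (simp add: deg_def)
 qed
 ultimately have "card ?D <= card {E\<in>pl V (Suc m). deg E x = 1}"
  using finite_pl[OF assms(1)] by (intro card_inj_on_le) auto
 then show ?thesis using assms card_pl[of "V - {x}" m] by (simp add: card_cartesian_product)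
qed

lemma pc_Suc_Suc: "n * pc n m <= pc (Suc n) (Suc m)"
proof -
 have "n * pc n m <= card {E\<in>pl {1..Suc n} (Suc m). deg E 1 = 1}" using card_leaf[of "{1..Suc n}" 1 m] by simp
 also have "... <= card (pl {1..Suc n} (Suc m))" by (rule card_mono) (auto intro: finite_pl)
 finally show ?thesis by (simp add: card_pl)
qed

section \<open>Graphs encoded as words of edge ends\<close>

text \<open>A code lists the edges in some order and each edge in some direction, so a graph with m
  edges has 2^m m! codes, and v occurs \<open>deg E v\<close> times in each of them. Degree
  conditions become conditions on letter counts, as in the configuration model.\<close>

fun codes :: "'a list => 'a set set => bool" where
 "codes [] E = (E = {})"
| "codes [x] E = False"
| "codes (x # y # w) E = (x ~= y \<and> {x, y} \<in> E \<and> codes w (E - {{x, y}}))"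

lemma codes_length: "codes w E ==> finite E ==> length w = 2 * card E"
proof (induction w E rule: codes.induct)
 case (3 x y w E)
 then have "card E = Suc (card (E - {{x, y}}))" by (metis card.remove codes.simps(3))
 then show ?case using 3 by simp
qed auto

lemma codes_set: "codes w E ==> set w \<subseteq> \<Union>E"
 by (induction w E rule: codes.induct) auto

lemma codes_unique: "codes w E ==> codes w F ==> E = F"
proof (induction w E arbitrary: F rule: codes.induct)
 case (3 x y w E)
 then have "E - {{x, y}} = F - {{x, y}}" by simp
 then show ?case using 3 by auto
qed auto

lemma codes_count: "codes w E ==> finite E ==> count_list w v = deg E v"
proof (induction w E rule: codes.induct)
 case (3 x y w E)
 then have e: "{x, y} \<in> E" "x ~= y" by auto
 have IH: "count_list w v = deg (E - {{x, y}}) v" using 3 by simp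
 have "{e \<in> E. v \<in> e} = (if v \<in> {x, y} then {{x, y}} else {}) \<union> {e \<in> E - {{x, y}}. v \<in> e}" using e by auto
 moreover have "card ... = (if v \<in> {x, y} then 1 else 0) + deg (E - {{x, y}}) v"
  using 3(3) by (subst card_Un_disjoint) (auto simp: deg_def)
 ultimately have "deg E v = (if v \<in> {x, y} then 1 else 0) + deg (E - {{x, y}}) v" by (simp add: deg_def)
 then show ?case using IH e by auto
qed (auto simp: deg_def)

lemma card_ordered_edges:
 assumes "simple_graph V E" "finite E"
 shows "finite {(x, y). {x, y} \<in> E} \<and> card {(x, y). {x, y} \<in> E} = 2 * card E"
proof -
 define h where "h = (%e::'a set. {(x, y). {x, y} = e})"
 have h2: "finite (h e) \<and> card (h e) = 2" if ee: "e \<in> E" for e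
 proof -
  obtain u v where uv: "e = {u, v}" "u ~= v" using simple_graphD[OF assms(1) ee] by blast
  then have "h e = {(u, v), (v, u)}" by (auto simp: h_def doubleton_eq_iff)
  then show ?thesis using uv by simp
 qed
 have Pu: "{(x, y). {x, y} \<in> E} = (\<Union>e\<in>E. h e)" by (auto simp: h_def)
 have "card (\<Union>e\<in>E. h e) = (\<Sum>e\<in>E. card (h e))"
  by (rule card_UN_disjoint) (use h2 assms in \<open>auto simp: h_def\<close>)
 then show ?thesis unfolding Pu using h2 assms by auto
qed

text \<open>The first two letters are one of the 2(m + 1) directed edges; the rest codes the graph
  without that edge.\<close>

lemma card_codes: "simple_graph V E ==> finite E ==> card E = m ==> finite {w. codes w E} \<and> card {w. codes w E} = 2 ^ m * fact m"
proof (induction m arbitrary: E)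
 case 0
 then have "E = {}" by simp
 moreover have "codes w {} \<longleftrightarrow> w = []" for w :: "'a list" by (cases "(w, {} :: 'a set set)" rule: codes.cases) auto
 ultimately show ?case by simp
next
 case (Suc m)
 define P where "P = {(x, y). {x, y} \<in> E}"
 have cP: "finite P" "card P = 2 * Suc m"
  using card_ordered_edges[OF Suc.prems(1,2)] Suc.prems(3) by (auto simp: P_def)
 have Pne: "x ~= y" if "(x, y) \<in> P" for x y
  using that simple_graph_edgeD[OF Suc.prems(1), of x y] by (auto simp: P_def)
 have IH: "finite {w. codes w (E - {e})} \<and> card {w. codes w (E - {e})} = 2 ^ m * fact m" if "e \<in> E" for e
  by (rule Suc.IH) (use Suc.prems that simple_graph_subsetE[OF Suc.prems(1), of "E - {e}"] in auto)
 let ?S = "SIGMA p:P. {w. codes w (E - {{fst p, snd p}})}"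
 have eq: "{w. codes w E} = (%(p, w). fst p # snd p # w) ` ?S"
 proof (intro equalityI subsetI)
  fix w assume w: "w \<in> {w. codes w E}"
  have "w ~= []" using w Suc.prems by auto
  then obtain x y u where xy: "w = x # y # u" using w by (cases "(w, E)" rule: codes.cases) auto
  then have "((x, y), u) \<in> ?S" using w by (auto simp: P_def)
  then show "w \<in> (%(p, w). fst p # snd p # w) ` ?S" using xy by (force simp: image_iff)
 qed (use Pne in \<open>auto simp: P_def\<close>)
 have fS: "finite ?S" using cP IH by (intro finite_SigmaI) (auto simp: P_def)
 have inj: "inj_on (%(p, w). fst p # snd p # w) ?S" by (auto simp: inj_on_def)
 have "card ?S = (\<Sum>p\<in>P. card {w. codes w (E - {{fst p, snd p}})})"
  by (rule card_SigmaI) (use cP IH in \<open>auto simp: P_def\<close>)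
 also have "... = (\<Sum>p\<in>P. 2 ^ m * fact m)" by (rule sum.cong) (use IH in \<open>auto simp: P_def\<close>)
 finally have "card ?S = 2 ^ Suc m * fact (Suc m)" using cP by (simp add: algebra_simps)
 then show ?case unfolding eq using fS card_image[OF inj] by simp
qed

text \<open>A code determines its graph, so different graphs occupy disjoint sets of 2^m m! words
  each.\<close>

lemma graphs_le_words:
 assumes "finite V" "\<And>E. E \<in> G ==> simple_graph V E \<and> card E = m" "finite W"
  "\<And>E w. E \<in> G ==> codes w E ==> w \<in> W"
 shows "card G * (2 ^ m * fact m) <= card W"
proof -
 have fG: "finite G" by (rule finite_subset[OF _ finite_simple_graphs[OF assms(1)]]) (use assms in auto)
 have c: "finite {w. codes w E} \<and> card {w. codes w E} = 2 ^ m * fact m" if "E \<in> G" for E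
  using assms(1,2) that by (intro card_codes[of V]) (auto intro: simple_graph_finite)
 have "card (\<Union>E\<in>G. {w. codes w E}) = (\<Sum>E\<in>G. card {w. codes w E})"
  by (rule card_UN_disjoint) (use fG c codes_unique in blast)+
 also have "... = card G * (2 ^ m * fact m)" using c by simp
 finally show ?thesis using assms(3,4) by (metis (no_types, lifting) UN_least card_mono mem_Collect_eq subsetI)
qed

text \<open>\<open>J v\<close> is the set of allowed multiplicities of the letter v, that is, of
  allowed degrees.\<close>

definition words :: "'a set => ('a => nat set) => nat => 'a list set" where
 "words V J L = {w. length w = L \<and> set w \<subseteq> V \<and> (\<forall>v\<in>V. count_list w v \<in> J v)}"

lemma finite_words: "finite V ==> finite (words V J L)"
 by (rule finite_subset[OF _ finite_lists_length_eq[of V L]]) (auto simp: words_def)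

text \<open>The positions of a can be chosen independently of the word that remains after filtering.
  Q is an arbitrary predicate because the induction strips a first letter b, which turns Q into
  \<open>%w. Q (b # w)\<close>.\<close>

lemma card_words_insert_letter:
 assumes "finite V" "a \<notin> V"
 shows "card {w. length w = L \<and> set w \<subseteq> insert a V \<and> count_list w a = j \<and> Q (filter (%u. u ~= a) w)}
  = (L choose j) * card {w. length w = L - j \<and> set w \<subseteq> V \<and> Q w}"
proof (induction L arbitrary: j Q)
 case 0
 have "{w. length w = 0 \<and> set w \<subseteq> insert a V \<and> count_list w a = j \<and> Q (filter (%u. u ~= a) w)} = (if j = 0 \<and> Q [] then {[]} else {})"
  by auto
 moreover have "{w. length w = 0 - j \<and> set w \<subseteq> V \<and> Q w} = (if Q [] then {[]} else {})" by auto
 ultimately show ?case by (cases j) auto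
next
 case (Suc L)
 let ?N = "%L j Q. {w. length w = L \<and> set w \<subseteq> insert a V \<and> count_list w a = j \<and> Q (filter (%u. u ~= a) w)}"
 let ?M = "%L Q. {w. length w = L \<and> set w \<subseteq> V \<and> Q w}"
 have fN: "finite (?N L j Q)" for L j Q
  by (rule finite_subset[OF _ finite_lists_length_eq[of "insert a V" L]]) (use assms in auto)
 have fM: "finite (?M L Q)" for L Q
  by (rule finite_subset[OF _ finite_lists_length_eq[of V L]]) (use assms in auto)
 have M: "card (?M (Suc L) Q) = (\<Sum>b\<in>V. card (?M L (%w. Q (b # w))))" for L Q
 proof -
  have "?M (Suc L) Q = (\<Union>b\<in>V. (#) b ` ?M L (%w. Q (b # w)))"
   by (auto simp: length_Suc_conv image_iff)
  moreover have "card (\<Union>b\<in>V. (#) b ` ?M L (%w. Q (b # w))) = (\<Sum>b\<in>V. card ((#) b ` ?M L (%w. Q (b # w))))"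
   by (rule card_UN_disjoint) (use fM assms(1) in auto)
  ultimately show ?thesis by (simp add: card_image)
 qed
 have N: "card (?N (Suc L) j Q) = (if j = 0 then 0 else card (?N L (j - 1) Q)) + (\<Sum>b\<in>V. card (?N L j (%w. Q (b # w))))" for j
 proof -
  let ?A = "if j = 0 then {} else (#) a ` ?N L (j - 1) Q"
  let ?B = "\<Union>b\<in>V. (#) b ` ?N L j (%w. Q (b # w))"
  have "?N (Suc L) j Q = ?A \<union> ?B"
   using assms(2) by (auto simp: length_Suc_conv image_iff split: if_splits)
  moreover have "?A \<inter> ?B = {}" using assms(2) by auto
  moreover have "card ?B = (\<Sum>b\<in>V. card ((#) b ` ?N L j (%w. Q (b # w))))"
   by (rule card_UN_disjoint) (use fN[of L j "%w. Q (_ # w)"] assms(1) in auto)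
  moreover have "finite ?A" "finite ?B" using fN fN[of L j "%w. Q (_ # w)"] assms(1) by auto
  ultimately show ?thesis by (simp add: card_Un_disjoint card_image)
 qed
 show ?case
 proof (cases "j = 0")
  case True
  then show ?thesis using N[of j] M[of L Q] Suc.IH[of 0 "%w. Q (_ # w)"] by simp
 next
  case False
  then obtain i where j: "j = Suc i" by (cases j) auto
  have "card (?N (Suc L) j Q) = (L choose i) * card (?M (L - i) Q) + (L choose j) * (\<Sum>b\<in>V. card (?M (L - j) (%w. Q (b # w))))"
   using N[of j] Suc.IH[of i Q] Suc.IH[of j "%w. Q (_ # w)"] j by (simp add: sum_distrib_left)
  also have "... = (Suc L choose j) * card (?M (Suc L - j) Q)"
  proof (cases "j <= L")
   case True
   then have "L - i = Suc (L - j)" using j by simp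
   then show ?thesis using M[of "L - j" Q] j True by (simp add: algebra_simps Suc_diff_le)
  next
   case False
   then show ?thesis using j by (simp add: binomial_eq_0)
  qed
  finally show ?thesis .
 qed
qed

lemma count_list_filter_neq: "v ~= a ==> count_list (filter (%u. u ~= a) w) v = count_list w v"
 by (induction w) auto

text \<open>The exponential generating function bound: the coefficient of a power series with
 nonnegative coefficients is at most its value at x divided by the power of x.\<close>

lemma card_words_le:
 assumes "finite V" "x > (0::real)" "\<And>v k. v \<in> V ==> (\<Sum>j\<in>{..k} \<inter> J v. x ^ j / fact j) <= F v"
 shows "real (card (words V J L)) <= fact L / x ^ L * (\<Prod>v\<in>V. F v)"
 using assms(1,3)
proof (induction V arbitrary: L rule: finite_induct)
 case empty
 have "words {} J L = (if L = 0 then {[]} else {})" by (auto simp: words_def)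
 then show ?case using assms(2) by auto
next
 case (insert a V)
 have P0: "(\<Prod>v\<in>V. F v) \<ge> 0"
 proof (rule prod_nonneg)
  fix v assume "v \<in> V"
  have "0 <= (\<Sum>j\<in>{..0} \<inter> J v. x ^ j / fact j)" using assms(2) by (intro sum_nonneg) auto
  then show "0 <= F v" using insert.prems[of v 0] \<open>v \<in> V\<close> by simp
 qed
 let ?N = "%j. {w. length w = L \<and> set w \<subseteq> insert a V \<and> count_list w a = j \<and> filter (%u. u ~= a) w \<in> {u. \<forall>v\<in>V. count_list u v \<in> J v}}"
 have sub: "words (insert a V) J L \<subseteq> (\<Union>j\<in>{..L} \<inter> J a. ?N j)"
 proof
  fix w assume w: "w \<in> words (insert a V) J L"
  have "\<forall>v\<in>V. count_list (filter (%u. u ~= a) w) v = count_list w v"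
   using insert.hyps(2) count_list_filter_neq by metis
  moreover have "count_list w a <= L" using w count_le_length[of w a] by (auto simp: words_def)
  ultimately show "w \<in> (\<Union>j\<in>{..L} \<inter> J a. ?N j)" using w by (auto simp: words_def)
 qed
 have fN: "finite (?N j)" for j
  by (rule finite_subset[OF _ finite_lists_length_eq[of "insert a V" L]]) (use insert in auto)
 have "card (words (insert a V) J L) <= card (\<Union>j\<in>{..L} \<inter> J a. ?N j)"
  using fN by (intro card_mono sub) auto
 also have "... <= (\<Sum>j\<in>{..L} \<inter> J a. card (?N j))" by (rule card_UN_le) auto
 also have "... = (\<Sum>j\<in>{..L} \<inter> J a. (L choose j) * card (words V J (L - j)))"
  using card_words_insert_letter[OF insert.hyps, of L _ "%u. u \<in> {u. \<forall>v\<in>V. count_list u v \<in> J v}"]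
  by (simp add: words_def)
 finally have "real (card (words (insert a V) J L)) <= (\<Sum>j\<in>{..L} \<inter> J a. real (L choose j) * real (card (words V J (L - j))))"
  by (metis (mono_tags, lifting) of_nat_le_iff of_nat_mult of_nat_sum sum.cong)
 also have "... <= (\<Sum>j\<in>{..L} \<inter> J a. fact L / x ^ L * (\<Prod>v\<in>V. F v) * (x ^ j / fact j))"
 proof (rule sum_mono)
  fix j assume j: "j \<in> {..L} \<inter> J a"
  have "real (L choose j) * real (card (words V J (L - j))) <= real (L choose j) * (fact (L - j) / x ^ (L - j) * (\<Prod>v\<in>V. F v))"
   using insert.IH insert.prems by (intro mult_left_mono) auto
  also have "... = fact L / x ^ L * (\<Prod>v\<in>V. F v) * (x ^ j / fact j)"
  proof -
   have "real (L choose j) = fact L / (fact j * fact (L - j))" using j by (simp add: binomial_fact)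
   moreover have "x ^ (L - j) = x ^ L / x ^ j" using j assms(2) by (simp add: power_diff)
   ultimately show ?thesis using assms(2) by (simp add: field_simps)
  qed
  finally show "real (L choose j) * real (card (words V J (L - j))) <= fact L / x ^ L * (\<Prod>v\<in>V. F v) * (x ^ j / fact j)" .
 qed
 also have "... = fact L / x ^ L * (\<Prod>v\<in>V. F v) * (\<Sum>j\<in>{..L} \<inter> J a. x ^ j / fact j)" by (simp add: sum_distrib_left)
 also have "... <= fact L / x ^ L * (\<Prod>v\<in>V. F v) * F a"
  using insert.prems P0 assms(2) by (intro mult_left_mono) auto
 finally show ?case using insert by (simp add: mult.commute mult.left_commute)
qed

section \<open>Forests: planarity and a lower bound for their number\<close>

definition adj :: "'a set set => ('a \<times> 'a) set" where
 "adj E = {(x, y). {x, y} \<in> E}"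

lemma adj_mono: "E \<subseteq> F ==> adj E \<subseteq> adj F"
 by (auto simp: adj_def)

lemma sym_adj: "sym (adj E)"
 by (auto simp: adj_def sym_def insert_commute)

lemma adj_rtrancl_sym: "(x, y) \<in> (adj E)\<^sup>* ==> (y, x) \<in> (adj E)\<^sup>*"
 using sym_rtrancl[OF sym_adj] by (metis symD)

lemma adj_rtrancl_mono: "E \<subseteq> F ==> (x, y) \<in> (adj E)\<^sup>* ==> (x, y) \<in> (adj F)\<^sup>*"
 using rtrancl_mono[OF adj_mono] by blast

text \<open>Every edge is a bridge. This form of acyclicity passes to subsets and can be checked one
  edge at a time.\<close>

definition forest :: "'a set set => bool" where
 "forest E \<longleftrightarrow> (\<forall>x y. {x, y} \<in> E --> (x, y) \<notin> (adj (E - {{x, y}}))\<^sup>*)"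

lemma forest_subset: "forest E ==> F \<subseteq> E ==> forest F"
 unfolding forest_def
proof (intro allI impI notI)
 fix x y assume a: "\<forall>x y. {x, y} \<in> E --> (x, y) \<notin> (adj (E - {{x, y}}))\<^sup>*" "F \<subseteq> E" "{x, y} \<in> F"
  and c: "(x, y) \<in> (adj (F - {{x, y}}))\<^sup>*"
 have "F - {{x, y}} \<subseteq> E - {{x, y}}" using a by blast
 from adj_rtrancl_mono[OF this c] show False using a by blast
qed

lemma adj_insert_rtrancl:
 "(a, b) \<in> (adj (insert {u, v} F))\<^sup>* ==> (a, b) \<in> (adj F)\<^sup>* \<or>
   (a, u) \<in> (adj F)\<^sup>* \<and> (v, b) \<in> (adj F)\<^sup>* \<or> (a, v) \<in> (adj F)\<^sup>* \<and> (u, b) \<in> (adj F)\<^sup>*"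
proof (induction rule: rtrancl_induct)
 case (step y z)
 show ?case
 proof (cases "(y, z) \<in> adj F")
  case True
  then show ?thesis using step.IH by (meson rtrancl.rtrancl_into_rtrancl)
 next
  case False
  then have "{y, z} = {u, v}" using step.hyps(2) by (auto simp: adj_def)
  then have "y = u \<and> z = v \<or> y = v \<and> z = u" by (auto simp: doubleton_eq_iff)
  then show ?thesis using step.IH by auto
 qed
qed auto

lemma forest_insert:
 assumes "forest E" "(u, v) \<notin> (adj E)\<^sup>*"
 shows "forest (insert {u, v} E)"
 unfolding forest_def
proof (intro allI impI notI)
 fix x y assume xy: "{x, y} \<in> insert {u, v} E" and con: "(x, y) \<in> (adj (insert {u, v} E - {{x, y}}))\<^sup>*"
 show False
 proof (cases "{x, y} = {u, v}")
  case True
  then have "(x, y) \<in> (adj E)\<^sup>*" using con by (auto intro: adj_rtrancl_mono[rotated])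
  moreover have "x = u \<and> y = v \<or> x = v \<and> y = u" using True by (auto simp: doubleton_eq_iff)
  ultimately show False using assms(2) adj_rtrancl_sym by metis
 next
  case False
  let ?F = "E - {{x, y}}"
  have xE: "{x, y} \<in> E" using xy False by simp
  have "insert {u, v} E - {{x, y}} = insert {u, v} ?F" using False by auto
  then have "(x, y) \<in> (adj (insert {u, v} ?F))\<^sup>*" using con by simp
  from adj_insert_rtrancl[OF this]
  have "(x, u) \<in> (adj ?F)\<^sup>* \<and> (v, y) \<in> (adj ?F)\<^sup>* \<or> (x, v) \<in> (adj ?F)\<^sup>* \<and> (u, y) \<in> (adj ?F)\<^sup>*"
   using assms(1) xE by (auto simp: forest_def)
  then have *: "(x, u) \<in> (adj E)\<^sup>* \<and> (v, y) \<in> (adj E)\<^sup>* \<or> (x, v) \<in> (adj E)\<^sup>* \<and> (u, y) \<in> (adj E)\<^sup>*"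
   using adj_rtrancl_mono[of ?F E] by blast
  have "(x, y) \<in> (adj E)\<^sup>*" "(y, x) \<in> (adj E)\<^sup>*" using xE by (auto simp: adj_def insert_commute)
  then have "(u, v) \<in> (adj E)\<^sup>*" using * adj_rtrancl_sym rtrancl_trans by metis
  then show False using assms(2) by simp
 qed
qed

text \<open>Among all directed edges (u, v) take one whose far side \<open>C u v\<close>, the set of
  vertices reachable from v without that edge, is smallest. A further edge from v to some w would
  have its far side \<open>C v w\<close> strictly inside, since v is missing there.\<close>

lemma forest_leaf:
 assumes "finite V" "simple_graph V E" "forest E" "E ~= {}"
 obtains u v where "{u, v} \<in> E" "u ~= v" "\<And>e. e \<in> E ==> v \<in> e ==> e = {u, v}"
proof -
 define C where "C = (%u v. {z\<in>V. (v, z) \<in> (adj (E - {{u, v}}))\<^sup>*})"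
 have "\<exists>p. {fst p, snd p} \<in> E" using assms(2,4) simple_graphD by (metis all_not_in_conv fst_conv snd_conv)
 then obtain p where p: "{fst p, snd p} \<in> E"
  and least: "\<And>q. {fst q, snd q} \<in> E ==> card (C (fst p) (snd p)) <= card (C (fst q) (snd q))"
  using ex_has_least_nat[of "%p. {fst p, snd p} \<in> E" _ "%p. card (C (fst p) (snd p))"] by metis
 define u v where "u = fst p" and "v = snd p"
 have uv: "{u, v} \<in> E" using p by (simp add: u_def v_def)
 have nuv: "u ~= v" "v \<in> V" using simple_graph_edgeD[OF assms(2) uv] by auto
 have "e = {u, v}" if e: "e \<in> E" "v \<in> e" for e
 proof (rule ccontr)
  assume ne: "e ~= {u, v}"
  obtain w where w: "e = {v, w}" "w ~= v" using simple_graph_other[OF assms(2) e] by blast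
  have vD: "(w, v) \<notin> (adj (E - {{v, w}}))\<^sup>*"
   using assms(3) e w unfolding forest_def by (metis insert_commute)
  have "(v, z) \<in> (adj (E - {{u, v}}))\<^sup>*" if "(w, z) \<in> (adj (E - {{v, w}}))\<^sup>*" for z
   using that
  proof (induction rule: rtrancl_induct)
   case base
   then show ?case using e w ne by (auto simp: adj_def)
  next
   case (step y z)
   have "y ~= v" "z ~= v" using step.hyps vD by (auto intro: rtrancl_into_rtrancl)
   then have "(y, z) \<in> adj (E - {{u, v}})" using step.hyps(2) by (auto simp: adj_def doubleton_eq_iff)
   then show ?case using step.IH by (rule rtrancl_into_rtrancl[rotated])
  qed
  then have "C v w \<subseteq> C u v" by (auto simp: C_def)
  moreover have "v \<in> C u v" "v \<notin> C v w" using vD nuv by (auto simp: C_def)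
  moreover have "finite (C u v)" using assms(1) by (simp add: C_def)
  ultimately have "card (C v w) < card (C u v)" by (intro psubset_card_mono) auto
  then show False using least[of "(v, w)"] e w by (simp add: u_def v_def)
 qed
 then show ?thesis using that uv nuv by blast
qed

lemma planar_forest:
 assumes "finite V" "simple_graph V E" "forest E"
 shows "planar V E"
 using assms(2,3)
proof (induction "card E" arbitrary: E)
 case 0
 then show ?case using simple_graph_finite[OF _ assms(1)] planar_empty[OF assms(1)] by auto
next
 case (Suc k)
 have "finite E" using Suc.prems simple_graph_finite assms(1) by blast
 then have "E ~= {}" using Suc.hyps(2) by auto
 from forest_leaf[OF assms(1) Suc.prems this] obtain u v where
  uv: "{u, v} \<in> E" "u ~= v" "\<And>e. e \<in> E ==> v \<in> e ==> e = {u, v}" by blast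
 let ?F = "E - {{u, v}}"
 have sF: "simple_graph V ?F" using Suc.prems simple_graph_subsetE by blast
 have "planar V ?F"
 proof (rule Suc.hyps(1))
  show "k = card ?F" using Suc.hyps(2) uv(1) \<open>finite E\<close> by simp
  show "forest ?F" by (rule forest_subset[OF Suc.prems(2)]) blast
 qed (rule sF)
 then have "planar V (insert {v, u} ?F)"
 proof (rule planar_insert_leaf[OF _ sF assms(1)])
  show "v \<in> V" "u \<in> V" "v ~= u" using simple_graph_edgeD[OF Suc.prems(1) uv(1)] by auto
  show "\<forall>e\<in>?F. v \<notin> e" using uv(3) by blast
 qed
 then show ?case using uv(1) by (simp add: insert_commute insert_absorb)
qed

definition fo :: "'a set => nat => 'a set set set" where
 "fo V m = {E. simple_graph V E \<and> card E = m \<and> forest E}"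

lemma fo_subset_pl: "finite V ==> fo V m \<subseteq> pl V m"
 by (auto simp: fo_def pl_def planar_forest)

lemma finite_fo: "finite V ==> finite (fo V m)"
 by (rule finite_subset[OF fo_subset_pl finite_pl])

text \<open>These pairs, among them all (v, v), are exactly those that no new edge of a forest may
  join.\<close>

definition cpairs :: "'a set => 'a set set => ('a \<times> 'a) set" where
 "cpairs V E = {(u, v)\<in>V \<times> V. (u, v) \<in> (adj E)\<^sup>*}"

text \<open>Double counting: a forest with an ordered pair from different components becomes a
  forest with one more edge, one of whose 2(m + 1) directed edges is marked.\<close>

lemma fo_extend:
 assumes "finite V"
 shows "(\<Sum>E\<in>fo V m. card (V \<times> V - cpairs V E)) <= 2 * Suc m * card (fo V (Suc m))"
proof -
 let ?A = "SIGMA E:fo V m. V \<times> V - cpairs V E"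
 let ?B = "SIGMA E:fo V (Suc m). {(x, y). {x, y} \<in> E}"
 let ?f = "%(E, p). (insert {fst p, snd p} E, p)"
 have fE: "finite E" "simple_graph V E" if "E \<in> fo V k" for E k
  using that assms by (auto simp: fo_def intro: simple_graph_finite)
 have new: "{u, v} \<notin> E" if "(u, v) \<notin> (adj E)\<^sup>*" for u v :: 'a and E
  using that by (auto simp: adj_def)
 have "inj_on ?f ?A"
 proof (rule inj_onI, clarsimp)
  fix E F u v assume "(u, v) \<notin> cpairs V E" "(u, v) \<notin> cpairs V F" "u \<in> V" "v \<in> V" "insert {u, v} E = insert {u, v} F"
  then have "{u, v} \<notin> E" "{u, v} \<notin> F" "insert {u, v} E - {{u, v}} = insert {u, v} F - {{u, v}}"
   using new[of u v E] new[of u v F] by (auto simp: cpairs_def)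
  then show "E = F" by simp
 qed
 moreover have "?f ` ?A \<subseteq> ?B"
 proof clarsimp
  fix E u v assume a: "E \<in> fo V m" "u \<in> V" "v \<in> V" "(u, v) \<notin> cpairs V E"
  then have c: "(u, v) \<notin> (adj E)\<^sup>*" by (auto simp: cpairs_def)
  then have "u ~= v" by auto
  then show "insert {u, v} E \<in> fo V (Suc m)"
   using a new[OF c] fE[OF a(1)] forest_insert[of E u v] c simple_graph_insert[of V E u v] by (auto simp: fo_def)
 qed
 moreover have co: "finite {(x, y). {x, y} \<in> E} \<and> card {(x, y). {x, y} \<in> E} = 2 * Suc m" if "E \<in> fo V (Suc m)" for E
  using card_ordered_edges[OF fE(2)[OF that] fE(1)[OF that]] that by (simp add: fo_def)
 moreover have fB: "finite ?B" using co by (intro finite_SigmaI finite_fo[OF assms]) blast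
 ultimately have "card ?A <= card ?B" using card_inj_on_le[of ?f ?A ?B] by blast
 moreover have "card ?A = (\<Sum>E\<in>fo V m. card (V \<times> V - cpairs V E))"
  by (rule card_SigmaI) (use finite_fo[OF assms] assms in auto)
 moreover have "card ?B = (\<Sum>E\<in>fo V (Suc m). card {(x, y). {x, y} \<in> E})"
  by (rule card_SigmaI) (use finite_fo[OF assms] co in blast)+
 moreover have "... = (\<Sum>E\<in>fo V (Suc m). 2 * Suc m)"
  by (rule sum.cong[OF refl]) (use co in blast)
 ultimately show ?thesis by (simp add: algebra_simps)
qed

fun pe :: "'a list => 'a set set" where
 "pe [] = {}"
| "pe [x] = {}"
| "pe (x # y # r) = insert {x, y} (pe (y # r))"

lemma pe_subset: "e \<in> pe p ==> e \<subseteq> set p"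
 by (induction p rule: pe.induct) auto

lemma card_pe: "distinct p ==> card (pe p) = length p - 1 \<and> finite (pe p)"
proof (induction p rule: pe.induct)
 case (3 x y r)
 then have "{x, y} \<notin> pe (y # r)" using pe_subset by fastforce
 then show ?case using 3 by auto
qed auto

lemma pe_snoc: "p ~= [] ==> pe (p @ [y]) = insert {last p, y} (pe p)"
 by (induction p rule: pe.induct) auto

lemma pe_prefix: "pe p \<subseteq> pe (p @ q)"
 by (induction p rule: pe.induct) auto

lemma rtrancl_path:
 assumes "(u, v) \<in> (adj E)\<^sup>*"
 obtains p where "p ~= []" "hd p = u" "last p = v" "distinct p" "pe p \<subseteq> E"
proof -
 have "\<exists>p. p ~= [] \<and> hd p = u \<and> last p = v \<and> distinct p \<and> pe p \<subseteq> E" using assms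
 proof (induction rule: rtrancl_induct)
  case base
  show ?case by (rule exI[of _ "[u]"]) auto
 next
  case (step y z)
  then obtain p where p: "p ~= []" "hd p = u" "last p = y" "distinct p" "pe p \<subseteq> E" by blast
  show ?case
  proof (cases "z \<in> set p")
   case True
   then obtain q r where qr: "p = q @ z # r" by (meson split_list)
   then have "pe (q @ [z]) \<subseteq> E" using p(5) pe_prefix[of "q @ [z]" r] by auto
   then show ?thesis using p qr by (intro exI[of _ "q @ [z]"]) (auto simp: hd_append split: if_splits)
  next
   case False
   then show ?thesis using p step(2) by (intro exI[of _ "p @ [z]"]) (auto simp: pe_snoc adj_def)
  qed
 qed
 then show ?thesis using that by blast
qed

lemma pe_set_subset: "simple_graph V E ==> pe p \<subseteq> E ==> hd p \<in> V ==> set p \<subseteq> V"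
proof (induction p rule: pe.induct)
 case (3 x y r)
 then have "y \<in> V" using simple_graph_edgeD[of V E x y] by auto
 then show ?case using 3 by auto
qed auto

definition vpaths :: "'a set => nat => 'a list set" where
 "vpaths V j = {p. length p = Suc j \<and> distinct p \<and> set p \<subseteq> V}"

lemma card_vpaths: "finite V ==> finite (vpaths V j) \<and> card (vpaths V j) <= card V ^ Suc j"
proof -
 assume V: "finite V"
 have s: "vpaths V j \<subseteq> {p. set p \<subseteq> V \<and> length p = Suc j}" by (auto simp: vpaths_def)
 then show ?thesis using card_mono[OF finite_lists_length_eq[OF V] s] finite_subset[OF s finite_lists_length_eq[OF V]]
  by (simp add: card_lists_length_eq[OF V])
qed

lemma cpairs_paths:
 assumes "finite V" "simple_graph V E"
 shows "card (cpairs V E) <= (\<Sum>j\<le>card E. card {p\<in>vpaths V j. pe p \<subseteq> E})"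
proof -
 have fE: "finite E" using assms simple_graph_finite by blast
 have f: "finite {p\<in>vpaths V j. pe p \<subseteq> E}" for j using card_vpaths[OF assms(1)] by simp
 have "cpairs V E \<subseteq> (%p. (hd p, last p)) ` (\<Union>j\<le>card E. {p\<in>vpaths V j. pe p \<subseteq> E})"
 proof clarsimp
  fix u v assume "(u, v) \<in> cpairs V E"
  then have uv: "u \<in> V" "(u, v) \<in> (adj E)\<^sup>*" by (auto simp: cpairs_def)
  obtain p where p: "p ~= []" "hd p = u" "last p = v" "distinct p" "pe p \<subseteq> E" using rtrancl_path[OF uv(2)] .
  then have "p \<in> vpaths V (length p - 1)" using pe_set_subset[OF assms(2)] uv by (auto simp: vpaths_def)
  moreover have "length p - 1 <= card E" using card_pe[OF p(4)] card_mono[OF fE p(5)] by simp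
  ultimately show "(u, v) \<in> (%p. (hd p, last p)) ` (\<Union>j\<le>card E. {p\<in>vpaths V j. pe p \<subseteq> E})"
   using p by (intro image_eqI[of _ _ p]) auto
 qed
 then have "card (cpairs V E) <= card (\<Union>j\<le>card E. {p\<in>vpaths V j. pe p \<subseteq> E})"
  using f by (meson card_image_le card_mono finite_UN_I finite_atMost finite_imageI le_trans)
 also have "... <= (\<Sum>j\<le>card E. card {p\<in>vpaths V j. pe p \<subseteq> E})" by (rule card_UN_le) simp
 finally show ?thesis .
qed

lemma card_filter_sum: "finite B ==> card {b\<in>B. P b} = (\<Sum>b\<in>B. if P b then 1 else 0)"
 by (simp add: sum.If_cases Int_def)

lemma sum_card_swap:
 assumes "finite A" "finite B"
 shows "(\<Sum>a\<in>A. card {b\<in>B. P a b}) = (\<Sum>b\<in>B. card {a\<in>A. P a b})"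
proof -
 have "(\<Sum>a\<in>A. card {b\<in>B. P a b}) = (\<Sum>a\<in>A. \<Sum>b\<in>B. if P a b then 1 else 0)"
  by (rule sum.cong[OF refl]) (rule card_filter_sum[OF assms(2)])
 also have "... = (\<Sum>b\<in>B. \<Sum>a\<in>A. if P a b then 1 else 0)" by (rule sum.swap)
 also have "... = (\<Sum>b\<in>B. card {a\<in>A. P a b})"
  by (rule sum.cong[OF refl]) (rule card_filter_sum[OF assms(1), symmetric])
 finally show ?thesis .
qed

text \<open>Each connected pair is charged to a path of some length j that joins it. There are at
  most \<open>card V ^ Suc j\<close> such paths, and deleting a given path is injective on the
  forests that contain it.\<close>

lemma sum_cpairs_fo:
 assumes V: "finite V"
 shows "(\<Sum>E\<in>fo V m. card (cpairs V E)) <= (\<Sum>j\<le>m. card V ^ Suc j * card (fo V (m - j)))"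
proof -
 have "(\<Sum>E\<in>fo V m. card (cpairs V E)) <= (\<Sum>E\<in>fo V m. \<Sum>j\<le>m. card {p\<in>vpaths V j. pe p \<subseteq> E})"
  by (rule sum_mono) (use cpairs_paths[OF V] in \<open>auto simp: fo_def\<close>)
 also have "... = (\<Sum>j\<le>m. \<Sum>E\<in>fo V m. card {p\<in>vpaths V j. pe p \<subseteq> E})" by (rule sum.swap)
 also have "... = (\<Sum>j\<le>m. \<Sum>p\<in>vpaths V j. card {E\<in>fo V m. pe p \<subseteq> E})"
  by (intro sum.cong refl sum_card_swap finite_fo[OF V]) (use card_vpaths[OF V] in auto)
 also have "... <= (\<Sum>j\<le>m. \<Sum>p\<in>vpaths V j. card (fo V (m - j)))"
 proof (intro sum_mono)
  fix j p assume p: "p \<in> vpaths V j"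
  have "inj_on (%E. E - pe p) {E\<in>fo V m. pe p \<subseteq> E}" by (auto simp: inj_on_def)
  moreover have "(%E. E - pe p) ` {E\<in>fo V m. pe p \<subseteq> E} \<subseteq> fo V (m - j)"
  proof clarify
   fix E assume E: "E \<in> fo V m" "pe p \<subseteq> E"
   have "card (E - pe p) = m - j"
    using E card_pe[of p] p by (subst card_Diff_subset) (auto simp: fo_def vpaths_def)
   then show "E - pe p \<in> fo V (m - j)"
    using E by (auto simp: fo_def intro: simple_graph_subsetE forest_subset)
  qed
  ultimately show "card {E\<in>fo V m. pe p \<subseteq> E} <= card (fo V (m - j))"
   using finite_fo[OF V] by (metis card_inj_on_le)
 qed
 also have "... <= (\<Sum>j\<le>m. card V ^ Suc j * card (fo V (m - j)))"
  using card_vpaths[OF V] by (intro sum_mono) (simp del: power_Suc)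
 finally show ?thesis .
qed

text \<open>Below the critical density few pairs are connected: by induction
  \<open>card (fo V (m - j))\<close> is at most (r/n)^j \<open>card (fo V m)\<close> with r < 1, so
  the path sum of \<open>sum_cpairs_fo\<close> is dominated by a geometric series and at most f/2
  n^2 \<open>card (fo V m)\<close>. All other pairs extend the forest.\<close>

lemma fo_growth:
 assumes V: "finite V" "card V = n" and e: "0 < f" "f < 1" "4 / f\<^sup>2 <= real n"
 shows "2 * real m <= (1 - f) * n ==> (1 - f / 2) * real n ^ 2 * card (fo V m) <= 2 * real (Suc m) * card (fo V (Suc m))"
proof (induction m rule: less_induct)
 case (less m)
 \<comment> \<open>The bound (1 - f) n for 2(i + 1), divided by the factor (1 - f/2) n from the
   induction hypothesis. Then 1/(1 - r) is at most 2/f, and n >= 4/f^2 turns 2/f n into at most f/2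
   n^2.\<close>
 define r where "r = (1 - f) / (1 - f / 2)"
 have n0: "real n > 0" using e by (smt (verit) divide_pos_pos zero_less_power)
 have r: "0 < r" "r < 1" "1 / (1 - r) <= 2 / f" using e by (auto simp: r_def field_simps)
 have step: "real (card (fo V i)) <= r / n * card (fo V (Suc i))" if "i < m" for i
 proof -
  have "2 * real (Suc i) <= 2 * real m" using that by simp
  then have le: "2 * real i <= (1 - f) * n" "2 * real (Suc i) <= (1 - f) * n" using that less.prems by linarith+
  have "(1 - f / 2) * real n ^ 2 * card (fo V i) <= 2 * real (Suc i) * card (fo V (Suc i))"
   using less.IH[OF that le(1)] .
  also have "... <= (1 - f) * n * card (fo V (Suc i))" using le(2) by (intro mult_right_mono) auto
  finally have "card (fo V i) <= (1 - f) * n * card (fo V (Suc i)) / ((1 - f / 2) * real n ^ 2)"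
   using n0 e by (simp add: field_simps)
  also have "... = r / n * card (fo V (Suc i))" using n0 e by (simp add: r_def power2_eq_square)
  finally show ?thesis .
 qed
 have it: "j <= m ==> real (card (fo V (m - j))) <= (r / n) ^ j * card (fo V m)" for j
 proof (induction j)
  case (Suc j)
  have "real (card (fo V (m - Suc j))) <= r / n * card (fo V (Suc (m - Suc j)))" using Suc.prems by (intro step) auto
  also have "Suc (m - Suc j) = m - j" using Suc.prems by simp
  also have "r / n * card (fo V (m - j)) <= r / n * ((r / n) ^ j * card (fo V m))"
   using Suc r n0 by (intro mult_left_mono) auto
  finally show ?case by simp
 qed simp
 have "real (\<Sum>E\<in>fo V m. card (cpairs V E)) <= real (\<Sum>j\<le>m. n ^ Suc j * card (fo V (m - j)))"
  using sum_cpairs_fo[OF V(1), of m] V(2) by (metis of_nat_le_iff)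
 also have "... = (\<Sum>j\<le>m. real n ^ Suc j * real (card (fo V (m - j))))" by simp
 also have "... <= (\<Sum>j\<le>m. real n ^ Suc j * ((r / n) ^ j * card (fo V m)))"
  using it by (intro sum_mono mult_left_mono) auto
 also have "... = n * card (fo V m) * (\<Sum>j\<le>m. r ^ j)"
  using n0 by (simp add: sum_distrib_left sum_distrib_right power_divide mult_ac)
 also have "... <= n * card (fo V m) * (1 / (1 - r))"
 proof (intro mult_left_mono)
  have "(\<Sum>j\<le>m. r ^ j) <= (\<Sum>j. r ^ j)" using r by (intro sum_le_suminf summable_geometric) auto
  then show "(\<Sum>j\<le>m. r ^ j) <= 1 / (1 - r)" using r by (simp add: suminf_geometric)
 qed auto
 also have "... <= n * card (fo V m) * (2 / f)" using r by (intro mult_left_mono) auto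
 also have "... <= f / 2 * real n ^ 2 * card (fo V m)"
 proof -
  have "2 / f <= f / 2 * n" using e by (simp add: field_simps power2_eq_square)
  then have "(2 / f) * (n * card (fo V m)) <= f / 2 * n * (n * card (fo V m))" by (intro mult_right_mono) auto
  then show ?thesis by (simp add: power2_eq_square mult_ac)
 qed
 finally have X: "(\<Sum>E\<in>fo V m. real (card (cpairs V E))) <= f / 2 * real n ^ 2 * card (fo V m)" by simp
 have "real (card (V \<times> V - cpairs V E)) = real n ^ 2 - real (card (cpairs V E))" for E
 proof -
  have s: "cpairs V E \<subseteq> V \<times> V" by (auto simp: cpairs_def)
  then have "card (V \<times> V - cpairs V E) + card (cpairs V E) = n * n"
   using V card_mono[OF _ s] by (subst card_Diff_subset) (auto intro: finite_subset simp: card_cartesian_product)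
  then have "real (card (V \<times> V - cpairs V E)) + real (card (cpairs V E)) = real n * real n"
   by (metis of_nat_add of_nat_mult)
  then show ?thesis by (simp add: power2_eq_square)
 qed
 then have "(\<Sum>E\<in>fo V m. real (card (V \<times> V - cpairs V E))) = real n ^ 2 * card (fo V m) - (\<Sum>E\<in>fo V m. real (card (cpairs V E)))"
  by (simp add: sum_subtractf)
 moreover have "(\<Sum>E\<in>fo V m. real (card (V \<times> V - cpairs V E))) <= 2 * real (Suc m) * card (fo V (Suc m))"
 proof -
  have "real (\<Sum>E\<in>fo V m. card (V \<times> V - cpairs V E)) <= real (2 * Suc m * card (fo V (Suc m)))"
   using fo_extend[OF V(1), of m] by (rule of_nat_mono)
  then show ?thesis by (simp only: of_nat_sum of_nat_mult of_nat_numeral)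
 qed
 ultimately show ?case using X by (simp add: algebra_simps)
qed

lemma card_fo_ge:
 assumes V: "finite V" "card V = n" and e: "0 < r" "r < 1" "4 / r\<^sup>2 <= real n"
 shows "2 * real m <= (1 - r) * n ==> ((1 - r / 2) * real n ^ 2) ^ m <= real (card (fo V m)) * (2 ^ m * fact m)"
proof (induction m)
 case 0
 have "{} \<in> fo V 0" by (auto simp: fo_def simple_graph_def forest_def)
 then have "1 <= card (fo V 0)" using finite_fo[OF V(1)] by (metis One_nat_def Suc_leI card_gt_0_iff empty_iff)
 then show ?case by simp
next
 case (Suc m)
 have "((1 - r / 2) * real n ^ 2) ^ Suc m <= (1 - r / 2) * real n ^ 2 * (real (card (fo V m)) * (2 ^ m * fact m))"
  using Suc e by (simp only: power_Suc) (intro mult_left_mono, auto)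
 also have "... = ((1 - r / 2) * real n ^ 2 * card (fo V m)) * (2 ^ m * fact m)" by simp
 also have "... <= (2 * real (Suc m) * card (fo V (Suc m))) * (2 ^ m * fact m)"
  using Suc.prems by (intro mult_right_mono fo_growth[OF assms]) auto
 finally show ?case by (simp add: algebra_simps)
qed

section \<open>Critical densities, and the number of planar graphs up to exp(o(n))\<close>

text \<open>Describes n tending to infinity together with 2m/n tending to 1. Both parameters are
  free, because the arguments pass to neighbouring pairs such as (n - i, m - c), and the filter is
  stable under such shifts.\<close>

definition crit :: "(nat \<times> nat) filter" where
 "crit = (INF (d, k)\<in>{0<..} \<times> UNIV. principal {(n, m). n \<ge> k \<and> \<bar>2 * real m - real n\<bar> <= d * real n})"

lemma eventually_crit:
 "eventually P crit \<longleftrightarrow> (\<exists>D>0. \<exists>k. \<forall>n\<ge>k. \<forall>m. \<bar>2 * real m - real n\<bar> <= D * real n --> P (n, m))"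
proof -
 let ?F = "%(d::real, k). principal {(n, m). n \<ge> k \<and> \<bar>2 * real m - real n\<bar> <= d * real n}"
 have "eventually P crit \<longleftrightarrow> (\<exists>b\<in>{0<..} \<times> UNIV. eventually P (?F b))" unfolding crit_def
 proof (rule eventually_INF_base)
  fix a b :: "real \<times> nat" assume ab: "a \<in> {0<..} \<times> UNIV" "b \<in> {0<..} \<times> UNIV"
  have "min d d' * real n <= d * real n" "min d d' * real n <= d' * real n" for d d' n by (auto intro: mult_right_mono)
  then have "?F (min (fst a) (fst b), max (snd a) (snd b)) <= inf (?F a) (?F b)"
   by (auto simp: case_prod_beta intro: order_trans)
  then show "\<exists>x\<in>{0<..} \<times> UNIV. ?F x <= inf (?F a) (?F b)" using ab
   by (intro bexI[of _ "(min (fst a) (fst b), max (snd a) (snd b))"]) (simp_all add: mem_Times_iff)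
 qed auto
 then have "eventually P crit \<longleftrightarrow> (\<exists>d k. 0 < d \<and> (\<forall>n m. k <= n \<and> \<bar>2 * real m - real n\<bar> <= d * real n --> P (n, m)))"
  by (simp add: eventually_principal Bex_def case_prod_beta)
 then show ?thesis by (simp only: imp_conjL) blast
qed

lemma eventually_critI:
 "d > 0 ==> (\<And>n m. n \<ge> k ==> \<bar>2 * real m - real n\<bar> <= d * real n ==> P (n, m)) ==> eventually P crit"
 unfolding eventually_crit by blast

text \<open>Attaching j new leaves one after another leads from (n - j, m - j) to (n, m).\<close>

lemma pc_leaves: "j <= n ==> j <= m ==> (n - j) ^ j * pc (n - j) (m - j) <= pc n m"
proof (induction j arbitrary: n m)
 case (Suc j)
 obtain n' m' where nm: "n = Suc n'" "m = Suc m'" using Suc.prems by (cases n; cases m) auto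
 have "(n' - j) ^ Suc j * pc (n' - j) (m' - j) <= n' * ((n' - j) ^ j * pc (n' - j) (m' - j))"
  by simp
 also have "... <= n' * pc n' m'" using Suc.IH[of n' m'] Suc.prems nm by (intro mult_left_mono) auto
 also have "... <= pc n m" using pc_Suc_Suc nm by simp
 finally show ?case using nm by simp
qed simp

lemma fact_ge_pow: "j <= m ==> (m - j) ^ j * fact (m - j) <= (fact m :: nat)"
proof (induction j arbitrary: m)
 case (Suc j)
 obtain m' where m': "m = Suc m'" using Suc.prems by (cases m) auto
 have "(m' - j) ^ Suc j * fact (m' - j) = (m' - j) * ((m' - j) ^ j * fact (m' - j))" by simp
 also have "... <= m * ((m' - j) ^ j * fact (m' - j))" using m' by (intro mult_right_mono) auto
 also have "... <= m * fact m'" using Suc m' by (intro mult_left_mono) auto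
 finally show ?case using m' by simp
qed simp

text \<open>The bound for forests requires 2m/n to stay below 1, whereas here it tends to 1. So a
  forest with n - j vertices and m - j edges, j about 2rn, is taken and j leaves are hung on it;
  this costs only a factor exp(O(r n)).\<close>

lemma pc_lower_bound:
 fixes h :: real
 assumes h: "h > 0"
 shows "eventually (%(n, m). exp (- h * n) * real n ^ (2 * m) <= real (pc n m) * (2 ^ m * fact m)) crit"
proof -
 \<comment> \<open>The losses add up to 21 r n: 18 r n from \<open>?a ^ (3 * n)\<close>, where ln
   \<open>?a\<close> >= -6r, and 3 r n from (1/2)^j, where j <= 3rn.\<close>
 define r where "r = min (1/20) (h / 21)"
 have e: "0 < r" "r <= 1/20" "21 * r <= h" using h by (auto simp: r_def min_def)
 define k where "k = nat \<lceil>2 * (4 / r\<^sup>2) + 1 / r\<rceil>"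
 show ?thesis
 proof (rule eventually_critI[of r k], use e in simp, unfold split)
  fix n m :: nat
  assume n: "n \<ge> k" and m: "\<bar>2 * real m - real n\<bar> <= r * real n"
  have nb: "2 * (4 / r\<^sup>2) + 1 / r <= real n" using n unfolding k_def by linarith
  have p1: "4 / r\<^sup>2 > 0" using e by simp
  then have en: "1 <= r * n" using nb e by (smt (verit) divide_pos_pos mult.commute pos_divide_le_eq)
  have n0: "real n > 0" using en e by (smt (verit) mult_nonneg_nonpos)
  define j where "j = nat \<lceil>2 * r * n\<rceil>"
  have j: "2 * r * n <= j" "j <= 3 * r * n" using en e n0 unfolding j_def by linarith+
  have eb: "r * n <= n / 20" using e n0 by (simp add: field_simps)
  have jn: "j <= n" "j <= m" using j m eb by linarith+
  let ?V = "{1..n - j}"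
  have rn: "real (n - j) = real n - j" "real (m - j) = real m - j" using jn by auto
  have nj: "real (n - j) \<ge> (1 - 3 * r) * n" using j rn by (simp add: algebra_simps)
  have c4: "4 / r\<^sup>2 <= real (n - j)"
  proof -
   have "real n / 2 <= real (n - j)" using j rn eb by linarith
   moreover have "4 / r\<^sup>2 <= real n / 2" using nb e by (smt (verit) divide_pos_pos field_sum_of_halves)
   ultimately show ?thesis by linarith
  qed
  have mj: "2 * real (m - j) <= (1 - r) * real (n - j)"
  proof -
   have "r * j \<ge> 0" using e by simp
   then show ?thesis using j m rn by (simp add: algebra_simps)
  qed
  have A: "((1 - r / 2) * real (n - j) ^ 2) ^ (m - j) <= real (card (fo ?V (m - j))) * (2 ^ (m - j) * fact (m - j))"
   by (rule card_fo_ge[of ?V "n - j" r "m - j"]) (use e c4 mj in auto)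
  also have "... <= real (pc (n - j) (m - j)) * (2 ^ (m - j) * fact (m - j))"
  proof (intro mult_right_mono)
   have "card (fo ?V (m - j)) <= card (pl ?V (m - j))" by (intro card_mono finite_pl fo_subset_pl) auto
   then show "real (card (fo ?V (m - j))) <= real (pc (n - j) (m - j))" by (simp add: card_pl)
  qed auto
  finally have A: "((1 - r / 2) * real (n - j) ^ 2) ^ (m - j) <= real (pc (n - j) (m - j)) * (2 ^ (m - j) * fact (m - j))" .
  have fm: "real (m - j) ^ j * fact (m - j) <= fact m"
  proof -
   have "(m - j) ^ j * fact (m - j) <= (fact m :: nat)" using fact_ge_pow jn by blast
   then have "real ((m - j) ^ j * fact (m - j)) <= real (fact m)" by (rule of_nat_mono)
   then show ?thesis by simp
  qed
  have m2: "real n / 2 <= 2 * real (m - j)" using j m rn eb by linarith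
  have B: "real (n - j) ^ j * (real n / 2) ^ j * ((1 - r / 2) * real (n - j) ^ 2) ^ (m - j) <= real (pc n m) * (2 ^ m * fact m)"
  proof -
   have "real (n - j) ^ j * (real n / 2) ^ j * ((1 - r / 2) * real (n - j) ^ 2) ^ (m - j)
    <= real (n - j) ^ j * (2 * real (m - j)) ^ j * (real (pc (n - j) (m - j)) * (2 ^ (m - j) * fact (m - j)))"
    using A m2 e by (intro mult_mono power_mono mult_nonneg_nonneg) auto
   also have "... = (real ((n - j) ^ j * pc (n - j) (m - j))) * ((2 ^ j * 2 ^ (m - j)) * (real (m - j) ^ j * fact (m - j)))"
    by (simp add: power_mult_distrib mult_ac)
   also have "... <= real (pc n m) * ((2 ^ j * 2 ^ (m - j)) * fact m)"
    using pc_leaves[OF jn] fm by (intro mult_mono mult_left_mono of_nat_mono) auto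
   also have "(2::real) ^ j * 2 ^ (m - j) = 2 ^ m" using jn by (metis le_add_diff_inverse power_add)
   finally show ?thesis .
  qed
  have mn: "m <= n" using m eb by linarith
  let ?a = "1 - 3 * r"
  have a: "0 < ?a" "?a <= 1" "?a <= 1 - r / 2" using e by auto
  have "exp (- h * n) * real n ^ (2 * m) <= ?a ^ (3 * n) * (1 / 2) ^ j * real n ^ (2 * m)"
  proof (intro mult_right_mono)
   have la: "ln ?a \<ge> - 6 * r"
   proof -
    have "- (3 * r) - 2 * (3 * r)\<^sup>2 <= ln (1 - 3 * r)"
     using e by (intro ln_one_minus_pos_lower_bound) auto
    moreover have "r\<^sup>2 <= r * (1 / 20)" unfolding power2_eq_square using e by (intro mult_left_mono) auto
    ultimately show ?thesis using e by (simp add: power_mult_distrib)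
   qed
   have "exp (- h * n) <= exp (- 18 * r * n - 3 * r * n)" using e n0
    by (simp add: algebra_simps)
   also have "... <= exp (3 * n * ln ?a - j * ln 2)"
   proof -
    have "3 * real n * ln ?a \<ge> 3 * real n * (- 6 * r)" using la by (intro mult_left_mono) auto
    moreover have "j * ln 2 <= real j * 1" using ln_2_less_1 by (intro mult_left_mono) auto
    ultimately show ?thesis using j by (simp add: algebra_simps)
   qed
   also have "... = ?a ^ (3 * n) * (1 / 2) ^ j"
   proof -
    have "exp (3 * n * ln ?a) = ?a ^ (3 * n)" using a by (metis exp_ln exp_of_nat_mult of_nat_mult of_nat_numeral)
    moreover have "exp (- (j * ln 2)) = (1 / 2 :: real) ^ j"
     by (metis exp_ln exp_minus exp_of_nat_mult inverse_eq_divide mult_minus_right power_one_over zero_less_numeral)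
    ultimately show ?thesis by (metis exp_add diff_conv_add_uminus)
   qed
   finally show "exp (- h * n) <= ?a ^ (3 * n) * (1 / 2) ^ j" .
  qed auto
  also have "... <= real (n - j) ^ j * (real n / 2) ^ j * ((1 - r / 2) * real (n - j) ^ 2) ^ (m - j)"
  proof -
   have x: "?a ^ (3 * n) <= ?a ^ (2 * m - j) * (1 - r / 2) ^ (m - j)"
   proof -
    have "?a ^ (3 * n) <= ?a ^ ((2 * m - j) + (m - j))" using a mn by (intro power_decreasing) auto
    also have "... <= ?a ^ (2 * m - j) * (1 - r / 2) ^ (m - j)"
     unfolding power_add using a by (intro mult_left_mono power_mono) auto
    finally show ?thesis .
   qed
   have ee: "real (n - j) ^ j * (real n / 2) ^ j * ((1 - r / 2) * real (n - j) ^ 2) ^ (m - j) =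
     (1 / 2) ^ j * real n ^ j * (1 - r / 2) ^ (m - j) * real (n - j) ^ (2 * m - j)"
   proof -
    have "2 * m - j = j + 2 * (m - j)" using jn by simp
    then have "real (n - j) ^ (2 * m - j) = real (n - j) ^ j * (real (n - j) ^ 2) ^ (m - j)"
     by (simp only: power_add power_mult)
    then show ?thesis by (simp only: power_mult_distrib power_divide power_one) (simp add: field_simps)
   qed
   have "(?a * n) ^ (2 * m - j) <= real (n - j) ^ (2 * m - j)" using nj a n0 by (intro power_mono) auto
   moreover have "real n ^ (2 * m) = real n ^ j * real n ^ (2 * m - j)" using jn by (simp flip: power_add)
   ultimately have y: "?a ^ (2 * m - j) * real n ^ (2 * m) <= real n ^ j * real (n - j) ^ (2 * m - j)"
    by (simp add: power_mult_distrib mult.left_commute mult_left_mono)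
   have "?a ^ (3 * n) * (1 / 2) ^ j * real n ^ (2 * m) <= (?a ^ (2 * m - j) * (1 - r / 2) ^ (m - j)) * (1 / 2) ^ j * real n ^ (2 * m)"
    using x by (intro mult_right_mono) auto
   also have "... = (1 - r / 2) ^ (m - j) * (1 / 2) ^ j * (?a ^ (2 * m - j) * real n ^ (2 * m))" by simp
   also have "... <= (1 - r / 2) ^ (m - j) * (1 / 2) ^ j * (real n ^ j * real (n - j) ^ (2 * m - j))"
    using y e by (intro mult_left_mono) auto
   finally show ?thesis unfolding ee by (simp add: mult_ac)
  qed
  also note B
  finally show "exp (- h * n) * real n ^ (2 * m) <= real (pc n m) * (2 ^ m * fact m)" .
 qed
qed

lemma fact_le_stirling: "L \<ge> 1 ==> (fact L :: real) <= exp 1 * L * (L / exp 1) ^ L"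
proof (induction L rule: nat_induct_at_least)
 case base
 then show ?case by simp
next
 case (Suc L)
 have L: "real L > 0" using Suc.hyps by simp
 have "(real L / real (Suc L)) ^ Suc L <= exp (- 1 / real (Suc L)) ^ Suc L"
  using exp_ge_add_one_self[of "- 1 / real (Suc L)"] by (intro power_mono) (auto simp: field_simps)
 also have "... = exp (- 1)" unfolding exp_of_nat_mult[symmetric] by simp
 finally have key: "exp 1 * real L ^ Suc L <= real (Suc L) ^ Suc L"
  by (simp add: power_divide exp_minus field_simps del: power_Suc of_nat_Suc)
 have "(fact (Suc L) :: real) = real (Suc L) * fact L" by simp
 also have "... <= real (Suc L) * (exp 1 * L * (L / exp 1) ^ L)" using Suc.IH by (intro mult_left_mono) auto
 also have "... = Suc L * (exp 1 * real L ^ Suc L) / exp 1 ^ L" by (simp add: power_divide field_simps)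
 also have "... <= Suc L * real (Suc L) ^ Suc L / exp 1 ^ L" using key by (intro divide_right_mono mult_left_mono) auto
 also have "... = exp 1 * Suc L * (Suc L / exp 1) ^ Suc L" by (simp add: power_divide field_simps)
 finally show ?case .
qed

lemma crit_ge: "eventually (%(n, m). n \<ge> k) crit"
 by (rule eventually_critI[of 1 k]) auto

lemma crit_near: "d > 0 ==> eventually (%(n, m). \<bar>2 * real m - real n\<bar> <= d * real n) crit"
 by (rule eventually_critI[of d 0]) auto

lemma crit_at_top: "eventually P at_top ==> eventually (%(n, m). P n) crit"
 unfolding eventually_at_top_linorder by (elim exE, rule eventually_critI[of 1]) auto

text \<open>A bounded shift changes 2m - n by a bounded amount, which for large n is absorbed by
  halving the width D.\<close>

lemma crit_shift:
 assumes "eventually P crit"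
 shows "eventually (%(n, m). P (n + a - b, m - c)) crit"
proof -
 obtain D k where d: "D > 0" and P: "\<And>n m. n \<ge> k ==> \<bar>2 * real m - real n\<bar> <= D * real n ==> P (n, m)"
  using assms unfolding eventually_crit by blast
 define d' where "d' = min (1/2) (D / 2)"
 have d': "d' > 0" "d' <= 1/2" "d' <= D / 2" using d by (auto simp: d'_def)
 define K where "K = nat \<lceil>(real (2 * c + a + b) + D * b) / (D / 2)\<rceil> + k + b + 4 * c"
 show ?thesis
 proof (rule eventually_critI[of d' K], use d' in simp, unfold split)
  fix n m assume n: "n \<ge> K" and m: "\<bar>2 * real m - real n\<bar> <= d' * real n"
  have dn: "d' * real n <= real n / 2" "d' * n <= D / 2 * n"
   using mult_right_mono[of d' "1/2" "real n"] mult_right_mono[of d' "D / 2" "real n"] d' by auto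
  have "real n \<ge> (real (2 * c + a + b) + D * b) / (D / 2)" "n \<ge> b" "n \<ge> 4 * c" "n \<ge> k + b"
   using n unfolding K_def by linarith+
  then have e: "real (2 * c + a + b) + D * b <= D / 2 * n" and "c <= m"
   using d m dn by (auto simp: field_simps)
  then have r: "real (n + a - b) = real n + a - b" "real (m - c) = real m - c" using \<open>n \<ge> b\<close> by auto
  have "D * a \<ge> 0" using d by simp
  then have "\<bar>2 * real (m - c) - real (n + a - b)\<bar> <= D * real (n + a - b)"
  proof -
   have "D * (real n + a - b) = D * n + D * a - D * b" by (simp add: algebra_simps)
   moreover have "2 * (real m - c) = 2 * real m - 2 * real c" by simp
   moreover have "2 * real c + a + b + D * b <= D * n / 2" using e by simp
   moreover have "\<bar>2 * real m - real n\<bar> <= D * n / 2" using m dn by simp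
   ultimately show ?thesis unfolding r using \<open>D * a \<ge> 0\<close> by linarith
  qed
  then show "P (n + a - b, m - c)" using P[of "n + a - b" "m - c"] \<open>n \<ge> k + b\<close> by simp
 qed
qed

lemma pc_pos: "eventually (%(n, m). pc n m > 0) crit"
proof -
 have "eventually (%(n, m). exp ((- 1 :: real) * n) * real n ^ (2 * m) <= real (pc n m) * (2 ^ m * fact m)) crit"
  by (rule pc_lower_bound) simp
 with crit_ge[of 1] show ?thesis
 proof eventually_elim
  case (elim p)
  obtain n m where p: "p = (n, m)" by (cases p)
  have "0 < exp ((- 1 :: real) * n) * real n ^ (2 * m)" using elim p by simp
  also have "... <= real (pc n m) * (2 ^ m * fact m)" using elim p by simp
  finally show ?case using p by (auto simp: zero_less_mult_iff)
 qed
qed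

section \<open>Degrees are nearly Poisson(1)\<close>

lemma sum_exp_le: "(x::real) \<ge> 0 ==> finite J ==> (\<Sum>i\<in>J. x ^ i / fact i) <= exp x"
proof -
 assume x: "x \<ge> 0" "finite J"
 have "(\<Sum>i\<in>J. x ^ i / fact i) = (\<Sum>i\<in>J. inverse (fact i) * x ^ i)" by (simp add: field_simps)
 also have "... <= (\<Sum>i. inverse (fact i) * x ^ i)"
  by (rule sum_le_suminf[OF summable_exp]) (use x in auto)
 also have "... = exp x" by (simp add: exp_def field_simps)
 finally show ?thesis .
qed

text \<open>The generating function bound at x = 1: a vertex of A contributes 1/d!, any other vertex
  at most e. Relative to e^n, each vertex of A costs exp(-1)/d!, as for independent Poisson(1)
  degrees.\<close>

lemma card_pl_deg_le:
 fixes n m :: nat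
 assumes "A \<subseteq> {1..n}"
 shows "real (card {E\<in>pl {1..n} m. \<forall>x\<in>A. deg E x = d}) * (2 ^ m * fact m)
  <= fact (2 * m) * exp n * (exp (- 1) / fact d) ^ card A"
proof -
 let ?V = "{1..n}"
 let ?J = "%v. if v \<in> A then {d} else UNIV"
 let ?G = "{E\<in>pl ?V m. \<forall>x\<in>A. deg E x = d}"
 let ?F = "%v. if v \<in> A then 1 / fact d else exp (1::real)"
 have "card ?G * (2 ^ m * fact m) <= card (words ?V ?J (2 * m))"
 proof (rule graphs_le_words[of ?V])
  fix E w assume E: "E \<in> ?G" and w: "codes w E"
  have f: "finite E" by (rule finite_plE[of E ?V m]) (use E in auto)
  have "set w \<subseteq> ?V" using codes_set[OF w] E simple_graph_subset[of ?V E] unfolding pl_def by blast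
  then show "w \<in> words ?V ?J (2 * m)"
   using codes_length[OF w f] codes_count[OF w f] E by (auto simp: words_def pl_def)
 qed (auto simp: pl_def intro: finite_words)
 then have "real (card ?G * (2 ^ m * fact m)) <= real (card (words ?V ?J (2 * m)))" by (rule of_nat_mono)
 also have "... <= fact (2 * m) / 1 ^ (2 * m) * (\<Prod>v\<in>?V. ?F v)"
 proof (rule card_words_le)
  fix v k
  have "(\<Sum>j\<le>k. 1 ^ j / fact j) <= exp (1::real)" by (rule sum_exp_le) auto
  then show "(\<Sum>j\<in>{..k} \<inter> ?J v. 1 ^ j / fact j) <= ?F v"
   by (cases "d <= k") auto
 qed auto
 also have "(\<Prod>v\<in>?V. ?F v) = (\<Prod>v\<in>A. 1 / fact d) * (\<Prod>v\<in>?V - A. exp 1)"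
 proof -
  have "(\<Prod>v\<in>?V. ?F v) = (\<Prod>v\<in>?V \<inter> {v. v \<in> A}. 1 / fact d) * (\<Prod>v\<in>?V \<inter> - {v. v \<in> A}. exp 1)"
   by (rule prod.If_cases) simp
  moreover have "?V \<inter> {v. v \<in> A} = A" "?V \<inter> - {v. v \<in> A} = ?V - A" using assms by auto
  ultimately show ?thesis by simp
 qed
 also have "... = exp n * (exp (- 1) / fact d) ^ card A"
 proof -
  have fA: "finite A" "card A <= n" using assms finite_subset[OF assms] card_mono[OF _ assms] by auto
  have c: "card (?V - A) = n - card A" using assms fA by (simp add: card_Diff_subset)
  have "exp (1::real) ^ (n - card A) = exp n * exp (- 1) ^ card A"
   using fA by (simp add: exp_of_nat_mult[symmetric] exp_add[symmetric] of_nat_diff)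
  then show ?thesis by (simp only: prod_constant c) (simp add: power_divide)
 qed
 finally show ?thesis by (simp add: mult_ac)
qed

text \<open>Stirling bounds the left side by (2m/n)^(2m) n^(2m) e^(n - 2m) up to a factor of order
  n, and both deviations are exp(o(n)) when 2m/n tends to 1. This brings the word bound into the
  form of \<open>pc_lower_bound\<close>.\<close>

lemma fact_subexp:
 fixes t :: real
 assumes "t > 0"
 shows "eventually (%(n, m). fact (2 * m) * exp n <= exp (t * n) * real n ^ (2 * m)) crit"
proof -
 define D where "D = min (1/2) (t / 8)"
 have d: "D > 0" "D <= 1/2" "D <= t / 8" using assms by (auto simp: D_def)
 have "eventually (%n. exp 1 * (2 * real n) <= exp (t / 2 * real n)) at_top"
  using assms by real_asymp
 then have "eventually (%(n, m). exp 1 * (2 * real n) <= exp (t / 2 * real n)) crit" by (rule crit_at_top)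
 with crit_near[OF d(1)] crit_ge[of 4] show ?thesis
 proof eventually_elim
  case (elim p)
  obtain n m where p: "p = (n, m)" by (cases p)
  have near: "\<bar>2 * real m - n\<bar> <= D * n" and n: "n \<ge> 4" and le: "exp 1 * (2 * real n) <= exp (t / 2 * real n)"
   using elim p by auto
  have dn: "D * n <= n / 2" "D * n <= t / 8 * n"
   using mult_right_mono[of D "1/2" "real n"] mult_right_mono[of D "t / 8" "real n"] d by auto
  have m1: "2 * m \<ge> 1" and m2: "2 * m <= 2 * n" using near dn n by linarith+
  have m2': "real (2 * m) <= 2 * real n" using near dn by simp
  have n0: "real n > 0" using n by simp
  let ?x = "real (2 * m) / n"
  have "?x <= exp (?x - 1)" using exp_ge_add_one_self[of "?x - 1"] by simp
  also have "... <= exp D" using near n0 by (simp add: field_simps abs_le_iff)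
  finally have "?x ^ (2 * m) <= exp D ^ (2 * m)" by (rule power_mono) simp
  also have "... <= exp D ^ (2 * n)" using m2 d by (intro power_increasing) auto
  also have "... = exp (2 * D * n)" by (simp add: exp_of_nat_mult[symmetric] mult_ac)
  finally have x: "?x ^ (2 * m) <= exp (2 * D * n)" .
  have "fact (2 * m) * exp n <= (exp 1 * real (2 * m) * (real (2 * m) / exp 1) ^ (2 * m)) * exp n"
   using fact_le_stirling[OF m1] by (intro mult_right_mono) auto
  also have "... = exp 1 * real (2 * m) * (?x ^ (2 * m) * real n ^ (2 * m)) * (exp n / exp 1 ^ (2 * m))"
   using n0 by (simp add: power_divide field_simps)
  also have "exp n / exp 1 ^ (2 * m) = exp (n - real (2 * m))"
   by (simp add: exp_diff exp_of_nat_mult[symmetric])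
  also have "exp 1 * real (2 * m) * (?x ^ (2 * m) * real n ^ (2 * m)) * exp (n - real (2 * m))
    <= exp 1 * (2 * real n) * (exp (2 * D * n) * real n ^ (2 * m)) * exp (D * n)"
   using x near m2' by (intro mult_mono mult_right_mono mult_left_mono) auto
  also have "... <= exp (t / 2 * n) * (exp (2 * D * n) * real n ^ (2 * m)) * exp (D * n)"
   using le by (intro mult_right_mono) auto
  also have "... = exp (t / 2 * n + 3 * (D * n)) * real n ^ (2 * m)"
   by (simp add: exp_add[symmetric] algebra_simps)
  also have "... <= exp (t * n) * real n ^ (2 * m)"
  proof -
   have "t * n \<ge> 0" using assms by simp
   then have "t / 2 * n + 3 * (D * n) <= t * n" using dn by (simp add: field_simps)
   then show ?thesis by (intro mult_right_mono) auto
  qed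
  finally show ?case using p by simp
 qed
qed

text \<open>The bound is uniform in A, since it will be summed over all vertex sets of a size linear
  in n.\<close>

lemma card_pl_deg_le_pc:
 fixes t :: real
 assumes "t > 0"
 shows "eventually (%(n, m). \<forall>A\<subseteq>{1..n}. real (card {E\<in>pl {1..n} m. \<forall>x\<in>A. deg E x = d})
  <= exp (t * n) * (exp (- 1) / fact d) ^ card A * pc n m) crit"
proof -
 have t2: "t / 2 > 0" using assms by simp
 from fact_subexp[OF t2] pc_lower_bound[OF t2] show ?thesis
 proof eventually_elim
  case (elim p)
  obtain n m where p: "p = (n, m)" by (cases p)
  have a: "fact (2 * m) * exp n <= exp (t / 2 * n) * real n ^ (2 * m)"
   and b: "exp (- (t / 2) * n) * real n ^ (2 * m) <= real (pc n m) * (2 ^ m * fact m)" using elim p by auto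
  have "exp (t / 2 * n) * real n ^ (2 * m) = exp (t * n) * (exp (- (t / 2) * n) * real n ^ (2 * m))"
  proof -
   have "t / 2 * n = t * n + (- (t / 2) * n)" by simp
   then show ?thesis by (metis exp_add mult.assoc)
  qed
  also have "... <= exp (t * n) * (real (pc n m) * (2 ^ m * fact m))" using b by (intro mult_left_mono) auto
  finally have c: "fact (2 * m) * exp n <= exp (t * n) * (real (pc n m) * (2 ^ m * fact m))" using a by linarith
  have "real (card {E\<in>pl {1..n} m. \<forall>x\<in>A. deg E x = d}) <= exp (t * n) * (exp (- 1) / fact d) ^ card A * pc n m"
   if A: "A \<subseteq> {1..n}" for A
  proof -
   have "real (card {E\<in>pl {1..n} m. \<forall>x\<in>A. deg E x = d}) * (2 ^ m * fact m)
    <= exp (t * n) * (real (pc n m) * (2 ^ m * fact m)) * (exp (- 1) / fact d) ^ card A"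
    by (rule order_trans[OF card_pl_deg_le[OF A] mult_right_mono[OF c]]) simp
   also have "... = (exp (t * n) * (exp (- 1) / fact d) ^ card A * pc n m) * (2 ^ m * fact m)" by (simp add: mult_ac)
   finally show ?thesis by (rule mult_right_le_imp_le) simp
  qed
  then show ?case using p by simp
 qed
qed

definition degv :: "nat => nat set set => nat => nat set" where
 "degv n E d = {x\<in>{1..n}. deg E x = d}"

lemma finite_degv [simp]: "finite (degv n E d)" by (simp add: degv_def)

lemma card_degv_le: "card (degv n E d) <= n"
proof -
 have "card (degv n E d) <= card {1..n}" by (rule card_mono) (auto simp: degv_def)
 then show ?thesis by simp
qed

text \<open>A binomial moment of linear order i, about f n: a bad graph has at least ((q + h/2)n)^i
  / i! sets of i vertices of degree d, while on average there are at most e^(tn) (qn)^i / i! of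
  them. The quotient e^(tn) r^i is exponentially small, so the subexponential loss of the counts
  does no harm.\<close>

lemma degree_tail:
 fixes h :: real
 assumes h: "h > 0"
 shows "eventually (%(n, m). real (card {E\<in>pl {1..n} m. (exp (- 1) / fact d + h) * n <= card (degv n E d)}) <= h * pc n m) crit"
proof -
 define q where "q = exp (- 1) / (fact d :: real)"
 \<comment> \<open>Keeps i <= 2fn below hn/4, so that the factors of the falling factorial stay
   above (q + h/2)n.\<close>
 define f where "f = min (1/2) (h / 8)"
 define r where "r = q / (q + h / 2)"
 have q: "q > 0" by (simp add: q_def)
 have k: "f > 0" "f <= h / 8" using h by (auto simp: f_def)
 have rho: "0 < r" "r < 1" using q h by (auto simp: r_def)
 \<comment> \<open>Half the decay rate of r^i, so that e^(tn) r^i <= e^(-tn).\<close>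
 define t where "t = f * - ln r / 2"
 have th: "t > 0" using k rho by (simp add: t_def mult_pos_neg)
 have "eventually (%n. exp (- t * real n) <= h) at_top" using th h by real_asymp
 then have e1: "eventually (%(n, m). exp (- t * real n) <= h) crit" by (rule crit_at_top)
 have "eventually (%n. f * real n \<ge> 1) at_top" using k by real_asymp
 then have e2: "eventually (%(n, m). f * real n \<ge> 1) crit" by (rule crit_at_top)
 from e1 e2 card_pl_deg_le_pc[OF th, of d] show ?thesis
 proof eventually_elim
  case (elim p)
  obtain n m where p: "p = (n, m)" by (cases p)
  have n1: "exp (- t * real n) <= h" "f * real n \<ge> 1"
   and up: "\<And>A. A \<subseteq> {1..n} ==> real (card {E\<in>pl {1..n} m. \<forall>x\<in>A. deg E x = d}) <= exp (t * n) * q ^ card A * pc n m"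
   using elim p by (auto simp: q_def)
  define i where "i = nat \<lceil>f * n\<rceil>"
  have i: "f * n <= i" "i <= 2 * f * n" using n1 k unfolding i_def by linarith+
  let ?B = "{E\<in>pl {1..n} m. (q + h) * n <= card (degv n E d)}"
  let ?S = "{A. A \<subseteq> {1..n} \<and> card A = i}"
  have fB: "finite ?B" using finite_pl[of "{1..n}" m] by simp
  have fS: "finite ?S" by simp
  have n0: "real n > 0" using n1 k by (smt (verit) mult_nonneg_nonpos)
  have "real (card ?B) * ((q + h / 2) * n) ^ i <= fact i * (\<Sum>E\<in>?B. real (card (degv n E d) choose i))"
  proof -
   have "((q + h / 2) * n) ^ i <= fact i * real (card (degv n E d) choose i)" if E: "E \<in> ?B" for E
   proof -
    let ?Z = "card (degv n E d)"
    have Z: "(q + h) * n <= ?Z" using E by simp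
    have "2 * f * n <= h / 4 * n" using k n0 by (intro mult_right_mono) auto
    then have iz: "i <= h / 4 * n" using i by linarith
    have qn: "q * n > 0" "h * n > 0" using q n0 h by auto
    have iZ: "i <= ?Z" using Z iz qn by (simp add: algebra_simps)
    have "((q + h / 2) * n) ^ i <= real (?Z - i) ^ i"
     using Z iz iZ qn q h by (intro power_mono) (auto simp: algebra_simps of_nat_diff)
    also have "... * fact (?Z - i) <= fact i * real (?Z choose i) * fact (?Z - i)"
    proof -
     have "(?Z - i) ^ i * fact (?Z - i) <= fact i * (?Z choose i) * (fact (?Z - i) :: nat)"
      using fact_ge_pow[OF iZ] binomial_fact_lemma[OF iZ] by (simp add: mult_ac)
     then have "real ((?Z - i) ^ i * fact (?Z - i)) <= real (fact i * (?Z choose i) * fact (?Z - i))" by (rule of_nat_mono)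
     then show ?thesis by simp
    qed
    then have "real (?Z - i) ^ i <= fact i * real (?Z choose i)" by (rule mult_right_le_imp_le) simp
    finally show ?thesis .
   qed
   then have "(\<Sum>E\<in>?B. ((q + h / 2) * n) ^ i) <= (\<Sum>E\<in>?B. fact i * real (card (degv n E d) choose i))" by (rule sum_mono)
   then show ?thesis by (simp add: sum_distrib_left)
  qed
  also have "(\<Sum>E\<in>?B. real (card (degv n E d) choose i)) = real (\<Sum>E\<in>?B. card {A\<in>?S. A \<subseteq> degv n E d})"
  proof -
   have "{A\<in>?S. A \<subseteq> degv n E d} = {A. A \<subseteq> degv n E d \<and> card A = i}" for E by (auto simp: degv_def)
   then show ?thesis using n_subsets[OF finite_degv] by simp
  qed
  also have "... = real (\<Sum>A\<in>?S. card {E\<in>?B. A \<subseteq> degv n E d})" using sum_card_swap[OF fB fS] by simp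
  also have "... <= (\<Sum>A\<in>?S. exp (t * n) * q ^ i * pc n m)"
   unfolding of_nat_sum
  proof (rule sum_mono)
   fix A assume A: "A \<in> ?S"
   have "card {E\<in>?B. A \<subseteq> degv n E d} <= card {E\<in>pl {1..n} m. \<forall>x\<in>A. deg E x = d}"
    using finite_pl[of "{1..n}" m] by (intro card_mono) (auto simp: degv_def)
   then show "real (card {E\<in>?B. A \<subseteq> degv n E d}) <= exp (t * n) * q ^ i * pc n m"
    using up[of A] A by auto
  qed
  also have "... = real (n choose i) * (exp (t * n) * q ^ i * pc n m)" using n_subsets[of "{1..n}" i] by simp
  also have "fact i * (real (n choose i) * (exp (t * n) * q ^ i * pc n m)) <= real n ^ i * (exp (t * n) * q ^ i * pc n m)"
  proof -
   have "(n choose i) * fact i <= n ^ i" using binomial_fact_pow by blast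
   then have "real ((n choose i) * fact i) <= real (n ^ i)" by (rule of_nat_mono)
   then have "real (n choose i) * fact i <= real n ^ i" by simp
   then have "(real (n choose i) * fact i) * (exp (t * n) * q ^ i * pc n m) <= real n ^ i * (exp (t * n) * q ^ i * pc n m)"
    using q by (intro mult_right_mono) auto
   then show ?thesis by (simp add: mult_ac)
  qed
  finally have "real (card ?B) * ((q + h / 2) * n) ^ i <= real n ^ i * (exp (t * n) * q ^ i * pc n m)" by simp
  then have "real (card ?B) <= real n ^ i * (exp (t * n) * q ^ i * pc n m) / ((q + h / 2) * n) ^ i"
   using q h n0 by (subst pos_le_divide_eq) (auto intro!: zero_less_power mult_pos_pos)
  also have "... = exp (t * n) * r ^ i * pc n m"
   using n0 q h by (simp add: r_def power_divide power_mult_distrib)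
  also have "... <= exp (t * n) * exp (- 2 * t * n) * pc n m"
  proof -
   have "r ^ i = exp (i * ln r)" using rho by (simp add: exp_of_nat_mult)
   also have "... <= exp (f * n * ln r)" using i rho by (simp add: mult_right_mono_neg)
   also have "f * n * ln r = - 2 * t * n" by (simp add: t_def)
   finally show ?thesis by (intro mult_right_mono mult_left_mono) auto
  qed
  also have "exp (t * n) * exp (- 2 * t * n) = exp (- t * n)" by (simp add: exp_add[symmetric])
  also have "exp (- t * n) * pc n m <= h * pc n m" using n1 by (intro mult_right_mono) auto
  finally show ?case using p by (simp add: q_def)
 qed
qed

section \<open>Ratios of counts for neighbouring parameters\<close>

lemma degree_mean:
 fixes y :: real
 assumes y: "y > 0"
 shows "eventually (%(n, m). real (\<Sum>E\<in>pl {1..n} m. card (degv n E d)) <= (exp (- 1) / fact d + y) * n * pc n m) crit"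
proof -
 have h: "y / 2 > 0" using y by simp
 from degree_tail[OF h, of d] show ?thesis
 proof eventually_elim
  case (elim p)
  obtain n m where p: "p = (n, m)" by (cases p)
  let ?P = "pl {1..n} m" and ?z = "(exp (- 1) / fact d + y / 2) * n"
  let ?B = "{E\<in>?P. ?z <= card (degv n E d)}"
  have B: "real (card ?B) <= y / 2 * pc n m" using elim p by simp
  have fP: "finite ?P" by (simp add: finite_pl)
  have z0: "0 <= ?z" using y by (intro mult_nonneg_nonneg add_nonneg_nonneg) auto
  have "real (card (degv n E d)) <= ?z + (if E \<in> ?B then real n else 0)" if "E \<in> ?P" for E
  proof (cases "E \<in> ?B")
   case True
   then show ?thesis using z0 card_degv_le[of n E d] by simp
  next
   case False
   then have "\<not> ?z <= card (degv n E d)" using that by blast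
   then show ?thesis using False by simp
  qed
  then have "(\<Sum>E\<in>?P. real (card (degv n E d))) <= (\<Sum>E\<in>?P. ?z + (if E \<in> ?B then real n else 0))" by (rule sum_mono)
  also have "... = card ?P * ?z + card ?B * n"
   using fP by (simp add: sum.distrib sum.inter_filter[symmetric])
  also have "card ?P = pc n m" by (simp add: card_pl)
  also have "pc n m * ?z + card ?B * n <= pc n m * ?z + (y / 2 * pc n m) * n" using mult_right_mono[OF B, of "real n"] by simp
  also have "... = (exp (- 1) / fact d + y) * n * pc n m" by (simp add: algebra_simps)
  finally show ?case using p by simp
 qed
qed

lemma sum_degv_eq: "(\<Sum>E\<in>pl {1..n} m. card (degv n E d)) = (\<Sum>x\<in>{1..n}. card {E\<in>pl {1..n} m. deg E x = d})"
 unfolding degv_def by (rule sum_card_swap) (auto intro: finite_pl)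

lemma handshake:
 assumes "simple_graph V E" "finite V"
 shows "(\<Sum>x\<in>V. deg E x) = 2 * card E"
proof -
 have "(\<Sum>x\<in>V. deg E x) = (\<Sum>e\<in>E. card {x\<in>V. x \<in> e})"
  unfolding deg_def by (rule sum_card_swap) (use assms simple_graph_finite in auto)
 also have "... = (\<Sum>e\<in>E. 2)"
 proof (rule sum.cong)
  fix e assume "e \<in> E"
  then obtain u v where "e = {u, v}" "u ~= v" "u \<in> V" "v \<in> V" using simple_graphD[OF assms(1)] by blast
  then have "{x\<in>V. x \<in> e} = {u, v}" by auto
  then show "card {x\<in>V. x \<in> e} = 2" using \<open>u ~= v\<close> by simp
 qed simp
 finally show ?thesis by simp
qed

text \<open>For each x there are \<open>pc (n - 1) m\<close> graphs in which x is isolated, so the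
  mean number of isolated vertices is n times this ratio.\<close>

lemma pc_isolated_upper:
 fixes h :: real
 assumes h: "h > 0"
 shows "eventually (%(n, m). real (pc (n - 1) m) <= (exp (- 1) + h) * pc n m) crit"
 using degree_mean[OF h, of 0] crit_ge[of 1]
proof eventually_elim
 case (elim p)
 obtain n m where p: "p = (n, m)" by (cases p)
 have n: "n \<ge> 1" using elim p by simp
 have "real (\<Sum>E\<in>pl {1..n} m. card (degv n E 0)) <= (exp (- 1) + h) * n * pc n m"
  using elim p by simp
 then have "real (\<Sum>x\<in>{1..n}. card {E\<in>pl {1..n} m. deg E x = 0}) <= (exp (- 1) + h) * n * pc n m"
  unfolding sum_degv_eq .
 moreover have "(\<Sum>x\<in>{1..n}. card {E\<in>pl {1..n} m. deg E x = 0}) = n * pc (n - 1) m"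
  by (simp add: card_isolated)
 ultimately have "real (n * pc (n - 1) m) <= (exp (- 1) + h) * n * pc n m" by (simp only:)
 then have "real n * real (pc (n - 1) m) <= real n * ((exp (- 1) + h) * pc n m)" by (simp add: mult_ac)
 then show ?case using p n by simp
qed

text \<open>By \<open>card_leaf\<close> each x is a leaf in at least (n - 1)
  \<open>pc (n - 1) (m - 1)\<close> graphs, while the mean number of leaves is at most about
  n/e.\<close>

lemma pc_leaf_upper:
 fixes h :: real
 assumes h: "h > 0"
 shows "eventually (%(n, m). real (n - 1) * real (pc (n - 1) (m - 1)) <= (exp (- 1) + h) * pc n m) crit"
 using degree_mean[OF h, of 1] crit_ge[of 4] crit_near[of "1/2", simplified]
proof eventually_elim
 case (elim p)
 obtain n m where p: "p = (n, m)" by (cases p)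
 have n: "n \<ge> 4" and near: "\<bar>2 * real m - real n\<bar> <= 1/2 * real n" using elim p by auto
 then have m: "m \<ge> 1" by (cases m) auto
 have "real (\<Sum>E\<in>pl {1..n} m. card (degv n E 1)) <= (exp (- 1) + h) * n * pc n m"
  using elim p by simp
 then have "real (\<Sum>x\<in>{1..n}. card {E\<in>pl {1..n} m. deg E x = 1}) <= (exp (- 1) + h) * n * pc n m"
  unfolding sum_degv_eq .
 moreover have "n * ((n - 1) * pc (n - 1) (m - 1)) <= (\<Sum>x\<in>{1..n}. card {E\<in>pl {1..n} m. deg E x = 1})"
 proof -
  have "(\<Sum>x\<in>{1..n}. (n - 1) * pc (n - 1) (m - 1)) <= (\<Sum>x\<in>{1..n}. card {E\<in>pl {1..n} m. deg E x = 1})"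
  proof (rule sum_mono)
   fix x assume "x \<in> {1..n}"
   then show "(n - 1) * pc (n - 1) (m - 1) <= card {E\<in>pl {1..n} m. deg E x = 1}"
    using card_leaf[of "{1..n}" x "m - 1"] m by simp
  qed
  then show ?thesis by simp
 qed
 then have "real (n * ((n - 1) * pc (n - 1) (m - 1))) <= real (\<Sum>x\<in>{1..n}. card {E\<in>pl {1..n} m. deg E x = 1})"
  by (rule of_nat_mono)
 ultimately have "real n * (real (n - 1) * real (pc (n - 1) (m - 1))) <= real n * ((exp (- 1) + h) * pc n m)" by (simp add: mult_ac)
 then show ?case using p n by simp
qed

text \<open>A lower bound out of upper bounds: the degrees 1 to D take at most their Poisson shares,
  degrees above D occur at no more than 2n/(D + 1) vertices by the handshake lemma, and all
  remaining vertices are isolated.\<close>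

lemma pc_isolated_lower:
 fixes h :: real
 assumes h: "h > 0"
 shows "eventually (%(n, m). (exp (- 1) - h) * pc n m <= real (pc (n - 1) m)) crit"
proof -
 \<comment> \<open>Makes 2/(D + 1) <= h/2. The D errors f below add up to the other h/2.\<close>
 define D where "D = nat \<lceil>4 / h\<rceil>"
 have D: "4 / h <= D" unfolding D_def by linarith
 then have D0: "D > 0" using h by (smt (verit) divide_pos_pos of_nat_0_less_iff)
 have Dn: "2 / (D + 1) <= h / 2"
 proof -
  have "4 <= h * D" using D h by (simp add: field_simps)
  then have "4 <= h * (D + 1)" using h by (simp add: algebra_simps)
  then show ?thesis by (simp add: field_simps)
 qed
 define f where "f = h / (2 * D)"
 have z: "f > 0" using h D0 by (simp add: f_def)
 have "eventually (%p. \<forall>d\<in>{1..D}. case p of (n, m) =>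
   real (\<Sum>E\<in>pl {1..n} m. card (degv n E d)) <= (exp (- 1) / fact d + f) * n * pc n m) crit"
  by (intro eventually_ball_finite finite_atLeastAtMost ballI degree_mean[OF z])
 with crit_ge[of 4] crit_near[of "1/2", simplified] show ?thesis
 proof eventually_elim
  case (elim p)
  obtain n m where p: "p = (n, m)" by (cases p)
  let ?P = "pl {1..n} m"
  have n4: "n \<ge> 4" and near: "\<bar>2 * real m - real n\<bar> <= 1/2 * real n"
   and up: "\<And>d. d \<in> {1..D} ==> real (\<Sum>E\<in>?P. card (degv n E d)) <= (exp (- 1) / fact d + f) * n * pc n m"
   using elim p by auto
  have n: "real n > 0" using n4 by simp
  have m: "2 * real m <= 2 * real n" using near by linarith
  have "real n <= card (degv n E 0) + (\<Sum>d\<in>{1..D}. real (card (degv n E d))) + 2 * real n / (D + 1)" if E: "E \<in> ?P" for E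
  proof -
   let ?H = "{x\<in>{1..n}. D < deg E x}"
   have "{1..n} = degv n E 0 \<union> (\<Union>d\<in>{1..D}. degv n E d) \<union> ?H"
   proof -
    have "x \<in> degv n E 0 \<union> (\<Union>d\<in>{1..D}. degv n E d) \<union> ?H" if x: "x \<in> {1..n}" for x
     using x by (cases "deg E x = 0"; cases "deg E x <= D") (auto simp: degv_def)
    then show ?thesis by (auto simp: degv_def)
   qed
   then have "n <= card (degv n E 0 \<union> (\<Union>d\<in>{1..D}. degv n E d) \<union> ?H)" by (metis card_atLeastAtMost diff_Suc_1 order_refl)
   also have "... <= card (degv n E 0) + (\<Sum>d\<in>{1..D}. card (degv n E d)) + card ?H"
    using card_Un_le[of "degv n E 0 \<union> (\<Union>d\<in>{1..D}. degv n E d)" ?H] card_Un_le[of "degv n E 0" "\<Union>d\<in>{1..D}. degv n E d"]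
     card_UN_le[of "{1..D}" "degv n E"] by simp
   finally have "real n <= real (card (degv n E 0) + (\<Sum>d\<in>{1..D}. card (degv n E d)) + card ?H)" by (rule of_nat_mono)
   then have a: "real n <= card (degv n E 0) + (\<Sum>d\<in>{1..D}. real (card (degv n E d))) + card ?H"
    by (simp only: of_nat_add of_nat_sum)
   have "(D + 1) * card ?H = (\<Sum>x\<in>?H. D + 1)" by simp
   also have "... <= (\<Sum>x\<in>?H. deg E x)" by (rule sum_mono) auto
   also have "... <= (\<Sum>x\<in>{1..n}. deg E x)" by (rule sum_mono2) auto
   also have "... = 2 * m" using E handshake[of "{1..n}" E] by (simp add: pl_def)
   finally have "real ((D + 1) * card ?H) <= real (2 * m)" by (rule of_nat_mono)
   then have "real (D + 1) * card ?H <= 2 * real n" using m by (simp add: algebra_simps)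
   then have "card ?H <= 2 * real n / (D + 1)" by (simp add: field_simps)
   then show ?thesis using a by simp
  qed
  then have "(\<Sum>E\<in>?P. real n) <= (\<Sum>E\<in>?P. card (degv n E 0) + (\<Sum>d\<in>{1..D}. real (card (degv n E d))) + 2 * real n / (D + 1))"
   by (rule sum_mono)
  also have "... = real (\<Sum>E\<in>?P. card (degv n E 0)) + (\<Sum>d\<in>{1..D}. real (\<Sum>E\<in>?P. card (degv n E d))) + pc n m * (2 * real n / (D + 1))"
  proof -
   have sw: "(\<Sum>E\<in>?P. \<Sum>d\<in>{1..D}. real (card (degv n E d))) = (\<Sum>d\<in>{1..D}. \<Sum>E\<in>?P. real (card (degv n E d)))"
    by (rule sum.swap)
   show ?thesis by (simp add: sum.distrib card_pl sw del: of_nat_Suc One_nat_def)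
  qed
  also have "... <= real (n * pc (n - 1) m) + (\<Sum>d\<in>{1..D}. (exp (- 1) / fact d + f) * n * pc n m) + pc n m * (2 * real n / (D + 1))"
  proof -
   have "(\<Sum>E\<in>?P. card (degv n E 0)) = n * pc (n - 1) m" unfolding sum_degv_eq by (simp add: card_isolated)
   then show ?thesis using sum_mono[of "{1..D}", OF up] by (simp del: of_nat_sum)
  qed
  also have "(\<Sum>d\<in>{1..D}. (exp (- 1) / fact d + f) * n * pc n m) = (exp (- 1) * (\<Sum>d\<in>{1..D}. 1 / fact d) + D * f) * n * pc n m"
   by (simp add: sum.distrib sum_distrib_left sum_distrib_right algebra_simps)
  also have "... <= (1 - exp (- 1) + h / 2) * n * pc n m"
  proof -
   have "(\<Sum>d\<le>D. 1 ^ d / fact d) <= (\<Sum>d. 1 ^ d / fact d :: real)"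
    using summable_exp[of "1::real"] by (intro sum_le_suminf) (auto simp: field_simps)
   then have "(\<Sum>d\<le>D. 1 / fact d) <= exp (1::real)" by (simp add: exp_def field_simps)
   moreover have "(\<Sum>d\<le>D. 1 / fact d :: real) = 1 + (\<Sum>d\<in>{1..D}. 1 / fact d)"
   proof -
    have "{..D} = insert 0 {1..D}" by auto
    then show ?thesis by simp
   qed
   ultimately have "(\<Sum>d\<in>{1..D}. 1 / fact d) <= exp (1::real) - 1" by simp
   then have "exp (- 1) * (\<Sum>d\<in>{1..D}. 1 / fact d) <= exp (- 1) * (exp (1::real) - 1)" by (intro mult_left_mono) auto
   also have "... = 1 - exp (- 1)" by (simp add: algebra_simps exp_add[symmetric])
   finally show ?thesis using D0 by (intro mult_right_mono) (auto simp: f_def)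
  qed
  also have "pc n m * (2 * real n / (D + 1)) <= pc n m * (real n * (h / 2))"
   using mult_left_mono[OF Dn, of "real n"] by (intro mult_left_mono) auto
  finally have "n * real (pc n m) <= n * (real (pc (n - 1) m) + (1 - exp (- 1) + h / 2) * pc n m + pc n m * (h / 2))"
   by (simp add: card_pl algebra_simps)
  then have "real (pc n m) <= real (pc (n - 1) m) + (1 - exp (- 1) + h / 2) * pc n m + pc n m * (h / 2)"
   using n by (rule mult_left_le_imp_le)
  then show ?case using p by (simp add: algebra_simps)
 qed
qed

text \<open>A detour over n + 1 vertices: adding a leaf compares (n, m - 1) with (n + 1, m), and
  removing an isolated vertex compares (n + 1, m) with (n, m). The factors 1/e and e cancel.\<close>

lemma pc_edge_upper:
 fixes h :: real
 assumes h: "h > 0"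
 shows "eventually (%(n, m). real n * real (pc n (m - 1)) <= (1 + h) * pc n m) crit"
proof -
 define e where "e = exp (- 1 :: real)"
 have e0: "e > 0" by (simp add: e_def)
 define z where "z = min (e / 2) (h * e / 4)"
 have z: "z > 0" "z <= e / 2" "z <= h * e / 4" using e0 h by (auto simp: z_def)
 have A: "(e + z) / (e - z) <= 1 + h"
 proof -
  have "h * z <= h * (e / 2)" using z h by (intro mult_left_mono) auto
  then have "e + z <= (1 + h) * (e - z)" using z by (simp add: algebra_simps)
  then show ?thesis using z e0 by (simp add: pos_divide_le_eq)
 qed
 from crit_shift[OF pc_leaf_upper[OF z(1)], of 1 0 0] crit_shift[OF pc_isolated_lower[OF z(1)], of 1 0 0]
 show ?thesis
 proof eventually_elim
  case (elim p)
  obtain n m where p: "p = (n, m)" by (cases p)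
  have 1: "n * real (pc n (m - 1)) <= (e + z) * pc (n + 1) m" and 2: "(e - z) * pc (n + 1) m <= pc n m"
   using elim p by (auto simp: e_def)
  have "real (pc (n + 1) m) <= pc n m / (e - z)" using 2 z e0 by (simp add: pos_le_divide_eq mult.commute)
  then have "(e + z) * pc (n + 1) m <= (e + z) * (pc n m / (e - z))" using e0 z by (intro mult_left_mono) auto
  also have "... = (e + z) / (e - z) * pc n m" by simp
  also have "... <= (1 + h) * pc n m" using A by (intro mult_right_mono) auto
  finally show ?case using 1 p by simp
 qed
qed

text \<open>A removed vertex costs 1/e and a removed edge 1/n. This prices the inner vertices and
  the edges of an embedded tree.\<close>

lemma pc_removal:
 fixes h :: real
 assumes "h > 0"
 shows "eventually (%(n, m). real n ^ c * real (pc (n - i) (m - c)) <= (exp (- real i) + h) * pc n m) crit"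
 using assms
proof (induction i arbitrary: h)
 case 0
 then show ?case
 proof (induction c arbitrary: h)
  case 0
  show ?case by (rule eventually_mono[OF crit_ge[of 0]]) (use 0 in \<open>auto simp: algebra_simps\<close>)
 next
  case (Suc c)
  define z where "z = min 1 (h / 3)"
  have z: "z > 0" "z <= 1" "3 * z <= h" using Suc.prems by (auto simp: z_def)
  from crit_shift[OF pc_edge_upper[OF z(1)], of 0 0 c] Suc.IH[OF z(1)] show ?case
  proof eventually_elim
   case (elim p)
   obtain n m where p: "p = (n, m)" by (cases p)
   have a: "n * real (pc n (m - c - 1)) <= (1 + z) * pc n (m - c)"
    and b: "real n ^ c * real (pc n (m - c)) <= (1 + z) * pc n m" using elim p by auto
   have "real n ^ Suc c * real (pc n (m - Suc c)) = real n ^ c * (n * real (pc n (m - c - 1)))" by (simp add: diff_right_commute)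
   also have "... <= real n ^ c * ((1 + z) * pc n (m - c))" using a by (intro mult_left_mono) auto
   also have "... = (1 + z) * (real n ^ c * real (pc n (m - c)))" by simp
   also have "... <= (1 + z) * ((1 + z) * pc n m)" using b z by (intro mult_left_mono) auto
   also have "... = ((1 + z) * (1 + z)) * pc n m" by simp
   also have "... <= (1 + h) * pc n m"
   proof (rule mult_right_mono)
    have "z * z <= z * 1" using z by (intro mult_left_mono) auto
    moreover have "(1 + z) * (1 + z) = 1 + 2 * z + z * z" by (simp add: algebra_simps)
    ultimately show "(1 + z) * (1 + z) <= 1 + h" using z by linarith
   qed simp
   finally show ?case using p by simp
  qed
 qed
next
 case (Suc i)
 define z where "z = min 1 (h / 3)"
 have z: "z > 0" "z <= 1" "3 * z <= h" using Suc.prems by (auto simp: z_def)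
 from crit_shift[OF pc_isolated_upper[OF z(1)], of 0 i c] Suc.IH[OF z(1)] show ?case
 proof eventually_elim
  case (elim p)
  obtain n m where p: "p = (n, m)" by (cases p)
  have a: "real (pc (n - i - 1) (m - c)) <= (exp (- 1) + z) * pc (n - i) (m - c)"
   and b: "real n ^ c * real (pc (n - i) (m - c)) <= (exp (- real i) + z) * pc n m" using elim p by auto
  have "real n ^ c * real (pc (n - Suc i) (m - c)) <= real n ^ c * ((exp (- 1) + z) * pc (n - i) (m - c))"
   using a by (intro mult_left_mono) (auto simp: diff_right_commute)
  also have "... = (exp (- 1) + z) * (real n ^ c * real (pc (n - i) (m - c)))" by simp
  also have "... <= (exp (- 1) + z) * ((exp (- real i) + z) * pc n m)" using b z by (intro mult_left_mono) (auto intro: add_nonneg_nonneg)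
  also have "... = ((exp (- 1) + z) * (exp (- real i) + z)) * pc n m" by simp
  also have "... <= (exp (- real (Suc i)) + h) * pc n m"
  proof (rule mult_right_mono)
   have "z * z <= z * 1" using z by (intro mult_left_mono) auto
   moreover have "exp (- 1) * z <= 1 * z" "z * exp (- real i) <= z * 1" using z by (auto intro!: mult_right_mono mult_left_mono)
   moreover have "exp (- real (Suc i)) = exp (- 1) * exp (- real i)" by (simp add: exp_add[symmetric])
   moreover have "(exp (- 1) + z) * (exp (- real i) + z) = exp (- 1) * exp (- real i) + exp (- 1) * z + z * exp (- real i) + z * z"
    by (simp add: algebra_simps)
   ultimately show "(exp (- 1) + z) * (exp (- real i) + z) <= exp (- real (Suc i)) + h" using z by linarith
  qed simp
  finally show ?case using p by simp
 qed
qed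

lemma pc_upper: "real (pc n m) * (2 ^ m * fact m) <= real n ^ (2 * m)"
proof -
 have "card (pl {1..n} m) * (2 ^ m * fact m) <= card {w. set w \<subseteq> {1..n} \<and> length w = 2 * m}"
 proof (rule graphs_le_words[of "{1..n}"])
  fix E w assume E: "E \<in> pl {1..n} m" and w: "codes w E"
  have "finite E" by (rule finite_plE[OF E]) simp
  moreover have "set w \<subseteq> {1..n}" using codes_set[OF w] E simple_graph_subset[of "{1..n}" E] unfolding pl_def by blast
  ultimately show "w \<in> {w. set w \<subseteq> {1..n} \<and> length w = 2 * m}" using codes_length[OF w] E by (simp add: pl_def)
 qed (auto simp: pl_def intro: finite_lists_length_eq)
 also have "... = n ^ (2 * m)" by (subst card_lists_length_eq) auto
 finally have "real (pc n m * (2 ^ m * fact m)) <= real (n ^ (2 * m))" by (simp add: card_pl del: of_nat_mult of_nat_power)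
 then show ?thesis by simp
qed

text \<open>In contrast to \<open>pc_removal\<close>, this is uniform in e up to m. For e <= Dn/4
  the ratio bound 2 is iterated; for larger e the crude upper and lower bounds for the counts
  suffice, because their discrepancy exp(Dn/4) is at most exp(e). The constant 6 covers 2
  exp(1).\<close>

lemma pc_edges_crude:
 "eventually (%(n, m). \<forall>e\<le>m. real n ^ e * real (pc n (m - e)) <= 6 ^ e * real (pc n m)) crit"
proof -
 obtain D0 k where d0: "D0 > 0" and R: "\<And>n m. n \<ge> k ==> \<bar>2 * real m - real n\<bar> <= D0 * n ==> n * real (pc n (m - 1)) <= (1 + 1) * pc n m"
  using pc_edge_upper[of 1] unfolding eventually_crit by (auto simp del: One_nat_def)
 define D where "D = min 1 D0"
 have d: "D > 0" "D <= 1" "D <= D0" using d0 by (auto simp: D_def)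
 have d2: "D / 2 > 0" "D / 4 > 0" using d by auto
 from pc_lower_bound[OF d2(2)] crit_near[OF d2(1)] crit_ge[of "Suc k"] show ?thesis
 proof eventually_elim
  case (elim p)
  obtain n m where p: "p = (n, m)" by (cases p)
  have n: "n \<ge> k" "n > 0" and near: "\<bar>2 * real m - real n\<bar> <= D / 2 * n"
   and lb: "exp (- (D / 4) * n) * real n ^ (2 * m) <= real (pc n m) * (2 ^ m * fact m)" using elim p by auto
  have dn: "D * n <= D0 * n" "D * n <= n" using d mult_right_mono[of D D0 "real n"] mult_right_mono[of D 1 "real n"] by auto
  have "real n ^ e * real (pc n (m - e)) <= 6 ^ e * real (pc n m)" if e: "e <= m" for e
  proof (cases "real e <= D / 4 * n")
   case True
   have "real n ^ e * real (pc n (m - e)) <= 2 ^ e * real (pc n m)" using e True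
   proof (induction e)
    case (Suc e)
    have s: "\<bar>2 * real (m - e) - real n\<bar> <= D0 * n"
    proof -
     have "real (m - e) = real m - real e" using Suc.prems by simp
     moreover have "real e <= D * n / 4" "\<bar>2 * real m - real n\<bar> <= D * n / 2" using Suc.prems near by auto
     ultimately show ?thesis using dn by linarith
    qed
    have "real n ^ Suc e * real (pc n (m - Suc e)) = real n ^ e * (n * real (pc n (m - e - 1)))" by (simp add: diff_right_commute)
    also have "... <= real n ^ e * (2 * pc n (m - e))" using R[OF n(1) s] by (intro mult_left_mono) auto
    also have "... = 2 * (real n ^ e * pc n (m - e))" by simp
    also have "... <= 2 * (2 ^ e * real (pc n m))" using Suc by (intro mult_left_mono) auto
    finally show ?case by simp
   qed simp
   also have "... <= 6 ^ e * real (pc n m)" by (intro mult_right_mono power_mono) auto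
   finally show ?thesis .
  next
   case False
   have F: "(0::real) < 2 ^ m * fact m" by simp
   have f: "(fact m :: real) <= real m ^ e * fact (m - e)"
   proof -
    have "fact m <= m ^ e * (fact (m - e) :: nat)" using e
    proof (induction e)
     case (Suc e)
     have "(fact (m - e) :: nat) = (m - e) * fact (m - Suc e)"
      using Suc.prems by (metis Suc_diff_Suc Suc_le_lessD fact_Suc of_nat_id)
     also have "... <= m * fact (m - Suc e)" by (intro mult_right_mono) auto
     finally have "fact m <= m ^ e * (m * fact (m - Suc e) :: nat)" using Suc by (meson Suc_leD le_trans mult_le_mono2)
     then show ?case by (simp add: mult_ac)
    qed simp
    then have "real (fact m) <= real (m ^ e * fact (m - e))" by (rule of_nat_mono)
    then show ?thesis by simp
   qed
   have "real n ^ e * real (pc n (m - e)) * (2 ^ m * fact m) <= real n ^ e * real (pc n (m - e)) * (2 ^ m * (real m ^ e * fact (m - e)))"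
    using f by (intro mult_left_mono) auto
   also have "... = (n * (2 * real m)) ^ e * (real (pc n (m - e)) * (2 ^ (m - e) * fact (m - e)))"
   proof -
    have tm: "(2::real) ^ m = 2 ^ e * 2 ^ (m - e)" using e by (metis le_add_diff_inverse power_add)
    show ?thesis unfolding tm by (simp add: power_mult_distrib mult_ac)
   qed
   also have "... <= (n * (2 * real n)) ^ e * real n ^ (2 * (m - e))"
   proof -
    have "real m <= real n" using near dn by linarith
    then have "n * (2 * real m) <= n * (2 * real n)" by (intro mult_left_mono) auto
    then have "(n * (2 * real m)) ^ e <= (n * (2 * real n)) ^ e" by (rule power_mono) simp
    then show ?thesis by (rule mult_mono[OF _ pc_upper]) auto
   qed
   also have "... = 2 ^ e * real n ^ (2 * m)"
   proof -
    have "2 * m = 2 * e + 2 * (m - e)" using e by simp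
    then have "real n ^ (2 * m) = real n ^ (2 * e) * real n ^ (2 * (m - e))" by (metis power_add)
    then show ?thesis by (simp add: power_mult_distrib power_mult power2_eq_square mult_ac)
   qed
   also have "... = 2 ^ e * exp (D / 4 * n) * (exp (- (D / 4) * n) * real n ^ (2 * m))"
   proof -
    have "exp (D / 4 * n) * exp (- (D / 4) * n) = 1" by (simp add: exp_add[symmetric])
    then have "2 ^ e * real n ^ (2 * m) = 2 ^ e * (exp (D / 4 * n) * exp (- (D / 4) * n)) * real n ^ (2 * m)" by simp
    then show ?thesis by (simp only: mult_ac)
   qed
   also have "... <= 2 ^ e * exp 1 ^ e * (real (pc n m) * (2 ^ m * fact m))"
   proof (rule mult_mono[OF _ lb])
    have "exp (D / 4 * n) <= exp (real e)" using False by simp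
    then have "exp (D / 4 * n) <= exp 1 ^ e" by (simp add: exp_of_nat_mult[symmetric])
    then show "2 ^ e * exp (D / 4 * n) <= 2 ^ e * exp 1 ^ e" by (rule mult_left_mono) simp
   qed auto
   also have "... <= 6 ^ e * (real (pc n m) * (2 ^ m * fact m))"
   proof (rule mult_right_mono)
    have "2 * exp 1 <= (6::real)" using exp_le by simp
    then have "(2 * exp 1) ^ e <= (6::real) ^ e" by (intro power_mono) auto
    then show "2 ^ e * exp 1 ^ e <= (6::real) ^ e" by (simp add: power_mult_distrib)
   qed simp
   finally have "real n ^ e * real (pc n (m - e)) * (2 ^ m * fact m) <= 6 ^ e * real (pc n m) * (2 ^ m * fact m)" by (simp only: mult.assoc)
   then show ?thesis using F by (rule mult_right_le_imp_le)
  qed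
  then show ?case using p by simp
 qed
qed

section \<open>Truncated Galton-Watson trees as unfoldings\<close>

text \<open>Unfolds a system of states with ordered lists of successors down to depth d.
  Neighbourhoods in graphs and descendants in rooted forests both arise in this way.\<close>

fun tree_of :: "('s => 's list) => nat => 's => nat list set" where
 "tree_of c 0 x = {[]}"
| "tree_of c (Suc d) x = insert [] (\<Union>i<length (c x). (#) i ` tree_of c d (c x ! i))"

fun walk :: "('s => 's list) => 's => nat list => 's" where
 "walk c x [] = x"
| "walk c x (i # p) = walk c (c x ! i) p"

definition nchild :: "nat list set => nat list => nat" where
 "nchild U p = card {i. p @ [i] \<in> U}"

definition inner_nodes :: "nat => nat list set => nat list set" where
 "inner_nodes d U = {p\<in>U. length p < d}"

text \<open>The product of the Poisson(1) weights at the nodes whose offspring is revealed; nodes at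
  depth d contribute nothing.\<close>

definition weight :: "nat => nat list set => real" where
 "weight d U = (\<Prod>p\<in>inner_nodes d U. exp (- 1) / fact (nchild U p))"

lemma walk_snoc: "walk c x (p @ [i]) = c (walk c x p) ! i"
 by (induction p arbitrary: x) auto

lemma Nil_in_tree_of [simp]: "[] \<in> tree_of c d x"
 by (cases d) auto

lemma tree_of_snoc: "p @ [i] \<in> tree_of c d x \<longleftrightarrow> p \<in> tree_of c d x \<and> length p < d \<and> i < length (c (walk c x p))"
proof (induction d arbitrary: x p)
 case (Suc d)
 show ?case
 proof (cases p)
  case Nil
  then show ?thesis by (auto simp: image_iff)
 next
  case (Cons j q)
  then show ?thesis using Suc.IH[of q "c x ! j"] by auto
 qed
qed auto

lemma finite_tree_of: "finite (tree_of c d x)"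
 by (induction d arbitrary: x) auto

lemma nchild_tree_of: "p \<in> tree_of c d x ==> length p < d ==> nchild (tree_of c d x) p = length (c (walk c x p))"
proof -
 assume "p \<in> tree_of c d x" "length p < d"
 then have "{i. p @ [i] \<in> tree_of c d x} = {..<length (c (walk c x p))}" by (auto simp: tree_of_snoc)
 then show ?thesis by (simp add: nchild_def)
qed

lemma weight_tree_of_Suc:
 "weight (Suc d) (tree_of c (Suc d) x) = exp (- 1) / fact (length (c x)) * (\<Prod>i<length (c x). weight d (tree_of c d (c x ! i)))"
proof -
 let ?U = "tree_of c (Suc d) x" and ?k = "length (c x)" and ?t = "%i. tree_of c d (c x ! i)"
 have inn: "inner_nodes (Suc d) ?U = insert [] (\<Union>i<?k. (#) i ` inner_nodes d (?t i))" by (auto simp: inner_nodes_def)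
 have fin: "finite (inner_nodes d (?t i))" for i using finite_tree_of[of c d "c x ! i"] by (simp add: inner_nodes_def)
 have n0: "nchild ?U [] = ?k" using nchild_tree_of[of "[]" c "Suc d" x] by simp
 have n1: "nchild ?U (i # p) = nchild (?t i) p" if "i < ?k" for i p
  unfolding nchild_def by (rule arg_cong[of _ _ card]) (use that in auto)
 have "weight (Suc d) ?U = exp (- 1) / fact (nchild ?U []) * (\<Prod>p\<in>(\<Union>i<?k. (#) i ` inner_nodes d (?t i)). exp (- 1) / fact (nchild ?U p))"
  unfolding weight_def inn using fin by (subst prod.insert) auto
 also have "(\<Prod>p\<in>(\<Union>i<?k. (#) i ` inner_nodes d (?t i)). exp (- 1) / fact (nchild ?U p)) =
   (\<Prod>i<?k. \<Prod>p\<in>(#) i ` inner_nodes d (?t i). exp (- 1) / fact (nchild ?U p))"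
  by (rule prod.UNION_disjoint) (use fin in auto)
 also have "... = (\<Prod>i<?k. weight d (?t i))"
  by (rule prod.cong[OF refl]) (simp add: prod.reindex weight_def n1 del: tree_of.simps)
 finally show ?thesis by (simp only: n0)
qed

lemma pmf_bind_ge: "pmf M a * pmf (f a) y <= pmf (bind_pmf M f) y"
proof -
 have "pmf M a * pmf (f a) y = (\<integral>x. indicator {a} x * pmf (f a) y \<partial>measure_pmf M)"
  by (simp add: measure_pmf_single)
 also have "... <= (\<integral>x. pmf (f x) y \<partial>measure_pmf M)"
 proof (rule integral_mono)
  show "integrable (measure_pmf M) (%x. indicator {a} x * pmf (f a) y)"
   by (rule measure_pmf.integrable_const_bound[of _ 1]) (auto simp: pmf_le_1 indicator_def)
  show "integrable (measure_pmf M) (%x. pmf (f x) y)"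
   by (rule measure_pmf.integrable_const_bound[of _ 1]) (auto simp: pmf_le_1)
 qed (auto simp: indicator_def)
 finally show ?thesis by (simp add: pmf_bind)
qed

lemma pmf_replicate_ge: "prod_list (map (pmf p) xs) <= pmf (replicate_pmf (length xs) p) xs"
proof (induction xs)
 case (Cons x xs)
 have "prod_list (map (pmf p) (x # xs)) <= pmf p x * (pmf (replicate_pmf (length xs) p) xs * pmf (return_pmf (x # xs)) (x # xs))"
  using Cons by (simp add: mult_left_mono)
 also have "... <= pmf p x * pmf (bind_pmf (replicate_pmf (length xs) p) (%xs. return_pmf (x # xs))) (x # xs)"
  by (intro mult_left_mono pmf_bind_ge) auto
 also have "... <= pmf (replicate_pmf (length (x # xs)) p) (x # xs)"
  unfolding list.size replicate_pmf.simps add_0_right add_Suc_right by (rule pmf_bind_ge)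
 finally show ?case .
qed simp

text \<open>One run of the generation process produces this tree, and its probability is the weight.
  The direction is the one required: counts are bounded above by weights, hence by
  probabilities.\<close>

lemma weight_le_pmf: "weight d (tree_of c d x) <= pmf (gw_trunc 1 d) (tree_of c d x)"
proof (induction d arbitrary: x)
 case 0
 then show ?case by (simp add: weight_def inner_nodes_def)
next
 case (Suc d)
 let ?k = "length (c x)" and ?t = "map (tree_of c d) (c x)" and ?U = "tree_of c (Suc d) x"
 let ?j = "%k ts. insert [] (\<Union>i<k. (%w. i # w) ` (ts ! i))"
 have U: "?U = ?j ?k ?t" by simp
 have "weight (Suc d) ?U = exp (- 1) / fact ?k * (\<Prod>i<?k. weight d (tree_of c d (c x ! i)))" by (rule weight_tree_of_Suc)
 also have "... <= exp (- 1) / fact ?k * (\<Prod>i<?k. pmf (gw_trunc 1 d) (tree_of c d (c x ! i)))"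
  by (intro mult_left_mono prod_mono conjI Suc.IH) (auto simp: weight_def intro!: prod_nonneg)
 also have "(\<Prod>i<?k. pmf (gw_trunc 1 d) (tree_of c d (c x ! i))) = prod_list (map (pmf (gw_trunc 1 d)) ?t)"
  by (simp add: prod.list_conv_set_nth atLeast0LessThan)
 also have "exp (- 1) / fact ?k * prod_list (map (pmf (gw_trunc 1 d)) ?t)
   <= pmf (poisson_pmf 1) ?k * pmf (replicate_pmf ?k (gw_trunc 1 d)) ?t"
  using pmf_replicate_ge[of "gw_trunc 1 d" ?t] by (simp add: mult_left_mono divide_right_mono)
 also have "... = pmf (poisson_pmf 1) ?k * (pmf (replicate_pmf ?k (gw_trunc 1 d)) ?t * pmf (return_pmf (?j ?k ?t)) ?U)"
  unfolding U by simp
 also have "... <= pmf (poisson_pmf 1) ?k * pmf (bind_pmf (replicate_pmf ?k (gw_trunc 1 d)) (%ts. return_pmf (?j ?k ts))) ?U"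
  by (intro mult_left_mono pmf_bind_ge) auto
 also have "... <= pmf (gw_trunc 1 (Suc d)) ?U" unfolding gw_trunc.simps by (rule pmf_bind_ge)
 finally show ?case .
qed

text \<open>Realised trees: address sets that occur as unfoldings of some child function.\<close>

definition rtree :: "nat => nat list set => bool" where
 "rtree d U \<longleftrightarrow> finite U \<and> [] \<in> U \<and> (\<forall>p i. p @ [i] \<in> U \<longleftrightarrow> p \<in> U \<and> length p < d \<and> i < nchild U p)
   \<and> weight d U <= pmf (gw_trunc 1 d) U"

lemma rtree_tree_of: "rtree d (tree_of c d x)"
 unfolding rtree_def
proof (intro conjI allI finite_tree_of Nil_in_tree_of weight_le_pmf)
 fix p i
 show "p @ [i] \<in> tree_of c d x \<longleftrightarrow> p \<in> tree_of c d x \<and> length p < d \<and> i < nchild (tree_of c d x) p"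
  using tree_of_snoc[of p i c d x] nchild_tree_of[of p c d x] by auto
qed

lemma rtreeD:
 assumes "rtree d U"
 shows "finite U" "[] \<in> U" "p @ [i] \<in> U \<longleftrightarrow> p \<in> U \<and> length p < d \<and> i < nchild U p" "weight d U <= pmf (gw_trunc 1 d) U"
 using assms unfolding rtree_def by blast+

lemma rtree_length: "rtree d U ==> p \<in> U ==> length p <= d"
 by (cases p rule: rev_cases) (auto simp: rtreeD(3))

lemma rtree_prefix: "rtree d U ==> p @ q \<in> U ==> p \<in> U"
proof (induction q rule: rev_induct)
 case (snoc i q)
 then show ?case using rtreeD(3)[of d U "p @ q" i] by simp
qed simp

lemma rtree_butlast: "rtree d U ==> p \<in> U ==> p ~= [] ==> butlast p \<in> inner_nodes d U \<and> last p < nchild U (butlast p)"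
 using rtreeD(3)[of d U "butlast p" "last p"] by (simp add: inner_nodes_def)

lemma rtree_nodes:
 assumes "rtree d U"
 shows "U = insert [] (\<Union>p\<in>inner_nodes d U. (%i. p @ [i]) ` {..<nchild U p})"
proof (intro equalityI subsetI)
 fix q assume q: "q \<in> U"
 show "q \<in> insert [] (\<Union>p\<in>inner_nodes d U. (%i. p @ [i]) ` {..<nchild U p})"
 proof (cases "q = []")
  case False
  then have "q = butlast q @ [last q]" "butlast q \<in> inner_nodes d U" "last q \<in> {..<nchild U (butlast q)}"
   using rtree_butlast[OF assms q] by auto
  then show ?thesis by blast
 qed simp
qed (use rtreeD[OF assms] in \<open>auto simp: inner_nodes_def\<close>)

lemma finite_inner: "rtree d U ==> finite (inner_nodes d U)"
 using rtreeD(1) by (simp add: inner_nodes_def)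

lemma card_rtree:
 assumes "rtree d U"
 shows "card U = Suc (\<Sum>p\<in>inner_nodes d U. nchild U p)"
proof -
 have "card U = card (insert [] (\<Union>p\<in>inner_nodes d U. (%i. p @ [i]) ` {..<nchild U p}))"
  using rtree_nodes[OF assms] by (rule arg_cong)
 also have "... = Suc (card (\<Union>p\<in>inner_nodes d U. (%i. p @ [i]) ` {..<nchild U p}))"
  using finite_inner[OF assms] by (subst card_insert_disjoint) auto
 also have "card (\<Union>p\<in>inner_nodes d U. (%i. p @ [i]) ` {..<nchild U p}) = (\<Sum>p\<in>inner_nodes d U. card ((%i. p @ [i]) ` {..<nchild U p}))"
  by (rule card_UN_disjoint) (use finite_inner[OF assms] in auto)
 also have "... = (\<Sum>p\<in>inner_nodes d U. nchild U p)" by (intro sum.cong refl) (simp add: card_image inj_on_def)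
 finally show ?thesis .
qed

section \<open>Counting labelled trees\<close>

text \<open>Lists of trees treat a single tree, as \<open>[U]\<close>, and the l + 1 trees along the
  spine alike; the pairs are the vertices of \<open>skel_graph\<close>.\<close>

definition nodes :: "nat list set list => (nat \<times> nat list) set" where
 "nodes Ts = (SIGMA j:{..<length Ts}. Ts ! j)"

definition inodes :: "nat => nat list set list => (nat \<times> nat list) set" where
 "inodes d Ts = (SIGMA j:{..<length Ts}. inner_nodes d (Ts ! j))"

definition nch :: "nat list set list => nat \<times> nat list => nat" where
 "nch Ts = (%(j, p). nchild (Ts ! j) p)"

definition rtrees :: "nat => nat list set list => bool" where
 "rtrees d Ts \<longleftrightarrow> (\<forall>U\<in>set Ts. rtree d U)"

lemma rtrees_nth: "rtrees d Ts ==> j < length Ts ==> rtree d (Ts ! j)"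
 by (simp add: rtrees_def)

lemma finite_nodes: "rtrees d Ts ==> finite (nodes Ts)"
 unfolding nodes_def by (intro finite_SigmaI) (auto dest: rtrees_nth rtreeD(1))

lemma finite_inodes: "rtrees d Ts ==> finite (inodes d Ts)"
 unfolding inodes_def by (intro finite_SigmaI) (auto dest: rtrees_nth finite_inner)

lemma inodes_subset: "inodes d Ts \<subseteq> nodes Ts"
 by (auto simp: inodes_def nodes_def inner_nodes_def)

lemma card_nodes:
 assumes "rtrees d Ts"
 shows "card (nodes Ts) = length Ts + (\<Sum>q\<in>inodes d Ts. nch Ts q)"
proof -
 have "card (nodes Ts) = (\<Sum>j<length Ts. card (Ts ! j))"
  unfolding nodes_def by (rule card_SigmaI) (auto dest: rtrees_nth[OF assms] rtreeD(1))
 also have "... = (\<Sum>j<length Ts. Suc (\<Sum>p\<in>inner_nodes d (Ts ! j). nchild (Ts ! j) p))"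
  by (rule sum.cong[OF refl]) (use rtrees_nth[OF assms] card_rtree in blast)
 also have "... = length Ts + (\<Sum>j<length Ts. \<Sum>p\<in>inner_nodes d (Ts ! j). nchild (Ts ! j) p)" by (simp only: sum_Suc) simp
 also have "(\<Sum>j<length Ts. \<Sum>p\<in>inner_nodes d (Ts ! j). nchild (Ts ! j) p) = (\<Sum>q\<in>inodes d Ts. nch Ts q)"
  unfolding inodes_def nch_def by (rule sum.Sigma) (auto dest: rtrees_nth[OF assms] finite_inner)
 finally show ?thesis .
qed

lemma prod_inodes_le_pmf:
 assumes "rtrees d Ts"
 shows "(\<Prod>q\<in>inodes d Ts. exp (- 1) / fact (nch Ts q)) <= pmf (replicate_pmf (length Ts) (gw_trunc 1 d)) Ts"
proof -
 have "(\<Prod>q\<in>inodes d Ts. exp (- 1) / fact (nch Ts q)) = (\<Prod>j<length Ts. weight d (Ts ! j))"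
  unfolding inodes_def nch_def weight_def
  by (subst prod.Sigma) (auto dest: rtrees_nth[OF assms] finite_inner simp: case_prod_beta)
 also have "... <= (\<Prod>j<length Ts. pmf (gw_trunc 1 d) (Ts ! j))"
  by (intro prod_mono conjI) (auto simp: weight_def intro!: prod_nonneg rtreeD(4)[OF rtrees_nth[OF assms], unfolded weight_def])
 also have "... = prod_list (map (pmf (gw_trunc 1 d)) Ts)" by (simp add: prod.list_conv_set_nth atLeast0LessThan)
 also have "... <= pmf (replicate_pmf (length Ts) (gw_trunc 1 d)) Ts" by (rule pmf_replicate_ge)
 finally show ?thesis .
qed

text \<open>A labelling of the nodes in which siblings carry increasing labels is determined by the labels of
 the roots and the sets of labels of the children of every inner node.\<close>

definition increasing :: "nat => nat list set list => (nat \<times> nat list => nat) => bool" where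
 "increasing d Ts f \<longleftrightarrow> (\<forall>(j, p)\<in>inodes d Ts. \<forall>i i'. i < i' --> i' < nch Ts (j, p) --> f (j, p @ [i]) < f (j, p @ [i']))"

definition csets :: "nat list set list => (nat \<times> nat list => nat) => nat \<times> nat list => nat set" where
 "csets Ts f q = (%i. f (fst q, snd q @ [i])) ` {..<nch Ts q}"

definition tdata :: "nat => nat list set list => (nat \<times> nat list => nat) => (nat => nat) \<times> (nat \<times> nat list => nat set)" where
 "tdata d Ts f = (restrict (%j. f (j, [])) {..<length Ts}, restrict (csets Ts f) (inodes d Ts))"

lemma increasing_nth:
 fixes f :: "nat => nat"
 assumes "\<And>i i'. i < i' ==> i' < k ==> f i < f i'" "i < k"
 shows "f i = sorted_list_of_set (f ` {..<k}) ! i"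
proof -
 have "sorted_wrt (<) (map f [0..<k])" using assms(1) by (auto simp: sorted_wrt_iff_nth_less)
 then have "sorted_list_of_set (set (map f [0..<k])) = map f [0..<k]"
  by (metis sorted_list_of_set.idem_if_sorted_distinct strict_sorted_iff)
 then show ?thesis using assms(2) by (simp add: atLeast0LessThan)
qed

text \<open>From the roots downwards: the child with index i carries the i-th smallest label in the
  set of children.\<close>

lemma tdata_eq:
 assumes T: "rtrees d Ts" and inc: "increasing d Ts f" "increasing d Ts g" and eq: "tdata d Ts f = tdata d Ts g"
  and q: "(j, p) \<in> nodes Ts"
 shows "f (j, p) = g (j, p)"
 using q
proof (induction p rule: rev_induct)
 case Nil
 then have "j < length Ts" by (simp add: nodes_def)
 then show ?case using eq by (auto simp: tdata_def restrict_def dest: fun_cong[of _ _ j])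
next
 case (snoc i p)
 then have j: "j < length Ts" and pi: "p @ [i] \<in> Ts ! j" by (auto simp: nodes_def)
 have r: "p \<in> Ts ! j" "length p < d" "i < nchild (Ts ! j) p" using rtreeD(3)[OF rtrees_nth[OF T j]] pi by auto
 then have inn: "(j, p) \<in> inodes d Ts" using j by (simp add: inodes_def inner_nodes_def)
 have i: "i < nch Ts (j, p)" using r by (simp add: nch_def)
 have c: "csets Ts f (j, p) = csets Ts g (j, p)"
  using eq inn by (auto simp: tdata_def restrict_def dest: fun_cong[of _ _ "(j, p)"])
 have "f (j, p @ [i]) = sorted_list_of_set ((%i. f (j, p @ [i])) ` {..<nch Ts (j, p)}) ! i"
  by (rule increasing_nth[OF _ i]) (use inc(1) inn in \<open>auto simp: increasing_def\<close>)
 also have "... = sorted_list_of_set ((%i. g (j, p @ [i])) ` {..<nch Ts (j, p)}) ! i"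
  using c by (simp add: csets_def)
 also have "... = g (j, p @ [i])"
  by (rule increasing_nth[OF _ i, symmetric]) (use inc(2) inn in \<open>auto simp: increasing_def\<close>)
 finally show ?case .
qed

lemma card_fibers_le:
 assumes "finite D" "f ` X \<subseteq> D" "\<And>y. y \<in> D ==> card {x\<in>X. f x = y} <= M" "finite X"
 shows "card X <= card D * M"
proof -
 have "X = (\<Union>y\<in>D. {x\<in>X. f x = y})" using assms(2) by auto
 then have "card X = card (\<Union>y\<in>D. {x\<in>X. f x = y})" by (rule arg_cong)
 also have "... <= (\<Sum>y\<in>D. card {x\<in>X. f x = y})" by (rule card_UN_le[OF assms(1)])
 also have "... <= (\<Sum>y\<in>D. M)" by (rule sum_mono) (rule assms(3))
 finally show ?thesis by simp
qed

text \<open>Each root has N possible labels, and the children of a node with k children have N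
  choose k <= N^k/k! possible label sets; the factors 1/k! will become Poisson weights. M bounds the
  number of objects that share their labels.\<close>

lemma count_labellings:
 assumes T: "rtrees d Ts" and V: "finite V" "card V = N" and X: "finite X"
  and emb: "\<And>x. x \<in> X ==> increasing d Ts (F x)" "\<And>x q. x \<in> X ==> q \<in> nodes Ts ==> F x q \<in> V"
  and fib: "\<And>y. y \<in> X ==> card {x\<in>X. tdata d Ts (F x) = tdata d Ts (F y)} <= M"
 shows "real (card X) <= real N ^ card (nodes Ts) * (\<Prod>q\<in>inodes d Ts. 1 / fact (nch Ts q)) * M"
proof -
 define D where "D = (PiE {..<length Ts} (%_. V)) \<times> (PiE (inodes d Ts) (%q. {S. S \<subseteq> V \<and> card S = nch Ts q}))"
 have fI: "finite (inodes d Ts)" by (rule finite_inodes[OF T])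
 have fD: "finite D" unfolding D_def using V fI by (intro finite_cartesian_product finite_PiE) auto
 have sub: "(%x. tdata d Ts (F x)) ` X \<subseteq> D"
 proof (rule image_subsetI)
  fix x assume x: "x \<in> X"
  have child: "(j, p @ [i]) \<in> nodes Ts" if "(j, p) \<in> inodes d Ts" "i < nch Ts (j, p)" for j p i
   using that rtreeD(3)[OF rtrees_nth[OF T, of j], of p i] by (auto simp: inodes_def nodes_def inner_nodes_def nch_def)
  have "restrict (csets Ts (F x)) (inodes d Ts) \<in> PiE (inodes d Ts) (%q. {S. S \<subseteq> V \<and> card S = nch Ts q})"
  proof (rule restrict_PiE_iff[THEN iffD2], intro ballI)
   fix q assume q: "q \<in> inodes d Ts"
   obtain j p where [simp]: "q = (j, p)" by (cases q)
   have "inj_on (%i. F x (j, p @ [i])) {..<nch Ts (j, p)}"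
   proof (rule inj_onI, rule ccontr)
    fix i i' assume i: "i \<in> {..<nch Ts (j, p)}" "i' \<in> {..<nch Ts (j, p)}" "F x (j, p @ [i]) = F x (j, p @ [i'])" "i ~= i'"
    have m: "F x (j, p @ [a]) < F x (j, p @ [b])" if "a < b" "b < nch Ts (j, p)" for a b
     using emb(1)[OF x] q that unfolding increasing_def by auto
    show False using m[of i i'] m[of i' i] i by (cases "i < i'") auto
   qed
   then show "csets Ts (F x) q \<in> {S. S \<subseteq> V \<and> card S = nch Ts q}"
    using emb(2)[OF x] child q by (auto simp: csets_def card_image)
  qed
  moreover have "restrict (%j. F x (j, [])) {..<length Ts} \<in> PiE {..<length Ts} (%_. V)"
   using emb(2)[OF x] rtreeD(2)[OF rtrees_nth[OF T]] by (auto simp: nodes_def)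
  ultimately show "tdata d Ts (F x) \<in> D" unfolding D_def tdata_def by simp
 qed
 have "card X <= card ((%x. tdata d Ts (F x)) ` X) * M"
 proof (rule card_fibers_le[of _ "%x. tdata d Ts (F x)"])
  fix z assume "z \<in> (%x. tdata d Ts (F x)) ` X"
  then obtain y where "y \<in> X" "z = tdata d Ts (F y)" by blast
  then show "card {x\<in>X. tdata d Ts (F x) = z} <= M" using fib by simp
 qed (use X in auto)
 also have "... <= card D * M" using card_mono[OF fD sub] by simp
 finally have "card X <= card D * M" .
 then have "real (card X) <= real (card D * M)" by (rule of_nat_mono)
 then have "real (card X) <= real (card D) * M" by simp
 also have "card D = N ^ length Ts * (\<Prod>q\<in>inodes d Ts. N choose nch Ts q)"
  unfolding D_def using V fI by (simp add: card_cartesian_product card_PiE n_subsets)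
 also have "real (N ^ length Ts * (\<Prod>q\<in>inodes d Ts. N choose nch Ts q)) * M
   <= (real N ^ length Ts * (\<Prod>q\<in>inodes d Ts. real N ^ nch Ts q * (1 / fact (nch Ts q)))) * M"
 proof (intro mult_right_mono)
  have "real (\<Prod>q\<in>inodes d Ts. N choose nch Ts q) <= (\<Prod>q\<in>inodes d Ts. real N ^ nch Ts q * (1 / fact (nch Ts q)))"
   unfolding of_nat_prod
  proof (intro prod_mono conjI)
   fix q
   have "(N choose nch Ts q) * fact (nch Ts q) <= N ^ nch Ts q" by (rule binomial_fact_pow)
   then have "real ((N choose nch Ts q) * fact (nch Ts q)) <= real (N ^ nch Ts q)" by (rule of_nat_mono)
   then show "real (N choose nch Ts q) <= real N ^ nch Ts q * (1 / fact (nch Ts q))" by (simp add: field_simps)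
  qed auto
  then show "real (N ^ length Ts * (\<Prod>q\<in>inodes d Ts. N choose nch Ts q)) <= real N ^ length Ts * (\<Prod>q\<in>inodes d Ts. real N ^ nch Ts q * (1 / fact (nch Ts q)))"
   by (simp add: mult_left_mono)
 qed auto
 also have "real N ^ length Ts * (\<Prod>q\<in>inodes d Ts. real N ^ nch Ts q * (1 / fact (nch Ts q)))
   = real N ^ card (nodes Ts) * (\<Prod>q\<in>inodes d Ts. 1 / fact (nch Ts q))"
  unfolding card_nodes[OF T] by (simp only: prod.distrib power_add power_sum mult_ac)
 finally show ?thesis .
qed

section \<open>From upper bounds for types to two-sided estimates\<close>

text \<open>Upper bounds for the types bound the share of B by the probability of T, and in the same
  way the share of the complement of B by that of the complement of T. As shares and probabilities
  both add up to 1, the estimate is two-sided. The errors r/(card F + 1) add up to at most r, and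
  the uncovered rest costs another r.\<close>

lemma scheffe_finite:
 fixes q :: "'a pmf" and r :: real
 assumes fin: "finite W" "finite F" "B \<subseteq> W"
  and up: "\<And>U. U \<in> F ==> real (card (A U)) <= (pmf q U + r / (card F + 1)) * card W"
  and sub: "\<And>U. U \<in> F ==> A U \<subseteq> W"
  and rest: "real (card (W - (\<Union>U\<in>F. A U))) <= r * card W"
  and ty: "\<And>U w. U \<in> F ==> w \<in> A U ==> w \<in> B \<longleftrightarrow> U \<in> T" and e: "r \<ge> 0" and ne: "W ~= {}"
 shows "\<bar>card B / card W - measure_pmf.prob q T\<bar> <= 2 * r"
proof -
 have O: "real (card W) > 0" using fin(1) ne by (simp add: card_gt_0_iff)
 have fA: "finite (A U)" if "U \<in> F" for U using sub[OF that] fin(1) finite_subset by blast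
 have bound: "real (card C) <= (measure_pmf.prob q T' + 2 * r) * card W"
  if C: "C \<subseteq> W" and ty: "\<And>U w. U \<in> F ==> w \<in> A U ==> w \<in> C ==> U \<in> T'" for C T'
 proof -
  have "C \<subseteq> (\<Union>U\<in>F \<inter> T'. A U) \<union> (W - (\<Union>U\<in>F. A U))" using C ty by blast
  then have "card C <= card ((\<Union>U\<in>F \<inter> T'. A U) \<union> (W - (\<Union>U\<in>F. A U)))"
   using fin fA by (intro card_mono) auto
  also have "... <= card (\<Union>U\<in>F \<inter> T'. A U) + card (W - (\<Union>U\<in>F. A U))" by (rule card_Un_le)
  also have "card (\<Union>U\<in>F \<inter> T'. A U) <= (\<Sum>U\<in>F \<inter> T'. card (A U))" using fin by (intro card_UN_le) auto
  finally have "card C <= (\<Sum>U\<in>F \<inter> T'. card (A U)) + card (W - (\<Union>U\<in>F. A U))" by simp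
  then have "real (card C) <= real ((\<Sum>U\<in>F \<inter> T'. card (A U)) + card (W - (\<Union>U\<in>F. A U)))" by (rule of_nat_mono)
  also have "... = (\<Sum>U\<in>F \<inter> T'. real (card (A U))) + real (card (W - (\<Union>U\<in>F. A U)))" by simp
  also have "... <= (\<Sum>U\<in>F \<inter> T'. (pmf q U + r / (card F + 1)) * card W) + r * card W"
   using up rest by (intro add_mono sum_mono) auto
  also have "... = ((\<Sum>U\<in>F \<inter> T'. pmf q U) + card (F \<inter> T') * (r / (card F + 1)) + r) * card W"
   by (subst sum_distrib_right[symmetric]) (simp add: sum.distrib algebra_simps)
  also have "... <= (measure_pmf.prob q T' + r + r) * card W"
  proof (intro mult_right_mono add_mono order_refl)
   have "(\<Sum>U\<in>F \<inter> T'. pmf q U) = measure_pmf.prob q (F \<inter> T')" using fin by (simp add: measure_measure_pmf_finite)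
   also have "... <= measure_pmf.prob q T'" by (intro measure_pmf.finite_measure_mono) auto
   finally show "(\<Sum>U\<in>F \<inter> T'. pmf q U) <= measure_pmf.prob q T'" .
   have "card (F \<inter> T') <= card F" using fin by (intro card_mono) auto
   then have "real (card (F \<inter> T')) * r <= real (card F + 1) * r" using e by (intro mult_right_mono) auto
   then show "card (F \<inter> T') * (r / (card F + 1)) <= r" by (simp add: field_simps)
  qed simp
  finally show ?thesis by (simp add: add.commute)
 qed
 have 1: "real (card B) <= (measure_pmf.prob q T + 2 * r) * card W"
  by (rule bound[OF fin(3)]) (use ty in blast)
 have 2: "real (card (W - B)) <= (measure_pmf.prob q (- T) + 2 * r) * card W"
  by (rule bound) (use ty in blast)+
 have "measure_pmf.prob q (- T) = 1 - measure_pmf.prob q T"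
  using measure_pmf.prob_compl[of T q] by (simp add: Compl_eq_Diff_UNIV)
 moreover have "real (card (W - B)) = card W - card B"
  using fin card_mono[OF fin(1,3)] finite_subset[OF fin(3,1)] by (simp add: card_Diff_subset of_nat_diff)
 ultimately have "real (card W) - card B <= (1 - measure_pmf.prob q T + 2 * r) * card W" using 2 by simp
 then have "card B \<ge> (measure_pmf.prob q T - 2 * r) * card W" by (simp add: algebra_simps)
 with 1 have "measure_pmf.prob q T - 2 * r <= card B / card W" "card B / card W <= measure_pmf.prob q T + 2 * r"
  using O by (auto simp: field_simps)
 then show ?thesis by linarith
qed

section \<open>Rooted isomorphisms and balls\<close>

lemma rooted_iso_sym: "rooted_iso G H ==> fst G ~= {} ==> snd (snd G) \<in> fst G ==> rooted_iso H G"
proof -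
 assume iso: "rooted_iso G H" and r: "snd (snd G) \<in> fst G"
 obtain V1 E1 r1 V2 E2 r2 where [simp]: "G = (V1, E1, r1)" "H = (V2, E2, r2)" by (cases G, cases H)
 obtain f where f: "bij_betw f V1 V2" "f r1 = r2" "\<And>u v. u \<in> V1 ==> v \<in> V1 ==> {u, v} \<in> E1 \<longleftrightarrow> {f u, f v} \<in> E2"
  using iso by (auto simp: rooted_iso_def)
 define g where "g = inv_into V1 f"
 have g: "bij_betw g V2 V1" unfolding g_def by (rule bij_betw_inv_into[OF f(1)])
 have fg: "f (g u) = u" "g u \<in> V1" if "u \<in> V2" for u
  using f(1) that by (auto simp: g_def bij_betw_inv_into_right intro: bij_betwE[OF g, rule_format, unfolded g_def])
 have "g r2 = r1" using f r by (auto simp: g_def bij_betw_def)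
 then show ?thesis using g f(3) fg by (auto simp: rooted_iso_def intro!: exI[of _ g])
qed

lemma rooted_iso_trans: "rooted_iso G H ==> rooted_iso H K ==> rooted_iso G K"
proof -
 assume iso: "rooted_iso G H" "rooted_iso H K"
 obtain V1 E1 r1 V2 E2 r2 V3 E3 r3 where [simp]: "G = (V1, E1, r1)" "H = (V2, E2, r2)" "K = (V3, E3, r3)"
  by (cases G, cases H, cases K)
 obtain f where f: "bij_betw f V1 V2" "f r1 = r2" "\<And>u v. u \<in> V1 ==> v \<in> V1 ==> {u, v} \<in> E1 \<longleftrightarrow> {f u, f v} \<in> E2"
  using iso by (auto simp: rooted_iso_def)
 obtain g where g: "bij_betw g V2 V3" "g r2 = r3" "\<And>u v. u \<in> V2 ==> v \<in> V2 ==> {u, v} \<in> E2 \<longleftrightarrow> {g u, g v} \<in> E3"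
  using iso by (auto simp: rooted_iso_def)
 have "f u \<in> V2" if "u \<in> V1" for u using f(1) that by (auto simp: bij_betw_def)
 then show ?thesis using bij_betw_trans[OF f(1) g(1)] f g by (auto simp: rooted_iso_def intro!: exI[of _ "g \<circ> f"])
qed

lemma dist_ball_subset: "dist_ball V E l r \<subseteq> V"
 by (induction l) auto

lemma root_in_dist_ball: "r \<in> V ==> r \<in> dist_ball V E l r"
 by (induction l) auto

text \<open>Neighbours have to lift only at vertices of distance less than l (\<open>cov\<close>),
  since neighbours of boundary vertices may leave the ball; edges between two boundary vertices are
  controlled by \<open>ind\<close>.\<close>

lemma ball_iso_cover:
 assumes inj: "inj_on f V1" "f ` V1 \<subseteq> V2" "r1 \<in> V1"
  and hom: "\<And>u v. u \<in> V1 ==> v \<in> V1 ==> {u, v} \<in> E1 ==> {f u, f v} \<in> E2"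
  and cov: "\<And>k u w. Suc k <= l ==> u \<in> dist_ball V1 E1 k r1 ==> w \<in> V2 ==> {f u, w} \<in> E2 ==> \<exists>v\<in>V1. w = f v \<and> {u, v} \<in> E1"
  and ind: "\<And>u v. u \<in> dist_ball V1 E1 l r1 ==> v \<in> dist_ball V1 E1 l r1 ==> {f u, f v} \<in> E2 ==> {u, v} \<in> E1"
 shows "rooted_iso (ball l (V1, E1, r1)) (ball l (V2, E2, f r1))"
proof -
 have eq: "k <= l ==> f ` dist_ball V1 E1 k r1 = dist_ball V2 E2 k (f r1)" for k
 proof (induction k)
  case 0
  then show ?case using inj by auto
 next
  case (Suc k)
  then have IH: "f ` dist_ball V1 E1 k r1 = dist_ball V2 E2 k (f r1)" by simp
  show ?case
  proof (intro equalityI subsetI)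
   fix w assume "w \<in> f ` dist_ball V1 E1 (Suc k) r1"
   then obtain v where v: "w = f v" "v \<in> dist_ball V1 E1 (Suc k) r1" by blast
   show "w \<in> dist_ball V2 E2 (Suc k) (f r1)"
   proof (cases "v \<in> dist_ball V1 E1 k r1")
    case True
    then have "w \<in> dist_ball V2 E2 k (f r1)" using v IH by blast
    then show ?thesis by simp
   next
    case False
    then obtain u where u: "v \<in> V1" "u \<in> dist_ball V1 E1 k r1" "{u, v} \<in> E1" using v by auto
    then have "{f u, f v} \<in> E2" using hom[of u v] dist_ball_subset[of V1 E1 k r1] by auto
    moreover have "f u \<in> dist_ball V2 E2 k (f r1)" using u IH by blast
    moreover have "f v \<in> V2" using u inj(2) by blast
    ultimately show ?thesis unfolding v(1) by auto
   qed
  next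
   fix w assume w: "w \<in> dist_ball V2 E2 (Suc k) (f r1)"
   show "w \<in> f ` dist_ball V1 E1 (Suc k) r1"
   proof (cases "w \<in> dist_ball V2 E2 k (f r1)")
    case True
    then have "w \<in> f ` dist_ball V1 E1 k r1" unfolding IH .
    then show ?thesis by auto
   next
    case False
    then obtain u' where "w \<in> V2" "u' \<in> dist_ball V2 E2 k (f r1)" "{u', w} \<in> E2" using w by auto
    then obtain u where u: "w \<in> V2" "u \<in> dist_ball V1 E1 k r1" "{f u, w} \<in> E2" unfolding IH[symmetric] by blast
    then obtain v where "v \<in> V1" "w = f v" "{u, v} \<in> E1" using cov[of k u w] Suc.prems by blast
    then show ?thesis using u by auto
   qed
  qed
 qed
 let ?B = "dist_ball V1 E1 l r1"
 have sub: "?B \<subseteq> V1" by (rule dist_ball_subset)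
 have "bij_betw f ?B (dist_ball V2 E2 l (f r1))"
  using eq[of l] inj_on_subset[OF inj(1) sub] by (simp add: bij_betw_def)
 moreover have "{u, v} \<in> induced ?B E1 \<longleftrightarrow> {f u, f v} \<in> induced (dist_ball V2 E2 l (f r1)) E2"
  if "u \<in> ?B" "v \<in> ?B" for u v
 proof -
  have "f u \<in> dist_ball V2 E2 l (f r1)" "f v \<in> dist_ball V2 E2 l (f r1)" unfolding eq[OF order_refl, symmetric] using that by auto
  then show ?thesis using that hom[of u v] ind[of u v] sub by (auto simp: induced_def)
 qed
 ultimately show ?thesis unfolding rooted_iso_def ball_def by auto
qed

text \<open>The degrees inside W add up to at least 2 \<open>card W\<close> - 1, and being even the
  sum is then at least 2 \<open>card W\<close>. This detects cycles near a vertex and bounds the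
  edges of a core from below.\<close>

lemma card_edges_min_degree:
 assumes sg: "simple_graph V E" and W: "finite W" and a: "a \<in> W" "\<exists>x\<in>W. {a, x} \<in> E"
  and two: "\<And>w. w \<in> W ==> w ~= a ==> \<exists>x\<in>W. \<exists>y\<in>W. x ~= y \<and> {w, x} \<in> E \<and> {w, y} \<in> E"
 shows "card W <= card {e\<in>E. e \<subseteq> W}"
proof -
 let ?F = "{e\<in>E. e \<subseteq> W}"
 have sF: "simple_graph W ?F" by (rule simple_graph_restrict[OF sg]) auto
 have fF: "finite ?F" by (rule simple_graph_finite[OF sF W])
 have "deg ?F w \<ge> (if w = a then 1 else 2)" if w: "w \<in> W" for w
 proof (cases "w = a")
  case True
  then obtain x where "x \<in> W" "{a, x} \<in> E" using a by blast
  then have "{a, x} \<in> {e\<in>?F. w \<in> e}" using True a by auto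
  moreover have "finite {e\<in>?F. w \<in> e}" by (rule finite_subset[OF _ fF]) blast
  ultimately have "card {e\<in>?F. w \<in> e} > 0" by (metis card_gt_0_iff empty_iff)
  then show ?thesis using True by (simp add: deg_def)
 next
  case False
  then obtain x y where xy: "x \<in> W" "y \<in> W" "x ~= y" "{w, x} \<in> E" "{w, y} \<in> E" using two[OF w] by blast
  have "{{w, x}, {w, y}} \<subseteq> {e\<in>?F. w \<in> e}" using xy w by auto
  moreover have "card {{w, x}, {w, y}} = 2" using xy by (simp add: doubleton_eq_iff)
  moreover have "finite {e\<in>?F. w \<in> e}" by (rule finite_subset[OF _ fF]) blast
  ultimately have "2 <= card {e\<in>?F. w \<in> e}" using card_mono by metis
  then show ?thesis using False by (simp add: deg_def)
 qed
 then have "(\<Sum>w\<in>W. if w = a then 1 else 2) <= (\<Sum>w\<in>W. deg ?F w)" by (rule sum_mono)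
 also have "... = 2 * card ?F" by (rule handshake[OF sF W])
 also have "(\<Sum>w\<in>W. if w = a then 1 else 2) = 1 + 2 * (card W - 1)"
  using W a(1) by (subst sum.remove[of _ a]) auto
 finally show ?thesis using W a(1) by (auto simp: card_gt_0_iff)
qed

section \<open>Neighbourhoods that are trees\<close>

text \<open>At nodes above depth l the whole neighbourhood in E is prescribed, and nodes at depth l
  are pairwise non-adjacent, so the ball of radius l is the tree. Increasing labels of siblings
  select one ordered tree for each neighbourhood; the factors 1/k! come from here.\<close>

definition tree_emb :: "nat => nat set set => nat list set => (nat list => nat) => bool" where
 "tree_emb l E U f \<longleftrightarrow> inj_on f U \<and>
  (\<forall>p\<in>U. length p < l --> {w. {f p, w} \<in> E} =
    (if p = [] then {} else {f (butlast p)}) \<union> (%i. f (p @ [i])) ` {..<nchild U p}) \<and>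
  (\<forall>p\<in>U. length p < l --> (\<forall>i i'. i < i' --> i' < nchild U p --> f (p @ [i]) < f (p @ [i']))) \<and>
  (\<forall>p\<in>U. \<forall>q\<in>U. length p = l --> length q = l --> {f p, f q} \<notin> E)"

lemma tree_embD:
 assumes "tree_emb l E U f"
 shows "inj_on f U"
  "p \<in> U ==> length p < l ==> {f p, w} \<in> E \<longleftrightarrow> p ~= [] \<and> w = f (butlast p) \<or> (\<exists>i<nchild U p. w = f (p @ [i]))"
  "p \<in> U ==> length p < l ==> i < i' ==> i' < nchild U p ==> f (p @ [i]) < f (p @ [i'])"
  "p \<in> U ==> q \<in> U ==> length p = l ==> length q = l ==> {f p, f q} \<notin> E"
proof -
 show "inj_on f U" using assms by (simp add: tree_emb_def)
 show "p \<in> U ==> q \<in> U ==> length p = l ==> length q = l ==> {f p, f q} \<notin> E"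
  using assms by (simp add: tree_emb_def)
 show "p \<in> U ==> length p < l ==> i < i' ==> i' < nchild U p ==> f (p @ [i]) < f (p @ [i'])"
  using assms by (simp add: tree_emb_def)
 assume p: "p \<in> U" "length p < l"
 then have "{w. {f p, w} \<in> E} = (if p = [] then {} else {f (butlast p)}) \<union> (%i. f (p @ [i])) ` {..<nchild U p}"
  using assms by (simp add: tree_emb_def)
 from eqset_imp_iff[OF this, of w]
 show "{f p, w} \<in> E \<longleftrightarrow> p ~= [] \<and> w = f (butlast p) \<or> (\<exists>i<nchild U p. w = f (p @ [i]))"
  by auto
qed

lemma tree_edges_length: "{u, v} \<in> tree_edges U ==> length v <= Suc (length u)"
 by (auto simp: tree_edges_def doubleton_eq_iff)

lemma dist_ball_tree: "u \<in> dist_ball U (tree_edges U) k [] ==> u \<in> U \<and> length u <= k"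
proof (induction k arbitrary: u)
 case (Suc k)
 show ?case
 proof (cases "u \<in> dist_ball U (tree_edges U) k []")
  case True
  then show ?thesis using Suc.IH[of u] by simp
 next
  case False
  then obtain w where "u \<in> U" "w \<in> dist_ball U (tree_edges U) k []" "{w, u} \<in> tree_edges U" using Suc.prems by auto
  then show ?thesis using Suc.IH[of w] tree_edges_length[of w u U] by simp
 qed
qed auto

lemma tree_edges_child: "p @ [i] \<in> U ==> {p, p @ [i]} \<in> tree_edges U"
 by (auto simp: tree_edges_def insert_commute intro!: exI[of _ "p @ [i]"])

lemma tree_edges_parent: "p \<in> U ==> p ~= [] ==> {p, butlast p} \<in> tree_edges U"
 by (auto simp: tree_edges_def)

lemma tree_emb_ball:
 assumes U: "rtree l U" and em: "tree_emb l E U f" and V: "f ` U \<subseteq> V"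
 shows "rooted_iso (ball l (U, tree_edges U, [])) (ball l (V, E, f []))"
proof (rule ball_iso_cover)
 note R = rtreeD[OF U] and M = tree_embD[OF em]
 show "inj_on f U" "f ` U \<subseteq> V" "[] \<in> U" using M R V by auto
 have adj: "{u, v} \<in> tree_edges U" if uv: "u \<in> U" "v \<in> U" "length u < l" "{f u, f v} \<in> E" for u v
 proof -
  from M(2)[OF uv(1,3), of "f v"] uv(4)
  consider "u ~= []" "f v = f (butlast u)" | i where "i < nchild U u" "f v = f (u @ [i])" by blast
  then show ?thesis
  proof cases
   case 1
   have "butlast u \<in> U" using rtree_butlast[OF U uv(1) 1(1)] by (simp add: inner_nodes_def)
   then have "v = butlast u" using inj_onD[OF M(1) 1(2)] uv by simp
   then show ?thesis using tree_edges_parent[OF uv(1) 1(1)] by simp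
  next
   case 2
   have "u @ [i] \<in> U" using R(3)[of u i] uv 2 by simp
   then have "v = u @ [i]" using inj_onD[OF M(1) 2(2)] uv by simp
   then show ?thesis using tree_edges_child \<open>u @ [i] \<in> U\<close> by simp
  qed
 qed
 show "{f u, f v} \<in> E" if uv: "u \<in> U" "v \<in> U" "{u, v} \<in> tree_edges U" for u v
 proof -
  obtain w where w: "w \<in> U" "w ~= []" "{u, v} = {w, butlast w}" using uv(3) by (auto simp: tree_edges_def)
  have b: "butlast w \<in> U" "length (butlast w) < l" "last w < nchild U (butlast w)"
   using rtree_butlast[OF U w(1,2)] by (auto simp: inner_nodes_def)
  have "{f (butlast w), f (butlast w @ [last w])} \<in> E" using M(2)[OF b(1,2)] b(3) by blast
  then have "{f (butlast w), f w} \<in> E" using w by simp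
  then show ?thesis using w(3) by (auto simp: doubleton_eq_iff insert_commute)
 qed
 show "\<exists>v\<in>U. w = f v \<and> {u, v} \<in> tree_edges U"
  if k: "Suc k <= l" "u \<in> dist_ball U (tree_edges U) k []" "{f u, w} \<in> E" for k u w
 proof -
  have u: "u \<in> U" "length u < l" using dist_ball_tree[OF k(2)] k(1) by auto
  from M(2)[OF u, of w] k(3)
  consider "u ~= []" "w = f (butlast u)" | i where "i < nchild U u" "w = f (u @ [i])" by blast
  then show ?thesis
  proof cases
   case 1
   have "butlast u \<in> U" using rtree_butlast[OF U u(1) 1(1)] by (simp add: inner_nodes_def)
   then show ?thesis using tree_edges_parent[OF u(1) 1(1)] 1 by blast
  next
   case 2
   have "u @ [i] \<in> U" using R(3)[of u i] u 2 by simp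
   then show ?thesis using tree_edges_child 2 by blast
  qed
 qed
 show "{u, v} \<in> tree_edges U" if uv: "u \<in> dist_ball U (tree_edges U) l []" "v \<in> dist_ball U (tree_edges U) l []" "{f u, f v} \<in> E" for u v
 proof -
  have u: "u \<in> U" "length u <= l" and v: "v \<in> U" "length v <= l"
   using dist_ball_tree[OF uv(1)] dist_ball_tree[OF uv(2)] by auto
  consider "length u < l" | "length v < l" | "length u = l" "length v = l" using u v by linarith
  then show ?thesis
  proof cases
   case 1 then show ?thesis using adj u v uv(3) by blast
  next
   case 2 then show ?thesis using adj[of v u] u v uv(3) by (simp add: insert_commute)
  next
   case 3 then show ?thesis using M(4) u v uv(3) by blast
  qed
 qed
qed

text \<open>A cycle together with a path that joins it to v spans at least as many edges as
  vertices, so this condition forces small balls around v to be trees.\<close>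

definition sparse_at :: "nat => nat set => nat set set => nat => bool" where
 "sparse_at b V E v \<longleftrightarrow> (\<forall>W\<subseteq>V. v \<in> W --> card W <= b --> card {e\<in>E. e \<subseteq> W} < card W)"

text \<open>Unfold the graph from v by non-backtracking walks. If two of them met, or if two ends at
  depth l were adjacent, then their vertices would form a set in which every vertex but v has two
  neighbours. It has at most 2(l + 1) vertices, so sparsity is contradicted.\<close>

lemma tree_emb_exists:
 assumes sg: "simple_graph V E" and V: "finite V" and v: "v \<in> V" and good: "sparse_at (2 * l + 2) V E v"
 shows "\<exists>U f. rtree l U \<and> tree_emb l E U f \<and> f [] = v \<and> f ` U \<subseteq> V"
proof -
 define N where "N = (%u. {w. {u, w} \<in> E})"
 \<comment> \<open>A state consists of the previous and the current vertex. The initial state (v, v)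
   excludes no neighbour, as v is not adjacent to itself.\<close>
 define c where "c = (%(w, u). map (Pair u) (sorted_list_of_set (N u - {w})))"
 define U where "U = tree_of c l (v, v)"
 define st where "st = walk c (v, v)"
 define f where "f = (%p. snd (st p))"
 define par where "par = (%p. fst (st p))"
 have NV: "N u \<subseteq> V" for u using simple_graph_edgeD[OF sg] by (auto simp: N_def)
 have fN: "finite (N u)" for u using finite_subset[OF NV V] .
 have U: "rtree l U" unfolding U_def by (rule rtree_tree_of)
 have st0: "f [] = v" "par [] = v" by (auto simp: f_def par_def st_def)
 have cst: "c (st p) = map (Pair (f p)) (sorted_list_of_set (N (f p) - {par p}))" for p
  by (simp add: c_def f_def par_def case_prod_beta)
 have nc: "nchild U p = card (N (f p) - {par p})" if "p \<in> U" "length p < l" for p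
  using nchild_tree_of[of p c l "(v, v)"] that cst[of p] by (simp add: U_def st_def)
 have sn: "f (p @ [i]) = sorted_list_of_set (N (f p) - {par p}) ! i" "par (p @ [i]) = f p"
  if "i < card (N (f p) - {par p})" for p i
  using that cst[of p] by (auto simp: f_def par_def st_def walk_snoc)
 have im: "(%i. f (p @ [i])) ` {..<nchild U p} = N (f p) - {par p}" if p: "p \<in> U" "length p < l" for p
 proof -
  let ?xs = "sorted_list_of_set (N (f p) - {par p})"
  have "(%i. f (p @ [i])) ` {..<nchild U p} = (!) ?xs ` {..<length ?xs}"
   using sn(1)[of _ p] nc[OF p] by (intro image_cong) auto
  also have "... = set ?xs" by (auto simp: set_conv_nth)
  finally show ?thesis using fN by simp
 qed
 have inc: "f (p @ [i]) < f (p @ [i'])" if "p \<in> U" "length p < l" "i < i'" "i' < nchild U p" for p i i'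
 proof -
  let ?xs = "sorted_list_of_set (N (f p) - {par p})"
  have "sorted_wrt (<) ?xs" by simp
  then have "?xs ! i < ?xs ! i'" using that nc[OF that(1,2)] by (auto simp: sorted_wrt_iff_nth_less)
  then show ?thesis using sn(1)[of i p] sn(1)[of i' p] nc[OF that(1,2)] that by simp
 qed
 have bl: "butlast p \<in> U \<and> length (butlast p) < l \<and> last p < nchild U (butlast p)" if "p \<in> U" "p ~= []" for p
  using rtree_butlast[OF U that] by (simp add: inner_nodes_def)
 have parb: "par p = f (butlast p)" "{f (butlast p), f p} \<in> E" "f p ~= par (butlast p)" if p: "p \<in> U" "p ~= []" for p
 proof -
  note b = bl[OF p]
  have "last p < card (N (f (butlast p)) - {par (butlast p)})" using b nc[of "butlast p"] by simp
  then show "par p = f (butlast p)" using sn(2)[of "last p" "butlast p"] p by simp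
  have "f (butlast p @ [last p]) \<in> N (f (butlast p)) - {par (butlast p)}" using im[of "butlast p"] b by blast
  then show "{f (butlast p), f p} \<in> E" "f p ~= par (butlast p)" using p by (auto simp: N_def)
 qed
 have vN: "v \<notin> N v" using simple_graph_edgeD[OF sg, of v v] by (auto simp: N_def)
 have nb: "N (f p) = (if p = [] then {} else {f (butlast p)}) \<union> (%i. f (p @ [i])) ` {..<nchild U p}" if p: "p \<in> U" "length p < l" for p
 proof (cases "p = []")
  case True
  then show ?thesis using im[OF p] st0 vN by simp
 next
  case False
  then have "f (butlast p) \<in> N (f p)" using parb(2)[OF p(1)] by (simp add: N_def insert_commute)
  then show ?thesis using im[OF p] parb(1)[OF p(1) False] False by auto
 qed
 have fV: "f p \<in> V" if "p \<in> U" for p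
 proof (cases "p = []")
  case True then show ?thesis using st0 v by simp
 next
  case False then show ?thesis using parb(2)[OF that False] simple_graph_edgeD[OF sg] by blast
 qed
 define pre where "pre = (%p::nat list. (%k. take k p) ` {..length p})"
 have preU: "pre p \<subseteq> U" if "p \<in> U" for p
  using rtree_prefix[OF U, of "take k p" "drop k p" for k] that by (auto simp: pre_def)
 have precard: "card (f ` pre p) <= Suc l" if "p \<in> U" for p
 proof -
  have "card (f ` pre p) <= card {..length p}" unfolding pre_def image_image by (rule card_image_le) simp
  then show ?thesis using rtree_length[OF U that] by simp
 qed
 have finpre: "finite (pre p)" for p by (simp add: pre_def)
 \<comment> \<open>Vertices inside the two walks have their predecessor and successor as distinct
   neighbours, so only the ends p and q need the assumption \<open>cond\<close>.\<close>
 have contra: False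
  if pq: "p \<in> U" "q \<in> U" "p ~= [] \<or> q ~= []"
   and cond: "\<And>r. r \<in> {p, q} ==> f r = v \<or> (\<exists>x\<in>f ` (pre p \<union> pre q). \<exists>y\<in>f ` (pre p \<union> pre q). x ~= y \<and> {f r, x} \<in> E \<and> {f r, y} \<in> E)" for p q
 proof -
  let ?W = "f ` (pre p \<union> pre q)"
  have subW: "?W \<subseteq> V" using preU[OF pq(1)] preU[OF pq(2)] fV by blast
  have fW: "finite ?W" using finite_subset[OF subW V] .
  have vW: "v \<in> ?W"
  proof -
   have "[] \<in> pre p" by (auto simp: pre_def intro!: image_eqI[of _ _ 0])
   then show ?thesis using st0 by force
  qed
  have cW: "card ?W <= 2 * l + 2"
   using card_Un_le[of "f ` pre p" "f ` pre q"] precard[OF pq(1)] precard[OF pq(2)] by (simp add: image_Un)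
  have first: "\<exists>x\<in>?W. {v, x} \<in> E"
  proof -
   obtain r where r: "r \<in> {p, q}" "r ~= []" using pq(3) by blast
   have t: "take 1 r \<in> pre r" using r(2) by (auto simp: pre_def Suc_le_eq)
   have rU: "take 1 r \<in> U" "take 1 r \<in> pre p \<union> pre q" "take 1 r ~= []"
    using t preU[OF pq(1)] preU[OF pq(2)] r by auto
   have "butlast (take 1 r) = []" by (cases r) auto
   then have "{v, f (take 1 r)} \<in> E" using parb(2)[OF rU(1,3)] st0 by simp
   then show ?thesis using rU by blast
  qed
  have two: "\<exists>x\<in>?W. \<exists>y\<in>?W. x ~= y \<and> {w, x} \<in> E \<and> {w, y} \<in> E" if w: "w \<in> ?W" "w ~= v" for w
  proof -
   obtain s r k where s: "w = f s" "s = take k r" "k <= length r" "r \<in> {p, q}" using w(1) by (auto simp: pre_def)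
   have rU: "r \<in> U" using s pq by blast
   show ?thesis
   proof (cases "k = length r")
    case True
    then show ?thesis using cond[OF s(4)] s w by auto
   next
    case False
    then have k: "k < length r" using s by simp
    have sn0: "s ~= []" using s(1) w(2) st0 by auto
    let ?t = "take (Suc k) r"
    have pr: "s \<in> pre r" "?t \<in> pre r" "butlast s \<in> pre r"
     using k s by (auto simp: pre_def butlast_take intro!: image_eqI[of _ _ "k - 1"])
    have sU: "s \<in> U" "?t \<in> U" using pr preU[OF rU] by auto
    have t: "butlast ?t = s" "?t ~= []" using k s by (auto simp: butlast_take)
    have "{f s, f ?t} \<in> E" "f ?t ~= par s" using parb(2,3)[OF sU(2) t(2)] t(1) by auto
    moreover have "{f s, f (butlast s)} \<in> E" "par s = f (butlast s)"
     using parb(1,2)[OF sU(1) sn0] by (auto simp: insert_commute)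
    moreover have "f ?t \<in> ?W" "f (butlast s) \<in> ?W" using pr s(4) by auto
    ultimately show ?thesis unfolding s(1) by metis
   qed
  qed
  have "card ?W <= card {e\<in>E. e \<subseteq> ?W}" using card_edges_min_degree[OF sg fW vW first two] by blast
  then show False using good subW vW cW unfolding sparse_at_def by (meson leD)
 qed
 have self: "r \<in> pre r" for r :: "nat list" by (auto simp: pre_def intro!: image_eqI[of _ _ "length r"])
 have preb: "butlast r \<in> pre r" for r :: "nat list"
  by (auto simp: pre_def butlast_conv_take intro!: image_eqI[of _ _ "length r - 1"])
 \<comment> \<open>Suppose p and q differ but have the same image. Either the images of their
   parents differ, which gives this vertex two neighbours, or by induction p and q are siblings,
   whose labels are distinct.\<close>
 have injl: "p \<in> U ==> q \<in> U ==> f p = f q ==> p = q" for p q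
 proof (induction "length p + length q" arbitrary: p q rule: less_induct)
  case less
  show ?case
  proof (rule ccontr)
   assume ne: "p ~= q"
   show False
   proof (cases "p = [] \<or> q = []")
    case True
    then have "f p = v" "f q = v" using less.prems st0 by auto
    then show False using contra[of p q] less.prems ne True by blast
   next
    case False
    let ?p = "butlast p" and ?q = "butlast q"
    have "f ?p ~= f ?q"
    proof
     assume eq: "f ?p = f ?q"
     have lt: "length ?p + length ?q < length p + length q" using False by (cases p; cases q) auto
     have pq: "?p = ?q"
      by (rule less.hyps[OF lt]) (use False bl less.prems eq in auto)
     have bp: "?p \<in> U" "length ?p < l" "last p < nchild U ?p" "last q < nchild U ?p"
      using bl[of p] bl[of q] less.prems False pq by auto
     have s: "?p @ [last p] = p" "?p @ [last q] = q" using False pq by (metis append_butlast_last_id)+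
     then have "last p ~= last q" using ne by metis
     then consider "last p < last q" | "last q < last p" by linarith
     then have "f (?p @ [last p]) ~= f (?p @ [last q])"
      using inc[OF bp(1,2) _ bp(4), of "last p"] inc[OF bp(1,2) _ bp(3), of "last q"] by cases auto
     then show False using s less.prems by simp
    qed
    moreover have e1: "{f p, f ?p} \<in> E" and e2: "{f q, f ?q} \<in> E"
     using parb(2)[of p] parb(2)[of q] less.prems(1,2) False unfolding insert_commute[of "f p"] insert_commute[of "f q"] by blast+
    moreover have "{f p, f ?q} \<in> E" using e2 unfolding less.prems(3) .
    moreover have "f ?p \<in> f ` (pre p \<union> pre q)" "f ?q \<in> f ` (pre p \<union> pre q)" using preb by blast+
    ultimately have two: "\<exists>x\<in>f ` (pre p \<union> pre q). \<exists>y\<in>f ` (pre p \<union> pre q). x ~= y \<and> {f p, x} \<in> E \<and> {f p, y} \<in> E"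
     by blast
    show False
    proof (rule contra[of p q])
     fix r assume "r \<in> {p, q}"
     then have "f r = f p" using less.prems(3) by auto
     then show "f r = v \<or> (\<exists>x\<in>f ` (pre p \<union> pre q). \<exists>y\<in>f ` (pre p \<union> pre q). x ~= y \<and> {f r, x} \<in> E \<and> {f r, y} \<in> E)"
      using two by simp
    qed (use less.prems False in auto)
   qed
  qed
 qed
 then have inj: "inj_on f U" by (auto intro: inj_onI)
 have bdry: "{f p, f q} \<notin> E" if pq: "p \<in> U" "q \<in> U" "length p = l" "length q = l" for p q
 proof
  assume e: "{f p, f q} \<in> E"
  then have "p ~= q" using simple_graph_edgeD[OF sg e] by auto
  then have l: "p ~= []" "q ~= []" using pq by auto
  have "f (butlast p) ~= f q" "f (butlast q) ~= f p"
  proof -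
   have "length (butlast p) < length q" "length (butlast q) < length p" using pq l by (cases p; cases q; simp)+
   then have "butlast p ~= q" "butlast q ~= p" by auto
   then show "f (butlast p) ~= f q" "f (butlast q) ~= f p"
    using inj_onD[OF inj, of "butlast p" q] inj_onD[OF inj, of "butlast q" p] bl[of p] bl[of q] pq l by blast+
  qed
  moreover have "{f p, f (butlast p)} \<in> E" "{f q, f (butlast q)} \<in> E" using parb(2) pq l by (auto simp: insert_commute)
  moreover have "f (butlast p) \<in> f ` (pre p \<union> pre q)" "f (butlast q) \<in> f ` (pre p \<union> pre q)"
   "f p \<in> f ` (pre p \<union> pre q)" "f q \<in> f ` (pre p \<union> pre q)" using preb self by blast+
  moreover have "{f q, f p} \<in> E" using e by (simp add: insert_commute)
  ultimately have "\<exists>x\<in>f ` (pre p \<union> pre q). \<exists>y\<in>f ` (pre p \<union> pre q). x ~= y \<and> {f p, x} \<in> E \<and> {f p, y} \<in> E"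
   "\<exists>x\<in>f ` (pre p \<union> pre q). \<exists>y\<in>f ` (pre p \<union> pre q). x ~= y \<and> {f q, x} \<in> E \<and> {f q, y} \<in> E"
   using e by blast+
  then show False using contra[of p q] pq l by blast
 qed
 have "tree_emb l E U f" unfolding tree_emb_def using inj nb inc bdry by (simp add: N_def)
 then show ?thesis using U st0 fV by (intro exI[of _ U] exI[of _ f]) auto
qed

text \<open>Inner nodes have no neighbours outside the tree, so their deletion removes exactly the
  \<open>card U - 1\<close> tree edges.\<close>

lemma tree_emb_incident:
 assumes U: "rtree l U" and em: "tree_emb l E U f" and sg: "simple_graph V E"
 shows "{e\<in>E. e \<inter> f ` inner_nodes l U ~= {}} = (%p. {f (butlast p), f p}) ` (U - {[]})"
  and "card ((%p. {f (butlast p), f p}) ` (U - {[]})) = card U - 1"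
proof -
 note R = rtreeD[OF U] and M = tree_embD[OF em]
 have bl: "butlast p \<in> U \<and> length (butlast p) < l \<and> last p < nchild U (butlast p)" if "p \<in> U" "p ~= []" for p
  using rtree_butlast[OF U that] by (simp add: inner_nodes_def)
 have edge: "{f (butlast p), f p} \<in> E" if p: "p \<in> U" "p ~= []" for p
 proof -
  have "{f (butlast p), f (butlast p @ [last p])} \<in> E" using M(2)[of "butlast p"] bl[OF p] by blast
  then show ?thesis using p by simp
 qed
 show "{e\<in>E. e \<inter> f ` inner_nodes l U ~= {}} = (%p. {f (butlast p), f p}) ` (U - {[]})"
 proof (intro equalityI subsetI)
  fix e assume "e \<in> {e\<in>E. e \<inter> f ` inner_nodes l U ~= {}}"
  then obtain p where p: "e \<in> E" "p \<in> U" "length p < l" "f p \<in> e" by (auto simp: inner_nodes_def)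
  obtain w where w: "e = {f p, w}" using simple_graph_other[OF sg p(1,4)] by blast
  from M(2)[OF p(2,3), of w] p(1) w
  consider "p ~= []" "w = f (butlast p)" | i where "i < nchild U p" "w = f (p @ [i])" by blast
  then show "e \<in> (%p. {f (butlast p), f p}) ` (U - {[]})"
  proof cases
   case 1
   then show ?thesis using p w by (auto simp: insert_commute)
  next
   case 2
   then have "p @ [i] \<in> U - {[]}" using R(3)[of p i] p by simp
   then show ?thesis using w 2 by (intro image_eqI[of _ _ "p @ [i]"]) auto
  qed
 next
  fix e assume "e \<in> (%p. {f (butlast p), f p}) ` (U - {[]})"
  then obtain p where p: "p \<in> U" "p ~= []" "e = {f (butlast p), f p}" by auto
  have "butlast p \<in> inner_nodes l U" using rtree_butlast[OF U p(1,2)] by simp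
  then show "e \<in> {e\<in>E. e \<inter> f ` inner_nodes l U ~= {}}" using edge[OF p(1,2)] p(3) by auto
 qed
 have "inj_on (%p. {f (butlast p), f p}) (U - {[]})"
 proof (rule inj_onI)
  fix p q assume p: "p \<in> U - {[]}" and q: "q \<in> U - {[]}" and eq: "{f (butlast p), f p} = {f (butlast q), f q}"
  have "f p = f q \<or> f (butlast p) = f q \<and> f p = f (butlast q)" using eq by (auto simp: doubleton_eq_iff)
  then show "p = q"
  proof
   assume "f p = f q"
   then show ?thesis using inj_onD[OF M(1)] p q by auto
  next
   assume "f (butlast p) = f q \<and> f p = f (butlast q)"
   then have "butlast p = q" "p = butlast q" using inj_onD[OF M(1)] p q bl by auto
   then have "length (butlast p) = length q" "length p = length (butlast q)" by metis+
   then have "length p - 1 = length q" "length p = length q - 1" by (simp_all only: length_butlast)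
   moreover have "length p > 0" using p by simp
   ultimately show ?thesis by linarith
  qed
 qed
 then have "card ((%p. {f (butlast p), f p}) ` (U - {[]})) = card (U - {[]})" by (rule card_image)
 then show "card ((%p. {f (butlast p), f p}) ` (U - {[]})) = card U - 1" using R by simp
qed

section \<open>Frequencies of tree types in planar graphs\<close>

definition emb_pairs :: "nat => nat => nat => nat list set => (nat set set \<times> nat) set" where
 "emb_pairs n m l U = {(E, v)\<in>pl {1..n} m \<times> {1..n}. \<exists>f. tree_emb l E U f \<and> f [] = v \<and> f ` U \<subseteq> {1..n}}"

lemma finite_emb_pairs: "finite (emb_pairs n m l U)"
 by (rule finite_subset[of _ "pl {1..n} m \<times> {1..n}"]) (auto simp: emb_pairs_def intro: finite_pl)

text \<open>For fixed labels of U, deleting the images of the inner nodes is injective and leaves a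
  planar graph with \<open>card (inner_nodes l U)\<close> fewer vertices and
  \<open>card U - 1\<close> fewer edges; \<open>count_labellings\<close> sums over the
  labels.\<close>

lemma card_emb_pairs:
 assumes U: "rtree l U"
 shows "real (card (emb_pairs n m l U)) <= real n ^ card U * (\<Prod>p\<in>inner_nodes l U. 1 / fact (nchild U p)) *
  real (pc (n - card (inner_nodes l U)) (m - (card U - 1)))"
proof -
 let ?V = "{1..n}" and ?X = "emb_pairs n m l U" and ?Ts = "[U]"
 have T: "rtrees l ?Ts" using U by (simp add: rtrees_def)
 have nodes: "nodes ?Ts = Pair 0 ` U" "inodes l ?Ts = Pair 0 ` inner_nodes l U" by (auto simp: nodes_def inodes_def)
 define f where "f = (%x. SOME g. tree_emb l (fst x) U g \<and> g [] = snd x \<and> g ` U \<subseteq> ?V)"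
 have f: "tree_emb l (fst x) U (f x) \<and> f x [] = snd x \<and> f x ` U \<subseteq> ?V" if "x \<in> ?X" for x
 proof -
  have "\<exists>g. tree_emb l (fst x) U g \<and> g [] = snd x \<and> g ` U \<subseteq> ?V" using that by (auto simp: emb_pairs_def)
  then show ?thesis unfolding f_def by (rule someI_ex)
 qed
 have pl: "fst x \<in> pl ?V m" if "x \<in> ?X" for x using that by (auto simp: emb_pairs_def)
 define F where "F = (%x (q::nat \<times> nat list). f x (snd q))"
 have inc: "increasing l ?Ts (F x)" if x: "x \<in> ?X" for x
  unfolding increasing_def F_def nodes(2) nch_def
  using tree_embD(3)[OF conjunct1[OF f[OF x]]] by (auto simp: inner_nodes_def)
 have "real (card ?X) <= real n ^ card (nodes ?Ts) * (\<Prod>q\<in>inodes l ?Ts. 1 / fact (nch ?Ts q)) *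
  real (pc (n - card (inner_nodes l U)) (m - (card U - 1)))"
 proof (rule count_labellings[OF T, of ?V _ _ F])
  show "card ?V = n" "finite ?V" "finite ?X" by (auto simp: finite_emb_pairs)
  show "increasing l ?Ts (F x)" if "x \<in> ?X" for x using inc that .
  show "F x q \<in> ?V" if "x \<in> ?X" "q \<in> nodes ?Ts" for x q using f[OF that(1)] that(2) unfolding nodes F_def by auto
  fix y assume y: "y \<in> ?X"
  let ?g = "f y" and ?I = "f y ` inner_nodes l U"
  let ?Y = "{x\<in>?X. tdata l ?Ts (F x) = tdata l ?Ts (F y)}"
  have same: "f x p = ?g p" if x: "x \<in> ?Y" and p: "p \<in> U" for x p
  proof -
   have "F x (0, p) = F y (0, p)"
    by (rule tdata_eq[OF T inc inc]) (use x y p nodes in auto)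
   then show ?thesis by (simp add: F_def)
  qed
  have inn: "inner_nodes l U \<subseteq> U" by (auto simp: inner_nodes_def)
  have I: "f x ` inner_nodes l U = ?I" if "x \<in> ?Y" for x
   using same[OF that] inn by (intro image_cong) auto
  have bl: "butlast p \<in> U" if "p \<in> U" for p
   using rtree_butlast[OF U that] rtreeD(2)[OF U] by (cases "p = []") (auto simp: inner_nodes_def)
  let ?T0 = "(%p. {?g (butlast p), ?g p}) ` (U - {[]})"
  have T0: "{e\<in>fst x. e \<inter> ?I ~= {}} = ?T0" if x: "x \<in> ?Y" for x
  proof -
   have xX: "x \<in> ?X" using x by simp
   have "{e\<in>fst x. e \<inter> ?I ~= {}} = (%p. {f x (butlast p), f x p}) ` (U - {[]})"
    using tree_emb_incident(1)[OF U conjunct1[OF f[OF xX]], of ?V] pl[OF xX] I[OF x] by (simp add: pl_def)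
   also have "... = ?T0" using same[OF x] bl by (intro image_cong) auto
   finally show ?thesis .
  qed
  have cT0: "card ?T0 = card U - 1"
   using tree_emb_incident(2)[OF U conjunct1[OF f[OF y]], of ?V] pl[OF y] by (simp add: pl_def)
  have "inj_on (%x. {e\<in>fst x. e \<inter> ?I = {}}) ?Y"
  proof (rule inj_onI)
   fix a b assume a: "a \<in> ?Y" and b: "b \<in> ?Y" and eq: "{e\<in>fst a. e \<inter> ?I = {}} = {e\<in>fst b. e \<inter> ?I = {}}"
   have "fst a = {e\<in>fst a. e \<inter> ?I = {}} \<union> {e\<in>fst a. e \<inter> ?I ~= {}}" by blast
   also have "... = {e\<in>fst b. e \<inter> ?I = {}} \<union> {e\<in>fst b. e \<inter> ?I ~= {}}" unfolding eq T0[OF a] T0[OF b] ..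
   also have "... = fst b" by blast
   finally have "fst a = fst b" .
   moreover have "snd a = snd b"
    using same[OF a, of "[]"] same[OF b, of "[]"] f[of a] f[of b] a b rtreeD(2)[OF U] by auto
   ultimately show "a = b" by (rule prod_eqI)
  qed
  moreover have "(%x. {e\<in>fst x. e \<inter> ?I = {}}) ` ?Y \<subseteq> pl (?V - ?I) (m - (card U - 1))"
  proof (rule image_subsetI)
   fix x assume x: "x \<in> ?Y"
   then have "fst x \<in> pl ?V m" using pl by blast
   from pl_remove_vertices[OF this, of ?I] show "{e\<in>fst x. e \<inter> ?I = {}} \<in> pl (?V - ?I) (m - (card U - 1))"
    unfolding T0[OF x] cT0 by simp
  qed
  ultimately have "card ?Y <= card (pl (?V - ?I) (m - (card U - 1)))"
   by (rule card_inj_on_le) (simp add: finite_pl)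
  also have "... = pc (card (?V - ?I)) (m - (card U - 1))" by (rule card_pl) simp
  also have "card (?V - ?I) = n - card (inner_nodes l U)"
  proof -
   have "?I \<subseteq> ?V" using f[OF y] inn by blast
   moreover have "card ?I = card (inner_nodes l U)"
    using tree_embD(1)[OF conjunct1[OF f[OF y]]] inn by (intro card_image) (rule inj_on_subset)
   ultimately show ?thesis by (subst card_Diff_subset) (auto intro: finite_subset)
  qed
  finally show "card ?Y <= pc (n - card (inner_nodes l U)) (m - (card U - 1))" .
 qed
 also have "card (nodes ?Ts) = card U" unfolding nodes by (rule card_image) (simp add: inj_on_def)
 also have "(\<Prod>q\<in>inodes l ?Ts. 1 / fact (nch ?Ts q)) = (\<Prod>p\<in>inner_nodes l U. 1 / fact (nchild U p))"
  unfolding nodes by (subst prod.reindex) (auto simp: inj_on_def nch_def)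
 finally show ?thesis .
qed

lemma tree_emb_path:
 assumes U: "rtree l U" and em: "tree_emb l E U f"
 shows "q \<in> U ==> \<exists>p. p ~= [] \<and> hd p = f [] \<and> last p = f q \<and> distinct p \<and> pe p \<subseteq> E \<and> length p = Suc (length q) \<and> set p \<subseteq> f ` {r\<in>U. length r <= length q}"
proof (induction q rule: rev_induct)
 case Nil
 then show ?case by (intro exI[of _ "[f []]"]) auto
next
 case (snoc i q)
 have q: "q \<in> U" "length q < l" "i < nchild U q" using rtreeD(3)[OF U, of q i] snoc.prems by auto
 obtain p where p: "p ~= []" "hd p = f []" "last p = f q" "distinct p" "pe p \<subseteq> E" "length p = Suc (length q)"
  "set p \<subseteq> f ` {r\<in>U. length r <= length q}" using snoc.IH[OF q(1)] by blast
 have "{f q, f (q @ [i])} \<in> E" using tree_embD(2)[OF em q(1,2)] q(3) by blast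
 moreover have "f (q @ [i]) \<notin> set p"
 proof
  assume "f (q @ [i]) \<in> set p"
  then obtain r where r: "r \<in> U" "length r <= length q" "f (q @ [i]) = f r" using p(7) by blast
  then have "q @ [i] = r" using inj_onD[OF tree_embD(1)[OF em]] snoc.prems by blast
  then show False using r(2) by auto
 qed
 ultimately show ?case using p snoc.prems q(1)
  by (intro exI[of _ "p @ [f (q @ [i])]"]) (fastforce simp: pe_snoc)
qed

lemma sum_paths_le:
 assumes V: "finite V" "card V = n"
 shows "(\<Sum>E\<in>pl V m. card {p\<in>vpaths V j. pe p \<subseteq> E}) <= n ^ Suc j * pc n (m - j)"
proof -
 have "(\<Sum>E\<in>pl V m. card {p\<in>vpaths V j. pe p \<subseteq> E}) = (\<Sum>p\<in>vpaths V j. card {E\<in>pl V m. pe p \<subseteq> E})"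
  by (rule sum_card_swap) (use finite_pl V card_vpaths in auto)
 also have "... <= (\<Sum>p\<in>vpaths V j. pc n (m - j))"
 proof (rule sum_mono)
  fix p assume "p \<in> vpaths V j"
  then have "card (pe p) = j" using card_pe[of p] by (simp add: vpaths_def)
  then show "card {E\<in>pl V m. pe p \<subseteq> E} <= pc n (m - j)" using card_pl_superset[OF V(1), of m "pe p"] V by simp
 qed
 also have "... <= n ^ Suc j * pc n (m - j)"
  using mult_right_mono[OF conjunct2[OF card_vpaths[OF V(1), of j]]] V by (simp del: power_Suc)
 finally show ?thesis .
qed

definition big_pairs :: "nat => nat => nat => nat => (nat set set \<times> nat) set" where
 "big_pairs n m l K = {(E, v)\<in>pl {1..n} m \<times> {1..n}. \<exists>U f. rtree l U \<and> tree_emb l E U f \<and> f [] = v \<and> f ` U \<subseteq> {1..n} \<and> K < card U}"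

text \<open>Markov's inequality: a tree with more than K nodes yields more than K paths of length at
  most l from v, and the mean number of paths is bounded by deleting their edges.\<close>

lemma card_big_pairs: "K * card (big_pairs n m l K) <= (\<Sum>j\<le>l. n ^ Suc j * pc n (m - j))"
proof -
 let ?V = "{1..n}"
 have fin: "finite (big_pairs n m l K)"
  by (rule finite_subset[of _ "pl ?V m \<times> ?V"]) (auto simp: big_pairs_def intro: finite_pl)
 let ?P = "%E v j. {p\<in>vpaths ?V j. pe p \<subseteq> E \<and> hd p = v}"
 have fP: "finite (?P E v j)" for E v j using card_vpaths[of ?V j] by simp
 have K: "K <= (\<Sum>j\<le>l. card (?P E v j))" if x: "(E, v) \<in> big_pairs n m l K" for E v
 proof -
  obtain U f where U: "rtree l U" "tree_emb l E U f" "f [] = v" "f ` U \<subseteq> ?V" "K < card U"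
   using x by (auto simp: big_pairs_def)
  have "f ` U \<subseteq> last ` (\<Union>j\<le>l. ?P E v j)"
  proof (rule image_subsetI)
   fix q assume q: "q \<in> U"
   from tree_emb_path[OF U(1,2) q] obtain p where p: "hd p = v" "last p = f q" "distinct p" "pe p \<subseteq> E" "length p = Suc (length q)"
    "set p \<subseteq> f ` {r\<in>U. length r <= length q}" using U(3) by blast
   have "length q <= l" by (rule rtree_length[OF U(1) q])
   moreover have "p \<in> ?P E v (length q)" using p U(4) by (auto simp: vpaths_def)
   ultimately show "f q \<in> last ` (\<Union>j\<le>l. ?P E v j)" using p(2) by (intro image_eqI[of _ _ p]) auto
  qed
  then have "card (f ` U) <= card (\<Union>j\<le>l. ?P E v j)"
   using fP by (meson card_image_le card_mono finite_UN_I finite_atMost finite_imageI le_trans)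
  also have "... <= (\<Sum>j\<le>l. card (?P E v j))" by (rule card_UN_le) simp
  also have "card (f ` U) = card U" by (rule card_image) (rule tree_embD(1)[OF U(2)])
  finally show ?thesis using U(5) by simp
 qed
 have "K * card (big_pairs n m l K) = (\<Sum>x\<in>big_pairs n m l K. K)" by simp
 also have "... <= (\<Sum>x\<in>big_pairs n m l K. \<Sum>j\<le>l. card (?P (fst x) (snd x) j))"
  by (rule sum_mono) (use K in auto)
 also have "... <= (\<Sum>x\<in>pl ?V m \<times> ?V. \<Sum>j\<le>l. card (?P (fst x) (snd x) j))"
  by (rule sum_mono2) (auto simp: big_pairs_def intro: finite_pl)
 also have "... = (\<Sum>E\<in>pl ?V m. \<Sum>v\<in>?V. \<Sum>j\<le>l. card (?P E v j))"
  by (subst sum.cartesian_product) (simp add: case_prod_beta)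
 also have "... = (\<Sum>E\<in>pl ?V m. \<Sum>j\<le>l. \<Sum>v\<in>?V. card (?P E v j))"
  by (intro sum.cong refl sum.swap)
 also have "... = (\<Sum>E\<in>pl ?V m. \<Sum>j\<le>l. card {p\<in>vpaths ?V j. pe p \<subseteq> E})"
 proof (intro sum.cong refl)
  fix E j
  have "{p\<in>vpaths ?V j. pe p \<subseteq> E} = (\<Union>v\<in>?V. ?P E v j)"
  proof -
   have "hd p \<in> ?V" if "p \<in> vpaths ?V j" for p using that by (cases p) (auto simp: vpaths_def)
   then show ?thesis by blast
  qed
  then have "card {p\<in>vpaths ?V j. pe p \<subseteq> E} = card (\<Union>v\<in>?V. ?P E v j)" by (rule arg_cong)
  also have "... = (\<Sum>v\<in>?V. card (?P E v j))" by (rule card_UN_disjoint) (use fP in auto)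
  finally show "(\<Sum>v\<in>?V. card (?P E v j)) = card {p\<in>vpaths ?V j. pe p \<subseteq> E}" by simp
 qed
 also have "... = (\<Sum>j\<le>l. \<Sum>E\<in>pl ?V m. card {p\<in>vpaths ?V j. pe p \<subseteq> E})" by (rule sum.swap)
 also have "... <= (\<Sum>j\<le>l. n ^ Suc j * pc n (m - j))" by (rule sum_mono) (rule sum_paths_le, auto)
 finally show ?thesis .
qed

definition dense_pairs :: "nat => nat => nat => (nat set set \<times> nat) set" where
 "dense_pairs n m b = {(E, v)\<in>pl {1..n} m \<times> {1..n}. \<not> sparse_at b {1..n} E v}"

text \<open>There are at most n^w vertex sets of size w, boundedly many choices of w edges inside,
  and each choice has probability of order n^(-w). So a graph has on average only O(1) such
  vertices, against n in total.\<close>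

lemma card_dense_pairs: "card (dense_pairs n m b) <= (\<Sum>w\<le>b. n ^ w * (2 ^ (2 ^ w) * (pc n (m - w) * w)))"
proof -
 let ?V = "{1..n}"
 let ?Ws = "%w. {W. W \<subseteq> ?V \<and> card W = w}" and ?Ss = "%W w. {S. S \<subseteq> Pow W \<and> card S = w}"
 let ?A = "\<Union>w\<le>b. \<Union>W\<in>?Ws w. \<Union>S\<in>?Ss W w. {E\<in>pl ?V m. S \<subseteq> E} \<times> W"
 have fP: "finite (pl ?V m)" by (simp add: finite_pl)
 have sub: "dense_pairs n m b \<subseteq> ?A"
 proof
  fix x assume "x \<in> dense_pairs n m b"
  then obtain E v W where x: "x = (E, v)" "E \<in> pl ?V m" "W \<subseteq> ?V" "v \<in> W" "card W <= b" "card W <= card {e\<in>E. e \<subseteq> W}"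
   by (auto simp: dense_pairs_def sparse_at_def not_less)
  obtain S where S: "S \<subseteq> {e\<in>E. e \<subseteq> W}" "card S = card W" using obtain_subset_with_card_n[OF x(6)] by metis
  then have "S \<in> ?Ss W (card W)" "S \<subseteq> E" by auto
  then show "x \<in> ?A" using x by blast
 qed
 have fW: "finite W" if "W \<in> ?Ws w" for W w using that finite_subset by auto
 have fS: "finite (?Ss W w)" if "W \<in> ?Ws w" for W w using fW[OF that] by (auto intro: finite_subset[of _ "Pow (Pow W)"])
 have "?A \<subseteq> pl ?V m \<times> ?V" by blast
 then have fA: "finite ?A" by (rule finite_subset) (rule finite_cartesian_product[OF fP finite_atLeastAtMost])
 have "card (dense_pairs n m b) <= card ?A" by (rule card_mono[OF fA sub])
 also have "... <= (\<Sum>w\<le>b. card (\<Union>W\<in>?Ws w. \<Union>S\<in>?Ss W w. {E\<in>pl ?V m. S \<subseteq> E} \<times> W))" by (rule card_UN_le) simp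
 also have "... <= (\<Sum>w\<le>b. n ^ w * (2 ^ (2 ^ w) * (pc n (m - w) * w)))"
 proof (rule sum_mono)
  fix w
  have "card (\<Union>W\<in>?Ws w. \<Union>S\<in>?Ss W w. {E\<in>pl ?V m. S \<subseteq> E} \<times> W) <= (\<Sum>W\<in>?Ws w. card (\<Union>S\<in>?Ss W w. {E\<in>pl ?V m. S \<subseteq> E} \<times> W))"
   by (rule card_UN_le) simp
  also have "... <= (\<Sum>W\<in>?Ws w. 2 ^ (2 ^ w) * (pc n (m - w) * w))"
  proof (rule sum_mono)
   fix W assume W: "W \<in> ?Ws w"
   have "card (\<Union>S\<in>?Ss W w. {E\<in>pl ?V m. S \<subseteq> E} \<times> W) <= (\<Sum>S\<in>?Ss W w. card ({E\<in>pl ?V m. S \<subseteq> E} \<times> W))"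
    by (rule card_UN_le) (rule fS[OF W])
   also have "... <= (\<Sum>S\<in>?Ss W w. pc n (m - w) * w)"
   proof (rule sum_mono)
    fix S assume S: "S \<in> ?Ss W w"
    have "card {E\<in>pl ?V m. S \<subseteq> E} <= pc n (m - w)" using card_pl_superset[of ?V m S] S by simp
    then show "card ({E\<in>pl ?V m. S \<subseteq> E} \<times> W) <= pc n (m - w) * w" using W by (simp add: card_cartesian_product)
   qed
   also have "... = card (?Ss W w) * (pc n (m - w) * w)" by simp
   also have "... <= 2 ^ (2 ^ w) * (pc n (m - w) * w)"
   proof (rule mult_right_mono)
    have "card (?Ss W w) <= card (Pow (Pow W))" using fW[OF W] by (intro card_mono) auto
    also have "... = 2 ^ (2 ^ w)" using fW[OF W] W by (simp add: card_Pow)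
    finally show "card (?Ss W w) <= 2 ^ (2 ^ w)" .
   qed simp
   finally show "card (\<Union>S\<in>?Ss W w. {E\<in>pl ?V m. S \<subseteq> E} \<times> W) <= 2 ^ (2 ^ w) * (pc n (m - w) * w)" .
  qed
  also have "... = (n choose w) * (2 ^ (2 ^ w) * (pc n (m - w) * w))" by (simp add: n_subsets)
  also have "... <= n ^ w * (2 ^ (2 ^ w) * (pc n (m - w) * w))"
  proof (rule mult_right_mono)
   show "n choose w <= n ^ w" using binomial_fact_pow[of n w] by (metis dual_order.trans fact_ge_1 mult.right_neutral mult_le_mono2)
  qed simp
  finally show "card (\<Union>W\<in>?Ws w. \<Union>S\<in>?Ss W w. {E\<in>pl ?V m. S \<subseteq> E} \<times> W) <= n ^ w * (2 ^ (2 ^ w) * (pc n (m - w) * w))" .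
 qed
 finally show ?thesis .
qed

definition rtree_types :: "nat => nat => nat list set set" where
 "rtree_types l K = {U. rtree l U \<and> card U <= K}"

lemma finite_rtree_types: "finite (rtree_types l K)"
proof (rule finite_subset)
 show "rtree_types l K \<subseteq> Pow {w. set w \<subseteq> {..<K} \<and> length w <= l}"
 proof clarify
  fix U w assume U: "U \<in> rtree_types l K" and w: "w \<in> U"
  then have r: "rtree l U" and K: "card U <= K" by (auto simp: rtree_types_def)
  have "w \<in> U ==> set w \<subseteq> {..<K}"
  proof (induction w rule: rev_induct)
   case (snoc i p)
   have p: "p \<in> U" "length p < l" "i < nchild U p" using rtreeD(3)[OF r] snoc.prems by auto
   have "nchild U p <= (\<Sum>p\<in>inner_nodes l U. nchild U p)"
    using p finite_inner[OF r] by (intro member_le_sum) (auto simp: inner_nodes_def)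
   then have "i < K" using card_rtree[OF r] K p(3) by simp
   then show ?case using snoc.IH[OF p(1)] by simp
  qed simp
  then show "set w \<subseteq> {..<K} \<and> length w <= l" using w rtree_length[OF r w] by simp
 qed
qed (simp add: finite_lists_length_le)

text \<open>Provides the hypotheses of \<open>scheffe_finite\<close> for a random pair (E, v). An
  uncovered pair has a dense spot at v or a tree with more than K nodes.\<close>

lemma local_types:
 fixes r :: real
 assumes e: "r > 0"
 obtains K where
  "eventually (%(n, m). (\<forall>U\<in>rtree_types l K. real (card (emb_pairs n m l U)) <=
    (pmf (gw_trunc 1 l) U + r / (card (rtree_types l K) + 1)) * card (pl {1..n} m \<times> {1..n})) \<and>
   real (card ((pl {1..n} m \<times> {1..n}) - (\<Union>U\<in>rtree_types l K. emb_pairs n m l U))) <= r * card (pl {1..n} m \<times> {1..n})) crit"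
proof -
 define C where "C = (\<Sum>j\<le>l. (6::real) ^ j)"
 define b where "b = 2 * l + 2"
 define D where "D = (\<Sum>w\<le>b. 2 ^ (2 ^ w) * (6 ^ w * real w))"
 \<comment> \<open>C bounds the mean number of paths of length at most l from a vertex, so K >= 2C/r
   leaves a share r/2 for large trees; dense spots get the other r/2.\<close>
 define K where "K = nat \<lceil>2 * C / r\<rceil> + 1"
 have C: "C \<ge> 0" unfolding C_def by (intro sum_nonneg) auto
 have K: "C / K <= r / 2" "K > 0"
 proof -
  have "2 * C / r <= real K" unfolding K_def by linarith
  then show "C / K <= r / 2" using e K_def by (simp add: field_simps)
 qed (simp add: K_def)
 let ?F = "rtree_types l K"
 have fF: "finite ?F" by (rule finite_rtree_types)
 have up: "eventually (%p. \<forall>U\<in>?F. case p of (n, m) => real (card (emb_pairs n m l U)) <=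
    (pmf (gw_trunc 1 l) U + r / (card ?F + 1)) * card (pl {1..n} m \<times> {1..n})) crit"
 proof (rule eventually_ball_finite[OF fF], rule ballI)
  fix U assume "U \<in> ?F"
  then have U: "rtree l U" by (simp add: rtree_types_def)
  let ?i = "card (inner_nodes l U)" and ?c = "card U - 1"
  define A where "A = (\<Prod>p\<in>inner_nodes l U. 1 / fact (nchild U p) :: real)"
  have A: "0 <= A" "A <= 1" unfolding A_def by (auto intro!: prod_nonneg prod_le_1 simp: divide_le_eq)
  have cU: "card U = Suc ?c" using card_rtree[OF U] by simp
  have z: "r / (card ?F + 1) > 0" using e by (simp add: add_pos_nonneg)
  show "eventually (%p. case p of (n, m) => real (card (emb_pairs n m l U)) <=
    (pmf (gw_trunc 1 l) U + r / (card ?F + 1)) * card (pl {1..n} m \<times> {1..n})) crit"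
   using pc_removal[OF z, of ?c ?i]
  proof eventually_elim
   case (elim p)
   obtain n m where p: "p = (n, m)" by (cases p)
   let ?z = "r / (card ?F + 1)"
   have *: "real n ^ ?c * real (pc (n - ?i) (m - ?c)) <= (exp (- real ?i) + ?z) * real (pc n m)" using elim p by simp
   have "real (card (emb_pairs n m l U)) <= real n ^ card U * A * real (pc (n - ?i) (m - ?c))"
    unfolding A_def by (rule card_emb_pairs[OF U])
   also have "... = A * n * (real n ^ ?c * real (pc (n - ?i) (m - ?c)))" by (subst cU) (simp add: mult_ac)
   also have "... <= A * n * ((exp (- real ?i) + ?z) * real (pc n m))" using * A by (intro mult_left_mono) auto
   also have "... = (A * exp (- real ?i) + A * ?z) * (real (pc n m) * n)" by (simp add: algebra_simps)
   also have "... <= (pmf (gw_trunc 1 l) U + ?z) * (real (pc n m) * n)"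
   proof (intro mult_right_mono add_mono)
    have "A * exp (- real ?i) = weight l U"
    proof -
     have "weight l U = (\<Prod>p\<in>inner_nodes l U. 1 / fact (nchild U p) * exp (- 1))"
      unfolding weight_def by (intro prod.cong refl) simp
     also have "... = A * exp (- 1) ^ ?i" unfolding prod.distrib A_def by simp
     also have "exp (- 1 :: real) ^ ?i = exp (- real ?i)" by (simp add: exp_of_nat_mult[symmetric])
     finally show ?thesis by simp
    qed
    then show "A * exp (- real ?i) <= pmf (gw_trunc 1 l) U" using rtreeD(4)[OF U] by simp
    show "A * ?z <= ?z" by (rule mult_left_le_one_le) (use A z in auto)
   qed auto
   finally show ?case using p by (simp add: card_cartesian_product card_pl)
  qed
 qed
 have "eventually (%n. D <= r / 2 * real n) at_top" using e by real_asymp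
 then have De: "eventually (%(n, m). D <= r / 2 * real n) crit" by (rule crit_at_top)
 have me: "eventually (%(n, m). b <= m) crit"
 proof (rule eventually_critI[of "1/2" "4 * b"], simp, unfold split)
  fix n m assume n: "4 * b <= n" and m: "\<bar>2 * real m - real n\<bar> <= 1 / 2 * real n"
  from n have "real (4 * b) <= real n" by (rule of_nat_mono)
  then show "b <= m" using m by linarith
 qed
 have rest: "eventually (%(n, m). real (card ((pl {1..n} m \<times> {1..n}) - (\<Union>U\<in>?F. emb_pairs n m l U))) <= r * card (pl {1..n} m \<times> {1..n})) crit"
  using De me pc_edges_crude
 proof eventually_elim
  case (elim p)
  obtain n m where p: "p = (n, m)" by (cases p)
  let ?V = "{1..n}"
  let ?A = "\<Union>U\<in>?F. emb_pairs n m l U"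
  have D: "D <= r / 2 * n" and bm: "b <= m" and cr: "\<And>e. e <= m ==> real n ^ e * real (pc n (m - e)) <= 6 ^ e * real (pc n m)"
   using elim p by auto
  have "pl ?V m \<times> ?V - ?A \<subseteq> dense_pairs n m b \<union> big_pairs n m l K"
  proof clarify
   fix E v assume Ev: "E \<in> pl ?V m" "v \<in> ?V" "(E, v) \<notin> ?A" "(E, v) \<notin> big_pairs n m l K"
   show "(E, v) \<in> dense_pairs n m b"
   proof (rule ccontr)
    assume "(E, v) \<notin> dense_pairs n m b"
    then have "sparse_at (2 * l + 2) ?V E v" using Ev by (simp add: dense_pairs_def b_def)
    then obtain U f where U: "rtree l U" "tree_emb l E U f" "f [] = v" "f ` U \<subseteq> ?V"
     using tree_emb_exists[of ?V E v l] Ev by (auto simp: pl_def)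
    show False
    proof (cases "card U <= K")
     case True
     then have "U \<in> ?F" using U by (simp add: rtree_types_def)
     moreover have "(E, v) \<in> emb_pairs n m l U" using U Ev by (auto simp: emb_pairs_def)
     ultimately show False using Ev by blast
    next
     case False
     then have "(E, v) \<in> big_pairs n m l K" unfolding big_pairs_def using U Ev(1,2) by force
     then show False using Ev by blast
    qed
   qed
  qed
  then have "card (pl ?V m \<times> ?V - ?A) <= card (dense_pairs n m b \<union> big_pairs n m l K)"
   by (rule card_mono[rotated]) (rule finite_subset[of _ "pl ?V m \<times> ?V"], auto simp: dense_pairs_def big_pairs_def finite_pl)
  also have "... <= card (dense_pairs n m b) + card (big_pairs n m l K)" by (rule card_Un_le)
  finally have "real (card (pl ?V m \<times> ?V - ?A)) <= real (card (dense_pairs n m b) + card (big_pairs n m l K))"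
   by (rule of_nat_mono)
  then have 1: "real (card (pl ?V m \<times> ?V - ?A)) <= real (card (dense_pairs n m b)) + real (card (big_pairs n m l K))"
   by simp
  have "real (card (dense_pairs n m b)) <= real (\<Sum>w\<le>b. n ^ w * (2 ^ (2 ^ w) * (pc n (m - w) * w)))"
   by (rule of_nat_mono) (rule card_dense_pairs)
  also have "... = (\<Sum>w\<le>b. (2 ^ (2 ^ w) * real w) * (real n ^ w * real (pc n (m - w))))" by (simp add: mult_ac)
  also have "... <= (\<Sum>w\<le>b. (2 ^ (2 ^ w) * real w) * (6 ^ w * real (pc n m)))"
   using bm by (intro sum_mono mult_left_mono cr) auto
  also have "... = D * real (pc n m)" by (simp add: D_def sum_distrib_left sum_distrib_right mult_ac)
  also have "... <= r / 2 * n * real (pc n m)" using D by (intro mult_right_mono) auto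
  finally have 2: "real (card (dense_pairs n m b)) <= r / 2 * n * real (pc n m)" .
  have "real (K * card (big_pairs n m l K)) <= real (\<Sum>j\<le>l. n ^ Suc j * pc n (m - j))"
   by (rule of_nat_mono) (rule card_big_pairs)
  also have "... = (\<Sum>j\<le>l. n * (real n ^ j * real (pc n (m - j))))" by (simp add: mult_ac)
  also have "... <= (\<Sum>j\<le>l. n * (6 ^ j * real (pc n m)))"
   using bm b_def by (intro sum_mono mult_left_mono cr) auto
  also have "... = C * (n * real (pc n m))" by (simp add: C_def sum_distrib_left sum_distrib_right mult_ac)
  finally have "real (card (big_pairs n m l K)) <= C / K * (n * real (pc n m))" using K(2) by (simp add: field_simps)
  also have "... <= r / 2 * (n * real (pc n m))" using K(1) by (intro mult_right_mono) auto
  finally have 3: "real (card (big_pairs n m l K)) <= r / 2 * (n * real (pc n m))" .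
  have "real (card (pl ?V m \<times> ?V - ?A)) <= r * (real (pc n m) * n)"
   using 1 2 3 by (simp add: algebra_simps)
  then show ?case using p by (simp add: card_cartesian_product card_pl)
 qed
 show ?thesis
 proof (rule that[of K], use up rest in eventually_elim)
  case (elim p)
  obtain n m where p: "p = (n, m)" by (cases p)
  show ?case using elim unfolding p split by (rule conjI)
 qed
qed

section \<open>The limit for P\<close>

lemma ball_root_in: "r \<in> V ==> snd (snd (ball l (V, E, r))) \<in> fst (ball l (V, E, r))"
 by (simp add: ball_def root_in_dist_ball)

lemma rooted_iso_ball_cong:
 assumes "rooted_iso (ball l (V1, E1, r1)) (ball l (V2, E2, r2))" "r1 \<in> V1"
 shows "rooted_iso (ball l (V2, E2, r2)) H \<longleftrightarrow> rooted_iso (ball l (V1, E1, r1)) H"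
proof -
 have "fst (ball l (V1, E1, r1)) ~= {}" using ball_root_in[OF assms(2), of l E1] by blast
 then have "rooted_iso (ball l (V2, E2, r2)) (ball l (V1, E1, r1))"
  using rooted_iso_sym[OF assms(1)] ball_root_in[OF assms(2)] by blast
 then show ?thesis using rooted_iso_trans[OF assms(1), of H] rooted_iso_trans[of _ _ H] by blast
qed

lemma rooted_iso_emb:
 assumes "(E, v) \<in> emb_pairs n m l U" "rtree l U"
 shows "rooted_iso (ball l ({1..n}, E, v)) H \<longleftrightarrow> rooted_iso (ball l (U, tree_edges U, [])) H"
proof -
 obtain f where f: "tree_emb l E U f" "f [] = v" "f ` U \<subseteq> {1..n}" using assms(1) by (auto simp: emb_pairs_def)
 have "rooted_iso (ball l (U, tree_edges U, [])) (ball l ({1..n}, E, v))"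
  using tree_emb_ball[OF assms(2) f(1,3)] f(2) by simp
 then show ?thesis by (rule rooted_iso_ball_cong) (rule rtreeD(2)[OF assms(2)])
qed

lemma crit_nonempty: "eventually (%(n, m). pl {1..n} m \<times> {1..n} ~= {} \<and> pc n m > 0 \<and> n > 0) crit"
 using pc_pos crit_ge[of 1]
proof eventually_elim
 case (elim p)
 obtain n m where p: "p = (n, m)" by (cases p)
 have "card (pl {1..n} m) > 0" "n \<ge> 1" using elim p by (auto simp: card_pl)
 then have "pl {1..n} m ~= {}" "1 \<in> {1..n}" by auto
 then show ?case using elim p by auto
qed

lemma prob_P_eq: "prob_P n m l H = card {(E, v)\<in>pl {1..n} m \<times> {1..n}. rooted_iso (ball l ({1..n}, E, v)) H} / card (pl {1..n} m \<times> {1..n})"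
proof -
 have "{(E, v)\<in>pl {1..n} m \<times> {1..n}. rooted_iso (ball l ({1..n}, E, v)) H} = (SIGMA E:pl {1..n} m. {v\<in>{1..n}. rooted_iso (ball l ({1..n}, E, v)) H})"
  by auto
 then have "card {(E, v)\<in>pl {1..n} m \<times> {1..n}. rooted_iso (ball l ({1..n}, E, v)) H} = (\<Sum>E\<in>pl {1..n} m. card {v\<in>{1..n}. rooted_iso (ball l ({1..n}, E, v)) H})"
  by (simp add: card_SigmaI finite_pl)
 then show ?thesis
  by (simp add: prob_P_def planar_graphs_pl card_cartesian_product sum_divide_distrib[symmetric])
qed

lemma prob_P_limit:
 "((%(n, m). prob_P n m l H) \<longlongrightarrow> measure_pmf.prob (gw_ball 1 l) {G. rooted_iso G H}) crit"
proof (rule tendstoI)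
 fix e :: real assume e: "e > 0"
 define r where "r = e / 3"
 have eps: "r > 0" "2 * r < e" using e by (auto simp: r_def)
 obtain K where K: "eventually (%(n, m). (\<forall>U\<in>rtree_types l K. real (card (emb_pairs n m l U)) <=
    (pmf (gw_trunc 1 l) U + r / (card (rtree_types l K) + 1)) * card (pl {1..n} m \<times> {1..n})) \<and>
   real (card ((pl {1..n} m \<times> {1..n}) - (\<Union>U\<in>rtree_types l K. emb_pairs n m l U))) <= r * card (pl {1..n} m \<times> {1..n})) crit"
  using local_types[OF eps(1)] by blast
 define T where "T = {U. rooted_iso (ball l (U, tree_edges U, [])) H}"
 have q: "measure_pmf.prob (gw_ball 1 l) {G. rooted_iso G H} = measure_pmf.prob (gw_trunc 1 l) T"
  by (simp add: gw_ball_def T_def vimage_def)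
 from K crit_nonempty
 show "eventually (%p. dist (case p of (n, m) => prob_P n m l H) (measure_pmf.prob (gw_ball 1 l) {G. rooted_iso G H}) < e) crit"
 proof eventually_elim
  case (elim p)
  obtain n m where p: "p = (n, m)" by (cases p)
  have "\<bar>card {(E, v)\<in>pl {1..n} m \<times> {1..n}. rooted_iso (ball l ({1..n}, E, v)) H} / card (pl {1..n} m \<times> {1..n}) - measure_pmf.prob (gw_trunc 1 l) T\<bar> <= 2 * r"
  proof (rule scheffe_finite[where F = "rtree_types l K" and A = "emb_pairs n m l"])
   show "w \<in> {(E, v)\<in>pl {1..n} m \<times> {1..n}. rooted_iso (ball l ({1..n}, E, v)) H} \<longleftrightarrow> U \<in> T"
    if "U \<in> rtree_types l K" "w \<in> emb_pairs n m l U" for U w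
    using that rooted_iso_emb[of "fst w" "snd w" n m l U H] by (auto simp: rtree_types_def T_def emb_pairs_def)
  qed (use elim p eps finite_rtree_types in \<open>auto simp: finite_pl emb_pairs_def\<close>)
  then show ?case using eps unfolding p by (simp add: prob_P_eq q dist_real_def)
 qed
qed

section \<open>Extinction of T(1) and the size of the largest component\<close>

text \<open>No node at depth l: the tree has died out and its truncation has cut off
  nothing.\<close>

definition dead :: "nat => nat list set => bool" where
 "dead l U \<longleftrightarrow> (\<forall>p\<in>U. length p < l)"

lemma prob_bind_pmf_ge:
 assumes "finite A"
 shows "(\<Sum>a\<in>A. pmf M a * measure_pmf.prob (f a) S) <= measure_pmf.prob (bind_pmf M f) S"
proof -
 have int: "integrable (measure_pmf M) g" if "\<And>x. 0 <= g x" "\<And>x. g x <= 1" for g :: "'a => real"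
  by (rule measure_pmf.integrable_const_bound[of _ 1]) (use that in auto)
 have "ennreal (measure_pmf.prob (bind_pmf M f) S) = (\<integral>\<^sup>+x. ennreal (measure_pmf.prob (f x) S) \<partial>measure_pmf M)"
  using emeasure_bind_pmf[of M f S] by (simp add: measure_pmf.emeasure_eq_measure)
 also have "... = ennreal (\<integral>x. measure_pmf.prob (f x) S \<partial>measure_pmf M)"
  by (rule nn_integral_eq_integral) (auto intro: int)
 finally have "measure_pmf.prob (bind_pmf M f) S = (\<integral>x. measure_pmf.prob (f x) S \<partial>measure_pmf M)"
  by (simp add: integral_nonneg_AE)
 moreover have "(\<integral>x. indicator A x * measure_pmf.prob (f x) S \<partial>measure_pmf M) <= (\<integral>x. measure_pmf.prob (f x) S \<partial>measure_pmf M)"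
  by (intro integral_mono int) (auto simp: indicator_def)
 moreover have "(\<integral>x. indicator A x * measure_pmf.prob (f x) S \<partial>measure_pmf M) = (\<Sum>a\<in>A. indicator A a * measure_pmf.prob (f a) S * pmf M a)"
  by (rule integral_measure_pmf_real[OF assms]) (auto simp: indicator_def split: if_splits)
 moreover have "... = (\<Sum>a\<in>A. pmf M a * measure_pmf.prob (f a) S)" by (intro sum.cong) auto
 ultimately show ?thesis by simp
qed

lemma prob_replicate_pmf_all:
 "measure_pmf.prob (replicate_pmf k p) {ts. \<forall>t\<in>set ts. Q t} = measure_pmf.prob p {t. Q t} ^ k"
proof (induction k)
 case (Suc k)
 let ?S = "{ts. \<forall>t\<in>set ts. Q t}" and ?R = "replicate_pmf k p"
 have "emeasure (replicate_pmf (Suc k) p) ?S = (\<integral>\<^sup>+x. emeasure (map_pmf ((#) x) ?R) ?S \<partial>measure_pmf p)"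
  by (simp add: map_pmf_def)
 also have "... = (\<integral>\<^sup>+x. emeasure ?R ?S * indicator {t. Q t} x \<partial>measure_pmf p)"
 proof (rule nn_integral_cong)
  fix x
  have "(#) x -` ?S = (if Q x then ?S else {})" by auto
  then show "emeasure (map_pmf ((#) x) ?R) ?S = emeasure ?R ?S * indicator {t. Q t} x" by simp
 qed
 also have "... = emeasure ?R ?S * emeasure (measure_pmf p) {t. Q t}" by (rule nn_integral_cmult_indicator) simp
 finally show ?case using Suc
  by (simp add: measure_pmf.emeasure_eq_measure ennreal_mult[symmetric] mult.commute)
qed simp

text \<open>The tree dies out if the subtrees of all k children do, and k is Poisson(1), so the
  expectation of a^k is exp(a - 1). Partial sums over k < N keep everything finite until the limit
  is taken.\<close>

lemma dead_step: "exp (measure_pmf.prob (gw_trunc 1 l) {U. dead l U} - 1) <= measure_pmf.prob (gw_trunc 1 (Suc l)) {U. dead (Suc l) U}"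
proof -
 let ?a = "measure_pmf.prob (gw_trunc 1 l) {U. dead l U}"
 let ?j = "%k ts. insert [] (\<Union>i<k. (%w. i # w) ` (ts ! i))"
 have g: "gw_trunc 1 (Suc l) = bind_pmf (poisson_pmf 1) (%k. map_pmf (?j k) (replicate_pmf k (gw_trunc 1 l)))"
  by (simp add: map_pmf_def)
 have le: "?a ^ k <= measure_pmf.prob (map_pmf (?j k) (replicate_pmf k (gw_trunc 1 l))) {U. dead (Suc l) U}" for k
 proof -
  have "measure_pmf.prob (replicate_pmf k (gw_trunc 1 l)) {ts. \<forall>t\<in>set ts. dead l t} <= measure_pmf.prob (replicate_pmf k (gw_trunc 1 l)) (?j k -` {U. dead (Suc l) U})"
  proof (rule measure_pmf.finite_measure_mono_AE)
   show "AE ts in measure_pmf (replicate_pmf k (gw_trunc 1 l)). ts \<in> {ts. \<forall>t\<in>set ts. dead l t} --> ts \<in> ?j k -` {U. dead (Suc l) U}"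
   proof (rule AE_pmfI)
    fix ts assume "ts \<in> set_pmf (replicate_pmf k (gw_trunc 1 l))"
    then have "length ts = k" by (auto simp: set_replicate_pmf)
    then show "ts \<in> {ts. \<forall>t\<in>set ts. dead l t} --> ts \<in> ?j k -` {U. dead (Suc l) U}"
     by (force simp: dead_def)
   qed
  qed simp
  then show ?thesis using prob_replicate_pmf_all[of k "gw_trunc 1 l" "dead l"] by simp
 qed
 have b: "exp (- 1) * (\<Sum>k<N. ?a ^ k / fact k) <= measure_pmf.prob (gw_trunc 1 (Suc l)) {U. dead (Suc l) U}" for N
 proof -
  have "exp (- 1) * (\<Sum>k<N. ?a ^ k / fact k) = (\<Sum>k<N. pmf (poisson_pmf 1) k * ?a ^ k)"
   by (simp add: sum_distrib_left mult_ac)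
  also have "... <= (\<Sum>k<N. pmf (poisson_pmf 1) k * measure_pmf.prob (map_pmf (?j k) (replicate_pmf k (gw_trunc 1 l))) {U. dead (Suc l) U})"
   by (intro sum_mono mult_left_mono le) auto
  also have "... <= measure_pmf.prob (gw_trunc 1 (Suc l)) {U. dead (Suc l) U}" unfolding g by (rule prob_bind_pmf_ge) simp
  finally show ?thesis .
 qed
 have "(%k. ?a ^ k / fact k) sums exp ?a" using exp_converges[of ?a] by (simp add: divide_inverse mult.commute scaleR_conv_of_real)
 then have "(%N. exp (- 1) * (\<Sum>k<N. ?a ^ k / fact k)) \<longlonglongrightarrow> exp (- 1) * exp ?a"
  unfolding sums_def by (rule tendsto_mult_left)
 then have "exp (- 1) * exp ?a <= measure_pmf.prob (gw_trunc 1 (Suc l)) {U. dead (Suc l) U}"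
  by (rule LIMSEQ_le_const2) (use b in blast)
 then show ?thesis by (simp add: exp_diff exp_minus field_simps)
qed

lemma exp_eq_self: "exp (x - 1) <= x ==> x = (1::real)"
proof (rule ccontr)
 assume a: "exp (x - 1) <= x" "x ~= 1"
 have "0 < x" using a(1) exp_gt_zero[of "x - 1"] by linarith
 then have "ln x < x - 1" using a(2) ln_le_minus_one[of x] ln_eq_minus_one[of x] by force
 moreover have "x - 1 <= ln x" using a(1) \<open>0 < x\<close> by (metis exp_le_cancel_iff exp_ln)
 ultimately show False by simp
qed

text \<open>The extinction probabilities increase to some x with exp(x - 1) <= x. The curve exp(x -
  1) touches the diagonal only at 1: mean offspring 1 is critical, and T(1) dies out.\<close>

lemma dead_limit: "(%l. measure_pmf.prob (gw_trunc 1 l) {U. dead l U}) \<longlonglongrightarrow> 1"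
proof -
 define a where "a = (%l. measure_pmf.prob (gw_trunc 1 l) {U. dead l U})"
 have st: "exp (a l - 1) <= a (Suc l)" for l unfolding a_def by (rule dead_step)
 have "a l <= a (Suc l)" for l using st[of l] exp_ge_add_one_self[of "a l - 1"] by linarith
 then have inc: "incseq a" by (rule incseq_SucI)
 have bd: "a l <= 1" for l by (simp add: a_def)
 from incseq_convergent[OF inc bd[THEN allI[of "%l. a l <= 1"]]] obtain x where x: "a \<longlonglongrightarrow> x" by (auto simp: bd)
 have "(%l. exp (a l - 1)) \<longlonglongrightarrow> exp (x - 1)" by (intro tendsto_intros x)
 moreover have "(%l. a (Suc l)) \<longlonglongrightarrow> x" using x by (rule LIMSEQ_Suc)
 ultimately have "exp (x - 1) <= x" using st by (intro LIMSEQ_le[of _ _ "%l. a (Suc l)"]) auto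
 then have "x = 1" by (rule exp_eq_self)
 then show ?thesis using x by (simp add: a_def)
qed

lemma component_adj:
 assumes "simple_graph V E"
 shows "component V E v = {u\<in>V. (v, u) \<in> (adj E)\<^sup>*}"
proof -
 have "{(x, y). x \<in> V \<and> y \<in> V \<and> {x, y} \<in> E} = adj E" using simple_graph_edgeD[OF assms] by (auto simp: adj_def)
 then show ?thesis by (simp add: component_def)
qed

lemma component_closed_subset:
 assumes sg: "simple_graph V E" and v: "v \<in> S" and cl: "\<And>u w. u \<in> S ==> {u, w} \<in> E ==> w \<in> S"
 shows "component V E v \<subseteq> S"
proof -
 have "u \<in> S" if "(v, u) \<in> (adj E)\<^sup>*" for u
  using that by (induction rule: rtrancl_induct) (use v cl in \<open>auto simp: adj_def\<close>)
 then show ?thesis unfolding component_adj[OF sg] by blast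
qed

lemma emb_component:
 assumes x: "(E, v) \<in> emb_pairs n m l U" and U: "rtree l U" and d: "dead l U"
 shows "card (component {1..n} E v) <= card U"
proof -
 obtain f where f: "tree_emb l E U f" "f [] = v" "f ` U \<subseteq> {1..n}" using x by (auto simp: emb_pairs_def)
 have sg: "simple_graph {1..n} E" using x by (auto simp: emb_pairs_def pl_def)
 have "component {1..n} E v \<subseteq> f ` U"
 proof (rule component_closed_subset[OF sg])
  show "v \<in> f ` U" using f(2) rtreeD(2)[OF U] by blast
  fix u w assume "u \<in> f ` U" "{u, w} \<in> E"
  then obtain p where p: "p \<in> U" "{f p, w} \<in> E" by auto
  have l: "length p < l" using d p by (auto simp: dead_def)
  from tree_embD(2)[OF f(1) p(1) l, of w] p(2)
  consider "p ~= []" "w = f (butlast p)" | i where "i < nchild U p" "w = f (p @ [i])" by blast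
  then show "w \<in> f ` U"
  proof cases
   case 1
   then show ?thesis using rtree_butlast[OF U p(1)] by (auto simp: inner_nodes_def)
  next
   case 2
   then show ?thesis using rtreeD(3)[OF U, of p i] p(1) l by auto
  qed
 qed
 then have "card (component {1..n} E v) <= card (f ` U)" by (rule card_mono[rotated]) (use rtreeD(1)[OF U] in auto)
 also have "... <= card U" by (rule card_image_le) (rule rtreeD(1)[OF U])
 finally show ?thesis .
qed

text \<open>Pick l such that T(1) is dead at depth l with probability above 1 - r/3. For a vertex of
  a dead type with at most K nodes the embedded tree contains the whole component. The types that
  survive, the error terms and the uncovered pairs cost r/3 each.\<close>

lemma large_components_rare:
 fixes r :: real
 assumes e: "r > 0"
 shows "\<exists>K. eventually (%(n, m). real (card {(E, v)\<in>pl {1..n} m \<times> {1..n}. K < card (component {1..n} E v)}) <= r * (real (pc n m) * n)) crit"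
proof -
 have e4: "r / 3 > 0" using e by simp
 from order_tendstoD(1)[OF dead_limit, of "1 - r / 3"] e4
 have "\<exists>l. 1 - r / 3 < measure_pmf.prob (gw_trunc 1 l) {U. dead l U}" by (auto simp: eventually_sequentially)
 then obtain l where l: "1 - r / 3 < measure_pmf.prob (gw_trunc 1 l) {U. dead l U}" by blast
 obtain K where K: "eventually (%(n, m). (\<forall>U\<in>rtree_types l K. real (card (emb_pairs n m l U)) <=
    (pmf (gw_trunc 1 l) U + r / 3 / (card (rtree_types l K) + 1)) * card (pl {1..n} m \<times> {1..n})) \<and>
   real (card ((pl {1..n} m \<times> {1..n}) - (\<Union>U\<in>rtree_types l K. emb_pairs n m l U))) <= r / 3 * card (pl {1..n} m \<times> {1..n})) crit"
  using local_types[OF e4] by blast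
 let ?F = "rtree_types l K"
 have fF: "finite ?F" by (rule finite_rtree_types)
 have c: "measure_pmf.prob (gw_trunc 1 l) {U. \<not> dead l U} <= r / 3"
  using l measure_pmf.prob_compl[of "{U. dead l U}" "gw_trunc 1 l"] by (simp add: Collect_neg_eq Compl_eq_Diff_UNIV)
 show ?thesis
 proof (rule exI[of _ K], use K in eventually_elim)
  case (elim p)
  obtain n m where p: "p = (n, m)" by (cases p)
  let ?O = "pl {1..n} m \<times> {1..n}"
  let ?R = "?O - (\<Union>U\<in>?F. emb_pairs n m l U)" and ?G = "?F \<inter> {U. \<not> dead l U}"
  let ?B = "{(E, v)\<in>?O. K < card (component {1..n} E v)}"
  have up: "\<And>U. U \<in> ?F ==> real (card (emb_pairs n m l U)) <= (pmf (gw_trunc 1 l) U + r / 3 / (card ?F + 1)) * card ?O"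
   and rest: "real (card ?R) <= r / 3 * card ?O" using elim p by auto
  have fO: "finite ?O" by (simp add: finite_pl)
  have "?B \<subseteq> ?R \<union> (\<Union>U\<in>?G. emb_pairs n m l U)"
  proof clarify
   fix E v assume a: "E \<in> pl {1..n} m" "v \<in> {1..n}" "K < card (component {1..n} E v)" "(E, v) \<notin> (\<Union>U\<in>?G. emb_pairs n m l U)"
   show "(E, v) \<in> ?R"
   proof (rule ccontr)
    assume "(E, v) \<notin> ?R"
    then obtain U where U: "U \<in> ?F" "(E, v) \<in> emb_pairs n m l U" using a by blast
    then have "dead l U" using a(4) by blast
    then have "card (component {1..n} E v) <= K"
     using emb_component[OF U(2)] U(1) by (auto simp: rtree_types_def)
    then show False using a(3) by simp
   qed
  qed
  then have "card ?B <= card (?R \<union> (\<Union>U\<in>?G. emb_pairs n m l U))"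
   by (rule card_mono[rotated]) (use fO fF finite_emb_pairs in auto)
  also have "... <= card ?R + card (\<Union>U\<in>?G. emb_pairs n m l U)" by (rule card_Un_le)
  also have "card (\<Union>U\<in>?G. emb_pairs n m l U) <= (\<Sum>U\<in>?G. card (emb_pairs n m l U))"
   by (rule card_UN_le) (use fF in auto)
  finally have cB: "card ?B <= card ?R + (\<Sum>U\<in>?G. card (emb_pairs n m l U))" by simp
  have "real (card ?B) <= real (card ?R + (\<Sum>U\<in>?G. card (emb_pairs n m l U)))"
   by (rule of_nat_mono[OF cB])
  also have "... = real (card ?R) + (\<Sum>U\<in>?G. real (card (emb_pairs n m l U)))" by simp
  also have "... <= r / 3 * card ?O + (\<Sum>U\<in>?G. (pmf (gw_trunc 1 l) U + r / 3 / (card ?F + 1)) * card ?O)"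
   using up rest by (intro add_mono sum_mono) auto
  also have "... = (r / 3 + ((\<Sum>U\<in>?G. pmf (gw_trunc 1 l) U) + card ?G * (r / 3 / (card ?F + 1)))) * card ?O"
   by (subst sum_distrib_right[symmetric]) (simp add: sum.distrib algebra_simps)
  also have "... <= (r / 3 + (r / 3 + r / 3)) * card ?O"
  proof (intro mult_right_mono add_mono order_refl)
   have "(\<Sum>U\<in>?G. pmf (gw_trunc 1 l) U) = measure_pmf.prob (gw_trunc 1 l) ?G"
    using fF by (simp add: measure_measure_pmf_finite)
   also have "... <= measure_pmf.prob (gw_trunc 1 l) {U. \<not> dead l U}" by (intro measure_pmf.finite_measure_mono) auto
   finally show "(\<Sum>U\<in>?G. pmf (gw_trunc 1 l) U) <= r / 3" using c by simp
   have "card ?G <= card ?F" using fF by (intro card_mono) auto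
   then have "real (card ?G) * (r / 3) <= real (card ?F + 1) * (r / 3)" using e by (intro mult_right_mono) auto
   then show "card ?G * (r / 3 / (card ?F + 1)) <= r / 3" by (simp add: field_simps)
  qed simp
  also have "... = r * (real (pc n m) * n)" by (simp add: card_cartesian_product card_pl)
  finally show ?case using p by simp
 qed
qed

lemma largest_comp:
 fixes n :: nat
 assumes sg: "simple_graph {1..n} E" and n: "n > 0"
 defines "L \<equiv> largest_comp {1..n} E"
 shows "L \<subseteq> {1..n}" "L ~= {}" "\<And>v. v \<in> L ==> component {1..n} E v = L"
  "\<And>v. v \<in> {1..n} ==> card (component {1..n} E v) <= card L" "\<And>u w. u \<in> L ==> {u, w} \<in> E ==> w \<in> L"
proof -
 let ?V = "{1..n}"
 define M where "M = Max ((%v. card (component ?V E v)) ` ?V)"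
 define r where "r = Min {v\<in>?V. card (component ?V E v) = M}"
 have L: "L = component ?V E r" by (simp add: L_def largest_comp_def M_def r_def Let_def)
 have ne: "?V ~= {}" using n by auto
 have "M \<in> (%v. card (component ?V E v)) ` ?V" unfolding M_def using ne by (intro Max_in) auto
 then have "{v\<in>?V. card (component ?V E v) = M} ~= {}" by auto
 then have "r \<in> {v\<in>?V. card (component ?V E v) = M}" unfolding r_def by (intro Min_in) auto
 then have r: "r \<in> ?V" "card L = M" using L by auto
 note c = component_adj[OF sg]
 show "L \<subseteq> ?V" unfolding L c by blast
 show "L ~= {}" using r unfolding L c by blast
 show "component ?V E v = L" if "v \<in> L" for v
  using that adj_rtrancl_sym[of r v E] unfolding L c by (auto intro: rtrancl_trans)
 show "card (component ?V E v) <= card L" if "v \<in> ?V" for v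
  unfolding r(2) M_def using that by (intro Max_ge) auto
 show "w \<in> L" if "u \<in> L" "{u, w} \<in> E" for u w
  using that simple_graph_edgeD[OF sg that(2)] unfolding L c by (auto simp: adj_def intro: rtrancl_into_rtrancl)
qed

text \<open>All vertices of L lie in a component of the size of L. So if L has more than K vertices,
  its size is at most the number of vertices in components larger than K, which is small on
  average.\<close>

lemma largest_comp_small:
 fixes r :: real
 assumes e: "r > 0"
 shows "eventually (%(n, m). (\<Sum>E\<in>pl {1..n} m. real (card (largest_comp {1..n} E))) <= r * (real (pc n m) * n)) crit"
proof -
 have e2: "r / 2 > 0" using e by simp
 obtain K where K: "eventually (%(n, m). real (card {(E, v)\<in>pl {1..n} m \<times> {1..n}. K < card (component {1..n} E v)}) <= r / 2 * (real (pc n m) * n)) crit"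
  using large_components_rare[OF e2] by blast
 have "eventually (%n. real K <= r / 2 * real n) at_top" using e by real_asymp
 then have "eventually (%(n, m). real K <= r / 2 * real n) crit" by (rule crit_at_top)
 from this K crit_ge[of 1] show ?thesis
 proof eventually_elim
  case (elim p)
  obtain n m where p: "p = (n, m)" by (cases p)
  let ?V = "{1..n}" and ?L = "largest_comp {1..n}"
  let ?H = "%E. {v\<in>?V. K < card (component ?V E v)}"
  have n: "n > 0" and Kn: "real K <= r / 2 * n" using elim p by auto
  have B: "real (card {(E, v)\<in>pl ?V m \<times> ?V. K < card (component ?V E v)}) <= r / 2 * (real (pc n m) * n)" using elim p by auto
  have "card (?L E) <= K + card (?H E)" if E: "E \<in> pl ?V m" for E
  proof (cases "card (?L E) <= K")
   case False
   have sg: "simple_graph ?V E" using E by (simp add: pl_def)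
   have "?L E \<subseteq> ?H E" using largest_comp(1,3)[OF sg n] False by auto
   then show ?thesis using card_mono[of "?H E" "?L E"] by simp
  qed simp
  then have "(\<Sum>E\<in>pl ?V m. card (?L E)) <= (\<Sum>E\<in>pl ?V m. K + card (?H E))" by (rule sum_mono)
  also have "... = card (pl ?V m) * K + card (SIGMA E:pl ?V m. ?H E)"
   by (subst card_SigmaI) (auto simp: finite_pl sum.distrib)
  also have "(SIGMA E:pl ?V m. ?H E) = {(E, v)\<in>pl ?V m \<times> ?V. K < card (component ?V E v)}" by auto
  finally have "real (\<Sum>E\<in>pl ?V m. card (?L E)) <= real (card (pl ?V m) * K + card {(E, v)\<in>pl ?V m \<times> ?V. K < card (component ?V E v)})"
   by (rule of_nat_mono)
  also have "... = pc n m * real K + card {(E, v)\<in>pl ?V m \<times> ?V. K < card (component ?V E v)}" by (simp add: card_pl)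
  also have "... <= pc n m * (r / 2 * n) + r / 2 * (real (pc n m) * n)" using Kn B by (intro add_mono mult_left_mono) auto
  also have "... = r * (real (pc n m) * n)" by simp
  finally show ?case using p by simp
 qed
qed

section \<open>The limit for S\<close>

lemma ball_closed_subset:
 assumes S: "S \<subseteq> V" "v \<in> S" and cl: "\<And>u w. u \<in> S ==> {u, w} \<in> E ==> w \<in> S"
 shows "ball l (S, induced S E, v) = ball l (V, E, v)"
proof -
 have eq: "dist_ball S (induced S E) l v = dist_ball V E l v \<and> dist_ball V E l v \<subseteq> S" for l
 proof (induction l)
  case 0
  then show ?case using S by auto
 next
  case (Suc l)
  then have IH: "dist_ball S (induced S E) l v = dist_ball V E l v" "dist_ball V E l v \<subseteq> S" by auto
  have "{w\<in>S. \<exists>u\<in>dist_ball V E l v. {u, w} \<in> induced S E} = {w\<in>V. \<exists>u\<in>dist_ball V E l v. {u, w} \<in> E}"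
  proof (intro set_eqI iffI)
   fix w assume "w \<in> {w\<in>V. \<exists>u\<in>dist_ball V E l v. {u, w} \<in> E}"
   then obtain u where u: "u \<in> dist_ball V E l v" "{u, w} \<in> E" by blast
   then have "u \<in> S" "w \<in> S" using IH(2) cl by blast+
   then show "w \<in> {w\<in>S. \<exists>u\<in>dist_ball V E l v. {u, w} \<in> induced S E}" using u by (auto simp: induced_def)
  qed (use S in \<open>auto simp: induced_def\<close>)
  moreover have "{w\<in>V. \<exists>u\<in>dist_ball V E l v. {u, w} \<in> E} \<subseteq> S" using IH(2) cl by blast
  ultimately show ?case using IH by simp
 qed
 have "induced (dist_ball V E l v) (induced S E) = induced (dist_ball V E l v) E"
  using conjunct2[OF eq[of l]] by (auto simp: induced_def)
 then show ?thesis unfolding ball_def using eq[of l] by simp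
qed

text \<open>S is closed under edges, so balls do not change. Averaging over S instead of {1..n}
  changes the normalisation and drops the vertices of L; each effect is at most
  \<open>card L / n\<close>, with L the largest component.\<close>

lemma prob_S_prob_P:
 assumes n: "n > 0"
 shows "\<bar>prob_S n m l H - prob_P n m l H\<bar> <= (1 / real (pc n m)) * (\<Sum>E\<in>pl {1..n} m. 2 * real (card (largest_comp {1..n} E)) / n)"
proof -
 let ?V = "{1..n}"
 define s where "s = (%E. let S = ?V - largest_comp ?V E in real (card {v\<in>S. rooted_iso (ball l (S, induced S E, v)) H}) / real (card S))"
 define t where "t = (%E. real (card {v\<in>?V. rooted_iso (ball l (?V, E, v)) H}) / real n)"
 have "prob_S n m l H - prob_P n m l H = (1 / real (pc n m)) * (\<Sum>E\<in>pl ?V m. s E - t E)"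
  by (simp add: prob_S_def prob_P_def s_def t_def pc_def planar_graphs_pl sum_subtractf right_diff_distrib diff_divide_distrib)
 also have "\<bar>...\<bar> = (1 / real (pc n m)) * \<bar>\<Sum>E\<in>pl ?V m. s E - t E\<bar>" by (simp add: abs_mult)
 also have "... <= (1 / real (pc n m)) * (\<Sum>E\<in>pl ?V m. 2 * real (card (largest_comp ?V E)) / n)"
 proof (rule mult_left_mono)
  have "\<bar>s E - t E\<bar> <= 2 * real (card (largest_comp ?V E)) / n" if E: "E \<in> pl ?V m" for E
  proof -
   have sg: "simple_graph ?V E" using E by (simp add: pl_def)
   let ?L = "largest_comp ?V E" let ?S = "?V - ?L"
   note LC = largest_comp[OF sg n]
   have cl: "w \<in> ?S" if "u \<in> ?S" "{u, w} \<in> E" for u w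
    using LC(5)[of w u] that simple_graph_edgeD[OF sg that(2)] by (auto simp: insert_commute)
   define a where "a = card {v\<in>?S. rooted_iso (ball l (?V, E, v)) H}"
   define b where "b = card {v\<in>?L. rooted_iso (ball l (?V, E, v)) H}"
   have "{v\<in>?S. rooted_iso (ball l (?S, induced ?S E, v)) H} = {v\<in>?S. rooted_iso (ball l (?V, E, v)) H}"
   proof -
    have "ball l (?S, induced ?S E, v) = ball l (?V, E, v)" if "v \<in> ?S" for v
     by (rule ball_closed_subset[OF _ that]) (use cl in blast)+
    then show ?thesis by (intro Collect_cong conj_cong) simp_all
   qed
   then have sE: "s E = real a / real (card ?S)" by (simp add: s_def Let_def a_def)
   have fL: "finite ?L" using LC(1) finite_subset by blast
   have "{v\<in>?V. rooted_iso (ball l (?V, E, v)) H} = {v\<in>?S. rooted_iso (ball l (?V, E, v)) H} \<union> {v\<in>?L. rooted_iso (ball l (?V, E, v)) H}"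
    using LC(1) by auto
   then have "card {v\<in>?V. rooted_iso (ball l (?V, E, v)) H} = a + b"
    unfolding a_def b_def using fL by (simp add: card_Un_disjoint disjoint_iff)
   then have tE: "t E = (real a + real b) / n" by (simp add: t_def)
   have aS: "a <= card ?S" unfolding a_def by (rule card_mono) auto
   have bL: "b <= card ?L" unfolding b_def by (rule card_mono[OF fL]) auto
   have cS: "real (card ?S) + real (card ?L) = n"
    using LC(1) fL card_mono[OF _ LC(1)] by (simp add: card_Diff_subset of_nat_diff)
   have nn: "real n > 0" using n by simp
   have "\<bar>s E - t E\<bar> <= \<bar>s E - real a / n\<bar> + real b / n"
    unfolding tE add_divide_distrib using divide_nonneg_nonneg[of "real b" "real n"] by linarith
   also have "\<bar>s E - real a / n\<bar> <= real (card ?L) / n"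
   \<comment> \<open>If S is empty, then the average is 0 by division by zero, and so is a.\<close>
   proof (cases "card ?S = 0")
    case True
    then have "a = 0" using aS by linarith
    then show ?thesis using sE by simp
   next
    case False
    then have "card ?S > 0" by linarith
    then have c0: "real (card ?S) > 0" by (simp only: of_nat_0_less_iff)
    have frac: "x / c - x / z = (x / c) * (y / z)" if "c > 0" "z > 0" "c + y = z" for x y c z :: real
    proof -
     have "x / c - x / z = x * (z - c) / (c * z)" using that(1,2) by (simp add: field_simps)
     moreover have "z - c = y" using that(3) by simp
     ultimately show ?thesis by simp
    qed
    have "s E - real a / n = (a / card ?S) * (real (card ?L) / n)"
     unfolding sE using frac[OF c0 nn cS, of "real a"] .
    also have "\<bar>...\<bar> <= 1 * (real (card ?L) / n)"
     unfolding abs_mult using aS c0 nn by (intro mult_mono) auto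
    finally show ?thesis by simp
   qed
   also have "real (card ?L) / n + real b / n <= 2 * real (card ?L) / n" using bL nn by (simp add: field_simps)
   finally show ?thesis by simp
  qed
  then have "(\<Sum>E\<in>pl ?V m. \<bar>s E - t E\<bar>) <= (\<Sum>E\<in>pl ?V m. 2 * real (card (largest_comp ?V E)) / n)" by (rule sum_mono)
  then show "\<bar>\<Sum>E\<in>pl ?V m. s E - t E\<bar> <= (\<Sum>E\<in>pl ?V m. 2 * real (card (largest_comp ?V E)) / n)"
   using sum_abs[of "%E. s E - t E" "pl ?V m"] by linarith
 qed simp
 finally show ?thesis .
qed

lemma prob_S_limit:
 "((%(n, m). prob_S n m l H) \<longlongrightarrow> measure_pmf.prob (gw_ball 1 l) {G. rooted_iso G H}) crit"
proof (rule tendstoI)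
 fix e :: real assume e: "e > 0"
 have e4: "e / 4 > 0" "e / 2 > 0" using e by auto
 from largest_comp_small[OF e4(1)] crit_nonempty tendstoD[OF prob_P_limit[of l H] e4(2)]
 show "eventually (%p. dist (case p of (n, m) => prob_S n m l H) (measure_pmf.prob (gw_ball 1 l) {G. rooted_iso G H}) < e) crit"
 proof eventually_elim
  case (elim p)
  obtain n m where p: "p = (n, m)" by (cases p)
  have n: "n > 0" "real (pc n m) > 0" using elim p by auto
  have L: "(\<Sum>E\<in>pl {1..n} m. real (card (largest_comp {1..n} E))) <= e / 4 * (real (pc n m) * n)" using elim p by auto
  have "\<bar>prob_S n m l H - prob_P n m l H\<bar> <= (1 / real (pc n m)) * (\<Sum>E\<in>pl {1..n} m. 2 * real (card (largest_comp {1..n} E)) / n)"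
   by (rule prob_S_prob_P[OF n(1)])
  also have "... = 2 / (real (pc n m) * n) * (\<Sum>E\<in>pl {1..n} m. real (card (largest_comp {1..n} E)))"
   by (simp add: sum_distrib_left sum_divide_distrib)
  also have "... <= 2 / (real (pc n m) * n) * (e / 4 * (real (pc n m) * n))" using L by (intro mult_left_mono) auto
  also have "... = e / 2" using n by (simp add: field_simps)
  finally have a: "\<bar>prob_S n m l H - prob_P n m l H\<bar> <= e / 2" .
  have "dist (prob_P n m l H) (measure_pmf.prob (gw_ball 1 l) {G. rooted_iso G H}) < e / 2" using elim p by simp
  with a show ?case unfolding p split dist_real_def by linarith
 qed
qed

section \<open>The largest component is unbounded\<close>

lemma deg_le_component:
 assumes sg: "simple_graph V E" and V: "finite V" and x: "x \<in> V"
 shows "deg E x < card (component V E x)"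
proof -
 let ?C = "component V E x"
 have fC: "finite ?C" unfolding component_adj[OF sg] using V by simp
 have xC: "x \<in> ?C" unfolding component_adj[OF sg] using x by simp
 have "{e\<in>E. x \<in> e} \<subseteq> (%w. {x, w}) ` (?C - {x})"
 proof
  fix e assume e: "e \<in> {e\<in>E. x \<in> e}"
  then obtain w where w: "e = {x, w}" "w ~= x" "w \<in> V" using simple_graph_other[OF sg, of e x] by blast
  then have "w \<in> ?C" unfolding component_adj[OF sg] using e by (auto simp: adj_def)
  then show "e \<in> (%w. {x, w}) ` (?C - {x})" using w by blast
 qed
 then have "deg E x <= card ((%w. {x, w}) ` (?C - {x}))" unfolding deg_def by (rule card_mono[rotated]) (use fC in simp)
 also have "... <= card (?C - {x})" by (rule card_image_le) (use fC in simp)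
 also have "... < card ?C" using fC xC by (rule card_Diff1_less)
 finally show ?thesis .
qed

text \<open>If L has at most K vertices, then all degrees are below K. But Poisson(1) gives the
  degrees up to K a total mass s < 1, so some d <= K would exceed its share by at least h n, which
  \<open>degree_tail\<close> makes unlikely.\<close>

lemma largest_comp_unbounded:
 fixes r :: real
 assumes e: "r > 0"
 shows "eventually (%(n, m). real (card {E\<in>pl {1..n} m. card (largest_comp {1..n} E) <= K}) <= r * real (pc n m)) crit"
proof -
 define s where "s = (\<Sum>d<Suc K. exp (- 1) / fact d :: real)"
 have "(\<Sum>d<Suc K. 1 ^ d / fact d) < (\<Sum>d. 1 ^ d / fact d :: real)"
  using summable_exp[of "1::real"] by (intro sum_less_suminf) (auto simp: field_simps)
 then have "(\<Sum>d<Suc K. 1 / fact d) < exp (1::real)" by (simp add: exp_def field_simps)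
 then have "exp (- 1) * (\<Sum>d<Suc K. 1 / fact d) < exp (- 1) * exp (1::real)" by (intro mult_strict_left_mono) auto
 moreover have "s = exp (- 1) * (\<Sum>d<Suc K. 1 / fact d)" by (simp add: s_def sum_distrib_left del: sum.lessThan_Suc)
 moreover have "exp (- 1) * exp 1 = (1::real)" by (simp add: exp_add[symmetric])
 ultimately have s: "s < 1" by simp
 define h where "h = min (r / Suc K) ((1 - s) / (2 * Suc K))"
 have eta: "h > 0" "Suc K * h <= r" "Suc K * h <= (1 - s) / 2"
 proof -
  have k: "real (Suc K) > 0" by simp
  show "h > 0" using e s k by (simp add: h_def)
  have "h <= r / real (Suc K)" "h <= (1 - s) / 2 / real (Suc K)" unfolding h_def by (auto simp: min_le_iff_disj)
  then show "Suc K * h <= r" "Suc K * h <= (1 - s) / 2"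
   using k by (simp_all only: pos_le_divide_eq mult.commute)
 qed
 have "eventually (%p. \<forall>d\<in>{..<Suc K}. case p of (n, m) =>
   real (card {E\<in>pl {1..n} m. (exp (- 1) / fact d + h) * n <= card (degv n E d)}) <= h * pc n m) crit"
  by (intro eventually_ball_finite finite_lessThan ballI degree_tail[OF eta(1)])
 with crit_ge[of 1] show ?thesis
 proof eventually_elim
  case (elim p)
  obtain n m where p: "p = (n, m)" by (cases p)
  let ?V = "{1..n}"
  let ?B = "%d. {E\<in>pl ?V m. (exp (- 1) / fact d + h) * n <= card (degv n E d)}"
  have n: "n > 0" and up: "\<And>d. d < Suc K ==> real (card (?B d)) <= h * pc n m" using elim p by auto
  have "{E\<in>pl ?V m. card (largest_comp ?V E) <= K} \<subseteq> (\<Union>d<Suc K. ?B d)"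
  proof (rule subsetI, rule ccontr)
   fix E assume E: "E \<in> {E\<in>pl ?V m. card (largest_comp ?V E) <= K}" and nB: "E \<notin> (\<Union>d<Suc K. ?B d)"
   have sg: "simple_graph ?V E" using E by (simp add: pl_def)
   have "?V = (\<Union>d<Suc K. degv n E d)"
   proof (intro equalityI subsetI)
    fix x assume x: "x \<in> ?V"
    have "deg E x < card (component ?V E x)" by (rule deg_le_component[OF sg _ x]) simp
    also have "... <= K" using largest_comp(4)[OF sg n x] E by simp
    finally have "deg E x < Suc K" by simp
    then show "x \<in> (\<Union>d<Suc K. degv n E d)" using x by (auto simp: degv_def)
   qed (auto simp: degv_def)
   then have "card ?V = card (\<Union>d<Suc K. degv n E d)" by (rule arg_cong)
   also have "... <= (\<Sum>d<Suc K. card (degv n E d))" by (rule card_UN_le) simp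
   finally have "n <= (\<Sum>d<Suc K. card (degv n E d))" by (simp del: sum.lessThan_Suc)
   then have "real n <= real (\<Sum>d<Suc K. card (degv n E d))" by (rule of_nat_mono)
   also have "... = (\<Sum>d<Suc K. real (card (degv n E d)))" by (rule of_nat_sum)
   also have "... <= (\<Sum>d<Suc K. (exp (- 1) / fact d + h) * n)"
    using nB E by (intro sum_mono) (auto simp: not_le intro: less_imp_le)
   also have "... = (s + Suc K * h) * n" by (subst sum_distrib_right[symmetric]) (simp add: sum.distrib s_def del: sum.lessThan_Suc)
   also have "... < 1 * real n" using eta(3) s n by (intro mult_strict_right_mono) (auto simp: field_simps)
   finally show False by simp
  qed
  then have "card {E\<in>pl ?V m. card (largest_comp ?V E) <= K} <= card (\<Union>d<Suc K. ?B d)"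
   by (rule card_mono[rotated]) (simp add: finite_pl)
  also have "... <= (\<Sum>d<Suc K. card (?B d))" by (rule card_UN_le) simp
  finally have "real (card {E\<in>pl ?V m. card (largest_comp ?V E) <= K}) <= real (\<Sum>d<Suc K. card (?B d))" by (rule of_nat_mono)
  also have "... = (\<Sum>d<Suc K. real (card (?B d)))" by (rule of_nat_sum)
  also have "... <= (\<Sum>d<Suc K. h * pc n m)" by (rule sum_mono) (use up in auto)
  also have "... = (Suc K * h) * pc n m" by simp
  also have "... <= r * real (pc n m)" using eta(2) by (intro mult_right_mono) auto
  finally show ?case using p by simp
 qed
qed

section \<open>Rooted forests and Cayley's formula\<close>

text \<open>Rooted forests on a set A with root set K as parent functions that fix everything outside the
 set of non-roots; acyclicity is expressed by a ranking that decreases along parents.\<close>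

definition pfun :: "'a set => 'a set => ('a => 'a) set" where
 "pfun A K = {p. (\<forall>x. x \<notin> A - K --> p x = x) \<and> (\<forall>x\<in>A. p x \<in> A) \<and> (\<exists>d::'a => nat. \<forall>x\<in>A - K. d (p x) < d x)}"

definition is_root :: "'a set => ('a => 'a) => 'a => 'a => bool" where
 "is_root K p x r \<longleftrightarrow> r \<in> K \<and> (\<exists>j. (p ^^ j) x = r)"

lemma pfunD:
 assumes "p \<in> pfun A K"
 shows "x \<notin> A - K ==> p x = x" "x \<in> A ==> p x \<in> A" "\<exists>d::'a => nat. \<forall>x\<in>A - K. d (p x) < d x"
 using assms unfolding pfun_def by blast+

lemma funpow_fixed: "f x = x ==> (f ^^ j) x = x"
 by (induction j) auto

lemma pfun_funpow_in: "p \<in> pfun A K ==> x \<in> A ==> (p ^^ j) x \<in> A"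
 by (induction j) (auto dest: pfunD(2))

lemma pfun_no_cycle:
 assumes "p \<in> pfun A K" "x \<in> A - K"
 shows "(p ^^ Suc j) x ~= x"
proof -
 obtain d :: "'a => nat" where d: "\<And>x. x \<in> A - K ==> d (p x) < d x" using pfunD(3)[OF assms(1)] by blast
 have le: "d (p y) <= d y" for y using d[of y] pfunD(1)[OF assms(1), of y] by (cases "y \<in> A - K") auto
 have "d ((p ^^ i) y) <= d y" for i y
 proof (induction i)
  case (Suc i)
  then show ?case using le[of "(p ^^ i) y"] by simp
 qed simp
 then have "d ((p ^^ j) (p x)) <= d (p x)" by blast
 then have "d ((p ^^ Suc j) x) < d x" using d[OF assms(2)] by (simp add: funpow_swap1)
 then show ?thesis by auto
qed

lemma is_root_unique:
 assumes "p \<in> pfun A K" "is_root K p x r" "is_root K p x r'"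
 shows "r = r'"
proof -
 obtain i j where ij: "(p ^^ i) x = r" "(p ^^ j) x = r'" "r \<in> K" "r' \<in> K" using assms by (auto simp: is_root_def)
 have fx: "p s = s" if "s \<in> K" for s using pfunD(1)[OF assms(1), of s] that by simp
 have "(p ^^ (i + j)) x = r" using ij funpow_fixed[of p, OF fx[OF ij(3)], of j] by (simp add: add.commute[of i] funpow_add)
 moreover have "(p ^^ (i + j)) x = r'" using ij funpow_fixed[of p, OF fx[OF ij(4)], of i] by (simp add: funpow_add)
 ultimately show ?thesis by simp
qed

lemma is_root_step:
 assumes "p \<in> pfun A K"
 shows "is_root K p (p x) r \<longleftrightarrow> is_root K p x r"
proof
 assume "is_root K p (p x) r"
 then obtain j where "r \<in> K" "(p ^^ j) (p x) = r" by (auto simp: is_root_def)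
 then have "(p ^^ Suc j) x = r" by (simp add: funpow_swap1)
 then show "is_root K p x r" using \<open>r \<in> K\<close> unfolding is_root_def by blast
next
 assume "is_root K p x r"
 then obtain j where j: "r \<in> K" "(p ^^ j) x = r" by (auto simp: is_root_def)
 have "p r = r" using pfunD(1)[OF assms, of r] j by simp
 then have "(p ^^ j) (p x) = r" using j by (simp add: funpow_swap1[symmetric])
 then show "is_root K p (p x) r" using j unfolding is_root_def by blast
qed

lemma is_root_exists:
 assumes "p \<in> pfun A K" "x \<in> A"
 shows "\<exists>r. is_root K p x r"
proof -
 obtain d :: "'a => nat" where d: "\<And>x. x \<in> A - K ==> d (p x) < d x" using pfunD(3)[OF assms(1)] by blast
 show ?thesis using assms(2)
 proof (induction "d x" arbitrary: x rule: less_induct)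
  case less
  show ?case
  proof (cases "x \<in> K")
   case True
   then have "is_root K p x x" unfolding is_root_def by (auto intro!: exI[of _ 0])
   then show ?thesis by blast
  next
   case False
   then show ?thesis using less.hyps[of "p x"] less.prems d[of x] pfunD(2)[OF assms(1)] is_root_step[OF assms(1)] by blast
  qed
 qed
qed

lemma is_root_self: "r \<in> K ==> is_root K p r r"
 unfolding is_root_def by (auto intro!: exI[of _ 0])

lemma finite_pfun: "finite A ==> finite (pfun A K)"
proof -
 assume A: "finite A"
 have "inj_on (%f. restrict f A) (pfun A K)"
 proof (rule inj_onI, rule ext)
  fix f g x assume p: "f \<in> pfun A K" "g \<in> pfun A K" "restrict f A = restrict g A"
  show "f x = g x"
  proof (cases "x \<in> A")
   case True then show ?thesis using fun_cong[OF p(3), of x] by simp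
  next
   case False then show ?thesis using pfunD(1)[OF p(1)] pfunD(1)[OF p(2)] by simp
  qed
 qed
 moreover have "(%f. restrict f A) ` pfun A K \<subseteq> PiE A (%_. A)" by (auto dest: pfunD(2))
 moreover have "finite (PiE A (%_. A))" using A by (intro finite_PiE) auto
 ultimately show ?thesis by (meson finite_imageD finite_subset)
qed

lemma pfun_detach:
 assumes "p \<in> pfun A K" "K \<subseteq> R"
 shows "(%y. if y \<in> R then y else p y) \<in> pfun A R"
proof -
 obtain d :: "'a => nat" where d: "\<And>x. x \<in> A - K ==> d (p x) < d x" using pfunD(3)[OF assms(1)] by blast
 show ?thesis unfolding pfun_def
  using pfunD(1,2)[OF assms(1)] d assms(2) by (auto intro!: exI[of _ d])
qed

text \<open>The root of y is in K, so y does not lie below x. Raising the rank of all vertices below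
  x, and of x itself, by d y + 1 puts x above its new parent y.\<close>

lemma pfun_attach:
 assumes p: "f \<in> pfun A (insert x K)" and x: "x \<in> A" "x \<notin> K" and y: "y \<in> A" "r \<in> K" "is_root (insert x K) f y r"
 shows "f(x := y) \<in> pfun A K"
proof -
 obtain d :: "'a => nat" where d: "\<And>z. z \<in> A - insert x K ==> d (f z) < d z" using pfunD(3)[OF p] by blast
 define d' where "d' = (%z. d z + (if is_root (insert x K) f z x then Suc (d y) else 0))"
 have ny: "\<not> is_root (insert x K) f y x" using is_root_unique[OF p y(3)] y(2) x(2) by blast
 have "d' ((f(x := y)) z) < d' z" if z: "z \<in> A - K" for z
 proof (cases "z = x")
  case True
  then show ?thesis using ny is_root_self[of x "insert x K" f] by (simp add: d'_def)
 next
  case False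
  then show ?thesis using d[of z] z is_root_step[OF p, of z x] by (simp add: d'_def)
 qed
 moreover have "(f(x := y)) z = z" if "z \<notin> A - K" for z using pfunD(1)[OF p, of z] that x by auto
 moreover have "(f(x := y)) z \<in> A" if "z \<in> A" for z using pfunD(2)[OF p that] y(1) by simp
 ultimately show ?thesis unfolding pfun_def by blast
qed

lemma is_root_detach_neq:
 assumes p: "f \<in> pfun A K" and x: "x \<in> A - K" and y: "y \<in> A" "\<And>j. (f ^^ j) y \<notin> S"
 shows "\<exists>r\<in>K. is_root (K \<union> S) (%z. if z \<in> K \<union> S then z else f z) y r"
proof -
 let ?g = "%z. if z \<in> K \<union> S then z else f z"
 have eq: "(?g ^^ j) y = (f ^^ j) y" for j
 proof (induction j)
  case (Suc j)
  have "(f ^^ j) y \<notin> S" using y(2) .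
  moreover have "f z = z" if "z \<in> K" for z using pfunD(1)[OF p, of z] that by simp
  ultimately show ?case using Suc by simp
 qed simp
 obtain r where "is_root K f y r" using is_root_exists[OF p y(1)] by blast
 then show ?thesis using eq unfolding is_root_def by auto
qed

text \<open>Conjugating the parent function with the transposition of h and h' exchanges the trees
  of the two roots.\<close>

lemma card_roots_eq:
 assumes A: "finite A" "R \<subseteq> A" and r: "h \<in> R" "h' \<in> R"
 shows "card {(g, y). g \<in> pfun A R \<and> y \<in> A \<and> is_root R g y h} <= card {(g, y). g \<in> pfun A R \<and> y \<in> A \<and> is_root R g y h'}"
proof (rule card_inj_on_le)
 define s where "s = Transposition.transpose h h'"
 have ss: "s (s x) = x" for x by (simp add: s_def)
 have sA: "s x \<in> A \<longleftrightarrow> x \<in> A" and sR: "s x \<in> R \<longleftrightarrow> x \<in> R" for x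
  using A(2) r by (auto simp: s_def Transposition.transpose_def)
 let ?f = "%(g, y). (%x. s (g (s x)), s y)"
 have pw: "((%x. s (g (s x))) ^^ j) x = s ((g ^^ j) (s x))" for g j x
  by (induction j) (auto simp: ss)
 show "inj_on ?f {(g, y). g \<in> pfun A R \<and> y \<in> A \<and> is_root R g y h}"
 proof (rule inj_onI)
  fix a b assume eq: "?f a = ?f b"
  obtain g y q z where [simp]: "a = (g, y)" "b = (q, z)" by (cases a, cases b)
  have "s (g (s (s x))) = s (q (s (s x)))" for x using eq by (auto dest: fun_cong[of _ _ "s x"])
  then have "s (s (g x)) = s (s (q x))" for x by (simp add: ss)
  then have "g = q" by (auto simp: ss)
  moreover have "s (s y) = s (s z)" using eq by simp
  ultimately show "a = b" by (simp add: ss)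
 qed
 show "?f ` {(g, y). g \<in> pfun A R \<and> y \<in> A \<and> is_root R g y h} \<subseteq> {(g, y). g \<in> pfun A R \<and> y \<in> A \<and> is_root R g y h'}"
 proof clarify
  fix g y assume p: "g \<in> pfun A R" and y: "y \<in> A" "is_root R g y h"
  obtain d :: "'a => nat" where d: "\<And>x. x \<in> A - R ==> d (g x) < d x" using pfunD(3)[OF p] by blast
  have "(%x. s (g (s x))) \<in> pfun A R" unfolding pfun_def
  proof (clarify, intro conjI allI impI ballI exI[of _ "d \<circ> s"])
   fix x assume "x \<notin> A - R"
   then show "s (g (s x)) = x" using pfunD(1)[OF p, of "s x"] sA sR ss by auto
  next
   fix x assume "x \<in> A"
   then show "s (g (s x)) \<in> A" using pfunD(2)[OF p, of "s x"] sA by auto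
  next
   fix x assume "x \<in> A - R"
   then show "(d \<circ> s) (s (g (s x))) < (d \<circ> s) x" using d[of "s x"] sA sR ss by auto
  qed
  moreover have "is_root R (%x. s (g (s x))) (s y) h'"
  proof -
   obtain j where "(g ^^ j) y = h" using y(2) by (auto simp: is_root_def)
   then have "((%x. s (g (s x))) ^^ j) (s y) = h'" by (simp add: pw ss) (simp add: s_def)
   then show ?thesis using r(2) unfolding is_root_def by blast
  qed
  ultimately show "(%x. s (g (s x))) \<in> pfun A R \<and> s y \<in> A \<and> is_root R (%x. s (g (s x))) (s y) h'"
   using y(1) sA by simp
 qed
 show "finite {(g, y). g \<in> pfun A R \<and> y \<in> A \<and> is_root R g y h'}"
  by (rule finite_subset[of _ "pfun A R \<times> A"]) (auto simp: finite_pfun A)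
qed

text \<open>By symmetry all roots have the same share of the pairs (forest, vertex), so the root of
  a random vertex lies in K with probability \<open>card K / card R\<close>.\<close>

lemma card_rooted_in:
 assumes A: "finite A" "R \<subseteq> A" and K: "K \<subseteq> R"
 shows "card R * card {(p, y). p \<in> pfun A R \<and> y \<in> A \<and> (\<exists>r\<in>K. is_root R p y r)} = card K * (card A * card (pfun A R))"
proof (cases "R = {}")
 case True
 then show ?thesis using K by auto
next
 case False
 then obtain f where f: "f \<in> R" by blast
 let ?S = "%r. {(p, y). p \<in> pfun A R \<and> y \<in> A \<and> is_root R p y r}"
 have fS: "finite (?S r)" for r
  by (rule finite_subset[of _ "pfun A R \<times> A"]) (auto simp: finite_pfun A)
 have c: "card (?S r) = card (?S f)" if "r \<in> R" for r
  using card_roots_eq[OF A that f] card_roots_eq[OF A f that] by simp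
 have cK: "card {(p, y). p \<in> pfun A R \<and> y \<in> A \<and> (\<exists>r\<in>K'. is_root R p y r)} = card K' * card (?S f)" if K': "K' \<subseteq> R" for K'
 proof -
  have "{(p, y). p \<in> pfun A R \<and> y \<in> A \<and> (\<exists>r\<in>K'. is_root R p y r)} = (\<Union>r\<in>K'. ?S r)" by auto
  then have "card {(p, y). p \<in> pfun A R \<and> y \<in> A \<and> (\<exists>r\<in>K'. is_root R p y r)} = card (\<Union>r\<in>K'. ?S r)" by (rule arg_cong)
  also have "... = (\<Sum>r\<in>K'. card (?S r))"
  proof (rule card_UN_disjoint)
   show "finite K'" using finite_subset[OF K'] finite_subset[OF A(2,1)] by blast
   show "\<forall>i\<in>K'. finite (?S i)" using fS by blast
   show "\<forall>i\<in>K'. \<forall>j\<in>K'. i ~= j --> ?S i \<inter> ?S j = {}"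
   proof (intro ballI impI equals0I)
    fix i j z assume "i ~= j" and z: "z \<in> ?S i \<inter> ?S j"
    obtain p y where "z = (p, y)" by (cases z)
    then show False using z is_root_unique[of p A R y i j] \<open>i ~= j\<close> by simp
   qed
  qed
  also have "... = (\<Sum>r\<in>K'. card (?S f))" by (rule sum.cong[OF refl]) (use c K' in blast)
  finally show ?thesis by simp
 qed
 have "{(p, y). p \<in> pfun A R \<and> y \<in> A \<and> (\<exists>r\<in>R. is_root R p y r)} = pfun A R \<times> A"
 proof -
  have "\<exists>r\<in>R. is_root R p y r" if "p \<in> pfun A R" "y \<in> A" for p y
   using is_root_exists[OF that] by (auto simp: is_root_def)
  then show ?thesis by auto
 qed
 then have "card R * card (?S f) = card (pfun A R) * card A" using cK[OF order_refl] by (simp add: card_cartesian_product)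
 then show ?thesis using cK[OF K] by simp
qed

text \<open>Cayley's formula k N^(N-k-1) for forests with k given roots, multiplied by N. In the
  induction, cutting a non-root x off its parent y yields a forest with the additional root x and a
  vertex y whose root is in K; by \<open>card_rooted_in\<close> these are a share k/(k + 1) of all
  pairs.\<close>

lemma card_pfun:
 assumes "finite A" "K \<subseteq> A" "K ~= {}"
 shows "card A * card (pfun A K) = card K * card A ^ card (A - K)"
 using assms(2,3)
proof (induction "card (A - K)" arbitrary: K)
 case 0
 then have "K = A" using assms(1) by auto
 moreover have "pfun A A = {%x. x}" by (auto simp: pfun_def)
 ultimately show ?case by simp
next
 case (Suc n)
 then have "A - K ~= {}" by auto
 then obtain x where x: "x \<in> A" "x \<notin> K" by blast
 let ?R = "insert x K"
 have fK: "finite K" using Suc.prems assms(1) finite_subset by blast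
 have c: "card (A - ?R) = n"
 proof -
  have "A - ?R = (A - K) - {x}" by blast
  then show ?thesis using Suc.hyps(2) x assms(1) by simp
 qed
 have IH: "card A * card (pfun A ?R) = card ?R * card A ^ n"
  using Suc.hyps(1)[of ?R] c Suc.prems x by simp
 let ?S = "{(f, y). f \<in> pfun A ?R \<and> y \<in> A \<and> (\<exists>r\<in>K. is_root ?R f y r)}"
 have "bij_betw (%f. (f(x := x), f x)) (pfun A K) ?S"
 proof (rule bij_betw_byWitness[where f' = "%(f, y). f(x := y)"])
  show "(%f. (f(x := x), f x)) ` pfun A K \<subseteq> ?S"
  proof clarify
   fix f assume p: "f \<in> pfun A K"
   have fixK: "f z = z" if "z \<in> K" for z using pfunD(1)[OF p, of z] that by simp
   have e: "f(x := x) = (%z. if z \<in> K \<union> {x} then z else f z)" using fixK by auto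
   have "(%z. if z \<in> K \<union> {x} then z else f z) \<in> pfun A (K \<union> {x})" by (rule pfun_detach[OF p]) (rule Un_upper1)
   then have 1: "f(x := x) \<in> pfun A ?R" unfolding e by (simp add: Un_commute)
   have nc: "(f ^^ j) (f x) \<notin> {x}" for j using pfun_no_cycle[OF p, of x j] x by (simp add: funpow_swap1)
   have "\<exists>r\<in>K. is_root (K \<union> {x}) (%z. if z \<in> K \<union> {x} then z else f z) (f x) r"
    by (rule is_root_detach_neq[OF p _ pfunD(2)[OF p x(1)] nc]) (use x in simp)
   then show "f(x := x) \<in> pfun A ?R \<and> f x \<in> A \<and> (\<exists>r\<in>K. is_root ?R (f(x := x)) (f x) r)"
    using 1 pfunD(2)[OF p x(1)] unfolding e by (simp add: Un_commute)
  qed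
  show "(%(f, y). f(x := y)) ` ?S \<subseteq> pfun A K"
   using pfun_attach[OF _ x] by auto
  have "f x = x" if "f \<in> pfun A ?R" for f using pfunD(1)[OF that, of x] by simp
  then show "\<forall>a'\<in>?S. (%f. (f(x := x), f x)) ((%(f, y). f(x := y)) a') = a'" by (auto simp: fun_upd_idem)
 qed auto
 then have "card (pfun A K) = card ?S" by (rule bij_betw_same_card)
 then have "card ?R * card (pfun A K) = card K * (card A * card (pfun A ?R))"
  using card_rooted_in[OF assms(1), of ?R K] Suc.prems x subset_insertI[of K x] by auto
 also have "... = card K * (card ?R * card A ^ n)" using IH by simp
 finally have "card ?R * card (pfun A K) = card ?R * (card K * card A ^ n)" by (simp only: mult.left_commute[of "card ?R" "card K"])
 moreover have "card ?R > 0" using fK by (simp add: card_gt_0_iff)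
 ultimately have "card (pfun A K) = card K * card A ^ n" using nat_mult_eq_cancel1 by blast
 then show ?case using Suc.hyps(2)[symmetric] by simp
qed

lemma card_rooted_in_eq:
 assumes A: "finite A" "R \<subseteq> A" and K: "K \<subseteq> R" "K ~= {}"
 shows "card {(p, y). p \<in> pfun A R \<and> y \<in> A \<and> (\<exists>r\<in>K. is_root R p y r)} = card K * card A ^ card (A - R)"
proof -
 have R: "R ~= {}" "card R > 0" using K A finite_subset[OF A(2,1)] by (auto simp: card_gt_0_iff)
 have "card R * card {(p, y). p \<in> pfun A R \<and> y \<in> A \<and> (\<exists>r\<in>K. is_root R p y r)} = card K * (card R * card A ^ card (A - R))"
  using card_rooted_in[OF A K(1)] unfolding card_pfun[OF A R(1)] .
 then have "card R * card {(p, y). p \<in> pfun A R \<and> y \<in> A \<and> (\<exists>r\<in>K. is_root R p y r)} = card R * (card K * card A ^ card (A - R))" by (simp only: mult.left_commute[of "card R" "card K"])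
 then show ?thesis by (rule iffD1[OF nat_mult_eq_cancel1[OF R(2)]])
qed

text \<open>Once their parents are prescribed, the vertices of S can be made roots without losing
  information.\<close>

lemma card_pfun_prescribed:
 assumes A: "finite A"
 shows "card {q\<in>pfun A K. \<forall>x\<in>S. q x = g x} <= card (pfun A (K \<union> S))"
proof (rule card_inj_on_le)
 let ?f = "%q y. if y \<in> K \<union> S then y else q y"
 show "inj_on ?f {q\<in>pfun A K. \<forall>x\<in>S. q x = g x}"
 proof (rule inj_onI, rule ext)
  fix q h x assume p: "q \<in> {q\<in>pfun A K. \<forall>x\<in>S. q x = g x}" "h \<in> {q\<in>pfun A K. \<forall>x\<in>S. q x = g x}" "?f q = ?f h"
  then have m: "q \<in> pfun A K" "h \<in> pfun A K" by auto
  consider "x \<in> S" | "x \<in> K" | "x \<notin> K \<union> S" by blast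
  then show "q x = h x"
  proof cases
   case 1 then show ?thesis using p by simp
  next
   case 2 then show ?thesis using pfunD(1)[OF m(1), of x] pfunD(1)[OF m(2), of x] by simp
  next
   case 3 then show ?thesis using fun_cong[OF p(3), of x] by simp
  qed
 qed
 show "?f ` {q\<in>pfun A K. \<forall>x\<in>S. q x = g x} \<subseteq> pfun A (K \<union> S)"
  using pfun_detach[of _ A K "K \<union> S"] by auto
qed (rule finite_pfun[OF A])

definition pedges :: "'a set => 'a set => ('a => 'a) => 'a set set" where
 "pedges A K p = (%x. {x, p x}) ` (A - K)"

lemma pfun_neq: "p \<in> pfun A K ==> x \<in> A - K ==> p x ~= x"
 using pfun_no_cycle[of p A K x 0] by simp

lemma pedges_inj:
 assumes "p \<in> pfun A K"
 shows "inj_on (%x. {x, p x}) (A - K)"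
proof (rule inj_onI)
 fix x y assume x: "x \<in> A - K" and y: "y \<in> A - K" and eq: "{x, p x} = {y, p y}"
 show "x = y"
 proof (rule ccontr)
  assume "x ~= y"
  then have "x = p y" "y = p x" using eq by (auto simp: doubleton_eq_iff)
  then have "(p ^^ Suc 1) x = x" by simp
  then show False using pfun_no_cycle[OF assms x] by blast
 qed
qed

text \<open>Induction along the rank of f: if the edge {x, f x} came from g in the opposite
  direction, then g would map f x to x, and by induction so would f, which is a cycle.\<close>

lemma pedges_eq_imp_eq:
 assumes p: "f \<in> pfun A K" "g \<in> pfun A K" and eq: "pedges A K f = pedges A K g"
 shows "f = g"
proof
 obtain d :: "'a => nat" where d: "\<And>x. x \<in> A - K ==> d (f x) < d x" using pfunD(3)[OF p(1)] by blast
 have "x \<in> A - K ==> f x = g x" for x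
 proof (induction "d x" arbitrary: x rule: less_induct)
  case less
  have "{x, f x} \<in> pedges A K g" using less.prems eq by (auto simp: pedges_def)
  then obtain y where y: "y \<in> A - K" "{x, f x} = {y, g y}" by (auto simp: pedges_def)
  then consider "x = y" "f x = g y" | "x = g y" "f x = y" by (auto simp: doubleton_eq_iff)
  then show ?case
  proof cases
   case 2
   then have "f y = g y" using less.hyps[of y] d[OF less.prems] y by simp
   then have "(f ^^ Suc 1) x = x" using 2 by simp
   then show ?thesis using pfun_no_cycle[OF p(1) less.prems] by blast
  qed simp
 qed
 then show "f x = g x" for x using pfunD(1)[OF p(1)] pfunD(1)[OF p(2)] by (cases "x \<in> A - K") auto
qed

text \<open>The vertices of A - K are isolated in D. In a set that contains the parents of its
  members, up to K, a vertex of largest rank is nobody's parent; so it can be attached last, as a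
  leaf.\<close>

lemma planar_attach_forest:
 assumes V: "finite V" "A \<subseteq> V" and K: "K \<subseteq> A" and p: "f \<in> pfun A K" and sg: "simple_graph V D" "planar V D"
  and iso: "\<And>e x. e \<in> D ==> x \<in> A - K ==> x \<notin> e"
 shows "simple_graph V (D \<union> pedges A K f) \<and> planar V (D \<union> pedges A K f)"
proof -
 obtain d :: "'a => nat" where d: "\<And>x. x \<in> A - K ==> d (f x) < d x" using pfunD(3)[OF p] by blast
 have fA: "finite A" using V finite_subset by blast
 have "simple_graph V (D \<union> (%x. {x, f x}) ` S) \<and> planar V (D \<union> (%x. {x, f x}) ` S)"
  if "S \<subseteq> A - K" "\<And>x. x \<in> S ==> f x \<in> S \<union> K" for S
  using that
 proof (induction "card S" arbitrary: S)
  case 0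
  have "finite S" by (rule finite_subset[of S A]) (use 0(2) fA in auto)
  then have "S = {}" using 0(1) by simp
  then show ?case using sg by simp
 next
  case (Suc k)
  have fS: "finite S" "S ~= {}" using Suc.hyps(2) by (auto intro: card_ge_0_finite)
  have "Max (d ` S) \<in> d ` S" using fS by (intro Max_in) auto
  then obtain x where x: "x \<in> S" "d x = Max (d ` S)" by auto
  have mx: "d y <= d x" if "y \<in> S" for y using that fS x(2) by simp
  let ?S = "S - {x}"
  have nx: "f y ~= x" if "y \<in> S" for y using d[of y] mx[OF that] Suc.prems(1) that by auto
  have IH: "simple_graph V (D \<union> (%x. {x, f x}) ` ?S) \<and> planar V (D \<union> (%x. {x, f x}) ` ?S)"
   by (rule Suc.hyps(1)) (use Suc.prems Suc.hyps(2) x fS nx in auto)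
  have xV: "x \<in> V" "f x \<in> V" "x ~= f x" using x Suc.prems V pfunD(2)[OF p] pfun_neq[OF p, of x] by auto
  have isol: "\<forall>e\<in>D \<union> (%x. {x, f x}) ` ?S. x \<notin> e" using iso[of _ x] x Suc.prems(1) nx by auto
  have ins: "D \<union> (%x. {x, f x}) ` S = insert {x, f x} (D \<union> (%x. {x, f x}) ` ?S)" using x by auto
  show ?case unfolding ins
   using planar_insert_leaf[OF conjunct2[OF IH] conjunct1[OF IH] V(1) xV(1) isol xV(2,3)]
    simple_graph_insert[OF conjunct1[OF IH] xV] by blast
 qed
 from this[of "A - K"] show ?thesis using pfunD(2)[OF p] by (auto simp: pedges_def)
qed

section \<open>The core of a component and the trees hanging from it\<close>

text \<open>Connectedness is the absence of smaller nonempty closed sets. A connectivity argument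
  then only has to exhibit a closed set, without any paths.\<close>

definition is_comp :: "'a set => 'a set set => 'a set => bool" where
 "is_comp V E A \<longleftrightarrow> simple_graph V E \<and> A \<subseteq> V \<and> A ~= {} \<and> (\<forall>u w. u \<in> A --> {u, w} \<in> E --> w \<in> A) \<and>
   (\<forall>S. S \<subseteq> A --> S ~= {} --> (\<forall>u w. u \<in> S --> {u, w} \<in> E --> w \<in> S) --> S = A)"

lemma is_compD:
 assumes "is_comp V E A"
 shows "simple_graph V E" "A \<subseteq> V" "A ~= {}" "u \<in> A ==> {u, w} \<in> E ==> w \<in> A"
  "S \<subseteq> A ==> x \<in> S ==> (\<And>u w. u \<in> S ==> {u, w} \<in> E ==> w \<in> S) ==> S = A"
proof -
 show "simple_graph V E" "A \<subseteq> V" "A ~= {}" "u \<in> A ==> {u, w} \<in> E ==> w \<in> A"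
  using assms unfolding is_comp_def by blast+
 have "\<forall>S. S \<subseteq> A --> S ~= {} --> (\<forall>u w. u \<in> S --> {u, w} \<in> E --> w \<in> S) --> S = A"
  using assms unfolding is_comp_def by blast
 moreover assume "S \<subseteq> A" "x \<in> S" "\<And>u w. u \<in> S ==> {u, w} \<in> E ==> w \<in> S"
 ultimately show "S = A" by (metis empty_iff)
qed

lemma is_comp_largest:
 assumes sg: "simple_graph {1..n} E" and n: "n > 0"
 shows "is_comp {1..n} E (largest_comp {1..n} E)"
proof -
 note L = largest_comp[OF sg n]
 have "S = largest_comp {1..n} E"
  if S: "S \<subseteq> largest_comp {1..n} E" "S ~= {}" "\<forall>u w. u \<in> S --> {u, w} \<in> E --> w \<in> S" for S
 proof -
  obtain x where x: "x \<in> S" using S(2) by blast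
  have "component {1..n} E x \<subseteq> S" by (rule component_closed_subset[OF sg x]) (use S(3) in blast)
  moreover have "component {1..n} E x = largest_comp {1..n} E" using L(3) x S(1) by blast
  ultimately show ?thesis using S(1) by blast
 qed
 moreover have "\<forall>u w. u \<in> largest_comp {1..n} E --> {u, w} \<in> E --> w \<in> largest_comp {1..n} E" using L(5) by blast
 ultimately show ?thesis unfolding is_comp_def using sg L(1,2) by blast
qed

definition ctwo :: "'a set set => 'a => 'a set => bool" where
 "ctwo E a X \<longleftrightarrow> a \<in> X \<and> (\<forall>x\<in>X. x ~= a --> (\<exists>y\<in>X. \<exists>z\<in>X. y ~= z \<and> {x, y} \<in> E \<and> {x, z} \<in> E))"

text \<open>The 2-core, except that the minimal vertex is always retained; the core of a tree is then a
 single vertex instead of empty.\<close>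

definition core :: "'a::linorder set set => 'a set => 'a set" where
 "core E A = \<Union>{X. X \<subseteq> A \<and> ctwo E (Min A) X}"

definition hangs :: "'a set set => 'a set => 'a set => ('a => 'a) => bool" where
 "hangs E A K p \<longleftrightarrow> p \<in> pfun A K \<and> induced A E = induced K E \<union> pedges A K p"

lemma hangsD:
 assumes "hangs E A K p" "K \<subseteq> A"
 shows "p \<in> pfun A K" "u \<in> A ==> w \<in> A ==> {u, w} \<in> E ==> u \<in> K \<and> w \<in> K \<or> u \<in> A - K \<and> w = p u \<or> w \<in> A - K \<and> u = p w"
proof -
 show "p \<in> pfun A K" using assms by (simp add: hangs_def)
 assume "u \<in> A" "w \<in> A" "{u, w} \<in> E"
 then have "{u, w} \<in> induced A E" by (simp add: induced_def)
 then have "{u, w} \<in> induced K E \<union> pedges A K p" unfolding assms(1)[unfolded hangs_def, THEN conjunct2] .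
 then show "u \<in> K \<and> w \<in> K \<or> u \<in> A - K \<and> w = p u \<or> w \<in> A - K \<and> u = p w"
  by (auto simp: induced_def pedges_def doubleton_eq_iff)
qed

text \<open>Otherwise the vertices that hang from x would form a closed set that misses b.\<close>

lemma hangs_root_neighbour:
 assumes c: "is_comp V E A" and h: "hangs E A K f" and K: "K \<subseteq> A" "x \<in> K" "b \<in> K" "b ~= x"
 shows "\<exists>y\<in>K. {x, y} \<in> E"
proof (rule ccontr)
 assume no: "\<not> (\<exists>y\<in>K. {x, y} \<in> E)"
 note p = hangsD(1)[OF h K(1)]
 let ?T = "{v\<in>A. is_root K f v x}"
 have "?T = A"
 proof (rule is_compD(5)[OF c])
  show "x \<in> ?T" using K is_root_self[of x K f] by blast
  fix u w assume u: "u \<in> ?T" and e: "{u, w} \<in> E"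
  have w: "w \<in> A" using is_compD(4)[OF c, of u w] u e by blast
  from hangsD(2)[OF h K(1) _ w e] u consider "u \<in> K" "w \<in> K" | "w = f u" | "u = f w" by blast
  then show "w \<in> ?T"
  proof cases
   case 1
   then have "u = x" using is_root_unique[OF p, of u u x] is_root_self[of u K f] u by blast
   then show ?thesis using no 1 e by blast
  next
   case 2
   then show ?thesis using u w is_root_step[OF p, of u x] by simp
  next
   case 3
   then show ?thesis using u w is_root_step[OF p, of w x] by simp
  qed
 qed blast
 then have "is_root K f b x" using K by blast
 then show False using is_root_unique[OF p, of b b x] is_root_self[of b K f] K by blast
qed

text \<open>A vertex of X outside K with largest rank has no neighbour in X except its parent,
  whereas \<open>ctwo\<close> demands two. So the core lies in every K from which the rest hangs as
  a forest.\<close>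

lemma ctwo_subset_hangs:
 assumes A: "finite A" and h: "hangs E A K f" and K: "K \<subseteq> A" "a \<in> K" and X: "X \<subseteq> A" "ctwo E a X"
 shows "X \<subseteq> K"
proof (rule ccontr)
 assume "\<not> X \<subseteq> K"
 then have ne: "X - K ~= {}" by blast
 have fX: "finite (X - K)" using A X finite_subset by blast
 note p = hangsD(1)[OF h K(1)]
 obtain d :: "'a => nat" where d: "\<And>x. x \<in> A - K ==> d (f x) < d x" using pfunD(3)[OF p] by blast
 have "Max (d ` (X - K)) \<in> d ` (X - K)" using ne fX by (intro Max_in) auto
 then obtain x where x: "x \<in> X - K" "d x = Max (d ` (X - K))" by auto
 have mx: "d w <= d x" if "w \<in> X - K" for w unfolding x(2) using that fX by (intro Max_ge) auto
 have nb: "w = f x" if w: "w \<in> X" and e: "{x, w} \<in> E" for w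
 proof -
  have "x \<in> A" "w \<in> A" using x w X by auto
  from hangsD(2)[OF h K(1) this e] x consider "w = f x" | "w \<in> A - K" "x = f w" by blast
  then show ?thesis
  proof cases
   case 2
   then show ?thesis using d[of w] mx[of w] w by auto
  qed
 qed
 have "x ~= a" using x K by blast
 then obtain y z where "y \<in> X" "z \<in> X" "y ~= z" "{x, y} \<in> E" "{x, z} \<in> E" using X(2) x(1) unfolding ctwo_def by blast
 then show False using nb[of y] nb[of z] by simp
qed

lemma hangs_remove:
 assumes h: "hangs E A K f" and sg: "simple_graph V E" and K: "K \<subseteq> A" "x \<in> K" "y \<in> K" "y ~= x" "{x, y} \<in> E"
  and u: "\<And>z. z \<in> K ==> {x, z} \<in> E ==> z = y"
 shows "hangs E A (K - {x}) (f(x := y))"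
proof -
 note p = hangsD(1)[OF h K(1)]
 have ins: "insert x (K - {x}) = K" using K by blast
 have "f(x := y) \<in> pfun A (K - {x})"
 proof (rule pfun_attach)
  show "is_root (insert x (K - {x})) f y y" unfolding ins by (rule is_root_self[OF K(3)])
 qed (use p K ins in auto)
 moreover have "induced K E = insert {x, y} (induced (K - {x}) E)"
 proof (intro equalityI subsetI)
  fix e assume e: "e \<in> induced K E"
  then have eE: "e \<in> E" "e \<subseteq> K" by (auto simp: induced_def)
  obtain s t where st: "e = {s, t}" using simple_graphD[OF sg eE(1)] by blast
  show "e \<in> insert {x, y} (induced (K - {x}) E)"
  proof (cases "x \<in> e")
   case True
   then obtain z where z: "e = {x, z}" using st by blast
   then have "z = y" using u[of z] eE by blast
   then show ?thesis using z by blast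
  next
   case False
   then show ?thesis using eE by (auto simp: induced_def)
  qed
 qed (use K in \<open>auto simp: induced_def\<close>)
 moreover have "pedges A (K - {x}) (f(x := y)) = insert {x, y} (pedges A K f)"
 proof -
  have "A - (K - {x}) = insert x (A - K)" using K by blast
  moreover have "(%z. {z, (f(x := y)) z}) ` (A - K) = (%z. {z, f z}) ` (A - K)" using K by (intro image_cong) auto
  ultimately show ?thesis by (simp add: pedges_def)
 qed
 ultimately show ?thesis using h by (auto simp: hangs_def)
qed

text \<open>Peeling, started from the trivial choice K = A: if K has least size, then no vertex of K
  other than a can have a single neighbour in K, because it could be hung below that
  neighbour.\<close>

lemma hangs_exists:
 assumes c: "is_comp V E A" and A: "finite A" "a \<in> A"
 shows "\<exists>K p. K \<subseteq> A \<and> ctwo E a K \<and> hangs E A K p"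
proof -
 let ?P = "%K. K \<subseteq> A \<and> a \<in> K \<and> (\<exists>p. hangs E A K p)"
 have "hangs E A A (%x. x)" by (auto simp: hangs_def pfun_def pedges_def)
 then have "?P A" using A by blast
 from ex_has_least_nat[of ?P, OF this, of card]
 obtain K where K: "?P K" and mn: "\<And>K'. ?P K' ==> card K <= card K'" by blast
 obtain p where h: "hangs E A K p" using K by blast
 have fK: "finite K" using K A finite_subset by blast
 have two: "\<exists>y\<in>K. \<exists>z\<in>K. y ~= z \<and> {x, y} \<in> E \<and> {x, z} \<in> E" if x: "x \<in> K" "x ~= a" for x
 proof (rule ccontr)
  assume no: "\<not> ?thesis"
  obtain y where y: "y \<in> K" "{x, y} \<in> E" using hangs_root_neighbour[OF c h, of x a] K x by blast
  have "y ~= x" using simple_graph_edgeD[OF is_compD(1)[OF c] y(2)] by blast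
  then have "hangs E A (K - {x}) (p(x := y))"
   using hangs_remove[OF h is_compD(1)[OF c], of x y] K x y no by blast
  then have "card K <= card (K - {x})" using mn[of "K - {x}"] K x by blast
  then show False using card_Diff1_less[OF fK x(1)] by linarith
 qed
 have "ctwo E a K" unfolding ctwo_def using K by (intro conjI ballI impI two) auto
 then show ?thesis using K h by blast
qed

lemma core_eqI:
 assumes A: "finite A" and h: "hangs E A K p" and K: "K \<subseteq> A" "ctwo E (Min A) K"
 shows "core E A = K"
proof -
 have "Min A \<in> K" using K by (simp add: ctwo_def)
 then show ?thesis using ctwo_subset_hangs[OF A h K(1)] K unfolding core_def by blast
qed

lemma core_hangs:
 assumes c: "is_comp V E A" and A: "finite A"
 shows "core E A \<subseteq> A" "ctwo E (Min A) (core E A)" "\<exists>p. hangs E A (core E A) p"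
proof -
 obtain K p where "K \<subseteq> A" "ctwo E (Min A) K" "hangs E A K p" using hangs_exists[OF c A Min_in[OF A is_compD(3)[OF c]]] by blast
 moreover from this have "core E A = K" using core_eqI[OF A] by blast
 ultimately show "core E A \<subseteq> A" "ctwo E (Min A) (core E A)" "\<exists>p. hangs E A (core E A) p" by auto
qed

lemma card_core_le_edges:
 assumes c: "is_comp V E A" and A: "finite A" and k: "card (core E A) \<ge> 2"
 shows "card (core E A) <= card (induced (core E A) E)"
proof -
 let ?K = "core E A" and ?a = "Min A"
 note K = core_hangs[OF c A]
 obtain p where h: "hangs E A ?K p" using K(3) by blast
 have a: "?a \<in> ?K" using K(2) by (simp add: ctwo_def)
 have fK: "finite ?K" using K(1) A finite_subset by blast
 have "\<not> ?K \<subseteq> {?a}" using k card_mono[of "{?a}" ?K] by auto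
 then obtain b where b: "b \<in> ?K" "b ~= ?a" by blast
 have "card ?K <= card {e\<in>E. e \<subseteq> ?K}"
 proof (rule card_edges_min_degree[OF is_compD(1)[OF c] fK a])
  show "\<exists>x\<in>?K. {?a, x} \<in> E" by (rule hangs_root_neighbour[OF c h K(1) a b])
 qed (use K(2) in \<open>auto simp: ctwo_def\<close>)
 then show ?thesis by (simp add: induced_def)
qed

lemma card_pedges: "p \<in> pfun A K ==> card (pedges A K p) = card (A - K)"
 unfolding pedges_def by (rule card_image[OF pedges_inj])

lemma hangs_disjoint: "p \<in> pfun A K ==> induced K E \<inter> pedges A K p = {}"
 by (auto simp: induced_def pedges_def)

lemma is_comp_touching:
 assumes c: "is_comp V E A"
 shows "{e\<in>E. e \<inter> A ~= {}} = induced A E"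
proof (intro equalityI subsetI)
 fix e assume e: "e \<in> {e\<in>E. e \<inter> A ~= {}}"
 then obtain x where x: "x \<in> e" "x \<in> A" "e \<in> E" by auto
 obtain s t where st: "e = {s, t}" using simple_graphD[OF is_compD(1)[OF c] x(3)] by blast
 obtain w where w: "e = {x, w}" using st x(1) by blast
 then have "w \<in> A" using is_compD(4)[OF c x(2)] x(3) by blast
 then show "e \<in> induced A E" using w x by (simp add: induced_def)
next
 fix e assume e: "e \<in> induced A E"
 then obtain s t where "e = {s, t}" using simple_graphD[OF is_compD(1)[OF c], of e] by (auto simp: induced_def)
 then show "e \<in> {e\<in>E. e \<inter> A ~= {}}" using e by (auto simp: induced_def)
qed

section \<open>Counting possible cores\<close>

text \<open>Candidates for the graph induced on a core. Planarity and connectedness are given up, as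
  only an upper bound is wanted.\<close>

definition cgraphs :: "'a set => 'a => nat => 'a set set set" where
 "cgraphs K a M = {F. simple_graph K F \<and> card F = M \<and> (\<forall>v\<in>K. v ~= a --> deg F v \<ge> 2)}"

lemma core_cgraphs:
 assumes sg: "simple_graph V E" and K: "finite K" "ctwo E a K"
 shows "induced K E \<in> cgraphs K a (card (induced K E))"
proof -
 have s: "simple_graph K (induced K E)" by (rule simple_graph_restrict[OF sg]) (simp add: induced_def)
 have f: "finite (induced K E)" by (rule simple_graph_finite[OF s K(1)])
 have "deg (induced K E) v \<ge> 2" if v: "v \<in> K" "v ~= a" for v
 proof -
  obtain y z where yz: "y \<in> K" "z \<in> K" "y ~= z" "{v, y} \<in> E" "{v, z} \<in> E" using K(2) v unfolding ctwo_def by blast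
  then have "{{v, y}, {v, z}} \<subseteq> {e \<in> induced K E. v \<in> e}" using v by (auto simp: induced_def)
  moreover have "card {{v, y}, {v, z}} = 2" using yz by (auto simp: doubleton_eq_iff)
  moreover have "finite {e \<in> induced K E. v \<in> e}" using f by simp
  ultimately show ?thesis unfolding deg_def using card_mono[of "{e \<in> induced K E. v \<in> e}" "{{v, y}, {v, z}}"] by linarith
 qed
 then show ?thesis using s by (simp add: cgraphs_def)
qed

text \<open>With M = k + e, the quotient (2M)!/(2^M M!) is the product of the odd numbers below 2M;
  the first k of them give at most 2^k k!, and each of the other e is at most B.\<close>

lemma fact_double_le: "2 * (k + e) <= B ==> fact (2 * (k + e)) <= (2 ^ (k + e) * fact (k + e)) * (2 ^ k * fact k * B ^ e :: nat)"
proof (induction e)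
 case 0
 show ?case
 proof (induction k)
  case (Suc k)
  have "fact (2 * (Suc k + 0)) = (2 * k + 2) * (2 * k + 1) * (fact (2 * (k + 0)) :: nat)" by (simp add: algebra_simps)
  also have "... <= (2 * Suc k) * (2 * Suc k) * ((2 ^ (k + 0) * fact (k + 0)) * (2 ^ k * fact k * B ^ 0))"
   by (intro mult_mono Suc) auto
  finally show ?case by (simp add: algebra_simps)
 qed simp
next
 case (Suc e)
 let ?j = "k + e"
 have "fact (2 * (k + Suc e)) = (2 * ?j + 2) * (2 * ?j + 1) * (fact (2 * ?j) :: nat)" by (simp add: algebra_simps)
 also have "... <= (2 * Suc ?j) * B * ((2 ^ ?j * fact ?j) * (2 ^ k * fact k * B ^ e))"
  by (intro mult_mono Suc.IH) (use Suc.prems in auto)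
 also have "... = (2 ^ (k + Suc e) * fact (k + Suc e)) * (2 ^ k * fact k * B ^ Suc e)" by (simp add: algebra_simps)
 finally show ?case .
qed

lemma exp_ge_power_div_fact: "(x::real) \<ge> 0 ==> x ^ j / fact j <= exp x"
 using sum_exp_le[of x "{j}"] by simp

text \<open>Bounds exp x - 1 - x, the generating function of the degrees at least 2.\<close>

lemma sum_exp_tail_le:
 fixes x :: real
 assumes x: "x \<ge> 0"
 shows "(\<Sum>j\<in>{..k} \<inter> {2..}. x ^ j / fact j) <= x\<^sup>2 / 2 * exp x"
proof -
 have "(\<Sum>j\<in>{..k} \<inter> {2..}. x ^ j / fact j) <= (\<Sum>j\<in>{..k} \<inter> {2..}. x\<^sup>2 / 2 * (x ^ (j - 2) / fact (j - 2)))"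
 proof (rule sum_mono)
  fix j assume "j \<in> {..k} \<inter> {2..}"
  then obtain i where i: "j = i + 2" by (auto simp: le_iff_add)
  have "2 * 1 <= (real i + 2) * (real i + 1)" by (intro mult_mono) auto
  then have "2 * fact i <= (real i + 2) * (real i + 1) * (fact i :: real)" by (intro mult_right_mono) auto
  then have "2 * fact i <= (fact (i + 2) :: real)" by (simp add: algebra_simps)
  then have "x ^ (i + 2) / fact (i + 2) <= x ^ (i + 2) / (2 * fact i)" using x by (intro divide_left_mono) auto
  then show "x ^ j / fact j <= x\<^sup>2 / 2 * (x ^ (j - 2) / fact (j - 2))" unfolding i by (simp add: power_add power2_eq_square algebra_simps)
 qed
 also have "... = (\<Sum>i\<in>(%j. j - 2) ` ({..k} \<inter> {2..}). x\<^sup>2 / 2 * (x ^ i / fact i))"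
  by (subst sum.reindex) (auto intro!: inj_onI)
 also have "... = x\<^sup>2 / 2 * (\<Sum>i\<in>(%j. j - 2) ` ({..k} \<inter> {2..}). x ^ i / fact i)" by (simp add: sum_distrib_left)
 also have "... <= x\<^sup>2 / 2 * exp x" using x by (intro mult_left_mono sum_exp_le) auto
 finally show ?thesis .
qed

text \<open>The word bound with degrees at least 2 away from a, where each vertex contributes at
  most x^2/2 e^x. A small x makes the loss exp(x k) as mild as desired, at the price of a factor
  1/x^2 per excess edge.\<close>

lemma card_cgraphs_few:
 fixes x :: real
 assumes K: "finite K" "card K = k" "a \<in> K" and x: "x > 0"
 shows "real (card (cgraphs K a (k + e))) <= fact k * exp (x * k) * (2 / x\<^sup>2) * (2 * real (k + e) / x\<^sup>2) ^ e"
proof -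
 let ?M = "k + e" and ?J = "%v. if v = a then UNIV else {2::nat..}"
 have k: "k \<ge> 1" using K(1,3) unfolding K(2)[symmetric] by (auto simp: Suc_le_eq card_gt_0_iff)
 have "card (cgraphs K a ?M) * (2 ^ ?M * fact ?M) <= card (words K ?J (2 * ?M))"
 proof (rule graphs_le_words[OF K(1)])
  show "simple_graph K E \<and> card E = ?M" if "E \<in> cgraphs K a ?M" for E using that by (simp add: cgraphs_def)
  show "finite (words K ?J (2 * ?M))" by (rule finite_words[OF K(1)])
  fix E w assume E: "E \<in> cgraphs K a ?M" and w: "codes w E"
  then have s: "simple_graph K E" by (simp add: cgraphs_def)
  have fE: "finite E" by (rule simple_graph_finite[OF s K(1)])
  have "set w \<subseteq> K" using codes_set[OF w] simple_graph_subset[OF s] by blast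
  then show "w \<in> words K ?J (2 * ?M)"
   using codes_length[OF w fE] codes_count[OF w fE] E by (auto simp: words_def cgraphs_def)
 qed
 then have "real (card (cgraphs K a ?M) * (2 ^ ?M * fact ?M)) <= real (card (words K ?J (2 * ?M)))" by (rule of_nat_mono)
 also have "... <= fact (2 * ?M) / x ^ (2 * ?M) * (\<Prod>v\<in>K. if v = a then exp x else x\<^sup>2 / 2 * exp x)"
 proof (rule card_words_le[OF K(1) x])
  fix v i assume "v \<in> K"
  show "(\<Sum>j\<in>{..i} \<inter> ?J v. x ^ j / fact j) <= (if v = a then exp x else x\<^sup>2 / 2 * exp x)"
   using sum_exp_le[of x "{..i}"] sum_exp_tail_le[of x i] x by simp
 qed
 also have "(\<Prod>v\<in>K. if v = a then exp x else x\<^sup>2 / 2 * exp x) = exp x * (x\<^sup>2 / 2 * exp x) ^ (k - 1)"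
 proof -
  have "(\<Prod>v\<in>K. if v = a then exp x else x\<^sup>2 / 2 * exp x) = exp x * (\<Prod>v\<in>K - {a}. if v = a then exp x else x\<^sup>2 / 2 * exp x)"
   using prod.remove[OF K(1,3), of "%v. if v = a then exp x else x\<^sup>2 / 2 * exp x"] by simp
  also have "(\<Prod>v\<in>K - {a}. if v = a then exp x else x\<^sup>2 / 2 * exp x) = (\<Prod>v\<in>K - {a}. x\<^sup>2 / 2 * exp x)" by (rule prod.cong) auto
  finally show ?thesis using K by simp
 qed
 also have "exp x * (x\<^sup>2 / 2 * exp x) ^ (k - 1) = exp (x * k) * (x\<^sup>2 / 2) ^ (k - 1)"
 proof -
  obtain k' where k': "k = Suc k'" using k by (cases k) auto
  have "exp (x * real (Suc k')) = exp x * exp x ^ k'" by (simp add: exp_of_nat_mult[symmetric] exp_add[symmetric] algebra_simps)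
  then show ?thesis unfolding k' by (simp add: power_mult_distrib power_divide algebra_simps)
 qed
 also have "fact (2 * ?M) / x ^ (2 * ?M) * (exp (x * k) * (x\<^sup>2 / 2) ^ (k - 1)) <=
  ((2 ^ ?M * fact ?M) * (2 ^ k * fact k * real (2 * ?M) ^ e)) / x ^ (2 * ?M) * (exp (x * k) * (x\<^sup>2 / 2) ^ (k - 1))"
 proof -
  have "real (fact (2 * ?M)) <= real ((2 ^ ?M * fact ?M) * (2 ^ k * fact k * (2 * ?M) ^ e))"
   using fact_double_le[of k e "2 * ?M"] by (intro of_nat_mono) simp
  then have "fact (2 * ?M) <= (2 ^ ?M * fact ?M) * (2 ^ k * fact k * real (2 * ?M) ^ e)" by simp
  then show ?thesis using x by (intro mult_right_mono divide_right_mono) auto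
 qed
 also have "... = (2 ^ ?M * fact ?M) * ((2 ^ k * fact k * real (2 * ?M) ^ e) / x ^ (2 * ?M) * (exp (x * k) * (x\<^sup>2 / 2) ^ (k - 1)))" by simp
 finally have "(2 ^ ?M * fact ?M) * real (card (cgraphs K a ?M)) <= (2 ^ ?M * fact ?M) * ((2 ^ k * fact k * real (2 * ?M) ^ e) / x ^ (2 * ?M) * (exp (x * k) * (x\<^sup>2 / 2) ^ (k - 1)))"
  by (simp add: mult.commute)
 then have "real (card (cgraphs K a ?M)) <= (2 ^ k * fact k * real (2 * ?M) ^ e) / x ^ (2 * ?M) * (exp (x * k) * (x\<^sup>2 / 2) ^ (k - 1))"
  by (rule mult_left_le_imp_le) simp
 also have "... = fact k * exp (x * k) * (2 / x\<^sup>2) * (2 * real ?M / x\<^sup>2) ^ e"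
 proof -
  have id: "(2 * c * F * B) / (b * b' * d) * (X * (b' / c)) = F * X * (2 / b) * (B / d)" if "b ~= 0" "b' ~= 0" "c ~= 0" "d ~= 0" for c F B b b' d X :: real
   using that by (simp add: field_simps)
  obtain k' where k': "k = Suc k'" using k by (cases k) auto
  have 1: "x ^ (2 * ?M) = x\<^sup>2 * (x\<^sup>2) ^ k' * (x\<^sup>2) ^ e" unfolding k' by (simp add: power_mult[symmetric] power_add[symmetric] algebra_simps)
  have 2: "(x\<^sup>2 / 2) ^ (k - 1) = (x\<^sup>2) ^ k' / 2 ^ k'" unfolding k' by (simp add: power_divide)
  have 3: "(2 * real ?M / x\<^sup>2) ^ e = real (2 * ?M) ^ e / (x\<^sup>2) ^ e" by (simp add: power_divide)
  have 4: "(2::real) ^ k = 2 * 2 ^ k'" unfolding k' by simp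
  show ?thesis unfolding 1 2 3 4 by (rule id) (use x in auto)
 qed
 finally show ?thesis .
qed

text \<open>For e >= k the degrees can be ignored. With M = k + e, the estimates M! >= (M/3)^M and M
  >= 2k bound k^(2M)/(2^M M!) by (3k/4)^M; splitting off k! >= (k/3)^k leaves (9/4 * 3/4 k)^e, and
  27/16 < 2.\<close>

lemma card_cgraphs_many:
 assumes K: "finite K" "card K = k" and e: "k <= e" and k: "k \<ge> 1"
 shows "real (card (cgraphs K a (k + e))) <= fact k * (2 * real k) ^ e"
proof -
 let ?M = "k + e"
 have "card (cgraphs K a ?M) * (2 ^ ?M * fact ?M) <= card {w. set w \<subseteq> K \<and> length w = 2 * ?M}"
 proof (rule graphs_le_words[OF K(1)])
  show "simple_graph K E \<and> card E = ?M" if "E \<in> cgraphs K a ?M" for E using that by (simp add: cgraphs_def)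
  show "finite {w. set w \<subseteq> K \<and> length w = 2 * ?M}" by (rule finite_lists_length_eq[OF K(1)])
  fix E w assume E: "E \<in> cgraphs K a ?M" and w: "codes w E"
  then have s: "simple_graph K E" by (simp add: cgraphs_def)
  have fE: "finite E" by (rule simple_graph_finite[OF s K(1)])
  have "set w \<subseteq> K" using codes_set[OF w] simple_graph_subset[OF s] by blast
  then show "w \<in> {w. set w \<subseteq> K \<and> length w = 2 * ?M}" using codes_length[OF w fE] E by (auto simp: cgraphs_def)
 qed
 also have "... = k ^ (2 * ?M)" using card_lists_length_eq[OF K(1)] K(2) by simp
 finally have 1: "real (card (cgraphs K a ?M)) * (2 ^ ?M * fact ?M) <= real k ^ (2 * ?M)"
  using of_nat_mono[of "card (cgraphs K a ?M) * (2 ^ ?M * fact ?M)" "k ^ (2 * ?M)", where 'a = real] by simp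
 have fm: "(real j / 3) ^ j <= fact j" for j
 proof -
  have "real j ^ j / fact j <= exp (real j)" by (rule exp_ge_power_div_fact) simp
  also have "... = exp 1 ^ j" using exp_of_nat_mult[of j "1::real"] by simp
  also have "... <= 3 ^ j" using exp_le by (intro power_mono) auto
  finally show ?thesis by (simp add: power_divide field_simps)
 qed
 have M0: "real ?M > 0" using k by simp
 have "real (card (cgraphs K a ?M)) * (2 ^ ?M * (real ?M / 3) ^ ?M) <= real (card (cgraphs K a ?M)) * (2 ^ ?M * fact ?M)"
  by (intro mult_left_mono fm) auto
 then have "real (card (cgraphs K a ?M)) * (2 * (real ?M / 3)) ^ ?M <= (real k * real k) ^ ?M"
  using 1 unfolding power2_eq_square[symmetric] power_mult[symmetric] power_mult_distrib[of 2 "real ?M / 3"] by linarith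
 then have "real (card (cgraphs K a ?M)) <= (real k * real k) ^ ?M / (2 * (real ?M / 3)) ^ ?M" using M0 by (simp add: pos_le_divide_eq)
 also have "... = (real k * real k / (2 * (real ?M / 3))) ^ ?M" by (simp add: power_divide)
 also have "... <= (3 / 4 * real k) ^ ?M"
 proof (rule power_mono)
  have m1: "real k * (2 * real k) <= real k * real ?M" using e by (intro mult_left_mono) auto
  have pos: "0 < 2 * (real ?M / 3)" using M0 by simp
  have "3 / 4 * real k * (2 * (real ?M / 3)) = real k * real ?M / 2" by simp
  then have "real k * real k <= 3 / 4 * real k * (2 * (real ?M / 3))" using m1 by linarith
  then show "real k * real k / (2 * (real ?M / 3)) <= 3 / 4 * real k" by (rule iffD2[OF pos_divide_le_eq[OF pos]])
 qed simp
 also have "... = (9 / 4) ^ k * (real k / 3) ^ k * (3 / 4 * real k) ^ e" by (simp add: power_add power_mult_distrib[symmetric])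
 also have "... <= (9 / 4) ^ e * fact k * (3 / 4 * real k) ^ e"
 proof (rule mult_right_mono)
  show "(9 / 4) ^ k * (real k / 3) ^ k <= (9 / 4) ^ e * fact k"
   by (rule mult_mono[OF power_increasing[OF e] fm]) auto
 qed simp
 also have "... = fact k * (27 / 16 * real k) ^ e" by (simp add: power_mult_distrib[symmetric])
 also have "... <= fact k * (2 * real k) ^ e" by (intro mult_left_mono power_mono) auto
 finally show ?thesis .
qed

text \<open>Each excess edge of the core takes an edge away from the rest of the graph, which costs
  12/n in \<open>card_core_fibre\<close>. The constant 96 makes this price times the growth per
  excess edge at most 1/2 in both ranges of e, so the sum over e converges.\<close>

lemma card_cgraphs_le:
 fixes x :: real
 assumes K: "finite K" "card K = k" "a \<in> K" and x: "0 < x" "x <= 1" and n: "96 * real k <= x\<^sup>2 * real n" "n > 0"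
 shows "real (card (cgraphs K a (k + e))) * (12 / real n) ^ e <= fact k * exp (x * k) * (2 / x\<^sup>2) * (1 / 2) ^ e"
proof -
 have k: "k \<ge> 1" using K(1,3) unfolding K(2)[symmetric] by (auto simp: Suc_le_eq card_gt_0_iff)
 have x2: "0 < x\<^sup>2" "x\<^sup>2 <= 1" using x by (auto simp: power_le_one)
 have n0: "real n > 0" using n by simp
 show ?thesis
 proof (cases "e <= k")
  case True
  have "real (card (cgraphs K a (k + e))) * (12 / real n) ^ e <= fact k * exp (x * k) * (2 / x\<^sup>2) * (2 * real (k + e) / x\<^sup>2) ^ e * (12 / real n) ^ e"
   by (intro mult_right_mono card_cgraphs_few K x) auto
  also have "... = fact k * exp (x * k) * (2 / x\<^sup>2) * (2 * real (k + e) / x\<^sup>2 * (12 / real n)) ^ e" by (simp only: power_mult_distrib mult.assoc)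
  also have "... <= fact k * exp (x * k) * (2 / x\<^sup>2) * (1 / 2) ^ e"
  proof (intro mult_left_mono power_mono)
   have "24 * real (k + e) <= 48 * real k" using True by simp
   then have "24 * real (k + e) * 2 <= x\<^sup>2 * real n" using n by linarith
   moreover have "x\<^sup>2 * real n > 0" using x2 n0 by simp
   moreover have "2 * real (k + e) / x\<^sup>2 * (12 / real n) = 24 * real (k + e) / (x\<^sup>2 * real n)" by simp
   ultimately show "2 * real (k + e) / x\<^sup>2 * (12 / real n) <= 1 / 2" by (simp add: divide_le_eq)
  qed (use x2 in auto)
  finally show ?thesis .
 next
  case False
  have "real (card (cgraphs K a (k + e))) * (12 / real n) ^ e <= fact k * (2 * real k) ^ e * (12 / real n) ^ e"
   by (intro mult_right_mono card_cgraphs_many K k) (use False in auto)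
  also have "... = fact k * (2 * real k * (12 / real n)) ^ e" by (simp only: power_mult_distrib mult.assoc)
  also have "... <= fact k * (1 / 2) ^ e"
  proof (intro mult_left_mono power_mono)
   have "x\<^sup>2 * real n <= 1 * real n" by (intro mult_right_mono x2) auto
   then have "48 * real k <= real n" using n by linarith
   then show "2 * real k * (12 / real n) <= 1 / 2" using n0 by (simp add: divide_simps)
  qed auto
  also have "... <= fact k * exp (x * k) * (2 / x\<^sup>2) * (1 / 2) ^ e"
  proof -
   have "1 * 1 <= exp (x * k) * (2 / x\<^sup>2)" using x x2 by (intro mult_mono) (auto simp: divide_simps)
   then have "fact k * 1 * (1 / 2) ^ e <= fact k * (exp (x * k) * (2 / x\<^sup>2)) * ((1::real) / 2) ^ e" by (intro mult_right_mono mult_left_mono) auto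
   then show ?thesis by (simp add: mult.assoc)
  qed
  finally show ?thesis .
 qed
qed

section \<open>Large cores are rare\<close>

lemma is_comp_split:
 assumes c: "is_comp V E A" and h: "hangs E A K p"
 shows "E = (induced K E \<union> {d\<in>E. d \<inter> A = {}}) \<union> pedges A K p"
proof -
 have "E = {d\<in>E. d \<inter> A ~= {}} \<union> {d\<in>E. d \<inter> A = {}}" by auto
 also have "{d\<in>E. d \<inter> A ~= {}} = induced A E" by (rule is_comp_touching[OF c])
 also have "induced A E = induced K E \<union> pedges A K p" using h by (simp add: hangs_def)
 finally show ?thesis by (simp only: ac_simps)
qed

lemma card_hangs:
 assumes c: "is_comp V E A" and h: "hangs E A K g" and K: "K \<subseteq> A" and A: "finite A" and E: "finite E"
 shows "card (induced A E) = card (induced K E) + card (A - K)"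
proof -
 note p = hangsD(1)[OF h K]
 have f: "finite (induced K E)" "finite (pedges A K g)" using E A by (auto simp: induced_def pedges_def)
 have "card (induced A E) = card (induced K E \<union> pedges A K g)" using h by (simp add: hangs_def)
 also have "... = card (induced K E) + card (pedges A K g)"
  by (rule card_Un_disjoint[OF f hangs_disjoint[OF p]])
 finally show ?thesis using card_pedges[OF p] by simp
qed

text \<open>A graph of this class is determined by its graph on K, the forest hanging from K and its
  graph outside A. For excess e there are at most N^(N-k) forests by Cayley's formula and (12/n)^e
  \<open>pc (n - N) (m - N)\<close> outer graphs; summation over e costs a factor 2.\<close>

lemma card_core_fibre:
 fixes x :: real
 assumes V: "V = {1..n}" and A: "A \<subseteq> V" "card A = N" "N > 0" "2 * N <= n" and K: "K \<subseteq> A" "card K = k" "k \<ge> 2"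
  and x: "0 < x" "x <= 1" and xk: "96 * real k <= x\<^sup>2 * real n"
  and R: "\<forall>e\<le>m - N. real (n - N) ^ e * pc (n - N) (m - N - e) <= 6 ^ e * real (pc (n - N) (m - N))"
 shows "real (card {E\<in>pl V m. largest_comp V E = A \<and> core E A = K})
  <= fact k * exp (x * k) * (4 / x\<^sup>2) * real N ^ (N - k) * pc (n - N) (m - N)"
proof -
 define S where "S = {E\<in>pl V m. largest_comp V E = A \<and> core E A = K}"
 have SD: "E \<in> pl V m" "simple_graph V E" "card E = m" "largest_comp V E = A" "core E A = K" if "E \<in> S" for E
  using that by (simp_all add: S_def pl_def)
 let ?a = "Min A"
 have n: "n > 0" using A by simp
 have fV: "finite V" using V by simp
 have fA: "finite A" using A(1) fV finite_subset by blast
 have fK: "finite K" using K(1) fA finite_subset by blast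
 have kN: "k <= N" using card_mono[OF fA K(1)] A K by simp
 define c where "c = fact k * exp (x * k) * (2 / x\<^sup>2) * real N ^ (N - k) * pc (n - N) (m - N)"
 have c0: "c \<ge> 0" unfolding c_def by (intro mult_nonneg_nonneg) auto
 \<comment> \<open>The number e counts the edges of the core beyond k, or equivalently those of A
   beyond N.\<close>
 define T where "T = (%e. {E\<in>S. card (induced K E) = k + e})"
 have comp: "is_comp V E A" "finite E" "card E = m" if "E \<in> S" for E
 proof -
  show "is_comp V E A" using is_comp_largest[OF SD(2)[OF that, unfolded V] n] SD(4)[OF that] unfolding V by simp
  show "finite E" by (rule finite_plE[OF SD(1)[OF that] fV])
  show "card E = m" by (rule SD(3)[OF that])
 qed
 have cE: "ctwo E ?a K" "\<exists>p. hangs E A K p" "k <= card (induced K E)" if E: "E \<in> S" for E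
  using core_hangs(2,3)[OF comp(1)[OF E] fA] card_core_le_edges[OF comp(1)[OF E] fA] K(2,3) unfolding SD(5)[OF E] by simp_all
 define P where "P = (%E. SOME p. hangs E A K p)"
 have P: "hangs E A K (P E)" if "E \<in> S" for E unfolding P_def by (rule someI_ex[OF cE(2)[OF that]])
 have cov: "S \<subseteq> (\<Union>e\<le>m. T e)"
 proof
  fix E assume E: "E \<in> S"
  have "induced K E \<subseteq> E" by (auto simp: induced_def)
  then have "card (induced K E) <= m" using comp(2,3)[OF E] card_mono[of E "induced K E"] by simp
  then have "E \<in> T (card (induced K E) - k)" "card (induced K E) - k <= m" using E cE(3)[OF E] by (auto simp: T_def)
  then show "E \<in> (\<Union>e\<le>m. T e)" by blast
 qed
 have Te: "real (card (T e)) <= c * (1 / 2) ^ e" for e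
 proof (cases "T e = {}")
  case True
  then show ?thesis using c0 by simp
 next
  case False
  have edges: "card (induced A E) = N + e" if E: "E \<in> T e" for E
  proof -
   have ES: "E \<in> S" using E by (simp add: T_def)
   have "card (induced A E) = (k + e) + (N - k)"
    using card_hangs[OF comp(1)[OF ES] P[OF ES] K(1) fA comp(2)[OF ES]] E fK A(2) K(1,2) by (simp add: T_def card_Diff_subset)
   then show ?thesis using kN by simp
  qed
  obtain E0 where E0: "E0 \<in> T e" using False by blast
  then have S0: "E0 \<in> S" by (simp add: T_def)
  have ind: "induced A E0 \<subseteq> E0" by (auto simp: induced_def)
  have "N + e <= m" using edges[OF E0] comp(2,3)[OF S0] card_mono[of E0 "induced A E0"] ind by simp
  then have em: "e <= m - N" by simp
  let ?D = "cgraphs K ?a (k + e) \<times> pfun A K \<times> pl (V - A) (m - (N + e))"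
  let ?f = "%E. (induced K E, P E, {d\<in>E. d \<inter> A = {}})"
  have aK: "?a \<in> K" using cE(1)[OF S0] by (simp add: ctwo_def)
  have fD: "finite ?D"
  proof -
   have "finite (cgraphs K ?a (k + e))" by (rule finite_subset[OF _ finite_simple_graphs[OF fK]]) (auto simp: cgraphs_def)
   then show ?thesis using finite_pfun[OF fA] finite_pl[of "V - A"] fV by auto
  qed
  have "card (T e) <= card ?D"
  proof (rule card_inj_on_le[OF _ _ fD])
   show "inj_on ?f (T e)"
   proof (rule inj_onI)
    fix E E' assume a: "E \<in> T e" "E' \<in> T e" "?f E = ?f E'"
    then have ES: "E \<in> S" "E' \<in> S" by (auto simp: T_def)
    have "induced K E = induced K E'" "P E = P E'" "{d\<in>E. d \<inter> A = {}} = {d\<in>E'. d \<inter> A = {}}" using a(3) by auto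
    then show "E = E'" using is_comp_split[OF comp(1)[OF ES(1)] P[OF ES(1)]] is_comp_split[OF comp(1)[OF ES(2)] P[OF ES(2)]] by simp
   qed
   show "?f ` T e \<subseteq> ?D"
   proof (rule image_subsetI)
    fix E assume E: "E \<in> T e"
    then have ES: "E \<in> S" by (simp add: T_def)
    have "{d\<in>E. d \<inter> A = {}} \<in> pl (V - A) (m - card {d\<in>E. d \<inter> A ~= {}})"
     by (rule pl_remove_vertices[OF _ fV]) (rule SD(1)[OF ES])
    then have "{d\<in>E. d \<inter> A = {}} \<in> pl (V - A) (m - (N + e))"
     unfolding is_comp_touching[OF comp(1)[OF ES]] edges[OF E] .
    moreover have "induced K E \<in> cgraphs K ?a (k + e)"
     using core_cgraphs[OF is_compD(1)[OF comp(1)[OF ES]] fK cE(1)[OF ES]] E by (simp add: T_def)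
    moreover have "P E \<in> pfun A K" by (rule hangsD(1)[OF P[OF ES] K(1)])
    ultimately show "?f E \<in> ?D" by simp
   qed
  qed
  then have "real (card (T e)) <= real (card ?D)" by (rule of_nat_mono)
  also have "... = real (card (cgraphs K ?a (k + e))) * (real (card (pfun A K)) * real (pc (n - N) (m - N - e)))"
   using card_pl[of "V - A" "m - (N + e)"] fV A V fA by (simp add: card_cartesian_product card_Diff_subset)
  \<comment> \<open>By R each missing edge costs 6/(n - N), and n <= 2(n - N).\<close>
  also have "... <= real (card (cgraphs K ?a (k + e))) * (real N ^ (N - k) * ((12 / real n) ^ e * pc (n - N) (m - N)))"
  proof (intro mult_left_mono mult_mono)
   have "N * card (pfun A K) = k * N ^ (N - k)"
   proof -
    have "K ~= {}" using K by auto
    then show ?thesis using card_pfun[OF fA K(1)] K A(2) fK by (simp add: card_Diff_subset)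
   qed
   also have "... <= N * N ^ (N - k)" using kN by simp
   finally have "card (pfun A K) <= N ^ (N - k)" using A(3) by simp
   then show "real (card (pfun A K)) <= real N ^ (N - k)" using of_nat_mono[of "card (pfun A K)" "N ^ (N - k)", where 'a = real] by simp
   have nN: "real (n - N) > 0" "real n <= 2 * real (n - N)" using A(3,4) by auto
   have "real (pc (n - N) (m - N - e)) * real (n - N) ^ e <= 6 ^ e * real (pc (n - N) (m - N))" using R em by (simp add: mult.commute)
   then have "real (pc (n - N) (m - N - e)) <= 6 ^ e * real (pc (n - N) (m - N)) / real (n - N) ^ e" using nN by (simp add: pos_le_divide_eq)
   also have "... = (6 / real (n - N)) ^ e * real (pc (n - N) (m - N))" by (simp add: power_divide)
   also have "... <= (12 / real n) ^ e * real (pc (n - N) (m - N))"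
    using nN n by (intro mult_right_mono power_mono) (auto simp: divide_simps)
   finally show "real (pc (n - N) (m - N - e)) <= (12 / real n) ^ e * real (pc (n - N) (m - N))" .
  qed auto
  also have "... = (real (card (cgraphs K ?a (k + e))) * (12 / real n) ^ e) * (real N ^ (N - k) * pc (n - N) (m - N))" by simp
  also have "... <= (fact k * exp (x * k) * (2 / x\<^sup>2) * (1 / 2) ^ e) * (real N ^ (N - k) * pc (n - N) (m - N))"
   by (intro mult_right_mono card_cgraphs_le[OF fK K(2) aK x xk n]) auto
  also have "... = c * (1 / 2) ^ e" by (simp add: c_def)
  finally show ?thesis .
 qed
 have "card S <= card (\<Union>e\<le>m. T e)"
 proof (rule card_mono[OF _ cov])
  have "finite (T e)" for e by (rule finite_subset[OF _ finite_pl[OF fV, of m]]) (auto simp: T_def SD(1))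
  then show "finite (\<Union>e\<le>m. T e)" by simp
 qed
 also have "... <= (\<Sum>e\<le>m. card (T e))" by (rule card_UN_le) simp
 finally have "real (card S) <= real (\<Sum>e\<le>m. card (T e))" by (rule of_nat_mono)
 also have "... = (\<Sum>e\<le>m. real (card (T e)))" by simp
 also have "... <= (\<Sum>e\<le>m. c * (1 / 2) ^ e)" by (intro sum_mono Te)
 also have "... = c * (\<Sum>e\<le>m. (1 / 2) ^ e)" by (simp add: sum_distrib_left)
 also have "... <= c * 2"
 proof (rule mult_left_mono)
  have "(1 - 1 / 2) * (\<Sum>i\<le>m. (1 / 2 :: real) ^ i) = 1 - (1 / 2) ^ Suc m" using sum_gp_basic[of "1/2::real" m] by simp
  then show "(\<Sum>i\<le>m. (1 / 2 :: real) ^ i) <= 2" by simp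
 qed (rule c0)
 also have "c * 2 = fact k * exp (x * k) * (4 / x\<^sup>2) * real N ^ (N - k) * pc (n - N) (m - N)" by (simp add: c_def)
 finally show ?thesis by (simp only: S_def)
qed

lemma sum_Pow_card:
 assumes "finite A"
 shows "(\<Sum>K\<in>Pow A. f (card K)) = (\<Sum>k\<le>card A. real (card A choose k) * f k)"
proof -
 have "(\<Sum>K\<in>Pow A. f (card K)) = (\<Sum>k\<in>{..card A}. \<Sum>K\<in>{K\<in>Pow A. card K = k}. f (card K))"
  by (rule sum.group[symmetric]) (use assms in \<open>auto intro: card_mono\<close>)
 also have "... = (\<Sum>k\<le>card A. real (card A choose k) * f k)"
 proof (rule sum.cong[OF refl])
  fix k
  have "(\<Sum>K\<in>{K\<in>Pow A. card K = k}. f (card K)) = (\<Sum>K\<in>{K\<in>Pow A. card K = k}. f k)" by (rule sum.cong) auto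
  also have "... = real (card A choose k) * f k" using n_subsets[OF assms, of k] by simp
  finally show "(\<Sum>K\<in>{K\<in>Pow A. card K = k}. f (card K)) = real (card A choose k) * f k" .
 qed
 finally show ?thesis .
qed

text \<open>Iterates \<open>pc_leaf_upper\<close> N times. N may be linear in n, so D is chosen
  small enough for all intermediate pairs (n - i, m - i) to stay near the critical density.\<close>

lemma pc_component_upper:
 fixes f :: real
 assumes z: "f > 0"
 shows "\<exists>D>0. eventually (%(n, m). \<forall>N. real N <= D * real n -->
  real (n choose N) * fact N * pc (n - N) (m - N) <= 2 * (exp (- 1) + f) ^ N * pc n m) crit"
proof -
 obtain D0 k where d0: "D0 > 0" and R: "\<And>n m. n \<ge> k ==> \<bar>2 * real m - real n\<bar> <= D0 * real n ==> real (n - 1) * real (pc (n - 1) (m - 1)) <= (exp (- 1) + f) * pc n m"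
  using pc_leaf_upper[OF z] unfolding eventually_crit by (auto simp del: One_nat_def)
 define D where "D = min (1 / 4) (D0 / 4)"
 have d: "D > 0" "D <= 1 / 4" "D <= D0 / 4" using d0 by (auto simp: D_def)
 let ?c = "exp (- 1) + f"
 have c0: "?c > 0" using z by (simp add: add_pos_pos)
 have "eventually (%(n, m). \<forall>N. real N <= D * real n -->
  real (n choose N) * fact N * pc (n - N) (m - N) <= 2 * ?c ^ N * pc n m) crit"
 proof (rule eventually_critI[OF d(1), of "2 * k + 1"], simp only: prod.case, intro allI impI)
  fix n m N :: nat
  assume n: "2 * k + 1 <= n" and near: "\<bar>2 * real m - real n\<bar> <= D * real n" and N: "real N <= D * real n"
  have N4: "4 * real N <= real n" using N d(2) mult_right_mono[OF d(2), of "real n"] by simp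
  have m4: "2 * real m \<ge> 3 / 4 * real n" using near mult_right_mono[OF d(2), of "real n"] by simp
  \<comment> \<open>The factor (n - i)/n turns the falling factorial of n into (n - 1)...(n - i),
    the product of the weights in \<open>pc_leaf_upper\<close>. At the end it is at least
    1/2.\<close>
  have step: "i <= N ==> real (n choose i) * fact i * (real (n - i) / real n) * pc (n - i) (m - i) <= ?c ^ i * pc n m" for i
  proof (induction i)
   case 0
   then show ?case using n by simp
  next
   case (Suc i)
   have i: "4 * real (Suc i) <= real n" using Suc.prems N4 by simp
   have r: "real (n - i) = real n - real i" "real (m - i) = real m - real i" "real (n - i) > 0" using i m4 by (auto simp: of_nat_diff)
   have "real (n - i - 1) * real (pc (n - i - 1) (m - i - 1)) <= ?c * pc (n - i) (m - i)"
   proof (rule R)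
    have "4 * i <= n" using i by simp
    then show "k <= n - i" using n by linarith
    have "\<bar>2 * real (m - i) - real (n - i)\<bar> <= D * real n + real i"
    proof -
     have "2 * real (m - i) - real (n - i) = (2 * real m - real n) - real i" unfolding r(1,2) by simp
     then show ?thesis using abs_triangle_ineq4[of "2 * real m - real n" "real i"] near by simp
    qed
    also have "... <= 2 * (D * real n)" using N Suc.prems by simp
    also have "... <= D0 / 2 * real n" using mult_right_mono[OF d(3), of "real n"] by simp
    also have "... <= D0 / 2 * (2 * real (n - i))" using d0 i unfolding r by (intro mult_left_mono) auto
    finally show "\<bar>2 * real (m - i) - real (n - i)\<bar> <= D0 * real (n - i)" by simp
   qed
   then have st: "real (n - Suc i) * real (pc (n - Suc i) (m - Suc i)) <= ?c * pc (n - i) (m - i)" by simp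
   have ch: "real (n choose Suc i) * fact (Suc i) = real (n choose i) * fact i * real (n - i)"
   proof -
    have "Suc i * (n choose Suc i) = (n - i) * (n choose i)" using binomial_absorb_comp[of n i] binomial_absorption[of i n] by simp
    then have "real (Suc i) * real (n choose Suc i) = real (n - i) * real (n choose i)" unfolding of_nat_mult[symmetric] by simp
    then have "real (Suc i) * real (n choose Suc i) * fact i = real (n - i) * real (n choose i) * fact i" by simp
    then show ?thesis by (simp only: fact_Suc of_nat_mult mult.commute mult.left_commute of_nat_fact)
   qed
   have "real (n choose Suc i) * fact (Suc i) * (real (n - Suc i) / real n) * pc (n - Suc i) (m - Suc i)
    = real (n choose i) * fact i * (real (n - i) / real n) * (real (n - Suc i) * real (pc (n - Suc i) (m - Suc i)))"
    unfolding ch by simp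
   also have "... <= real (n choose i) * fact i * (real (n - i) / real n) * (?c * pc (n - i) (m - i))"
    by (intro mult_left_mono st) auto
   also have "... = ?c * (real (n choose i) * fact i * (real (n - i) / real n) * pc (n - i) (m - i))" by simp
   also have "... <= ?c * (?c ^ i * pc n m)" using Suc c0 by (intro mult_left_mono) auto
   finally show ?case by simp
  qed
  have h: "1 / 2 <= real (n - N) / real n" using N4 n by (simp add: of_nat_diff divide_simps)
  have "real (n choose N) * fact N * pc (n - N) (m - N) * (1 / 2) <= real (n choose N) * fact N * pc (n - N) (m - N) * (real (n - N) / real n)"
   by (intro mult_left_mono h) auto
  also have "... <= ?c ^ N * pc n m" using step[OF order_refl] by (simp only: ac_simps)
  finally show "real (n choose N) * fact N * pc (n - N) (m - N) <= 2 * ?c ^ N * pc n m" by simp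
 qed
 then show ?thesis using d(1) by blast
qed


text \<open>One term of the exponential series at yN, combined with y^j >= y^(yN) for j <=
  yN.\<close>

lemma power_div_fact_le:
 fixes y :: real
 assumes y: "0 < y" "y <= 1" and j: "real j <= y * real N"
 shows "real N ^ j / fact j <= exp (real N * (y - y * ln y))"
proof -
 have "(y * real N) ^ j / fact j <= exp (y * real N)" using y by (intro exp_ge_power_div_fact) auto
 then have "y ^ j * (real N ^ j / fact j) <= exp (y * real N)" by (simp add: power_mult_distrib)
 moreover have "exp (y * real N * ln y) <= y ^ j"
 proof -
  have "y * real N * ln y <= real j * ln y" using j y by (intro mult_right_mono_neg) (auto simp: ln_le_zero_iff)
  moreover have "y ^ j = exp (real j * ln y)" using y by (simp add: exp_of_nat_mult)
  ultimately show ?thesis by simp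
 qed
 ultimately have "exp (y * real N * ln y) * (real N ^ j / fact j) <= exp (y * real N)"
  using mult_right_mono[of "exp (y * real N * ln y)" "y ^ j" "real N ^ j / fact j"] by simp
 then have "real N ^ j / fact j <= exp (y * real N) / exp (y * real N * ln y)" by (simp add: pos_le_divide_eq mult.commute)
 then show ?thesis by (simp add: exp_diff[symmetric] algebra_simps)
qed

lemma sum_geometric_tail:
 fixes r :: real
 assumes r: "0 <= r" "r < 1"
 shows "(\<Sum>N\<in>{K..n}. r ^ N) <= r ^ K / (1 - r)"
proof (cases "K <= n")
 case True
 have "(1 - r) * (\<Sum>N\<in>{K..n}. r ^ N) <= r ^ K" using sum_gp_multiplied[OF True, of r] r by simp
 then show ?thesis using r by (simp add: pos_le_divide_eq mult.commute)
qed (use r in simp)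

text \<open>A first moment over the size N of L and the size k > uN of its core. The choices of
  vertex sets, core, forest and outer graph multiply to about exp(-N) N^(N-k)/(N-k)!, relative to
  \<open>pc n m\<close>, and this is at most exp(-g N) with g > 0, which is summable over N.\<close>

lemma large_core_rare:
 fixes u w :: real
 assumes e: "0 < u" "u < 1" and t: "w > 0"
 shows "\<exists>K. \<exists>D>0. eventually (%(n, m). real (card {E\<in>pl {1..n} m. K <= card (largest_comp {1..n} E) \<and>
  real (card (largest_comp {1..n} E)) <= D * real n \<and>
  real (card (core E (largest_comp {1..n} E))) > u * real (card (largest_comp {1..n} E))}) <= w * real (pc n m)) crit"
proof -
 define y where "y = 1 - u"
 \<comment> \<open>Here 1 - g is the exponent of \<open>power_div_fact_le\<close> at y = 1 - u. The
   three losses exp(xk), (1/e + v)^N against e^(-N), and N + 1 use g/4 each; this leaves r^N with r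
   = exp(-g/4).\<close>
 define g where "g = u + y * ln y"
 define x where "x = min 1 (g / 4)"
 \<comment> \<open>As exp 1 <= 3, this makes (1/e + v)^N at most exp(N(g/4 - 1)).\<close>
 define v where "v = g / 12"
 have y: "0 < y" "y < 1" using e by (auto simp: y_def)
 have g: "g > 0"
 proof -
  have "ln (1 / y) < 1 / y - 1" using ln_less_self[of 1] ln_add_one_self_less_self[of "1 / y - 1"] y by simp
  then have "y * ln (1 / y) < y * (1 / y - 1)" using y by (intro mult_strict_left_mono) auto
  moreover have "y * (1 / y - 1) = 1 - y" using y by (simp add: field_simps)
  ultimately show ?thesis using y by (simp add: g_def ln_div) (simp add: y_def)
 qed
 have x: "0 < x" "x <= 1" "x <= g / 4" using g by (auto simp: x_def)
 have z: "v > 0" using g by (simp add: v_def)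
 define r where "r = exp (- g / 4)"
 have r: "0 < r" "r < 1" using g by (auto simp: r_def)
 define C where "C = 8 / x\<^sup>2 * (1 + 4 / g)"
 have C: "C > 0" using x g by (auto simp: C_def intro!: mult_pos_pos add_pos_pos divide_pos_pos)
 have "(%K. C * (r ^ K / (1 - r))) \<longlonglongrightarrow> C * (0 / (1 - r))" using r by (intro tendsto_intros LIMSEQ_realpow_zero) auto
 then have "eventually (%K. C * (r ^ K / (1 - r)) < w) sequentially" using t by (auto elim: order_tendstoD(2))
 then obtain K1 where K1: "\<And>K. K \<ge> K1 ==> C * (r ^ K / (1 - r)) < w" by (auto simp: eventually_sequentially)
 \<comment> \<open>K1 makes the tail of the geometric series small. The term 2/u forces the core to
   have at least two vertices, hence at least as many edges as vertices.\<close>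
 define K where "K = K1 + nat \<lceil>2 / u\<rceil> + 1"
 have K: "C * (r ^ K / (1 - r)) < w" "2 <= u * real K" "K \<ge> 1"
 proof -
  show "C * (r ^ K / (1 - r)) < w" by (rule K1) (simp add: K_def)
  have "2 / u <= real K" by (simp add: K_def) linarith
  then show "2 <= u * real K" using e by (simp add: field_simps)
  show "K \<ge> 1" by (simp add: K_def)
 qed
 obtain D1 where d1: "D1 > 0" and ev1: "eventually (%(n, m). \<forall>N. real N <= D1 * real n -->
  real (n choose N) * fact N * pc (n - N) (m - N) <= 2 * (exp (- 1) + v) ^ N * pc n m) crit"
  using pc_component_upper[OF z] by blast
 obtain D2 k2 where d2: "D2 > 0" and R2: "\<And>n m. n \<ge> k2 ==> \<bar>2 * real m - real n\<bar> <= D2 * real n ==> \<forall>e\<le>m. real n ^ e * real (pc n (m - e)) <= 6 ^ e * real (pc n m)"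
  using pc_edges_crude unfolding eventually_crit split by blast
 \<comment> \<open>The bound x^2/96 serves \<open>card_cgraphs_le\<close>, as k <= N <= Dn; D2/4
   keeps (n - N, m - N) near the critical density.\<close>
 define D where "D = min (min (1 / 4) (x\<^sup>2 / 96)) (min D1 (D2 / 4))"
 have d: "D > 0" "D <= 1 / 4" "D <= x\<^sup>2 / 96" "D <= D1" "D <= D2 / 4" using d1 d2 x by (auto simp: D_def)
 have main: "eventually (%(n, m). real (card {E\<in>pl {1..n} m. K <= card (largest_comp {1..n} E) \<and>
  real (card (largest_comp {1..n} E)) <= D * real n \<and>
  real (card (core E (largest_comp {1..n} E))) > u * real (card (largest_comp {1..n} E))}) <= w * real (pc n m)) crit"
  using ev1 crit_near[OF d(1)] crit_ge[of "2 * k2 + 1"]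
 proof eventually_elim
  case (elim p)
  obtain n m where p: "p = (n, m)" by (cases p)
  have pcu: "\<And>N. real N <= D1 * real n ==> real (n choose N) * fact N * pc (n - N) (m - N) <= 2 * (exp (- 1) + v) ^ N * pc n m"
   and near: "\<bar>2 * real m - real n\<bar> <= D * real n" and n: "2 * k2 + 1 <= n" using elim p by auto
  let ?V = "{1..n}"
  let ?L = "largest_comp ?V"
  define B where "B = {E\<in>pl ?V m. K <= card (?L E) \<and> real (card (?L E)) <= D * real n \<and> real (card (core E (?L E))) > u * real (card (?L E))}"
  define Q where "Q = (%N k. if K <= N \<and> real N <= D * real n \<and> u * real N < real k then
    fact k * exp (x * real k) * (4 / x\<^sup>2) * real N ^ (N - k) * pc (n - N) (m - N) else 0)"
  define F where "F = (%A Kc. {E\<in>pl ?V m. ?L E = A \<and> core E A = Kc})"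
  have sgE: "simple_graph ?V E" if "E \<in> pl ?V m" for E using that by (simp add: pl_def)
  have n0: "n > 0" using n by simp
  have cov: "B \<subseteq> (\<Union>(A, Kc)\<in>(SIGMA A:Pow ?V. Pow A). F A Kc \<inter> B)"
  proof
   fix E assume E: "E \<in> B"
   then have EP: "E \<in> pl ?V m" by (simp add: B_def)
   have c: "is_comp ?V E (?L E)" by (rule is_comp_largest[OF sgE[OF EP] n0])
   have s: "?L E \<subseteq> ?V" by (rule is_compD(2)[OF c])
   have "core E (?L E) \<subseteq> ?L E" by (rule core_hangs(1)[OF c finite_subset[OF s]]) simp
   then have "(?L E, core E (?L E)) \<in> (SIGMA A:Pow ?V. Pow A)" using s by simp
   moreover have "E \<in> F (?L E) (core E (?L E)) \<inter> B" using E EP by (simp add: F_def)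
   ultimately show "E \<in> (\<Union>(A, Kc)\<in>(SIGMA A:Pow ?V. Pow A). F A Kc \<inter> B)" by blast
  qed
  have finP: "finite A" if "A \<in> Pow {1..n}" for A :: "nat set" using that finite_subset[of A "{1..n}"] by blast
  have finS: "finite (SIGMA A:Pow ?V. Pow A)" by (intro finite_SigmaI) (use finP in auto)
  have fF: "finite (F A Kc)" for A Kc by (rule finite_subset[of _ "pl ?V m"]) (auto simp: F_def finite_pl)
  have dn: "D * real n <= 1 / 4 * real n" "D * real n <= x\<^sup>2 / 96 * real n" "D * real n <= D1 * real n" "D * real n <= D2 / 4 * real n"
   by (rule mult_right_mono[OF d(2)] mult_right_mono[OF d(3)] mult_right_mono[OF d(4)] mult_right_mono[OF d(5)], simp)+
  have cell: "real (card (F A Kc \<inter> B)) <= Q (card A) (card Kc)" if A: "A \<subseteq> ?V" and Kc: "Kc \<subseteq> A" for A Kc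
  proof (cases "F A Kc \<inter> B = {}")
   case True
   then show ?thesis by (auto simp: Q_def intro!: mult_nonneg_nonneg)
  next
   case False
   then obtain E where E: "E \<in> F A Kc" "E \<in> B" by blast
   then have h: "K <= card A" "real (card A) <= D * real n" "u * real (card A) < real (card Kc)" by (auto simp: F_def B_def)
   have N0: "card A > 0" using h(1) K(3) by simp
   have "u * real K <= u * real (card A)" using h(1) e by (intro mult_left_mono) auto
   then have k2: "2 <= card Kc" using K(2) h(3) by simp
   have kA: "card Kc <= card A" using card_mono[of A Kc] Kc A finite_subset[of A ?V] by simp
   have N4: "4 * real (card A) <= real n" using h(2) dn(1) by simp
   have m4: "2 * real m \<ge> 3 / 4 * real n" using near dn(1) by simp
   have rr: "real (n - card A) = real n - real (card A)" "real (m - card A) = real m - real (card A)" using N4 m4 by (auto simp: of_nat_diff)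
   have "real (card (F A Kc)) <= fact (card Kc) * exp (x * real (card Kc)) * (4 / x\<^sup>2) * real (card A) ^ (card A - card Kc) * pc (n - card A) (m - card A)"
    unfolding F_def
   proof (rule card_core_fibre[OF refl A refl N0 _ Kc refl k2 x(1,2)])
    show "2 * card A <= n" using N4 by simp
    show "96 * real (card Kc) <= x\<^sup>2 * real n" using kA h(2) dn(2) by simp
    show "\<forall>e\<le>m - card A. real (n - card A) ^ e * pc (n - card A) (m - card A - e) <= 6 ^ e * real (pc (n - card A) (m - card A))"
    proof (rule R2)
     have "4 * card A <= n" using N4 by simp
     then show "k2 <= n - card A" using n by linarith
     have "\<bar>2 * real (m - card A) - real (n - card A)\<bar> <= D * real n + real (card A)"

     proof -
      have "2 * real (m - card A) - real (n - card A) = (2 * real m - real n) - real (card A)" unfolding rr by simp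
      then show ?thesis using abs_triangle_ineq4[of "2 * real m - real n" "real (card A)"] near by simp
     qed
     also have "... <= D2 / 2 * real n" using h(2) dn(4) by simp
     also have "... <= D2 / 2 * (2 * real (n - card A))" using d2 N4 unfolding rr by (intro mult_left_mono) auto
     finally show "\<bar>2 * real (m - card A) - real (n - card A)\<bar> <= D2 * real (n - card A)" by simp
    qed
   qed
   then have "real (card (F A Kc)) <= Q (card A) (card Kc)" using h by (simp add: Q_def)
   moreover have "card (F A Kc \<inter> B) <= card (F A Kc)" by (rule card_mono[OF fF]) blast
   ultimately show ?thesis by linarith
  qed
  have "card B <= card (\<Union>(A, Kc)\<in>(SIGMA A:Pow ?V. Pow A). F A Kc \<inter> B)"
   by (rule card_mono[OF _ cov]) (use finS fF in auto)
  also have "... <= (\<Sum>(A, Kc)\<in>(SIGMA A:Pow ?V. Pow A). card (F A Kc \<inter> B))"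
   using card_UN_le[OF finS, of "%(A, Kc). F A Kc \<inter> B"] by (simp add: case_prod_beta)
  also have "... = (\<Sum>A\<in>Pow ?V. \<Sum>Kc\<in>Pow A. card (F A Kc \<inter> B))"
   by (rule sum.Sigma[symmetric]) (use finP in auto)
  finally have "real (card B) <= real (\<Sum>A\<in>Pow ?V. \<Sum>Kc\<in>Pow A. card (F A Kc \<inter> B))" by (rule of_nat_mono)
  also have "... = (\<Sum>A\<in>Pow ?V. \<Sum>Kc\<in>Pow A. real (card (F A Kc \<inter> B)))" by simp
  also have "... <= (\<Sum>A\<in>Pow ?V. \<Sum>Kc\<in>Pow A. Q (card A) (card Kc))" by (intro sum_mono cell) auto
  also have "... = (\<Sum>A\<in>Pow ?V. \<Sum>k\<le>card A. real (card A choose k) * Q (card A) k)"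
   by (intro sum.cong refl sum_Pow_card) (use finP in auto)
  also have "... = (\<Sum>N\<le>n. real (n choose N) * (\<Sum>k\<le>N. real (N choose k) * Q N k))"
   using sum_Pow_card[of ?V "%N. \<Sum>k\<le>N. real (N choose k) * Q N k"] by simp
  also have "... <= (\<Sum>N\<le>n. if K <= N then C * pc n m * r ^ N else 0)"
  proof (rule sum_mono)
   fix N assume "N \<in> {..n}"
   show "real (n choose N) * (\<Sum>k\<le>N. real (N choose k) * Q N k) <= (if K <= N then C * pc n m * r ^ N else 0)"
   proof (cases "K <= N \<and> real N <= D * real n")
    case False
    then have "Q N k = 0" for k by (auto simp: Q_def)
    then show ?thesis using C r by simp
   next
    case True
    define q where "q = exp (x * real N) * (4 / x\<^sup>2) * pc (n - N) (m - N)"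
    have q0: "q \<ge> 0" by (simp add: q_def)
    have "(\<Sum>k\<le>N. real (N choose k) * Q N k) <= (\<Sum>k\<le>N. fact N * exp (real N * (1 - g)) * q)"
    proof (rule sum_mono)
     fix k assume k: "k \<in> {..N}"
     show "real (N choose k) * Q N k <= fact N * exp (real N * (1 - g)) * q"
     proof (cases "u * real N < real k")
      case f: False
      then show ?thesis using q0 by (simp add: Q_def)
     next
      case t: True
      have kk: "exp (x * real k) <= exp (x * real N)" using k x by simp
      have "real (N choose k) * fact k * real N ^ (N - k) = fact N * (real N ^ (N - k) / fact (N - k))"
       using k by (simp add: binomial_fact)
      also have "... <= fact N * exp (real N * (y - y * ln y))"
       by (intro mult_left_mono power_div_fact_le) (use y t k in \<open>auto simp: y_def of_nat_diff algebra_simps\<close>)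
      also have "y - y * ln y = 1 - g" by (simp add: g_def y_def)
      finally have b: "real (N choose k) * fact k * real N ^ (N - k) <= fact N * exp (real N * (1 - g))" .
      have "real (N choose k) * Q N k = (real (N choose k) * fact k * real N ^ (N - k)) * (exp (x * real k) * (4 / x\<^sup>2) * pc (n - N) (m - N))"
       using True t by (simp add: Q_def)
      also have "... <= (fact N * exp (real N * (1 - g))) * q"
       unfolding q_def by (rule mult_mono[OF b mult_right_mono[OF mult_right_mono[OF kk]]]) auto
      finally show ?thesis .
     qed
    qed
    also have "... = real (N + 1) * fact N * exp (real N * (1 - g)) * q" by simp
    finally have in1: "(\<Sum>k\<le>N. real (N choose k) * Q N k) <= real (N + 1) * fact N * exp (real N * (1 - g)) * q" .
    have "real (n choose N) * (\<Sum>k\<le>N. real (N choose k) * Q N k) <= real (n choose N) * (real (N + 1) * fact N * exp (real N * (1 - g)) * q)"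
     by (rule mult_left_mono[OF in1]) simp
    also have "... = (real (n choose N) * fact N * pc (n - N) (m - N)) * (real (N + 1) * exp (real N * (1 - g)) * exp (x * real N) * (4 / x\<^sup>2))"
     by (simp only: q_def mult.assoc mult.commute mult.left_commute)
    also have "... <= (2 * (exp (- 1) + v) ^ N * pc n m) * (real (N + 1) * exp (real N * (1 - g)) * exp (x * real N) * (4 / x\<^sup>2))"
     by (intro mult_right_mono pcu) (use True dn in auto)
    also have "... <= (2 * exp (real N * (g / 4 - 1)) * pc n m) * (((1 + 4 / g) * exp (real N * (g / 4))) * exp (real N * (1 - g)) * exp (real N * (g / 4)) * (4 / x\<^sup>2))"
    proof -
     have a1: "(exp (- 1) + v) ^ N <= exp (real N * (g / 4 - 1))"
     proof -
      have "exp (- 1) + v = exp (- 1) * (1 + exp 1 * v)" by (simp add: exp_minus field_simps)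
      also have "... <= exp (- 1) * exp (exp 1 * v)" by (intro mult_left_mono exp_ge_add_one_self) auto
      also have "... <= exp (- 1) * exp (g / 4)"
      proof -
       have "exp 1 * v <= 3 * v" using exp_le z by (intro mult_right_mono) auto
       then show ?thesis by (simp add: v_def)
      qed
      also have "... = exp (g / 4 - 1)" by (simp add: exp_add[symmetric])
      finally have "(exp (- 1) + v) ^ N <= exp (g / 4 - 1) ^ N" using z by (intro power_mono) (auto intro: add_nonneg_nonneg)
      then show ?thesis by (simp add: exp_of_nat_mult)
     qed
     have a2: "real (N + 1) <= (1 + 4 / g) * exp (real N * (g / 4))"
     proof -
      have "real N * (g / 4) <= exp (real N * (g / 4))" using exp_ge_add_one_self[of "real N * (g / 4)"] by linarith
      then have "4 / g * (real N * (g / 4)) <= 4 / g * exp (real N * (g / 4))" using g by (intro mult_left_mono) auto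
      moreover have "4 / g * (real N * (g / 4)) = real N" using g by simp
      moreover have "1 <= exp (real N * (g / 4))" using g by simp
      moreover have "(1 + 4 / g) * exp (real N * (g / 4)) = exp (real N * (g / 4)) + 4 / g * exp (real N * (g / 4))" by (simp only: distrib_right mult_1)
      moreover have "real (N + 1) = real N + 1" by simp
      ultimately show ?thesis by linarith
     qed
     have a3: "exp (x * real N) <= exp (real N * (g / 4))" using mult_left_mono[OF x(3), of "real N"] by (simp add: mult.commute)
     have b1: "2 * (exp (- 1) + v) ^ N * pc n m <= 2 * exp (real N * (g / 4 - 1)) * pc n m" using a1 by (intro mult_right_mono) auto
     have b2: "real (N + 1) * exp (real N * (1 - g)) <= ((1 + 4 / g) * exp (real N * (g / 4))) * exp (real N * (1 - g))" by (rule mult_right_mono[OF a2]) simp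
     have b3: "real (N + 1) * exp (real N * (1 - g)) * exp (x * real N) <= ((1 + 4 / g) * exp (real N * (g / 4))) * exp (real N * (1 - g)) * exp (real N * (g / 4))"
      by (rule mult_mono[OF b2 a3]) (use g in auto)
     have b4: "real (N + 1) * exp (real N * (1 - g)) * exp (x * real N) * (4 / x\<^sup>2) <= ((1 + 4 / g) * exp (real N * (g / 4))) * exp (real N * (1 - g)) * exp (real N * (g / 4)) * (4 / x\<^sup>2)"
      by (rule mult_right_mono[OF b3]) simp
     show ?thesis by (rule mult_mono[OF b1 b4]) auto
    qed
    also have "... = C * pc n m * (exp (real N * (g / 4 - 1)) * exp (real N * (g / 4)) * exp (real N * (1 - g)) * exp (real N * (g / 4)))"
     by (simp add: C_def)
    also have "exp (real N * (g / 4 - 1)) * exp (real N * (g / 4)) * exp (real N * (1 - g)) * exp (real N * (g / 4)) = exp (real N * (- g / 4))"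
     unfolding exp_add[symmetric] by (simp add: algebra_simps)
    also have "... = r ^ N" unfolding r_def by (rule exp_of_nat_mult)
    finally show ?thesis using True by simp
   qed
  qed
  also have "... = (\<Sum>N\<in>{K..n}. C * pc n m * r ^ N)"
   by (rule sum.mono_neutral_cong_right) auto
  also have "... = C * pc n m * (\<Sum>N\<in>{K..n}. r ^ N)" by (simp add: sum_distrib_left)
  also have "... <= C * pc n m * (r ^ K / (1 - r))" using C r by (intro mult_left_mono sum_geometric_tail) auto
  also have "... = C * (r ^ K / (1 - r)) * pc n m" by simp
  also have "... <= w * pc n m" using K(1) by (intro mult_right_mono) auto
  finally show ?case unfolding p B_def by simp
 qed
 show ?thesis using d(1) main by blast
qed

section \<open>Neighbourhoods in a hanging forest as balls of the skeleton tree\<close>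

definition skel_edges :: "nat list set list => (nat \<times> nat list) set set" where
 "skel_edges Ts = (\<Union>i<length Ts. (%e. (%w. (i, w)) ` e) ` tree_edges (Ts ! i)) \<union> {{(i, []), (Suc i, [])} | i. Suc i < length Ts}"

lemma skel_graph_eq: "skel_graph Ts = (nodes Ts, skel_edges Ts, (0, []))"
 by (auto simp: skel_graph_def skel_edges_def nodes_def)

lemma skel_edges_cases:
 assumes "{u, v} \<in> skel_edges Ts"
 obtains (tree) j w where "j < length Ts" "w \<in> Ts ! j" "w ~= []" "{u, v} = {(j, w), (j, butlast w)}"
  | (spine) j where "Suc j < length Ts" "{u, v} = {(j, []), (Suc j, [])}"
 using assms unfolding skel_edges_def tree_edges_def by fastforce

lemma skel_edges_tree: "j < length Ts ==> w \<in> Ts ! j ==> w ~= [] ==> {(j, w), (j, butlast w)} \<in> skel_edges Ts"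
proof -
 assume a: "j < length Ts" "w \<in> Ts ! j" "w ~= []"
 have "{w, butlast w} \<in> tree_edges (Ts ! j)" using a by (auto simp: tree_edges_def)
 moreover have "{(j, w), (j, butlast w)} = (%w. (j, w)) ` {w, butlast w}" by simp
 ultimately show ?thesis unfolding skel_edges_def using a(1) by blast
qed

lemma skel_edges_spine: "Suc j < length Ts ==> {(j, []), (Suc j, [])} \<in> skel_edges Ts"
 unfolding skel_edges_def by blast

lemma dist_ball_skel: "u \<in> dist_ball (nodes Ts) (skel_edges Ts) k (0, []) ==> u \<in> nodes Ts \<and> fst u + length (snd u) <= k"
proof (induction k arbitrary: u)
 case (Suc k)
 show ?case
 proof (cases "u \<in> dist_ball (nodes Ts) (skel_edges Ts) k (0, [])")
  case True
  then show ?thesis using Suc.IH[of u] by simp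
 next
  case False
  then obtain w where w: "u \<in> nodes Ts" "w \<in> dist_ball (nodes Ts) (skel_edges Ts) k (0, [])" "{w, u} \<in> skel_edges Ts"
   using Suc.prems by auto
  have IH: "fst w + length (snd w) <= k" using Suc.IH[OF w(2)] by blast
  from w(3) have "fst u + length (snd u) <= Suc (fst w + length (snd w))"
   by (cases rule: skel_edges_cases) (auto simp: doubleton_eq_iff)
  then show ?thesis using IH w(1) by simp
 qed
qed auto

text \<open>The spine of a vertex is its chain of parents; tree j holds the descendants of the j-th
  ancestor that are not reached through the ancestor before. So the vertices with parent g (j, p)
  are its children in tree j and, for p = [] and j > 0, the previous spine vertex. All nodes avoid
  K.\<close>

definition skel_emb :: "nat => nat set => nat set => (nat => nat) => nat list set list => (nat \<times> nat list => nat) => bool" where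
 "skel_emb l A K f Ts g \<longleftrightarrow> rtrees l Ts \<and> length Ts = Suc l \<and> inj_on g (nodes Ts) \<and> g ` nodes Ts \<subseteq> A - K \<and>
  (\<forall>j<l. f (g (j, [])) = g (Suc j, [])) \<and>
  (\<forall>j p. (j, p) \<in> inodes l Ts --> (\<forall>y. y \<in> A - K \<and> f y = g (j, p) \<longleftrightarrow>
    (\<exists>i<nch Ts (j, p). y = g (j, p @ [i])) \<or> p = [] \<and> j > 0 \<and> y = g (j - 1, []))) \<and>
  increasing l Ts g"

lemma skel_embD:
 assumes "skel_emb l A K f Ts g"
 shows "rtrees l Ts" "length Ts = Suc l" "inj_on g (nodes Ts)" "u \<in> nodes Ts ==> g u \<in> A - K"
  "j < l ==> f (g (j, [])) = g (Suc j, [])"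
  "(j, p) \<in> inodes l Ts ==> y \<in> A - K \<and> f y = g (j, p) \<longleftrightarrow>
    (\<exists>i<nch Ts (j, p). y = g (j, p @ [i])) \<or> p = [] \<and> j > 0 \<and> y = g (j - 1, [])"
  "increasing l Ts g"
 using assms unfolding skel_emb_def by blast+

lemma rtrees_nodes_snoc:
 assumes "rtrees l Ts"
 shows "(j, p @ [i]) \<in> nodes Ts \<longleftrightarrow> (j, p) \<in> inodes l Ts \<and> i < nch Ts (j, p)"
proof (cases "j < length Ts")
 case True
 then show ?thesis using rtreeD(3)[OF rtrees_nth[OF assms True], of p i] by (auto simp: nodes_def inodes_def nch_def inner_nodes_def)
qed (auto simp: nodes_def inodes_def)

lemma rtrees_nodes_Nil: "rtrees l Ts ==> j < length Ts ==> (j, []) \<in> nodes Ts"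
 using rtreeD(2)[OF rtrees_nth] by (simp add: nodes_def)

lemma skel_emb_parent:
 assumes e: "skel_emb l A K f Ts g" and n: "(j, p) \<in> nodes Ts" "p ~= []"
 shows "(j, butlast p) \<in> nodes Ts" "f (g (j, p)) = g (j, butlast p)"
proof -
 obtain q i where q: "p = q @ [i]" using n(2) by (cases p rule: rev_cases) auto
 have "(j, q) \<in> inodes l Ts" "i < nch Ts (j, q)" using rtrees_nodes_snoc[OF skel_embD(1)[OF e], of j q i] n q by auto
 then show "(j, butlast p) \<in> nodes Ts" "f (g (j, p)) = g (j, butlast p)"
  using skel_embD(6)[OF e, of j q "g (j, p)"] q inodes_subset[of l Ts] by auto
qed

lemma skel_emb_last:
 assumes e: "skel_emb l A K f Ts g" and n: "u \<in> nodes Ts"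
 shows "\<exists>t. (f ^^ t) (g u) = g (l, [])"
proof -
 obtain j p where u: "u = (j, p)" by (cases u)
 have 1: "(j, p) \<in> nodes Ts ==> (f ^^ length p) (g (j, p)) = g (j, [])" for p
 proof (induction p rule: rev_induct)
  case (snoc i p)
  have s: "f (g (j, p @ [i])) = g (j, p)" "(j, p) \<in> nodes Ts" using skel_emb_parent[OF e snoc.prems] by auto
  then show ?case using snoc.IH by (simp add: funpow_swap1)
 qed simp
 have j: "j <= l" using n u skel_embD(2)[OF e] by (auto simp: nodes_def)
 have 2: "j + t <= l ==> (f ^^ t) (g (j, [])) = g (j + t, [])" for t
  by (induction t) (auto simp: skel_embD(5)[OF e])
 have "(f ^^ (l - j + length p)) (g u) = g (l, [])" using 1[of p] 2[of "l - j"] n u j by (simp only: funpow_add o_apply) simp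
 then show ?thesis by blast
qed

text \<open>From every node the parents lead to the last spine vertex, so a return to a node would
  close a cycle.\<close>

lemma skel_emb_no_return:
 assumes e: "skel_emb l A K f Ts g" and p: "f \<in> pfun A K" and n: "u \<in> nodes Ts"
 shows "(f ^^ t) (f (g (l, []))) ~= g u"
proof
 assume a: "(f ^^ t) (f (g (l, []))) = g u"
 obtain t' where "(f ^^ t') (g u) = g (l, [])" using skel_emb_last[OF e n] by blast
 then have "(f ^^ Suc (t' + t)) (g (l, [])) = g (l, [])" using a by (simp add: funpow_swap1 funpow_add)
 moreover have "g (l, []) \<in> A - K" by (rule skel_embD(4)[OF e rtrees_nodes_Nil[OF skel_embD(1)[OF e]]]) (simp add: skel_embD(2)[OF e])
 ultimately show False using pfun_no_cycle[OF p, of "g (l, [])" "t' + t"] by blast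
qed

text \<open>The nodes avoid K, and the edges of D lie inside K, so at a node adjacency means being
  its parent or having it as parent.\<close>

lemma skel_emb_ball:
 assumes e: "skel_emb l A K f Ts g" and p: "f \<in> pfun A K" and D: "\<And>d. d \<in> D ==> d \<subseteq> K"
 shows "rooted_iso (ball l (skel_graph Ts)) (ball l (A, D \<union> pedges A K f, g (0, [])))"
 unfolding skel_graph_eq
proof (rule ball_iso_cover)
 note M = skel_embD[OF e]
 show "inj_on g (nodes Ts)" by (rule M(3))
 show "g ` nodes Ts \<subseteq> A" using M(4) by blast
 show "(0, []) \<in> nodes Ts" by (rule rtrees_nodes_Nil[OF M(1)]) (simp add: M(2))
 have up: "{g u, f (g u)} \<in> D \<union> pedges A K f" if "u \<in> nodes Ts" for u using M(4)[OF that] by (auto simp: pedges_def)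
 have nb: "w = f (g u) \<or> w \<in> A - K \<and> f w = g u" if u: "u \<in> nodes Ts" and "{g u, w} \<in> D \<union> pedges A K f" for u w
 proof -
  have "{g u, w} \<notin> D" using D[of "{g u, w}"] M(4)[OF u] by blast
  then have "{g u, w} \<in> pedges A K f" using that by blast
  then show ?thesis by (auto simp: pedges_def doubleton_eq_iff)
 qed
 show "{g u, g v} \<in> D \<union> pedges A K f" if uv: "u \<in> nodes Ts" "v \<in> nodes Ts" "{u, v} \<in> skel_edges Ts" for u v
 proof -
  have "g v = f (g u) \<or> g u = f (g v)"
   using uv(3)
  proof (cases rule: skel_edges_cases)
   case (tree j w)
   then consider "u = (j, w)" "v = (j, butlast w)" | "v = (j, w)" "u = (j, butlast w)" by (auto simp: doubleton_eq_iff)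
   then show ?thesis by cases (use skel_emb_parent(2)[OF e _ tree(3), of j] uv in auto)
  next
   case (spine j)
   then consider "u = (j, [])" "v = (Suc j, [])" | "v = (j, [])" "u = (Suc j, [])" by (auto simp: doubleton_eq_iff)
   then show ?thesis by cases (use M(5)[of j] spine(1) M(2) in auto)
  qed
  then show ?thesis using up[OF uv(1)] up[OF uv(2)] by (auto simp: insert_commute)
 qed
 have parent: "\<exists>v\<in>nodes Ts. f (g u) = g v \<and> {u, v} \<in> skel_edges Ts" if u: "u \<in> nodes Ts" "u ~= (l, [])" for u
 proof -
  obtain j p where jp: "u = (j, p)" by (cases u)
  have j: "j < Suc l" "p \<in> Ts ! j" using u jp M(2) by (auto simp: nodes_def)
  show ?thesis
  proof (cases "p = []")
   case True
   then have jl: "j < l" using u j jp by auto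
   have "(Suc j, []) \<in> nodes Ts" by (rule rtrees_nodes_Nil[OF M(1)]) (use jl M(2) in simp)
   then show ?thesis using M(5)[OF jl] skel_edges_spine[of j Ts] jl M(2) jp True by auto
  next
   case False
   then show ?thesis using skel_emb_parent[OF e, of j p] skel_edges_tree[of j Ts p] u jp j M(2) by auto
  qed
 qed
 show "\<exists>v\<in>nodes Ts. w = g v \<and> {u, v} \<in> skel_edges Ts"
  if k: "Suc k <= l" "u \<in> dist_ball (nodes Ts) (skel_edges Ts) k (0, [])" "{g u, w} \<in> D \<union> pedges A K f" for k u w
 proof -
  have u: "u \<in> nodes Ts" "fst u + length (snd u) < l" using dist_ball_skel[OF k(2)] k(1) by auto
  obtain j p where jp: "u = (j, p)" by (cases u)
  have inn: "(j, p) \<in> inodes l Ts" using u jp by (auto simp: inodes_def nodes_def inner_nodes_def)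
  from nb[OF u(1) k(3)] show ?thesis
  proof
   assume "w = f (g u)"
   moreover have "u ~= (l, [])" using u(2) by auto
   ultimately show ?thesis using parent[OF u(1)] by simp
  next
   assume "w \<in> A - K \<and> f w = g u"
   then consider i where "i < nch Ts (j, p)" "w = g (j, p @ [i])" | "p = []" "j > 0" "w = g (j - 1, [])"
    using M(6)[OF inn, of w] jp by auto
   then show ?thesis
   proof cases
    case 1
    have n: "(j, p @ [i]) \<in> nodes Ts" using rtrees_nodes_snoc[OF M(1), of j p i] inn 1 by simp
    then have "{(j, p @ [i]), (j, p)} \<in> skel_edges Ts" using skel_edges_tree[of j Ts "p @ [i]"] by (simp add: nodes_def)
    then show ?thesis using n 1 jp by (auto simp: insert_commute)
   next
    case 2
    have jl: "j < Suc l" using u(2) jp by simp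
    have n: "(j - 1, []) \<in> nodes Ts" by (rule rtrees_nodes_Nil[OF M(1)]) (use jl M(2) in simp)
    have "{(j - 1, []), (Suc (j - 1), [])} \<in> skel_edges Ts" by (rule skel_edges_spine) (use 2 jl M(2) in simp)
    then have "{u, (j - 1, [])} \<in> skel_edges Ts" using 2 jp by (simp add: insert_commute)
    then show ?thesis using n 2(3) by blast
   qed
  qed
 qed
 have adj: "{u, v} \<in> skel_edges Ts" if uv: "u \<in> nodes Ts" "v \<in> nodes Ts" "g v = f (g u)" for u v
 proof (cases "u = (l, [])")
  case True
  then show ?thesis using skel_emb_no_return[OF e p uv(2), of 0] uv(3) by simp
 next
  case False
  then obtain v' where v': "v' \<in> nodes Ts" "f (g u) = g v'" "{u, v'} \<in> skel_edges Ts" using parent[OF uv(1)] by blast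
  then have "v = v'" using inj_onD[OF M(3), of v v'] uv by simp
  then show ?thesis using v'(3) by simp
 qed
 show "{u, v} \<in> skel_edges Ts" if uv: "u \<in> dist_ball (nodes Ts) (skel_edges Ts) l (0, [])" "v \<in> dist_ball (nodes Ts) (skel_edges Ts) l (0, [])"
   "{g u, g v} \<in> D \<union> pedges A K f" for u v
 proof -
  have n: "u \<in> nodes Ts" "v \<in> nodes Ts" using dist_ball_skel[OF uv(1)] dist_ball_skel[OF uv(2)] by auto
  from nb[OF n(1) uv(3)] consider "g v = f (g u)" | "g u = f (g v)" by auto
  then show ?thesis by cases (use adj[of u v] adj[of v u] n in \<open>auto simp: insert_commute\<close>)
 qed
qed

text \<open>Unfold the sets of children along the spine of v. Iterating f leads from any node back
  to the spine, and the absence of cycles makes the labels distinct.\<close>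

lemma skel_emb_exists:
 assumes A: "finite A" and p: "f \<in> pfun A K" and v: "v \<in> A" and far: "\<And>j. j <= l ==> (f ^^ j) v \<notin> K"
 shows "\<exists>Ts g. skel_emb l A K f Ts g \<and> g (0, []) = v"
proof -
 \<comment> \<open>The previous spine vertex is excluded throughout the j-th tree, although it can
   occur only as a child of the j-th spine vertex.\<close>
 define c where "c = (%j x. sorted_list_of_set ({y\<in>A - K. f y = x} - (if j = 0 then {} else {(f ^^ (j - 1)) v})))"
 define Ts where "Ts = map (%j. tree_of (c j) l ((f ^^ j) v)) [0..<Suc l]"
 define g where "g = (%(j, p). walk (c j) ((f ^^ j) v) p)"
 have len: "length Ts = Suc l" by (simp add: Ts_def)
 have nth: "Ts ! j = tree_of (c j) l ((f ^^ j) v)" if "j < Suc l" for j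
  unfolding Ts_def using that by (simp del: upt_Suc)
 have T: "rtrees l Ts" by (auto simp: rtrees_def Ts_def rtree_tree_of)
 have setc: "set (c j x) = {y\<in>A - K. f y = x} - (if j = 0 then {} else {(f ^^ (j - 1)) v})" for j x
  unfolding c_def using A by (intro set_sorted_list_of_set) auto
 have dc: "distinct (c j x)" "sorted_wrt (<) (c j x)" for j x unfolding c_def by auto
 have g0: "g (j, []) = (f ^^ j) v" for j by (simp add: g_def)
 have gs: "g (j, p @ [i]) = c j (g (j, p)) ! i" for j p i by (simp add: g_def walk_snoc)
 have nch: "nch Ts (j, p) = length (c j (g (j, p)))" if "(j, p) \<in> inodes l Ts" for j p
  using that nchild_tree_of[of p "c j" l "(f ^^ j) v"] nth[of j] len by (simp add: inodes_def inner_nodes_def nch_def g_def)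
 have kid: "g (j, p @ [i]) \<in> set (c j (g (j, p)))" "(j, p) \<in> nodes Ts" "i < length (c j (g (j, p)))" if "(j, p @ [i]) \<in> nodes Ts" for j p i
 proof -
  have i: "(j, p) \<in> inodes l Ts" "i < nch Ts (j, p)" using that rtrees_nodes_snoc[OF T, of j p i] by auto
  then show "g (j, p @ [i]) \<in> set (c j (g (j, p)))" "i < length (c j (g (j, p)))" using nch gs by auto
  show "(j, p) \<in> nodes Ts" using i(1) inodes_subset by blast
 qed
 have par: "f (g (j, p @ [i])) = g (j, p)" if "(j, p @ [i]) \<in> nodes Ts" for j p i using kid(1)[OF that] by (simp add: setc)
 have jl: "j <= l" if "(j, p) \<in> nodes Ts" for j p using that len by (auto simp: nodes_def)
 have inAK: "g (j, p) \<in> A - K" if "(j, p) \<in> nodes Ts" for j p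
 proof (cases p rule: rev_cases)
  case Nil
  then show ?thesis using far[OF jl[OF that]] pfun_funpow_in[OF p v] by (simp add: g0)
 next
  case (snoc q i)
  then show ?thesis using kid(1)[of j q i] that by (simp add: setc)
 qed
 have iter: "(j, q @ r) \<in> nodes Ts ==> (f ^^ length r) (g (j, q @ r)) = g (j, q) \<and> (j, q) \<in> nodes Ts" for j q r
 proof (induction r rule: rev_induct)
  case (snoc i r)
  have 1: "(j, (q @ r) @ [i]) \<in> nodes Ts" using snoc.prems by simp
  have 2: "(j, q @ r) \<in> nodes Ts" using kid(2)[OF 1] .
  have "f (g (j, (q @ r) @ [i])) = g (j, q @ r)" by (rule par[OF 1])
  then show ?case using snoc.IH[OF 2] by (simp add: funpow_swap1)
 qed simp
 have nocyc: "a = b" if ab: "(f ^^ a) v = (f ^^ b) v" "a <= l" for a b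
 proof (rule ccontr)
  assume "a ~= b"
  then consider d where "b = a + Suc d" | d where "a = b + Suc d" by (metis less_iff_Suc_add linorder_neqE_nat add_Suc_right)
  then show False
  proof cases
   case 1
   have "(f ^^ Suc d) ((f ^^ a) v) = (f ^^ b) v" unfolding 1 by (simp only: funpow_add add.commute[of a] o_apply)
   then show False using pfun_no_cycle[OF p, of "(f ^^ a) v" d] ab far[OF ab(2)] pfun_funpow_in[OF p v, of a] by simp
  next
   case 2
   have "(f ^^ Suc d) ((f ^^ b) v) = (f ^^ a) v" unfolding 2 by (simp only: funpow_add add.commute[of b] o_apply)
   moreover have "(f ^^ b) v \<notin> K" by (rule far) (use 2 ab(2) in simp)
   ultimately show False using pfun_no_cycle[OF p, of "(f ^^ b) v" d] ab(1) pfun_funpow_in[OF p v, of b] by simp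
  qed
 qed
 have root: "q = [] \<and> i = j" if ij: "i <= l" "(j, q) \<in> nodes Ts" "(f ^^ i) v = g (j, q)" for i j q
 proof -
  have "(f ^^ length q) (g (j, q)) = (f ^^ j) v" using iter[of j "[]" q] ij by (simp add: g0)
  then have "(f ^^ (length q + i)) v = (f ^^ j) v" using ij(3)[symmetric] by (simp add: funpow_add)
  then have jj: "j = length q + i" using nocyc[of j "length q + i"] jl[OF ij(2)] by simp
  show ?thesis
  proof (cases q)
   case Nil
   then show ?thesis using jj by simp
  next
   case (Cons i0 r)
   have it: "(f ^^ length r) (g (j, [i0] @ r)) = g (j, [i0])" "(j, [i0]) \<in> nodes Ts" using iter[of j "[i0]" r] ij(2) Cons by auto
   have "g (j, [i0]) = (f ^^ (length r + i)) v" using it(1) ij(3)[symmetric] Cons by (simp add: funpow_add)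
   then have "g (j, [i0]) = (f ^^ (j - 1)) v" "j ~= 0" using jj Cons by auto
   moreover have "g (j, [] @ [i0]) \<in> set (c j (g (j, [])))" by (rule kid(1)) (use it(2) in simp)
   ultimately show ?thesis by (simp add: setc)
  qed
 qed
 have inj': "(j, p) \<in> nodes Ts ==> (j', p') \<in> nodes Ts ==> g (j, p) = g (j', p') ==> j = j' \<and> p = p'" for j p j' p'
 proof (induction p arbitrary: p' rule: rev_induct)
  case Nil
  then show ?case using root[of j j' p'] jl by (simp add: g0)
 next
  case (snoc i p)
  show ?case
  proof (cases p' rule: rev_cases)
   case Nil
   then show ?thesis using root[of j' j "p @ [i]"] snoc.prems jl by (simp add: g0)
  next
   case p': (snoc q i')
   have "g (j, p) = g (j', q)" using par[OF snoc.prems(1)] par[of j' q i'] snoc.prems p' by simp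
   then have eq: "j = j'" "p = q" using snoc.IH[of q] kid(2)[OF snoc.prems(1)] kid(2)[of j' q i'] snoc.prems p' by auto
   have "c j (g (j, p)) ! i = c j (g (j, p)) ! i'" using snoc.prems(3) p' eq gs by simp
   then have "i = i'" using kid(3)[OF snoc.prems(1)] kid(3)[of j' q i'] snoc.prems(2) p' eq nth_eq_iff_index_eq[OF dc(1)] by simp
   then show ?thesis using eq p' by simp
  qed
 qed
 have "skel_emb l A K f Ts g" unfolding skel_emb_def
 proof (intro conjI allI impI T len)
  show "inj_on g (nodes Ts)" using inj' by (intro inj_onI) auto
  show "g ` nodes Ts \<subseteq> A - K" using inAK by auto
  show "f (g (j, [])) = g (Suc j, [])" for j by (simp add: g0)
  show "increasing l Ts g" unfolding increasing_def
  proof (intro ballI, clarify)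
   fix j p i i' :: nat and q :: "nat list" assume q: "(j, q) \<in> inodes l Ts" and i: "i < i'" "i' < nch Ts (j, q)"
   show "g (j, q @ [i]) < g (j, q @ [i'])"
    using sorted_wrt_nth_less[OF dc(2) i(1)] i(2) by (simp add: gs nch[OF q])
  qed
  fix j p y assume i: "(j, p) \<in> inodes l Ts"
  have n: "(j, p) \<in> nodes Ts" using i inodes_subset by blast
  have "(\<exists>i<nch Ts (j, p). y = g (j, p @ [i])) \<longleftrightarrow> y \<in> set (c j (g (j, p)))"
   unfolding nch[OF i] gs in_set_conv_nth by auto
  moreover have "p = [] \<and> j > 0 \<and> y = g (j - 1, []) \<longleftrightarrow> j > 0 \<and> y = (f ^^ (j - 1)) v \<and> f y = g (j, p)"
  proof (cases "j > 0")
   case True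
   have e: "f ((f ^^ (j - 1)) v) = (f ^^ j) v" using True by (cases j) auto
   show ?thesis
   proof
    assume "p = [] \<and> j > 0 \<and> y = g (j - 1, [])"
    then show "j > 0 \<and> y = (f ^^ (j - 1)) v \<and> f y = g (j, p)" using e by (simp add: g0)
   next
    assume a: "j > 0 \<and> y = (f ^^ (j - 1)) v \<and> f y = g (j, p)"
    then have y: "y = (f ^^ (j - 1)) v" "f y = g (j, p)" by blast+
    have "(f ^^ j) v = g (j, p)" by (rule trans[OF e[symmetric] y(2)[unfolded y(1)]])
    then have "p = []" using root[of j j p] jl[OF n] n by blast
    then show "p = [] \<and> j > 0 \<and> y = g (j - 1, [])" using a by (simp add: g0)
   qed
  qed simp
  moreover have "(f ^^ (j - 1)) v \<in> A - K" using far[of "j - 1"] jl[OF n] pfun_funpow_in[OF p v] by simp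
  ultimately show "y \<in> A - K \<and> f y = g (j, p) \<longleftrightarrow> (\<exists>i<nch Ts (j, p). y = g (j, p @ [i])) \<or> p = [] \<and> j > 0 \<and> y = g (j - 1, [])"
   by (auto simp: setc split: if_splits)
 qed
 then show ?thesis using g0[of 0] by (intro exI[of _ Ts] exI[of _ g]) simp
qed

text \<open>With the labels fixed, delete the inner nodes and add the other nodes to the roots. What
  remains to be known is this forest and the parent of the last spine vertex, whose root lies in K
  by \<open>skel_emb_no_return\<close>; such pairs are counted by
  \<open>card_rooted_in_eq\<close>.\<close>

lemma card_skel_fibre:
 assumes A: "finite A" and K: "K \<subseteq> A" "K ~= {}" and e: "skel_emb l A K g0 Ts h"
 shows "card {g\<in>pfun A K. \<exists>q. skel_emb l A K g Ts q \<and> (\<forall>u\<in>nodes Ts. q u = h u)}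
  <= card K * (card A - card (inodes l Ts)) ^ (card A - card K - card (nodes Ts))"
proof -
 define I where "I = h ` inodes l Ts"
 define Nd where "Nd = h ` nodes Ts"
 \<comment> \<open>The nodes at depth l keep the trees below them and become roots.\<close>
 define R where "R = K \<union> (Nd - I)"
 let ?S = "{g\<in>pfun A K. \<exists>q. skel_emb l A K g Ts q \<and> (\<forall>u\<in>nodes Ts. q u = h u)}"
 let ?f = "%g::nat => nat. (%z. if z \<in> K \<union> Nd then z else g z)"
 have T: "rtrees l Ts" "length Ts = Suc l" and inj: "inj_on h (nodes Ts)" using skel_embD(1,2,3)[OF e] .
 have Nd: "Nd \<subseteq> A - K" using skel_embD(4)[OF e] unfolding Nd_def by blast
 have INd: "I \<subseteq> Nd" using inodes_subset unfolding I_def Nd_def by blast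
 have ln: "(l, []) \<in> nodes Ts" by (rule rtrees_nodes_Nil[OF T(1)]) (simp add: T(2))
 have SP: "g \<in> pfun A K" "\<And>j p. (j, p) \<in> nodes Ts ==> p ~= [] ==> g (h (j, p)) = h (j, butlast p)"
   "\<And>j. j < l ==> g (h (j, [])) = h (Suc j, [])"
   "\<And>y. y \<in> A - K ==> g y \<in> I ==> y \<in> Nd" "\<And>u t. u \<in> nodes Ts ==> (g ^^ t) (g (h (l, []))) ~= h u" if S: "g \<in> ?S" for g
 proof -
  obtain q where p: "g \<in> pfun A K" and s: "skel_emb l A K g Ts q" and eq: "\<And>u. u \<in> nodes Ts ==> q u = h u" using S by blast
  note M = skel_embD[OF s]
  show "g \<in> pfun A K" by (rule p)
  show "g (h (j, p)) = h (j, butlast p)" if "(j, p) \<in> nodes Ts" "p ~= []" for j p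
   using skel_emb_parent[OF s that] eq that(1) by simp
  show "g (h (j, [])) = h (Suc j, [])" if j: "j < l" for j
  proof -
   have "(j, []) \<in> nodes Ts" "(Suc j, []) \<in> nodes Ts" using j T(2) by (auto intro!: rtrees_nodes_Nil[OF T(1)])
   then show ?thesis using M(5)[OF j] eq by simp
  qed
  show "(g ^^ t) (g (h (l, []))) ~= h u" if "u \<in> nodes Ts" for u t
   using skel_emb_no_return[OF s p that, of t] eq[OF that] eq[OF ln] by simp
  show "y \<in> Nd" if y: "y \<in> A - K" "g y \<in> I" for y
  proof -
   obtain j p where jp: "(j, p) \<in> inodes l Ts" "g y = h (j, p)" using y(2) unfolding I_def by auto
   have jpn: "(j, p) \<in> nodes Ts" using jp(1) inodes_subset by blast
   have "y \<in> A - K \<and> g y = q (j, p)" using y(1) jp(2) eq[OF jpn] by simp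
   then consider i where "i < nch Ts (j, p)" "y = q (j, p @ [i])" | "j > 0" "y = q (j - 1, [])"
    using M(6)[OF jp(1), of y] by blast
   then show ?thesis
   proof cases
    case 1
    then have "(j, p @ [i]) \<in> nodes Ts" using rtrees_nodes_snoc[OF T(1)] jp(1) by simp
    then show ?thesis using 1(2) eq unfolding Nd_def by simp
   next
    case 2
    have "j < length Ts" using jpn by (simp add: nodes_def)
    then have "(j - 1, []) \<in> nodes Ts" by (intro rtrees_nodes_Nil[OF T(1)]) simp
    then show ?thesis using 2(2) eq unfolding Nd_def by simp
   qed
  qed
 qed
 let ?D = "{(g, y). g \<in> pfun (A - I) R \<and> y \<in> A - I \<and> (\<exists>r\<in>K. is_root R g y r)}"
 have "card ?S <= card ?D"
 proof (rule card_inj_on_le[where f = "%g. (?f g, g (h (l, [])))"])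
  show "inj_on (%g. (?f g, g (h (l, [])))) ?S"
  proof (rule inj_onI, rule ext)
   fix g g' x assume S: "g \<in> ?S" "g' \<in> ?S" and eq: "(?f g, g (h (l, []))) = (?f g', g' (h (l, [])))"
   have e1: "?f g = ?f g'" and e2: "g (h (l, [])) = g' (h (l, []))" using eq by blast+
   consider "x \<in> Nd" | "x \<in> K" | "x \<notin> K \<union> Nd" by blast
   then show "g x = g' x"
   proof cases
    case 1
    then obtain j p where jp: "(j, p) \<in> nodes Ts" "x = h (j, p)" unfolding Nd_def by auto
    have "j <= l" using jp T(2) by (auto simp: nodes_def)
    then consider "p ~= []" | "p = []" "j < l" | "p = []" "j = l" by linarith
    then show ?thesis
     by cases (use SP(2)[OF S(1) jp(1)] SP(2)[OF S(2) jp(1)] SP(3)[OF S(1)] SP(3)[OF S(2)] e2 jp(2) in auto)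
   next
    case 2
    then show ?thesis using pfunD(1)[OF SP(1)[OF S(1)], of x] pfunD(1)[OF SP(1)[OF S(2)], of x] by simp
   next
    case 3
    then show ?thesis using fun_cong[OF e1, of x] by simp
   qed
  qed
  show "(%g. (?f g, g (h (l, [])))) ` ?S \<subseteq> ?D"
  proof (rule image_subsetI)
   fix g assume S: "g \<in> ?S"
   note P = SP[OF S]
   have lA: "h (l, []) \<in> A" "h (l, []) \<in> A - K" using Nd ln unfolding Nd_def by auto
   have nr: "(g ^^ t) (g (h (l, []))) \<notin> Nd" for t using P(5)[of _ t] unfolding Nd_def by blast
   obtain d :: "nat => nat" where d: "\<And>x. x \<in> A - K ==> d (g x) < d x" using pfunD(3)[OF P(1)] by blast
   have "?f g \<in> pfun (A - I) R" unfolding pfun_def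
   proof (clarify, intro conjI allI impI ballI exI[of _ d])
    fix x assume "x \<notin> A - I - R"
    then have "x \<in> K \<union> Nd \<or> x \<notin> A" using INd by (auto simp: R_def)
    then show "?f g x = x" using pfunD(1)[OF P(1), of x] by auto
   next
    fix x assume x: "x \<in> A - I"
    show "?f g x \<in> A - I"
    proof (cases "x \<in> K \<union> Nd")
     case False
     then have "g x \<notin> I" using P(4)[of x] x by blast
     then show ?thesis using False x pfunD(2)[OF P(1), of x] by simp
    qed (use x in simp)
   next
    fix x assume "x \<in> A - I - R"
    then have "x \<in> A - K" "x \<notin> K \<union> Nd" by (auto simp: R_def)
    then show "d (?f g x) < d x" using d[of x] by simp
   qed
   moreover have "g (h (l, [])) \<in> A - I" using nr[of 0] INd pfunD(2)[OF P(1) lA(1)] by auto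
   moreover have "\<exists>r\<in>K. is_root R (?f g) (g (h (l, []))) r"
    using is_root_detach_neq[OF P(1) lA(2) pfunD(2)[OF P(1) lA(1)] nr] by (auto simp: is_root_def R_def)
   ultimately show "(?f g, g (h (l, []))) \<in> ?D" by simp
  qed
  show "finite ?D" by (rule finite_subset[of _ "pfun (A - I) R \<times> (A - I)"]) (use A finite_pfun[of "A - I"] in auto)
 qed
 also have "... = card K * card (A - I) ^ card (A - I - R)"
  by (rule card_rooted_in_eq) (use A K Nd INd in \<open>auto simp: R_def\<close>)
 also have "card (A - I) = card A - card (inodes l Ts)"
 proof -
  have "I \<subseteq> A" using INd Nd by blast
  moreover from this have "finite I" using A by (rule finite_subset)
  moreover have "card I = card (inodes l Ts)" unfolding I_def by (rule card_image[OF inj_on_subset[OF inj inodes_subset]])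
  ultimately show ?thesis by (simp add: card_Diff_subset)
 qed
 also have "card (A - I - R) = card A - card K - card (nodes Ts)"
 proof -
  have eq: "A - I - R = A - (K \<union> Nd)" using INd by (auto simp: R_def)
  have f: "finite K" "finite Nd" using K Nd A finite_subset by blast+
  have "card (K \<union> Nd) = card K + card Nd" by (rule card_Un_disjoint[OF f]) (use Nd in blast)
  moreover have "card Nd = card (nodes Ts)" unfolding Nd_def by (rule card_image[OF inj])
  moreover have "K \<union> Nd \<subseteq> A" using K Nd by blast
  ultimately show ?thesis unfolding eq using f by (simp add: card_Diff_subset)
 qed
 finally show ?thesis .
qed

section \<open>The local limit of a uniform forest hanging from a small set\<close>

definition skel_pairs :: "nat => nat set => nat set => nat list set list => ((nat => nat) \<times> nat) set" where
 "skel_pairs l A K Ts = {(p, v). p \<in> pfun A K \<and> v \<in> A \<and> (\<exists>f. skel_emb l A K p Ts f \<and> f (0, []) = v)}"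

lemma card_pfun_pairs:
 assumes "finite A" "K \<subseteq> A" "K ~= {}"
 shows "card (pfun A K \<times> A) = card K * card A ^ (card A - card K)"
 using card_pfun[OF assms] card_Diff_subset[OF finite_subset[OF assms(2,1)] assms(2)] by (simp add: card_cartesian_product mult.commute)

lemma finite_skel_pairs: "finite A ==> finite (skel_pairs l A K Ts)"
 by (rule finite_subset[of _ "pfun A K \<times> A"]) (auto simp: skel_pairs_def finite_pfun)

text \<open>Let there be N vertices, k roots, h nodes and i inner nodes. Relative to the total k
  N^(N-k), the labels and the fibre give the product of all 1/nch! times (1 - i/N)^(N-k-h), about
  exp(-i): a factor 1/e per inner node, as for Poisson(1) offspring. The error h(h + k)/N in the
  exponent is small if k/N is and N is large.\<close>

lemma card_skel_pairs:
 assumes A: "finite A" and K: "K \<subseteq> A" "K ~= {}" and T: "rtrees l Ts" "length Ts = Suc l"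
 shows "real (card (skel_pairs l A K Ts)) <= pmf (replicate_pmf (Suc l) (gw_trunc 1 l)) Ts
  * exp (real (card (nodes Ts) * (card (nodes Ts) + card K)) / real (card A)) * real (card (pfun A K \<times> A))"
proof (cases "skel_pairs l A K Ts = {}")
 case False
 let ?X = "skel_pairs l A K Ts" and ?N = "card A" and ?k = "card K" and ?h = "card (nodes Ts)" and ?i = "card (inodes l Ts)"
 let ?P = "\<Prod>q\<in>inodes l Ts. 1 / fact (nch Ts q) :: real"
 define F where "F = (%(p, v). SOME g. skel_emb l A K p Ts g \<and> g (0, []) = v)"
 have F: "skel_emb l A K (fst x) Ts (F x)" "F x (0, []) = snd x" "fst x \<in> pfun A K" if "x \<in> ?X" for x
 proof -
  obtain p v where x: "x = (p, v)" by (cases x)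
  then have "\<exists>g. skel_emb l A K p Ts g \<and> g (0, []) = v" using that by (simp add: skel_pairs_def)
  from someI_ex[OF this] show "skel_emb l A K (fst x) Ts (F x)" "F x (0, []) = snd x" by (auto simp: x F_def)
  show "fst x \<in> pfun A K" using that x by (simp add: skel_pairs_def)
 qed
 have n0: "(0, []) \<in> nodes Ts" by (rule rtrees_nodes_Nil[OF T(1)]) (simp add: T(2))
 obtain x0 where x0: "x0 \<in> ?X" using False by blast
 have hk: "?h + ?k <= ?N"
 proof -
  have s: "F x0 ` nodes Ts \<subseteq> A - K" using skel_embD(4)[OF F(1)[OF x0]] by blast
  have "?h = card (F x0 ` nodes Ts)" by (rule card_image[symmetric, OF skel_embD(3)[OF F(1)[OF x0]]])
  also have "... <= card (A - K)" by (rule card_mono[OF _ s]) (use A in simp)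
  finally show ?thesis using card_Diff_subset[OF finite_subset[OF K(1) A] K(1)] card_mono[OF A K(1)] by simp
 qed
 have ih: "?i <= ?h" by (rule card_mono[OF finite_nodes[OF T(1)] inodes_subset])
 have k0: "?k > 0" using K finite_subset[OF K(1) A] by (simp add: card_gt_0_iff)
 have N0: "real ?N > 0" using hk k0 by simp
 have fib: "card {x\<in>?X. tdata l Ts (F x) = tdata l Ts (F y)} <= ?k * (?N - ?i) ^ (?N - ?k - ?h)" if y: "y \<in> ?X" for y
 proof -
  have eq: "F x u = F y u" if "x \<in> ?X" "tdata l Ts (F x) = tdata l Ts (F y)" "u \<in> nodes Ts" for x u
   using tdata_eq[OF T(1) skel_embD(7)[OF F(1)[OF that(1)]] skel_embD(7)[OF F(1)[OF y]] that(2), of "fst u" "snd u"] that(3) by simp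
  have "card {x\<in>?X. tdata l Ts (F x) = tdata l Ts (F y)} <=
   card {p\<in>pfun A K. \<exists>r. skel_emb l A K p Ts r \<and> (\<forall>u\<in>nodes Ts. r u = F y u)}"
  proof (rule card_inj_on_le[where f = fst])
   show "inj_on fst {x\<in>?X. tdata l Ts (F x) = tdata l Ts (F y)}"
   proof (rule inj_onI)
    fix x x' assume x: "x \<in> {x\<in>?X. tdata l Ts (F x) = tdata l Ts (F y)}" "x' \<in> {x\<in>?X. tdata l Ts (F x) = tdata l Ts (F y)}" "fst x = fst x'"
    then have "snd x = snd x'" using F(2)[of x] F(2)[of x'] eq[of x, OF _ _ n0] eq[of x', OF _ _ n0] by simp
    then show "x = x'" using x(3) by (simp add: prod_eq_iff)
   qed
   show "fst ` {x\<in>?X. tdata l Ts (F x) = tdata l Ts (F y)} \<subseteq> {p\<in>pfun A K. \<exists>r. skel_emb l A K p Ts r \<and> (\<forall>u\<in>nodes Ts. r u = F y u)}"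
    using F(1,3) eq by blast
  qed (use finite_pfun[OF A] in simp)
  also have "... <= ?k * (?N - ?i) ^ (?N - ?k - ?h)" by (rule card_skel_fibre[OF A K F(1)[OF y]])
  finally show ?thesis .
 qed
 have "real (card ?X) <= real ?N ^ ?h * ?P * real (?k * (?N - ?i) ^ (?N - ?k - ?h))"
 proof (rule count_labellings[OF T(1) A refl finite_skel_pairs[OF A]])
  show "increasing l Ts (F x)" if "x \<in> ?X" for x using skel_embD(7)[OF F(1)[OF that]] .
  show "F x q \<in> A" if "x \<in> ?X" "q \<in> nodes Ts" for x q using skel_embD(4)[OF F(1)[OF that(1)] that(2)] by blast
 qed (rule fib)
 also have "... = real ?N ^ ?h * ?P * (?k * real (?N - ?i) ^ (?N - ?k - ?h))" by simp
 also have "... <= real ?N ^ ?h * ?P * (?k * (real ?N ^ (?N - ?k - ?h) * (exp (- real ?i) * exp (real (?h * (?h + ?k)) / ?N))))"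
 proof (intro mult_left_mono)
  let ?c = "?N - ?k - ?h"
  have "real (?N - ?i) = real ?N * (1 - real ?i / real ?N)" using ih hk N0 by (simp add: of_nat_diff field_simps)
  also have "... <= real ?N * exp (- (real ?i / real ?N))" using N0 exp_ge_add_one_self[of "- (real ?i / real ?N)"] by (intro mult_left_mono) auto
  finally have "real (?N - ?i) ^ ?c <= (real ?N * exp (- (real ?i / real ?N))) ^ ?c" by (intro power_mono) auto
  also have "... = real ?N ^ ?c * exp (real ?c * (- (real ?i / real ?N)))" by (simp only: power_mult_distrib exp_of_nat_mult)
  also have "... <= real ?N ^ ?c * (exp (- real ?i) * exp (real (?h * (?h + ?k)) / ?N))"
  proof (intro mult_left_mono)
   have c: "real ?c = real ?N - real (?h + ?k)" using hk by (simp add: of_nat_diff)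
   have "real ?c * (- (real ?i / real ?N)) = - real ?i + real ?i * real (?h + ?k) / real ?N" unfolding c using N0 by (simp add: field_simps)
   also have "... <= - real ?i + real ?h * real (?h + ?k) / real ?N"
    using ih N0 by (intro add_left_mono divide_right_mono mult_right_mono) auto
   finally have "real ?c * (- (real ?i / real ?N)) <= - real ?i + real (?h * (?h + ?k)) / real ?N" by simp
   then show "exp (real ?c * (- (real ?i / real ?N))) <= exp (- real ?i) * exp (real (?h * (?h + ?k)) / ?N)"
    unfolding exp_add[symmetric] by simp
  qed simp
  finally show "real (?N - ?i) ^ ?c <= real ?N ^ ?c * (exp (- real ?i) * exp (real (?h * (?h + ?k)) / ?N))" .
 qed (auto intro!: mult_nonneg_nonneg prod_nonneg)
 also have "... = (?P * exp (- real ?i)) * exp (real (?h * (?h + ?k)) / ?N) * (?k * (real ?N ^ ?h * real ?N ^ (?N - ?k - ?h)))"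
  by (simp only: ac_simps)
 also have "real ?N ^ ?h * real ?N ^ (?N - ?k - ?h) = real ?N ^ (?N - ?k)" unfolding power_add[symmetric] using hk by simp
 also have "real ?k * real ?N ^ (?N - ?k) = real (card (pfun A K \<times> A))" unfolding card_pfun_pairs[OF A K] by simp
 also have "?P * exp (- real ?i) = (\<Prod>q\<in>inodes l Ts. exp (- 1) / fact (nch Ts q))"
 proof -
  have eq: "exp (- real ?i) = (\<Prod>q\<in>inodes l Ts. exp (- 1 :: real))" by (simp add: exp_of_nat_mult[symmetric])
  show ?thesis unfolding eq prod.distrib[symmetric] by simp
 qed
 also have "(\<Prod>q\<in>inodes l Ts. exp (- 1) / fact (nch Ts q)) * exp (real (?h * (?h + ?k)) / ?N) * real (card (pfun A K \<times> A))
  <= pmf (replicate_pmf (Suc l) (gw_trunc 1 l)) Ts * exp (real (?h * (?h + ?k)) / ?N) * real (card (pfun A K \<times> A))"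
  using prod_inodes_le_pmf[OF T(1)] T(2) by (intro mult_right_mono) auto
 finally show ?thesis .
qed simp

text \<open>If the pairs in X are encoded by D such that a code determines the second component and
 the values of the parent function on b further vertices, then X is small, because prescribing
 b parents turns b vertices into additional roots.\<close>

lemma card_prescribed_le:
 assumes A: "finite A" and K: "K \<subseteq> A" "K ~= {}" and D: "finite D" "f ` X \<subseteq> D" and X: "finite X" "\<And>x. x \<in> X ==> fst x \<in> pfun A K"
  and S: "\<And>x. x \<in> X ==> S (f x) \<subseteq> A - K \<and> card (S (f x)) = b"
  and det: "\<And>x y. x \<in> X ==> y \<in> X ==> f x = f y ==> snd x = snd y \<and> (\<forall>z\<in>S (f x). fst x z = fst y z)"
 shows "card A ^ b * (card A * card X) <= card D * ((card K + b) * card A ^ (card A - card K))"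
proof (cases "X = {}")
 case False
 let ?N = "card A" and ?k = "card K"
 have b: "b <= ?N - ?k"
 proof -
  obtain x where "x \<in> X" using False by blast
  then have "b <= card (A - K)" using S[of x] card_mono[of "A - K" "S (f x)"] A by auto
  then show ?thesis using card_Diff_subset[OF finite_subset[OF K(1) A] K(1)] by simp
 qed
 have cell: "?N * card {x\<in>X. f x = s} <= (?k + b) * ?N ^ (?N - ?k - b)" for s
 proof (cases "\<exists>y\<in>X. f y = s")
  case True
  then obtain y where y: "y \<in> X" "f y = s" by blast
  have s: "S s \<subseteq> A - K" "card (S s) = b" using S[OF y(1)] y(2) by auto
  have "card {x\<in>X. f x = s} <= card {p\<in>pfun A K. \<forall>z\<in>S s. p z = fst y z}"
  proof (rule card_inj_on_le[where f = fst])
   show "inj_on fst {x\<in>X. f x = s}"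
   proof (rule inj_onI)
    fix x x' assume x: "x \<in> {x\<in>X. f x = s}" "x' \<in> {x\<in>X. f x = s}" "fst x = fst x'"
    then show "x = x'" using det[of x x'] by (simp add: prod_eq_iff)
   qed
   show "fst ` {x\<in>X. f x = s} \<subseteq> {p\<in>pfun A K. \<forall>z\<in>S s. p z = fst y z}"
   proof (rule image_subsetI)
    fix x assume x: "x \<in> {x\<in>X. f x = s}"
    then have "\<forall>z\<in>S s. fst x z = fst y z" using det[of x y] y by simp
    then show "fst x \<in> {p\<in>pfun A K. \<forall>z\<in>S s. p z = fst y z}" using x X(2) by simp
   qed
  qed (use finite_pfun[OF A] in simp)
  also have "... <= card (pfun A (K \<union> S s))" by (rule card_pfun_prescribed[OF A])
  finally have "?N * card {x\<in>X. f x = s} <= ?N * card (pfun A (K \<union> S s))" by simp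
  also have "... = card (K \<union> S s) * ?N ^ card (A - (K \<union> S s))" by (rule card_pfun[OF A]) (use K s in auto)
  also have "card (K \<union> S s) = ?k + b"
   using card_Un_disjoint[of K "S s"] s finite_subset[OF K(1) A] finite_subset[OF s(1)] A by auto
  also have "card (A - (K \<union> S s)) = ?N - ?k - b"
  proof -
   have "K \<union> S s \<subseteq> A" using K s by blast
   then show ?thesis using \<open>card (K \<union> S s) = ?k + b\<close> card_Diff_subset[of "K \<union> S s" A] finite_subset[of "K \<union> S s" A] A by simp
  qed
  finally show ?thesis .
 next
  case False
  then have "{x\<in>X. f x = s} = {}" by blast
  then show ?thesis by (simp only: card.empty mult_0_right le0)
 qed
 have "card X = card (\<Union>s\<in>D. {x\<in>X. f x = s})" by (rule arg_cong[of _ _ card]) (use D in auto)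
 also have "... <= (\<Sum>s\<in>D. card {x\<in>X. f x = s})" by (rule card_UN_le[OF D(1)])
 finally have "?N * card X <= ?N * (\<Sum>s\<in>D. card {x\<in>X. f x = s})" by simp
 also have "... = (\<Sum>s\<in>D. ?N * card {x\<in>X. f x = s})" by (rule sum_distrib_left)
 also have "... <= (\<Sum>s\<in>D. (?k + b) * ?N ^ (?N - ?k - b))" by (rule sum_mono[OF cell])
 also have "... = card D * ((?k + b) * ?N ^ (?N - ?k - b))" by simp
 finally have "?N ^ b * (?N * card X) <= ?N ^ b * (card D * ((?k + b) * ?N ^ (?N - ?k - b)))" by simp
 also have "... = card D * ((?k + b) * (?N ^ b * ?N ^ (?N - ?k - b)))" by (simp only: ac_simps)
 also have "?N ^ b * ?N ^ (?N - ?k - b) = ?N ^ (?N - ?k)" unfolding power_add[symmetric] using b by (simp only: le_add_diff_inverse)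
 finally show ?thesis .
qed simp

text \<open>Split by the first time i at which the chain of parents meets K. The i vertices before
  are distinct non-roots, and the chain prescribes their parents; with N^i k possible chains, a
  share of at most (k + i)/N remains.\<close>

lemma card_hit_roots:
 assumes A: "finite A" and K: "K \<subseteq> A" "K ~= {}"
 shows "card A * card {(g, v). g \<in> pfun A K \<and> v \<in> A \<and> (\<exists>j\<le>l. (g ^^ j) v \<in> K)} <= Suc l * ((card K + l) * card (pfun A K \<times> A))"
proof -
 let ?N = "card A" and ?k = "card K"
 have N0: "?N > 0" using K A by (auto simp: card_gt_0_iff)
 define X where "X = (%i. {(g, v). g \<in> pfun A K \<and> v \<in> A \<and> (g ^^ i) v \<in> K \<and> (\<forall>j<i. (g ^^ j) v \<notin> K)})"
 have fX: "finite (X i)" for i by (rule finite_subset[of _ "pfun A K \<times> A"]) (auto simp: X_def finite_pfun A)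
 have Xi: "?N * card (X i) <= (?k + i) * card (pfun A K \<times> A)" for i
 proof -
  let ?f = "%(g, v). (map (%t. (g ^^ t) v) [0..<i], (g ^^ i) v)"
  let ?D = "{xs. set xs \<subseteq> A \<and> length xs = i} \<times> K"
  have "?N ^ i * (?N * card (X i)) <= card ?D * ((?k + i) * ?N ^ (?N - ?k))"
  proof (rule card_prescribed_le[OF A K _ _ fX, where f = ?f and S = "%(xs, r). set xs"])
   show "finite ?D" using finite_lists_length_eq[OF A] finite_subset[OF K(1) A] by blast
   show "?f ` X i \<subseteq> ?D" by (auto simp: X_def pfun_funpow_in)
   show "fst x \<in> pfun A K" if "x \<in> X i" for x using that by (auto simp: X_def)
   fix x assume x: "x \<in> X i"
   obtain g v where xv: "x = (g, v)" by (cases x)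
   have p: "g \<in> pfun A K" "v \<in> A" "\<And>j. j < i ==> (g ^^ j) v \<notin> K" using x xv by (auto simp: X_def)
   have inj: "inj_on (%t. (g ^^ t) v) {..<i}"
   proof (rule inj_onI)
    have no: "(g ^^ a) v ~= (g ^^ b) v" if "a < b" "b < i" for a b
    proof -
     obtain d where d: "b = Suc (a + d)" using \<open>a < b\<close> less_iff_Suc_add by blast
     have "(g ^^ b) v = (g ^^ Suc d) ((g ^^ a) v)" unfolding d by (simp add: funpow_add add.commute[of a])
     moreover have "(g ^^ a) v \<in> A - K" using p(3)[of a] pfun_funpow_in[OF p(1,2), of a] that by simp
     ultimately show ?thesis using pfun_no_cycle[OF p(1), of "(g ^^ a) v" d] by auto
    qed
    fix a b assume "a \<in> {..<i}" "b \<in> {..<i}" "(g ^^ a) v = (g ^^ b) v"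
    then show "a = b" using no[of a b] no[of b a] by (cases a b rule: linorder_cases) auto
   qed
   show "(case ?f x of (xs, r) => set xs) \<subseteq> A - K \<and> card (case ?f x of (xs, r) => set xs) = i"
    using p pfun_funpow_in[OF p(1,2)] card_image[OF inj] by (auto simp: xv atLeast0LessThan)
   fix y assume y: "y \<in> X i" and eq: "?f x = ?f y"
   obtain h w where yw: "y = (h, w)" by (cases y)
   have E: "(g ^^ t) v = (h ^^ t) w" if "t <= i" for t using eq that by (cases "t = i") (auto simp: xv yw)
   have "g z = h z" if z: "z \<in> (%t. (g ^^ t) v) ` {0..<i}" for z
   proof -
    obtain t where t: "t < i" "z = (g ^^ t) v" using z by auto
    then show ?thesis using E[of "Suc t"] E[of t] by simp
   qed
   moreover have "v = w" using E[of 0] by simp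
   ultimately show "snd x = snd y \<and> (\<forall>z\<in>(case ?f x of (xs, r) => set xs). fst x z = fst y z)" by (auto simp: xv yw)
  qed
  also have "card ?D = ?N ^ i * ?k" using card_lists_length_eq[OF A] by (simp add: card_cartesian_product)
  finally have "?N ^ i * (?N * card (X i)) <= ?N ^ i * ((?k + i) * (?k * ?N ^ (?N - ?k)))" by (simp only: ac_simps)
  then show ?thesis using N0 unfolding card_pfun_pairs[OF A K] by simp
 qed
 have "{(g, v). g \<in> pfun A K \<and> v \<in> A \<and> (\<exists>j\<le>l. (g ^^ j) v \<in> K)} \<subseteq> (\<Union>i\<le>l. X i)"
 proof clarify
  fix g v j assume p: "g \<in> pfun A K" "v \<in> A" and j: "j <= l" "(g ^^ j) v \<in> K"
  define i where "i = (LEAST i. (g ^^ i) v \<in> K)"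
  have "(g ^^ i) v \<in> K" "i <= j"
   unfolding i_def by (rule LeastI[of "%i. (g ^^ i) v \<in> K", OF j(2)], rule Least_le[of "%i. (g ^^ i) v \<in> K", OF j(2)])
  moreover have "(g ^^ t) v \<notin> K" if "t < i" for t using not_less_Least[of t] that unfolding i_def by blast
  ultimately have "(g, v) \<in> X i" "i <= l" using p j by (auto simp: X_def)
  then show "(g, v) \<in> (\<Union>i\<le>l. X i)" by blast
 qed
 then have "card {(g, v). g \<in> pfun A K \<and> v \<in> A \<and> (\<exists>j\<le>l. (g ^^ j) v \<in> K)} <= card (\<Union>i\<le>l. X i)"
  by (intro card_mono) (use fX in auto)
 also have "... <= (\<Sum>i\<le>l. card (X i))" by (rule card_UN_le) simp
 finally have "?N * card {(g, v). g \<in> pfun A K \<and> v \<in> A \<and> (\<exists>j\<le>l. (g ^^ j) v \<in> K)} <= ?N * (\<Sum>i\<le>l. card (X i))" by simp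
 also have "... = (\<Sum>i\<le>l. ?N * card (X i))" by (rule sum_distrib_left)
 also have "... <= (\<Sum>i\<le>l. (?k + l) * card (pfun A K \<times> A))"
 proof (rule sum_mono)
  fix i assume "i \<in> {..l}"
  then have "(?k + i) * card (pfun A K \<times> A) <= (?k + l) * card (pfun A K \<times> A)" by (intro mult_right_mono) auto
  then show "?N * card (X i) <= (?k + l) * card (pfun A K \<times> A)" using Xi[of i] by linarith
 qed
 finally show ?thesis by simp
qed


lemma skel_emb_iter:
 assumes e: "skel_emb l A K f Ts g" and n: "(j, p) \<in> nodes Ts" and t: "t <= length p"
 shows "(f ^^ t) (g (j, p)) = g (j, take (length p - t) p) \<and> (j, take (length p - t) p) \<in> nodes Ts"
 using t
proof (induction t)
 case (Suc t)
 let ?q = "take (length p - t) p"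
 have q: "(j, ?q) \<in> nodes Ts" "?q ~= []" using Suc by auto
 have b: "butlast ?q = take (length p - Suc t) p" using Suc.prems by (simp add: butlast_take)
 show ?case using skel_emb_parent[OF e q] Suc by (simp add: b)
qed (use n in simp)

lemma skel_emb_spine:
 assumes e: "skel_emb l A K p Ts f"
 shows "t <= l ==> (p ^^ t) (f (0, [])) = f (t, [])"
 by (induction t) (auto simp: skel_embD(5)[OF e])

text \<open>The vertex u sits at depth a in the tree of the j-th ancestor of v; the j + a vertices
  on the two chains before they meet are distinct non-roots.\<close>

definition hanging :: "nat => nat => nat set => nat set => ((nat => nat) \<times> nat \<times> nat) set" where
 "hanging j a A K = {(p, v, u). p \<in> pfun A K \<and> v \<in> A \<and> u \<in> A \<and> (p ^^ a) u = (p ^^ j) v \<and>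
   (%t. (p ^^ t) v) ` {..<j} \<union> (%t. (p ^^ t) u) ` {..<a} \<subseteq> A - K \<and>
   card ((%t. (p ^^ t) v) ` {..<j} \<union> (%t. (p ^^ t) u) ` {..<a}) = j + a}"

lemma finite_hanging: "finite A ==> finite (hanging j a A K)"
 by (rule finite_subset[of _ "pfun A K \<times> A \<times> A"]) (auto simp: hanging_def finite_pfun)

text \<open>The mean number of such u is bounded: a code has j + 1 + a letters and prescribes j + a
  parents, so the letters in excess amount to the choice of v alone.\<close>

lemma card_hanging:
 assumes A: "finite A" and K: "K \<subseteq> A" "K ~= {}"
 shows "card (hanging j a A K) <= (1 + j + a) * card (pfun A K \<times> A)"
proof -
 let ?N = "card A" and ?k = "card K" and ?X = "hanging j a A K"
 have N0: "?N > 0" using K A by (auto simp: card_gt_0_iff)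
 have k0: "?k > 0" using K finite_subset[OF K(1) A] by (simp add: card_gt_0_iff)
 \<comment> \<open>The first list ends with the meeting point, so that the parents of all other
   letters can be read off.\<close>
 let ?f = "%(p, v, u). (map (%t. (p ^^ t) v) [0..<Suc j], map (%t. (p ^^ t) u) [0..<a])"
 let ?S = "%(xs, ys). set (take j xs) \<union> set ys"
 let ?D = "{xs. set xs \<subseteq> A \<and> length xs = Suc j} \<times> {xs. set xs \<subseteq> A \<and> length xs = a}"
 have Sf: "?S (?f (p, v, u)) = (%t. (p ^^ t) v) ` {..<j} \<union> (%t. (p ^^ t) u) ` {..<a}" for p :: "nat => nat" and v u
  by (auto simp: take_map take_upt simp del: upt_Suc)
 have "?N ^ (j + a) * (?N * card ?X) <= card ?D * ((?k + (j + a)) * ?N ^ (?N - ?k))"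
 proof (rule card_prescribed_le[OF A K _ _ finite_hanging[OF A], where f = ?f and S = ?S])
  show "finite ?D" using finite_lists_length_eq[OF A] by blast
  show "?f ` ?X \<subseteq> ?D" by (auto simp: hanging_def pfun_funpow_in simp del: upt_Suc)
  show "fst x \<in> pfun A K" if "x \<in> ?X" for x using that by (auto simp: hanging_def)
  fix x assume x: "x \<in> ?X"
  obtain p v u where xv: "x = (p, v, u)" by (cases x)
  show "?S (?f x) \<subseteq> A - K \<and> card (?S (?f x)) = j + a"
   using x unfolding xv Sf by (simp add: hanging_def)
  fix y assume y: "y \<in> ?X" and eq: "?f x = ?f y"
  obtain g w z where yw: "y = (g, w, z)" by (cases y)
  have eq1: "map (%t. (p ^^ t) v) [0..<Suc j] = map (%t. (g ^^ t) w) [0..<Suc j]"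
   and eq2: "map (%t. (p ^^ t) u) [0..<a] = map (%t. (g ^^ t) z) [0..<a]" using eq unfolding xv yw by auto
  have E1: "(p ^^ t) v = (g ^^ t) w" if t: "t <= j" for t
   using arg_cong[OF eq1, of "%xs. xs ! t"] t by (simp del: upt_Suc)
  have ends: "(p ^^ a) u = (p ^^ j) v" "(g ^^ a) z = (g ^^ j) w" using x y by (auto simp: hanging_def xv yw)
  have E2: "(p ^^ t) u = (g ^^ t) z" if t: "t <= a" for t
  proof (cases "t = a")
   case True
   then show ?thesis using ends E1[of j] by simp
  next
   case False
   then show ?thesis using arg_cong[OF eq2, of "%xs. xs ! t"] t by simp
  qed
  have "p s = g s" if s: "s \<in> (%t. (p ^^ t) v) ` {..<j} \<union> (%t. (p ^^ t) u) ` {..<a}" for s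
  proof -
   from s consider t where "t < j" "s = (p ^^ t) v" | t where "t < a" "s = (p ^^ t) u" by auto
   then show ?thesis
   proof cases
    case 1
    then show ?thesis using E1[of t] E1[of "Suc t"] by simp
   next
    case 2
    then show ?thesis using E2[of t] E2[of "Suc t"] by simp
   qed
  qed
  moreover have "v = w" "u = z" using E1[of 0] E2[of 0] by auto
  ultimately show "snd x = snd y \<and> (\<forall>z\<in>?S (?f x). fst x z = fst y z)" unfolding xv Sf yw by simp
 qed
 also have "card ?D = ?N ^ Suc j * ?N ^ a" using card_lists_length_eq[OF A] by (simp add: card_cartesian_product)
 also have "?N ^ Suc j * ?N ^ a = ?N ^ (j + a) * ?N" by (simp add: power_add)
 finally have "(?N ^ (j + a) * ?N) * card ?X <= (?N ^ (j + a) * ?N) * ((?k + (j + a)) * ?N ^ (?N - ?k))" by (simp only: ac_simps)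
 then have "card ?X <= (?k + (j + a)) * ?N ^ (?N - ?k)" using N0 by simp
 also have "?k + (j + a) <= ?k * (1 + j + a)"
 proof -
  have "1 * (j + a) <= ?k * (j + a)" using k0 by (intro mult_right_mono) auto
  then show ?thesis by (simp add: algebra_simps)
 qed
 finally show ?thesis unfolding card_pfun_pairs[OF A K] by (simp add: algebra_simps)
qed

text \<open>Markov's inequality: every node of a tree on the spine is counted by
  \<open>hanging\<close>, for some j and a up to l, and these means are bounded.\<close>

lemma card_large_skel:
 assumes A: "finite A" and K: "K \<subseteq> A" "K ~= {}"
 shows "M * card {(g, v). g \<in> pfun A K \<and> v \<in> A \<and> (\<exists>Ts h. skel_emb l A K g Ts h \<and> h (0, []) = v \<and> (\<exists>j\<le>l. M < card (Ts ! j)))}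
  <= Suc l * (Suc l * ((1 + 2 * l) * card (pfun A K \<times> A)))"
proof -
 let ?Y = "{(g, v). g \<in> pfun A K \<and> v \<in> A \<and> (\<exists>Ts h. skel_emb l A K g Ts h \<and> h (0, []) = v \<and> (\<exists>j\<le>l. M < card (Ts ! j)))}"
 let ?W = "pfun A K \<times> A"
 have fW: "finite ?W" using A finite_pfun[OF A] by blast
 have fY: "finite ?Y" by (rule finite_subset[OF _ fW]) auto
 let ?c = "%x j a. card {u\<in>A. (fst x, snd x, u) \<in> hanging j a A K}"
 have pt: "M <= (\<Sum>j\<le>l. \<Sum>a\<le>l. ?c x j a)" if xY: "x \<in> ?Y" for x
 proof -
  obtain g v where x: "x = (g, v)" by (cases x)
  obtain Ts h j where p: "g \<in> pfun A K" "v \<in> A" and e: "skel_emb l A K g Ts h" "h (0, []) = v" and j: "j <= l" "M < card (Ts ! j)"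
   using xY x by auto
  note E = skel_embD[OF e(1)]
  have jl: "j < length Ts" using j E(2) by simp
  have rt: "rtree l (Ts ! j)" by (rule rtrees_nth[OF E(1) jl])
  have inj: "inj_on (%p. h (j, p)) (Ts ! j)"
  proof (rule inj_onI)
   fix q q' assume "q \<in> Ts ! j" "q' \<in> Ts ! j" "h (j, q) = h (j, q')"
   then show "q = q'" using inj_onD[OF E(3), of "(j, q)" "(j, q')"] jl by (simp add: nodes_def)
  qed
  have sub: "(%p. h (j, p)) ` (Ts ! j) \<subseteq> (\<Union>a\<le>l. {u\<in>A. (fst x, snd x, u) \<in> hanging j a A K})"
  proof (rule image_subsetI)
   fix q assume q: "q \<in> Ts ! j"
   have n: "(j, q) \<in> nodes Ts" using q jl by (simp add: nodes_def)
   let ?a = "length q"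
   have al: "?a <= l" by (rule rtree_length[OF rt q])
   let ?J1 = "(%t. (t, [] :: nat list)) ` {..<j}" and ?J2 = "(%t. (j, take (?a - t) q)) ` {..<?a}"
   let ?J = "?J1 \<union> ?J2"
   have J: "?J \<subseteq> nodes Ts"
   proof (rule Un_least)
    show "?J1 \<subseteq> nodes Ts" using rtrees_nodes_Nil[OF E(1)] jl by auto
    show "(%t. (j, take (?a - t) q)) ` {..<?a} \<subseteq> nodes Ts" using skel_emb_iter[OF e(1) n] by auto
   qed
   have cJ: "card ?J = j + ?a"
   proof -
    have i1: "inj_on (%t. (t, [] :: nat list)) {..<j}" by (auto simp: inj_on_def)
    have i2: "inj_on (%t. (j, take (?a - t) q)) {..<?a}"
    proof (rule inj_onI)
     fix s t assume st: "s \<in> {..<?a}" "t \<in> {..<?a}" "(j, take (?a - s) q) = (j, take (?a - t) q)"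
     then have "length (take (?a - s) q) = length (take (?a - t) q)" by simp
     then show "s = t" using st by simp
    qed
    have "card ?J = card ?J1 + card ?J2"
     by (rule card_Un_disjoint) auto
    then show ?thesis using card_image[OF i1] card_image[OF i2] by simp
   qed
   have im: "(%t. (g ^^ t) v) ` {..<j} \<union> (%t. (g ^^ t) (h (j, q))) ` {..<?a} = h ` ?J"
   proof -
    have "(%t. (g ^^ t) v) ` {..<j} = (%t. h (t, [])) ` {..<j}"
     by (rule image_cong[OF refl]) (use skel_emb_spine[OF e(1)] e(2) j in auto)
    moreover have "(%t. (g ^^ t) (h (j, q))) ` {..<?a} = (%t. h (j, take (?a - t) q)) ` {..<?a}"
     by (rule image_cong[OF refl]) (use skel_emb_iter[OF e(1) n] in auto)
    ultimately show ?thesis by (simp add: image_Un image_image)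
   qed
   have "(g ^^ ?a) (h (j, q)) = (g ^^ j) v" using skel_emb_iter[OF e(1) n order_refl] skel_emb_spine[OF e(1) j(1)] e(2) by simp
   moreover have "h ` ?J \<subseteq> A - K" using E(4) J by blast
   moreover have "card (h ` ?J) = j + ?a" using card_image[OF inj_on_subset[OF E(3) J]] cJ by simp
   moreover have "h (j, q) \<in> A" using E(4)[OF n] by blast
   ultimately have "(g, v, h (j, q)) \<in> hanging j ?a A K" using p unfolding hanging_def mem_Collect_eq prod.case im by (intro conjI)
   then show "h (j, q) \<in> (\<Union>a\<le>l. {u\<in>A. (fst x, snd x, u) \<in> hanging j a A K})"
    using al \<open>h (j, q) \<in> A\<close> by (auto simp: x)
  qed
  have "M <= card (Ts ! j)" using j(2) by simp
  also have "... = card ((%p. h (j, p)) ` (Ts ! j))" by (rule card_image[OF inj, symmetric])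
  also have "... <= card (\<Union>a\<le>l. {u\<in>A. (fst x, snd x, u) \<in> hanging j a A K})" by (rule card_mono[OF _ sub]) (use A in auto)
  also have "... <= (\<Sum>a\<le>l. ?c x j a)" by (rule card_UN_le) simp
  also have "... <= (\<Sum>j\<le>l. \<Sum>a\<le>l. ?c x j a)" by (rule member_le_sum) (use j in auto)
  finally show ?thesis .
 qed
 have swap: "(\<Sum>x\<in>?W. ?c x j a) = card (hanging j a A K)" for j a
 proof -
  have "(\<Sum>x\<in>?W. ?c x j a) = card (SIGMA x:?W. {u\<in>A. (fst x, snd x, u) \<in> hanging j a A K})"
   by (rule card_SigmaI[symmetric]) (use fW A in auto)
  also have "... = card (hanging j a A K)"
  proof (rule bij_betw_same_card[where f = "%(x, u). (fst x, snd x, u)"], rule bij_betw_imageI)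
   show "inj_on (%(x, u). (fst x, snd x, u)) (SIGMA x:?W. {u\<in>A. (fst x, snd x, u) \<in> hanging j a A K})"
    by (auto simp: inj_on_def)
   show "(%(x, u). (fst x, snd x, u)) ` (SIGMA x:?W. {u\<in>A. (fst x, snd x, u) \<in> hanging j a A K}) = hanging j a A K"
    by (auto simp: hanging_def image_iff)
  qed
  finally show ?thesis .
 qed
 have "M * card ?Y = (\<Sum>x\<in>?Y. M)" by simp
 also have "... <= (\<Sum>x\<in>?Y. \<Sum>j\<le>l. \<Sum>a\<le>l. ?c x j a)" by (rule sum_mono[OF pt])
 also have "... <= (\<Sum>x\<in>?W. \<Sum>j\<le>l. \<Sum>a\<le>l. ?c x j a)" by (rule sum_mono2[OF fW]) auto
 also have "... = (\<Sum>j\<le>l. \<Sum>a\<le>l. \<Sum>x\<in>?W. ?c x j a)"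
  by (subst sum.swap, rule sum.cong[OF refl], rule sum.swap)
 also have "... = (\<Sum>j\<le>l. \<Sum>a\<le>l. card (hanging j a A K))" unfolding swap ..
 also have "... <= (\<Sum>j\<le>l. \<Sum>a\<le>l. (1 + 2 * l) * card ?W)"
 proof (intro sum_mono)
  fix j a assume "j \<in> {..l}" "a \<in> {..l}"
  then have "(1 + j + a) * card ?W <= (1 + 2 * l) * card ?W" by (intro mult_right_mono) auto
  then show "card (hanging j a A K) <= (1 + 2 * l) * card ?W" using card_hanging[OF A K, of j a] by linarith
 qed
 finally show ?thesis by simp
qed

text \<open>Applies \<open>scheffe_finite\<close> with the lists of l + 1 trees of at most M nodes
  as types. Uncovered are the vertices whose chain meets K within l steps and those with a large
  tree. The estimate is uniform in A, K and D, because K will be a random core and D its induced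
  graph.\<close>

lemma forest_local_limit:
 fixes r :: real
 assumes e: "r > 0"
 shows "\<exists>N0. \<exists>g>0. g < 1 \<and> (\<forall>(A :: nat set) K D. finite A --> K \<subseteq> A --> K ~= {} --> N0 <= card A --> real (card K) <= g * real (card A) --> (\<forall>d\<in>D. d \<subseteq> K) -->
  \<bar>real (card {(s, v)\<in>pfun A K \<times> A. rooted_iso (ball l (A, D \<union> pedges A K s, v)) H}) / real (card (pfun A K \<times> A))
   - measure_pmf.prob (skel_ball l) {G. rooted_iso G H}\<bar> <= 2 * r)"
proof -
 let ?q = "replicate_pmf (Suc l) (gw_trunc 1 l)"
 let ?T = "{Ts. rooted_iso (ball l (skel_graph Ts)) H}"
 have prq: "measure_pmf.prob (skel_ball l) {G. rooted_iso G H} = measure_pmf.prob ?q ?T"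
  by (simp add: skel_ball_def vimage_def)
 define M where "M = nat \<lceil>real (Suc l * (Suc l * (1 + 2 * l))) / (r / 2)\<rceil> + 1"
 have M: "real (Suc l * (Suc l * (1 + 2 * l))) <= r / 2 * real M" "M > 0"
 proof -
  have "real (Suc l * (Suc l * (1 + 2 * l))) / (r / 2) <= real M" unfolding M_def by linarith
  then show "real (Suc l * (Suc l * (1 + 2 * l))) <= r / 2 * real M" using e by (simp only: pos_divide_le_eq half_gt_zero mult.commute)
 qed (simp add: M_def)
 define F where "F = {Ts. set Ts \<subseteq> rtree_types l M \<and> length Ts = Suc l}"
 have finF: "finite F" unfolding F_def by (rule finite_lists_length_eq[OF finite_rtree_types])
 have F: "rtrees l Ts" "length Ts = Suc l" "card (nodes Ts) <= Suc l * M" if Ts: "Ts \<in> F" for Ts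
 proof -
  show T: "rtrees l Ts" "length Ts = Suc l" using Ts by (auto simp: F_def rtrees_def rtree_types_def)
  have "card (nodes Ts) = (\<Sum>j<length Ts. card (Ts ! j))"
   unfolding nodes_def by (rule card_SigmaI) (auto dest: rtrees_nth[OF T(1)] rtreeD(1))
  also have "... <= (\<Sum>j<length Ts. M)"
  proof (rule sum_mono)
   fix j assume "j \<in> {..<length Ts}"
   then have "Ts ! j \<in> rtree_types l M" using Ts nth_mem[of j Ts] unfolding F_def by blast
   then show "card (Ts ! j) <= M" by (simp add: rtree_types_def)
  qed
  finally show "card (nodes Ts) <= Suc l * M" using T(2) by simp
 qed
 \<comment> \<open>The error that \<open>scheffe_finite\<close> allows per type; u, g and N0 keep
   the factor exp(h(h + k)/N) of \<open>card_skel_pairs\<close> below 1 + y.\<close>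
 define y where "y = r / (real (card F) + 1)"
 define u where "u = ln (1 + y)"
 define h where "h = Suc l * M"
 have eta: "y > 0" using e by (simp add: y_def)
 have rho: "u > 0" using eta by (simp add: u_def)
 have h: "h > 0" using M(2) by (simp add: h_def)
 define g where "g = min (1 / 2) (min (u / (2 * real h)) (r / (4 * real (Suc l))))"
 have d: "g > 0" "g < 1" "g <= u / (2 * real h)" "g <= r / (4 * real (Suc l))" using rho h e by (auto simp: g_def)
 have d1: "real h * g <= u / 2" using d(3) h by (simp add: field_simps)
 have d2: "real (Suc l) * g <= r / 4" using d(4) by (simp add: field_simps)
 define N0 where "N0 = nat \<lceil>real (h * h) / (u / 2)\<rceil> + nat \<lceil>real (Suc l * l) / (r / 4)\<rceil> + 1"
 have N0: "real (h * h) <= u / 2 * real N" "real (Suc l * l) <= r / 4 * real N" if "N0 <= N" for N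
 proof -
  have N: "real N0 <= real N" using that by simp
  have "real (h * h) / (u / 2) <= real N" "real (Suc l * l) / (r / 4) <= real N" using N unfolding N0_def by linarith+
  moreover have "u / 2 > 0" "r / 4 > 0" using rho e by auto
  ultimately show "real (h * h) <= u / 2 * real N" "real (Suc l * l) <= r / 4 * real N" by (simp_all only: pos_divide_le_eq mult.commute)
 qed
 have main: "\<bar>real (card {(s, v)\<in>pfun A K \<times> A. rooted_iso (ball l (A, D \<union> pedges A K s, v)) H}) / real (card (pfun A K \<times> A))
   - measure_pmf.prob ?q ?T\<bar> <= 2 * r"
  if A: "finite A" and K: "K \<subseteq> A" "K ~= {}" and N: "N0 <= card A" and k: "real (card K) <= g * real (card A)" and D: "\<forall>d\<in>D. d \<subseteq> K" for A K :: "nat set" and D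
 proof (rule scheffe_finite[where F = F and A = "skel_pairs l A K" and r = r])
  let ?W = "pfun A K \<times> A"
  have A0: "real (card A) > 0" using K A by (auto simp: card_gt_0_iff)
  show fO: "finite ?W" using A finite_pfun[OF A] by blast
  show "finite F" by (rule finF)
  show "{(s, v)\<in>pfun A K \<times> A. rooted_iso (ball l (A, D \<union> pedges A K s, v)) H} \<subseteq> ?W" by auto
  show "r \<ge> 0" using e by simp
  have "card (pfun A K \<times> A) > 0" unfolding card_pfun_pairs[OF A K] using K A finite_subset[OF K(1) A] by (auto simp: card_gt_0_iff)
  then show "?W ~= {}" by auto
  show "skel_pairs l A K Ts \<subseteq> ?W" for Ts by (auto simp: skel_pairs_def)
  show "real (card (skel_pairs l A K Ts)) <= (pmf ?q Ts + r / (card F + 1)) * card ?W" if Ts: "Ts \<in> F" for Ts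
  proof -
   let ?h = "card (nodes Ts)"
   have hh: "?h <= h" using F(3)[OF Ts] by (simp add: h_def)
   have "real (?h * (?h + card K)) <= real (h * (h + card K))" using hh by (intro of_nat_mono mult_mono) auto
   also have "... = real (h * h) + real h * real (card K)" by (simp add: algebra_simps)
   also have "... <= u / 2 * real (card A) + real h * (g * real (card A))"
    by (intro add_mono N0(1)[OF N] mult_left_mono[OF k]) simp
   also have "real h * (g * real (card A)) <= u / 2 * real (card A)" using mult_right_mono[OF d1, of "real (card A)"] by (simp add: mult.assoc)
   finally have "real (?h * (?h + card K)) <= u * real (card A)" by simp
   then have "real (?h * (?h + card K)) / real (card A) <= u" using A0 by (simp add: pos_divide_le_eq)
   then have ex: "exp (real (?h * (?h + card K)) / real (card A)) <= 1 + y" using eta by (simp add: u_def ln_ge_iff[symmetric])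
   have "real (card (skel_pairs l A K Ts)) <= pmf ?q Ts * exp (real (?h * (?h + card K)) / real (card A)) * real (card ?W)"
    by (rule card_skel_pairs[OF A K F(1,2)[OF Ts]])
   also have "... <= pmf ?q Ts * (1 + y) * real (card ?W)" by (intro mult_right_mono mult_left_mono ex) auto
   also have "... <= (pmf ?q Ts + y) * real (card ?W)"
   proof (rule mult_right_mono)
    have "pmf ?q Ts * y <= 1 * y" using eta by (intro mult_right_mono pmf_le_1) auto
    then show "pmf ?q Ts * (1 + y) <= pmf ?q Ts + y" by (simp add: distrib_left)
   qed simp
   finally show ?thesis by (simp add: y_def add.commute)
  qed
  show "c \<in> {(s, v)\<in>pfun A K \<times> A. rooted_iso (ball l (A, D \<union> pedges A K s, v)) H} \<longleftrightarrow> Ts \<in> ?T"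
   if Ts: "Ts \<in> F" and w: "c \<in> skel_pairs l A K Ts" for Ts c
  proof -
   obtain s v where o: "c = (s, v)" by (cases c)
   obtain z where p: "s \<in> pfun A K" "v \<in> A" and em: "skel_emb l A K s Ts z" "z (0, []) = v" using w o by (auto simp: skel_pairs_def)
   have n0: "(0, []) \<in> nodes Ts" by (rule rtrees_nodes_Nil[OF F(1)[OF Ts]]) (simp add: F(2)[OF Ts])
   have "rooted_iso (ball l (nodes Ts, skel_edges Ts, (0, []))) (ball l (A, D \<union> pedges A K s, v))"
    using skel_emb_ball[OF em(1) p(1), of D] D em(2) by (simp add: skel_graph_eq)
   from rooted_iso_ball_cong[OF this n0, of H] show ?thesis using p by (simp add: o skel_graph_eq)
  qed
  show "real (card (?W - (\<Union>Ts\<in>F. skel_pairs l A K Ts))) <= r * card ?W"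
  proof -
   let ?X = "{(s, v). s \<in> pfun A K \<and> v \<in> A \<and> (\<exists>j\<le>l. (s ^^ j) v \<in> K)}"
   let ?Y = "{(s, v). s \<in> pfun A K \<and> v \<in> A \<and> (\<exists>Ts z. skel_emb l A K s Ts z \<and> z (0, []) = v \<and> (\<exists>j\<le>l. M < card (Ts ! j)))}"
   have f: "finite ?X" "finite ?Y" by (rule finite_subset[OF _ fO], auto)+
   have "?W - (\<Union>Ts\<in>F. skel_pairs l A K Ts) \<subseteq> ?X \<union> ?Y"
   proof
    fix x assume x: "x \<in> ?W - (\<Union>Ts\<in>F. skel_pairs l A K Ts)"
    obtain s v where xv: "x = (s, v)" by (cases x)
    have p: "s \<in> pfun A K" "v \<in> A" using x xv by auto
    show "x \<in> ?X \<union> ?Y"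
    proof (cases "\<exists>j\<le>l. (s ^^ j) v \<in> K")
     case True
     then show ?thesis using p xv by simp
    next
     case False
     then obtain Ts z where em: "skel_emb l A K s Ts z" "z (0, []) = v" using skel_emb_exists[OF A p, of l] by blast
     have "(s, v) \<in> skel_pairs l A K Ts" using em p by (auto simp: skel_pairs_def)
     then have nF: "Ts \<notin> F" using x xv by blast
     have "\<exists>j\<le>l. M < card (Ts ! j)"
     proof (rule ccontr)
      assume no: "\<not> ?thesis"
      have "set Ts \<subseteq> rtree_types l M"
      proof
       fix U assume "U \<in> set Ts"
       then obtain j where j: "j < length Ts" "U = Ts ! j" by (auto simp: in_set_conv_nth)
       have "j <= l" using j(1) skel_embD(2)[OF em(1)] by simp
       then have "\<not> M < card U" using no j(2) by blast
       moreover have "rtree l U" unfolding j(2) by (rule rtrees_nth[OF skel_embD(1)[OF em(1)] j(1)])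
       ultimately have "card U <= M" "rtree l U" by simp_all
       then show "U \<in> rtree_types l M" by (simp add: rtree_types_def)
      qed
      then show False using nF skel_embD(2)[OF em(1)] by (simp add: F_def)
     qed
     then have "(s, v) \<in> ?Y" using em p by blast
     then show ?thesis using xv by blast
    qed
   qed
   then have "card (?W - (\<Union>Ts\<in>F. skel_pairs l A K Ts)) <= card (?X \<union> ?Y)" by (intro card_mono) (use f in auto)
   also have "... <= card ?X + card ?Y" by (rule card_Un_le)
   finally have "real (card (?W - (\<Union>Ts\<in>F. skel_pairs l A K Ts))) <= real (card ?X + card ?Y)" by (rule of_nat_mono)
   moreover have "real (card ?X) <= r / 2 * card ?W"
   proof -
    have "real (card A * card ?X) <= real (Suc l * ((card K + l) * card ?W))" by (rule of_nat_mono[OF card_hit_roots[OF A K]])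
    then have "real (card A) * real (card ?X) <= (real (Suc l) * real (card K) + real (Suc l * l)) * real (card ?W)"
     by (simp only: of_nat_mult of_nat_add distrib_right distrib_left mult.assoc)
    also have "... <= (r / 2 * real (card A)) * real (card ?W)"
    proof (rule mult_right_mono)
     have "real (Suc l) * real (card K) <= real (Suc l) * (g * real (card A))" by (rule mult_left_mono[OF k]) simp
     also have "... = real (Suc l) * g * real (card A)" by simp
     also have "... <= r / 4 * real (card A)" by (rule mult_right_mono[OF d2]) simp
     finally show "real (Suc l) * real (card K) + real (Suc l * l) <= r / 2 * real (card A)" using N0(2)[OF N] by linarith
    qed simp
    finally have "real (card A) * real (card ?X) <= real (card A) * (r / 2 * card ?W)" by (simp only: ac_simps)
    then show ?thesis using A0 by (rule mult_left_le_imp_le)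
   qed
   moreover have "real (card ?Y) <= r / 2 * card ?W"
   proof -
    have "real (M * card ?Y) <= real (Suc l * (Suc l * ((1 + 2 * l) * card ?W)))" by (rule of_nat_mono[OF card_large_skel[OF A K]])
    then have "real M * real (card ?Y) <= real (Suc l * (Suc l * (1 + 2 * l))) * real (card ?W)"
     by (simp only: of_nat_mult mult.assoc)
    also have "... <= r / 2 * real M * real (card ?W)" by (rule mult_right_mono[OF M(1)]) simp
    finally have "real M * real (card ?Y) <= real M * (r / 2 * card ?W)" by (simp only: ac_simps)
    then show ?thesis using M(2) by (simp add: mult_le_cancel_left)
   qed
   ultimately show ?thesis by simp
  qed
 qed
 show ?thesis unfolding prq
  by (rule exI[of _ N0], rule exI[of _ g]) (use d(1,2) main in blast)
qed

section \<open>Rehanging the forest of the largest component\<close>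

lemma is_comp_component:
 assumes c: "is_comp V E A" and v: "v \<in> A"
 shows "component V E v = A"
proof -
 note sg = is_compD(1)[OF c]
 have "component V E v \<subseteq> A" by (rule component_closed_subset[OF sg v]) (use is_compD(4)[OF c] in blast)
 moreover have "component V E v = A" if "component V E v \<subseteq> A"
 proof (rule is_compD(5)[OF c that])
  show "v \<in> component V E v" using v is_compD(2)[OF c] unfolding component_adj[OF sg] by blast
  fix u w assume "u \<in> component V E v" "{u, w} \<in> E"
  then show "w \<in> component V E v" using simple_graph_edgeD[OF sg, of u w] unfolding component_adj[OF sg]
   by (auto simp: adj_def intro: rtrancl_into_rtrancl)
 qed
 ultimately show ?thesis by blast
qed

lemma component_subset_outside:
 assumes c: "is_comp V E A" and c': "is_comp V E' A" and same: "\<And>d. d \<in> E ==> d \<inter> A = {} ==> d \<in> E'" and v: "v \<in> V" "v \<notin> A"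
 shows "component V E v \<subseteq> component V E' v"
proof (rule component_closed_subset[OF is_compD(1)[OF c]])
 note sg' = is_compD(1)[OF c']
 show "v \<in> component V E' v" using v unfolding component_adj[OF sg'] by blast
 fix u w assume u: "u \<in> component V E' v" and e: "{u, w} \<in> E"
 have "component V E' v \<subseteq> - A"
 proof (rule component_closed_subset[OF sg'])
  show "v \<in> - A" using v by blast
  fix x y assume "x \<in> - A" "{x, y} \<in> E'"
  then show "y \<in> - A" using is_compD(4)[OF c', of y x] by (auto simp: insert_commute)
 qed
 then have uA: "u \<notin> A" using u by blast
 then have "w \<notin> A" using is_compD(4)[OF c, of w u] e by (auto simp: insert_commute)
 then have "{u, w} \<in> E'" using same[OF e] uA by simp
 then show "w \<in> component V E' v" using u simple_graph_edgeD[OF sg', of u w] unfolding component_adj[OF sg']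
  by (auto simp: adj_def intro: rtrancl_into_rtrancl)
qed

text \<open>The two graphs agree outside A and both have A as a component, so all their components
  agree and even ties are broken alike.\<close>

lemma largest_comp_cong:
 assumes c: "is_comp V E A" and c': "is_comp V E' A" and same: "{d\<in>E. d \<inter> A = {}} = {d\<in>E'. d \<inter> A = {}}"
 shows "largest_comp V E' = largest_comp V E"
proof -
 have s: "d \<in> E \<longleftrightarrow> d \<in> E'" if "d \<inter> A = {}" for d using same that by blast
 have "component V E' v = component V E v" for v
 proof -
  consider "v \<in> A" | "v \<in> V" "v \<notin> A" | "v \<notin> V" by blast
  then show ?thesis
  proof cases
   case 1
   then show ?thesis using is_comp_component[OF c] is_comp_component[OF c'] by simp
  next
   case 2
   show ?thesis using component_subset_outside[OF c c' _ 2] component_subset_outside[OF c' c _ 2] s by blast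
  next
   case 3
   have e: "component V F v = {}" if "simple_graph V F" for F :: "nat set set"
   proof -
    have "component V F v \<subseteq> {v}" by (rule component_closed_subset[OF that]) (use simple_graph_edgeD[OF that] 3 in auto)
    moreover have "v \<notin> component V F v" using 3 unfolding component_adj[OF that] by blast
    ultimately show ?thesis by blast
   qed
   show ?thesis using e is_compD(1)[OF c] is_compD(1)[OF c'] by simp
  qed
 qed
 then have "component V E' = component V E" by (rule ext)
 then show ?thesis by (simp add: largest_comp_def)
qed

text \<open>Re-hanging the forest: connectivity of A only depends on the core, since every vertex is
 joined to the core by its chain of parents.\<close>

lemma is_comp_rehang:
 assumes c: "is_comp V E A" and h: "hangs E A K f0" and K: "K \<subseteq> A" and p: "f \<in> pfun A K"
  and sg: "simple_graph V E'" and E': "E' = (induced K E \<union> {d\<in>E. d \<inter> A = {}}) \<union> pedges A K f"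
 shows "is_comp V E' A"
proof -
 note p0 = hangsD(1)[OF h K]
 have up: "{x, f x} \<in> E'" if "x \<in> A - K" for x using that unfolding E' pedges_def by blast
 have cl: "w \<in> A" if u: "u \<in> A" and e: "{u, w} \<in> E'" for u w
 proof -
  from e consider "{u, w} \<in> induced K E" | "{u, w} \<inter> A = {}" | x where "x \<in> A - K" "{u, w} = {x, f x}" unfolding E' pedges_def by blast
  then show ?thesis
  proof cases
   case 1
   then show ?thesis using K by (auto simp: induced_def)
  next
   case 2
   then show ?thesis using u by blast
  next
   case 3
   then have "w = x \<or> w = f x" by (auto simp: doubleton_eq_iff)
   then show ?thesis using 3(1) pfunD(2)[OF p, of x] by auto
  qed
 qed
 have "S = A" if S: "S \<subseteq> A" "S ~= {}" and clS: "\<forall>u w. u \<in> S --> {u, w} \<in> E' --> w \<in> S" for S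
 proof -
  obtain x where x: "x \<in> S" using S by blast
  have it: "(f ^^ j) x \<in> S" for j
  proof (induction j)
   case (Suc j)
   show ?case
   proof (cases "(f ^^ j) x \<in> A - K")
    case True
    then show ?thesis using clS Suc up[OF True] by simp
   next
    case False
    then show ?thesis using pfunD(1)[OF p False] Suc by simp
   qed
  qed (use x in simp)
  obtain r where r: "r \<in> K" "r \<in> S" using is_root_exists[OF p, of x] x S(1) it unfolding is_root_def by blast
  let ?T = "{v\<in>A. \<exists>r\<in>S \<inter> K. is_root K f0 v r}"
  have "?T = A"
  proof (rule is_compD(5)[OF c])
   show "r \<in> ?T" using r K is_root_self[of r K f0] by blast
   fix u w assume u: "u \<in> ?T" and e: "{u, w} \<in> E"
   have w: "w \<in> A" using is_compD(4)[OF c, of u w] u e by blast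
   obtain s where s: "s \<in> S \<inter> K" "is_root K f0 u s" using u by blast
   from hangsD(2)[OF h K _ w e] u consider "u \<in> K" "w \<in> K" | "w = f0 u" | "u = f0 w" by blast
   then show "w \<in> ?T"
   proof cases
    case 1
    then have "u = s" using is_root_unique[OF p0, of u u s] is_root_self[of u K f0] s by blast
    moreover have "{u, w} \<in> E'" using 1 e unfolding E' induced_def by blast
    ultimately have "w \<in> S \<inter> K" using clS s 1 by blast
    then show ?thesis using w is_root_self[of w K f0] by blast
   next
    case 2
    then show ?thesis using s w is_root_step[OF p0, of u s] by blast
   next
    case 3
    then show ?thesis using s w is_root_step[OF p0, of w s] by blast
   qed
  qed blast
  have KS: "K \<subseteq> S"
  proof
   fix k assume k: "k \<in> K"
   then obtain s where "s \<in> S \<inter> K" "is_root K f0 k s" using \<open>?T = A\<close> K by blast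
   then show "k \<in> S" using is_root_unique[OF p0, of k k s] is_root_self[of k K f0] k by blast
  qed
  obtain d :: "'a => nat" where d: "\<And>x. x \<in> A - K ==> d (f x) < d x" using pfunD(3)[OF p] by blast
  have "y \<in> A ==> y \<in> S" for y
  proof (induction "d y" arbitrary: y rule: less_induct)
   case less
   show ?case
   proof (cases "y \<in> K")
    case False
    then have yA: "y \<in> A - K" using less.prems by blast
    have "f y \<in> S" using less.hyps[OF d[OF yA]] pfunD(2)[OF p less.prems] by blast
    moreover have "{f y, y} \<in> E'" using up[OF yA] by (simp add: insert_commute)
    ultimately show ?thesis using clS by blast
   qed (use KS in blast)
  qed
  then show ?thesis using S(1) by blast
 qed
 moreover have "\<forall>u w. u \<in> A --> {u, w} \<in> E' --> w \<in> A" using cl by blast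
 ultimately show ?thesis unfolding is_comp_def using sg is_compD(2,3)[OF c] by blast
qed

text \<open>Given A, K and all edges D outside the hanging forest, every rooted forest may be hung
  on K: the graph stays planar, A stays the largest component and K its core. So, conditionally on
  these data, the forest is uniform.\<close>

lemma core_fibre_bij:
 assumes V: "V = {1..n}" and E: "E \<in> pl V m" and L: "largest_comp V E = A" and Kc: "core E A = K" and n: "n > 0"
 defines "D \<equiv> induced K E \<union> {d\<in>E. d \<inter> A = {}}"
 shows "bij_betw (%f. D \<union> pedges A K f) (pfun A K)
  {E'\<in>pl V m. largest_comp V E' = A \<and> core E' A = K \<and> induced K E' \<union> {d\<in>E'. d \<inter> A = {}} = D}"
  "\<And>f. f \<in> pfun A K ==> induced A (D \<union> pedges A K f) = induced K E \<union> pedges A K f"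
proof -
 have fV: "finite V" using V by simp
 have comp: "is_comp V F A" if "F \<in> pl V m" "largest_comp V F = A" for F
  using is_comp_largest[of n F] that n unfolding V pl_def by auto
 have c: "is_comp V E A" by (rule comp[OF E L])
 note sgE = is_compD(1)[OF c] and AV = is_compD(2)[OF c]
 have fA: "finite A" using AV fV by (rule finite_subset)
 have K: "K \<subseteq> A" "ctwo E (Min A) K" "\<exists>f. hangs E A K f" using core_hangs[OF c fA] unfolding Kc .
 obtain f0 where h0: "hangs E A K f0" using K(3) by blast
 note p0 = hangsD(1)[OF h0 K(1)]
 have split0: "E = D \<union> pedges A K f0" unfolding D_def by (rule is_comp_split[OF c h0])
 have DE: "D \<subseteq> E" unfolding D_def induced_def by blast
 have fE: "finite E" by (rule finite_plE[OF E fV])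
 have fD: "finite D" using DE fE by (rule finite_subset)
 have ne: "d ~= {}" if "d \<in> E" for d using simple_graphD[OF sgE that] by blast
 have Diso: "x \<notin> d" if "d \<in> D" "x \<in> A - K" for d x using that unfolding D_def induced_def by blast
 have pm: "\<exists>x\<in>A - K. x \<in> d" if "d \<in> pedges A K f" for d f using that unfolding pedges_def by blast
 have disj: "D \<inter> pedges A K f = {}" for f using Diso pm by blast
 have pA: "d \<subseteq> A" if "d \<in> pedges A K f" "f \<in> pfun A K" for d f using that pfunD(2)[OF that(2)] unfolding pedges_def by auto
 have cardD: "card (D \<union> pedges A K f) = card D + card (A - K)" if p: "f \<in> pfun A K" for f
 proof -
  have "finite (pedges A K f)" using fA by (simp add: pedges_def)
  then show ?thesis using card_Un_disjoint[OF fD _ disj] card_pedges[OF p] by simp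
 qed
 have m: "card D + card (A - K) = m" using cardD[OF p0] split0 E by (simp add: pl_def)
 have indK: "induced K (D \<union> pedges A K f) = induced K E" for f
 proof (intro equalityI subsetI)
  fix d assume d: "d \<in> induced K (D \<union> pedges A K f)"
  then have dK: "d \<subseteq> K" and "d \<in> D \<union> pedges A K f" by (auto simp: induced_def)
  then have "d \<in> D" using pm[of d f] by blast
  then show "d \<in> induced K E" using dK DE by (auto simp: induced_def)
 next
  fix d assume "d \<in> induced K E"
  then show "d \<in> induced K (D \<union> pedges A K f)" unfolding D_def by (auto simp: induced_def)
 qed
 have out: "{d \<in> D \<union> pedges A K f. d \<inter> A = {}} = {d\<in>E. d \<inter> A = {}}" for f
 proof (intro equalityI subsetI)
  fix d assume d: "d \<in> {d \<in> D \<union> pedges A K f. d \<inter> A = {}}"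
  then have "d \<notin> pedges A K f" using pm[of d f] by blast
  then show "d \<in> {d\<in>E. d \<inter> A = {}}" using d DE by blast
 next
  fix d assume "d \<in> {d\<in>E. d \<inter> A = {}}"
  then show "d \<in> {d \<in> D \<union> pedges A K f. d \<inter> A = {}}" unfolding D_def by blast
 qed
 show indA: "induced A (D \<union> pedges A K f) = induced K E \<union> pedges A K f" if p: "f \<in> pfun A K" for f
 proof (intro equalityI subsetI)
  fix d assume "d \<in> induced A (D \<union> pedges A K f)"
  then have dA: "d \<subseteq> A" and "d \<in> D \<union> pedges A K f" by (auto simp: induced_def)
  then show "d \<in> induced K E \<union> pedges A K f" unfolding D_def using ne[of d] by blast
 next
  fix d assume d: "d \<in> induced K E \<union> pedges A K f"
  then have "d \<subseteq> A" using pA[OF _ p, of d] K(1) unfolding induced_def by blast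
  then show "d \<in> induced A (D \<union> pedges A K f)" using d unfolding D_def induced_def by blast
 qed
 show "bij_betw (%f. D \<union> pedges A K f) (pfun A K)
  {E'\<in>pl V m. largest_comp V E' = A \<and> core E' A = K \<and> induced K E' \<union> {d\<in>E'. d \<inter> A = {}} = D}"
 proof (rule bij_betw_imageI)
  show "inj_on (%f. D \<union> pedges A K f) (pfun A K)"
  proof (rule inj_onI)
   fix f g assume p: "f \<in> pfun A K" "g \<in> pfun A K" and eq: "D \<union> pedges A K f = D \<union> pedges A K g"
   have "pedges A K f = pedges A K g" using eq disj[of f] disj[of g] by blast
   then show "f = g" by (rule pedges_eq_imp_eq[OF p])
  qed
  show "(%f. D \<union> pedges A K f) ` pfun A K = {E'\<in>pl V m. largest_comp V E' = A \<and> core E' A = K \<and> induced K E' \<union> {d\<in>E'. d \<inter> A = {}} = D}"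
  proof (intro equalityI subsetI)
   fix E' assume "E' \<in> (%f. D \<union> pedges A K f) ` pfun A K"
   then obtain f where p: "f \<in> pfun A K" and E': "E' = D \<union> pedges A K f" by blast
   have sgD: "simple_graph V D" by (rule simple_graph_subsetE[OF sgE DE])
   have plD: "planar V D" using E planar_mono[of V E V D] DE sgD by (simp add: pl_def)
   have sp: "simple_graph V E'" "planar V E'" using planar_attach_forest[OF fV AV K(1) p sgD plD Diso] unfolding E' by blast+
   then have "E' \<in> pl V m" using cardD[OF p] m by (simp add: pl_def E')
   moreover have c': "is_comp V E' A" by (rule is_comp_rehang[OF c h0 K(1) p sp(1)]) (simp add: E' D_def)
   have "largest_comp V E' = A" unfolding L[symmetric]
    by (rule largest_comp_cong[OF c c', unfolded L[symmetric]]) (use out[of f] in \<open>simp add: E' L\<close>)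
   moreover have "core E' A = K"
   proof (rule core_eqI[OF fA _ K(1)])
    show "hangs E' A K f" using p indA[OF p] indK[of f] by (simp add: hangs_def E')
    have KE: "{x, y} \<in> E'" if "x \<in> K" "y \<in> K" "{x, y} \<in> E" for x y using that unfolding E' D_def induced_def by blast
    show "ctwo E' (Min A) K" unfolding ctwo_def
    proof (intro conjI ballI impI)
     show "Min A \<in> K" using K(2) by (simp add: ctwo_def)
     fix x assume x: "x \<in> K" "x ~= Min A"
     then obtain y z where "y \<in> K" "z \<in> K" "y ~= z" "{x, y} \<in> E" "{x, z} \<in> E" using K(2) unfolding ctwo_def by blast
     then show "\<exists>y\<in>K. \<exists>z\<in>K. y ~= z \<and> {x, y} \<in> E' \<and> {x, z} \<in> E'" using KE x(1) by blast
    qed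
   qed
   moreover have "induced K E' \<union> {d\<in>E'. d \<inter> A = {}} = D" by (simp only: E' indK out) (simp only: D_def)
   ultimately show "E' \<in> {E'\<in>pl V m. largest_comp V E' = A \<and> core E' A = K \<and> induced K E' \<union> {d\<in>E'. d \<inter> A = {}} = D}" by simp
  next
   fix E' assume E': "E' \<in> {E'\<in>pl V m. largest_comp V E' = A \<and> core E' A = K \<and> induced K E' \<union> {d\<in>E'. d \<inter> A = {}} = D}"
   have c': "is_comp V E' A" by (rule comp) (use E' in auto)
   obtain f where h: "hangs E' A K f" using core_hangs(3)[OF c' fA] E' by auto
   have "E' = D \<union> pedges A K f" using is_comp_split[OF c' h] E' by simp
   then show "E' \<in> (%f. D \<union> pedges A K f) ` pfun A K" using hangsD(1)[OF h K(1)] by blast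
  qed
 qed
qed


section \<open>The limit for L\<close>

lemma abs_local_average_le:
 fixes q :: real
 assumes "finite A" "0 <= q" "q <= 1"
 shows "\<bar>real (card {v\<in>A. P v}) / real (card A) - q\<bar> <= 1"
proof -
 have "card {v\<in>A. P v} <= card A" using assms(1) by (intro card_mono) auto
 then have f1: "real (card {v\<in>A. P v}) / real (card A) <= 1" by (simp add: divide_le_eq)
 have f2: "0 <= real (card {v\<in>A. P v}) / real (card A)" by simp
 show ?thesis by (rule abs_leI) (use f1 f2 assms(2,3) in linarith)+
qed

text \<open>Graphs with L larger than B, of size at most h1 n and with a small core are partitioned
  into the fibres of \<open>core_fibre_bij\<close>; on each of them the mean is within 2r of the
  limit. The three kinds of exceptions have share at most r each, and 2r + 3r < e.\<close>

lemma prob_L_limit: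
 "((%(n, m). prob_L n m l H) \<longlongrightarrow> measure_pmf.prob (skel_ball l) {G. rooted_iso G H}) crit"
proof (rule tendstoI)
 fix e :: real assume e: "e > 0"
 define q where "q = measure_pmf.prob (skel_ball l) {G. rooted_iso G H}"
 have q: "0 <= q" "q <= 1" by (auto simp: q_def)
 define r where "r = e / 6"
 have eps: "r > 0" using e by (simp add: r_def)
 obtain N0 h where d: "h > 0" "h < 1" and forest: "\<And>(A :: nat set) K D. finite A ==> K \<subseteq> A ==> K ~= {} ==> N0 <= card A ==>
   real (card K) <= h * real (card A) ==> \<forall>d\<in>D. d \<subseteq> K ==>
  \<bar>real (card {(s, v)\<in>pfun A K \<times> A. rooted_iso (ball l (A, D \<union> pedges A K s, v)) H}) / real (card (pfun A K \<times> A)) - q\<bar> <= 2 * r"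
  using forest_local_limit[OF eps, of l H] unfolding q_def[symmetric] by blast
 obtain K0 h1 where d1: "h1 > 0" and rare: "eventually (%(n, m). real (card {E\<in>pl {1..n} m. K0 <= card (largest_comp {1..n} E) \<and>
  real (card (largest_comp {1..n} E)) <= h1 * real n \<and>
  real (card (core E (largest_comp {1..n} E))) > h * real (card (largest_comp {1..n} E))}) <= r * real (pc n m)) crit"
  using large_core_rare[OF d eps] by blast
 define B where "B = max N0 K0"
 \<comment> \<open>With this mean, Markov's inequality leaves a share r for graphs whose L has more
   than h1 n vertices.\<close>
 have ed: "r * h1 > 0" using eps d1 by simp
 from rare largest_comp_small[OF ed] largest_comp_unbounded[OF eps, of B] crit_nonempty
 show "eventually (%p. dist (case p of (n, m) => prob_L n m l H) (measure_pmf.prob (skel_ball l) {G. rooted_iso G H}) < e) crit"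
 proof eventually_elim
  case (elim p)
  obtain n m where p: "p = (n, m)" by (cases p)
  let ?V = "{1..n}"
  let ?L = "largest_comp ?V"
  have n: "n > 0" and pc0: "pc n m > 0" using elim p by auto
  have nn: "real n > 0" using n by simp
  define g where "g = (%E. real (card {v\<in>?L E. rooted_iso (ball l (?L E, induced (?L E) E, v)) H}) / real (card (?L E)))"
  have comp: "is_comp ?V E (?L E)" if "E \<in> pl ?V m" for E
   by (rule is_comp_largest[OF _ n]) (use that in \<open>simp add: pl_def\<close>)
  have fL: "finite (?L E)" if "E \<in> pl ?V m" for E using is_compD(2)[OF comp[OF that]] finite_subset by blast
  have fpl: "finite (pl ?V m)" by (rule finite_pl) simp
  have cpl: "card (pl ?V m) = pc n m" by (simp add: card_pl)
  define good where "good = (%(A :: nat set) (K :: nat set). B < card A \<and> real (card A) <= h1 * real n \<and> real (card K) <= h * real (card A))"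
  define G where "G = {E\<in>pl ?V m. good (?L E) (core E (?L E))}"
  have G_sub: "G \<subseteq> pl ?V m" by (auto simp: G_def)
  have fG: "finite G" by (rule finite_subset[OF G_sub fpl])
  define f where "f = (%E. (?L E, core E (?L E), induced (core E (?L E)) E \<union> {d\<in>E. d \<inter> ?L E = {}}))"
  have fibre: "\<bar>\<Sum>E'\<in>{E'\<in>G. f E' = b}. g E' - q\<bar> <= (\<Sum>E'\<in>{E'\<in>G. f E' = b}. 2 * r)" if b: "b \<in> f ` G" for b
  proof -
   obtain E where E: "E \<in> G" "b = f E" using b by blast
   have Epl: "E \<in> pl ?V m" using E(1) G_sub by blast
   define A where "A = ?L E"
   define K where "K = core E A"
   define D where "D = induced K E \<union> {d\<in>E. d \<inter> A = {}}"
   have bb: "b = (A, K, D)" by (simp add: E(2) f_def A_def K_def D_def)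
   have gd: "good A K" using E(1) by (simp add: G_def A_def K_def)
   have fA: "finite A" unfolding A_def by (rule fL[OF Epl])
   have KA: "K \<subseteq> A" "K ~= {}" using core_hangs(1,2)[OF comp[OF Epl] fL[OF Epl]] by (auto simp: K_def A_def ctwo_def)
   have A0: "card A > 0" using KA fA by (auto simp: card_gt_0_iff)
   have pf0: "card (pfun A K) > 0"
   proof -
    have "card (pfun A K \<times> A) > 0" unfolding card_pfun_pairs[OF fA KA] using KA fA finite_subset[OF KA(1) fA] by (auto simp: card_gt_0_iff)
    then show ?thesis by (simp add: card_cartesian_product)
   qed
   note bij = core_fibre_bij[OF refl Epl A_def[symmetric] K_def[symmetric] n, folded D_def]
   have fib: "{E'\<in>G. f E' = b} = {E'\<in>pl ?V m. ?L E' = A \<and> core E' A = K \<and> induced K E' \<union> {d\<in>E'. d \<inter> A = {}} = D}"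
    unfolding G_def bb f_def using gd by auto
   have gv: "g (D \<union> pedges A K s) = real (card {v\<in>A. rooted_iso (ball l (A, induced K E \<union> pedges A K s, v)) H}) / real (card A)" if p: "s \<in> pfun A K" for s
   proof -
    have "?L (D \<union> pedges A K s) = A" using bij_betw_apply[OF bij(1) p] by simp
    then show ?thesis unfolding g_def using bij(2)[OF p] by simp
   qed
   have "(\<Sum>E'\<in>{E'\<in>G. f E' = b}. g E' - q) = (\<Sum>s\<in>pfun A K. g (D \<union> pedges A K s) - q)"
    unfolding fib by (rule sum.reindex_bij_betw[OF bij(1), symmetric])
   also have "... = (\<Sum>s\<in>pfun A K. real (card {v\<in>A. rooted_iso (ball l (A, induced K E \<union> pedges A K s, v)) H}) / real (card A) - q)"
    by (rule sum.cong[OF refl]) (simp add: gv)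
   also have "... = (\<Sum>s\<in>pfun A K. real (card {v\<in>A. rooted_iso (ball l (A, induced K E \<union> pedges A K s, v)) H})) / real (card A) - real (card (pfun A K)) * q"
    by (simp add: sum_subtractf sum_divide_distrib)
   also have "(\<Sum>s\<in>pfun A K. real (card {v\<in>A. rooted_iso (ball l (A, induced K E \<union> pedges A K s, v)) H}))
    = real (card {(s, v)\<in>pfun A K \<times> A. rooted_iso (ball l (A, induced K E \<union> pedges A K s, v)) H})"
   proof -
    have "{(s, v)\<in>pfun A K \<times> A. rooted_iso (ball l (A, induced K E \<union> pedges A K s, v)) H}
     = (SIGMA s:pfun A K. {v\<in>A. rooted_iso (ball l (A, induced K E \<union> pedges A K s, v)) H})" by auto
    then show ?thesis using finite_pfun[OF fA] fA by (simp add: card_SigmaI)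
   qed
   finally have s1: "(\<Sum>E'\<in>{E'\<in>G. f E' = b}. g E' - q) = real (card {(s, v)\<in>pfun A K \<times> A. rooted_iso (ball l (A, induced K E \<union> pedges A K s, v)) H}) / real (card A) - real (card (pfun A K)) * q" .
   define X where "X = real (card {(s, v)\<in>pfun A K \<times> A. rooted_iso (ball l (A, induced K E \<union> pedges A K s, v)) H})"
   have fl: "\<bar>X / real (card (pfun A K \<times> A)) - q\<bar> <= 2 * r" unfolding X_def
    by (rule forest[OF fA KA]) (use gd in \<open>auto simp: good_def B_def induced_def\<close>)
   have "X / real (card A) - real (card (pfun A K)) * q = real (card (pfun A K)) * (X / real (card (pfun A K \<times> A)) - q)"
    using pf0 A0 by (simp add: card_cartesian_product right_diff_distrib)
   then have "\<bar>X / real (card A) - real (card (pfun A K)) * q\<bar> = real (card (pfun A K)) * \<bar>X / real (card (pfun A K \<times> A)) - q\<bar>"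
    by (simp add: abs_mult)
   also have "... <= real (card (pfun A K)) * (2 * r)" by (rule mult_left_mono[OF fl]) simp
   finally have "\<bar>X / real (card A) - real (card (pfun A K)) * q\<bar> <= real (card (pfun A K)) * (2 * r)" .
   moreover have "card {E'\<in>G. f E' = b} = card (pfun A K)" unfolding fib by (rule bij_betw_same_card[OF bij(1), symmetric])
   ultimately show ?thesis unfolding s1 X_def[symmetric] by simp
  qed
  have "(\<Sum>E\<in>G. g E - q) = (\<Sum>b\<in>f ` G. \<Sum>E'\<in>{E'\<in>G. f E' = b}. g E' - q)"
   by (rule sum.group[symmetric]) (use fG in auto)
  also have "\<bar>...\<bar> <= (\<Sum>b\<in>f ` G. \<bar>\<Sum>E'\<in>{E'\<in>G. f E' = b}. g E' - q\<bar>)" by (rule sum_abs)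
  also have "... <= (\<Sum>b\<in>f ` G. \<Sum>E'\<in>{E'\<in>G. f E' = b}. 2 * r)" by (rule sum_mono[OF fibre])
  also have "... = (\<Sum>E\<in>G. 2 * r)" by (rule sum.group) (use fG in auto)
  also have "... = 2 * r * real (card G)" by simp
  also have "... <= 2 * r * real (pc n m)"
   using card_mono[OF fpl G_sub] eps unfolding cpl by (intro mult_left_mono) auto
  finally have sG: "\<bar>\<Sum>E\<in>G. g E - q\<bar> <= 2 * r * real (pc n m)" .
  let ?X = "{E\<in>pl ?V m. card (?L E) <= B}" and ?Y = "{E\<in>pl ?V m. h1 * real n < real (card (?L E))}"
   and ?Z = "{E\<in>pl ?V m. K0 <= card (?L E) \<and> real (card (?L E)) <= h1 * real n \<and> real (card (core E (?L E))) > h * real (card (?L E))}"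
  have cX: "real (card ?X) <= r * real (pc n m)" and cZ: "real (card ?Z) <= r * real (pc n m)"
   and sm: "(\<Sum>E\<in>pl ?V m. real (card (?L E))) <= r * h1 * (real (pc n m) * real n)" using elim p by auto
  have cY: "real (card ?Y) <= r * real (pc n m)"
  proof -
   have "(h1 * real n) * real (card ?Y) = (\<Sum>E\<in>?Y. h1 * real n)" by simp
   also have "... <= (\<Sum>E\<in>?Y. real (card (?L E)))" by (rule sum_mono) simp
   also have "... <= (\<Sum>E\<in>pl ?V m. real (card (?L E)))" by (rule sum_mono2[OF fpl]) auto
   also have "... <= r * h1 * (real (pc n m) * real n)" by (rule sm)
   also have "... = (h1 * real n) * (r * real (pc n m))" by simp
   finally show ?thesis by (rule mult_left_le_imp_le) (use d1 nn in simp)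
  qed
  have rest: "\<bar>\<Sum>E\<in>pl ?V m - G. g E - q\<bar> <= 3 * r * real (pc n m)"
  proof -
   have "\<bar>\<Sum>E\<in>pl ?V m - G. g E - q\<bar> <= (\<Sum>E\<in>pl ?V m - G. \<bar>g E - q\<bar>)" by (rule sum_abs)
   also have "... <= (\<Sum>E\<in>pl ?V m - G. 1)"
    by (rule sum_mono) (use abs_local_average_le[OF fL q] in \<open>simp add: g_def\<close>)
   also have "... = real (card (pl ?V m - G))" by simp
   also have "... <= real (card (?X \<union> (?Y \<union> ?Z)))"
   proof (intro of_nat_mono card_mono)
    show "finite (?X \<union> (?Y \<union> ?Z))" using fpl by simp
    show "pl ?V m - G \<subseteq> ?X \<union> (?Y \<union> ?Z)" by (auto simp: G_def good_def B_def not_le not_less)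
   qed
   also have "... <= real (card ?X + (card ?Y + card ?Z))"
    by (intro of_nat_mono order_trans[OF card_Un_le] add_left_mono card_Un_le)
   also have "... <= 3 * r * real (pc n m)" using cX cY cZ by simp
   finally show ?thesis .
  qed
  have "prob_L n m l H - q = (1 / real (pc n m)) * (\<Sum>E\<in>pl ?V m. g E - q)"
   using pc0 cpl by (simp add: prob_L_def g_def Let_def pc_def[symmetric] planar_graphs_pl sum_subtractf right_diff_distrib)
  also have "(\<Sum>E\<in>pl ?V m. g E - q) = (\<Sum>E\<in>pl ?V m - G. g E - q) + (\<Sum>E\<in>G. g E - q)"
   by (rule sum.subset_diff[OF G_sub fpl])
  finally have "\<bar>prob_L n m l H - q\<bar> = (1 / real (pc n m)) * \<bar>(\<Sum>E\<in>pl ?V m - G. g E - q) + (\<Sum>E\<in>G. g E - q)\<bar>"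
   by (simp add: abs_mult)
  also have "... <= (1 / real (pc n m)) * (5 * r * real (pc n m))" using sG rest by (intro mult_left_mono) auto
  also have "... = 5 * r" using pc0 by simp
  also have "... < e" using e by (simp add: r_def)
  finally show ?case unfolding p q_def by (simp add: dist_real_def)
 qed
qed

section \<open>From the filter to the sequence m\<close>

lemma filterlim_crit:
 assumes m: "\<And>n. real (m n) = real n / 2 + s n" and s: "(%n. s n / real n) \<longlonglongrightarrow> 0"
 shows "filterlim (%n. (n, m n)) crit sequentially"
 unfolding filterlim_iff
proof (intro allI impI)
 fix P assume "eventually P crit"
 then obtain D k where d: "D > 0" and P: "\<And>n m. n \<ge> k ==> \<bar>2 * real m - real n\<bar> <= D * real n ==> P (n, m)"
  unfolding eventually_crit by blast
 have "eventually (%n. dist (s n / real n) 0 < D / 2) sequentially" using s d by (intro tendstoD) auto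
 then show "eventually (%n. P (n, m n)) sequentially"
  using eventually_ge_at_top[of k] eventually_gt_at_top[of 0]
 proof eventually_elim
  case (elim n)
  then have "\<bar>s n\<bar> < D / 2 * real n" by (simp add: abs_divide divide_less_eq)
  moreover have "2 * real (m n) - real n = 2 * s n" unfolding m by simp
  ultimately show ?case using elim(2) by (intro P) (auto simp: abs_mult)
 qed
qed

theorem theorem1p4:
  fixes m :: "nat \<Rightarrow> nat" and s :: "nat \<Rightarrow> real"
  assumes m_def: "\<And>n. real (m n) = real n / 2 + s n"
    and s_pos: "\<And>n. s n > 0"
    and s_small: "(\<lambda>n. s n / real n) \<longlonglongrightarrow> 0"
    and s_large: "filterlim (\<lambda>n. s n ^ 3 / real n ^ 2) at_top sequentially"
  shows
    "(\<forall>(H :: nat rgraph) l. finite_rooted_graph H \<longrightarrow>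
       (\<lambda>n. prob_L n (m n) l H) \<longlonglongrightarrow> measure_pmf.prob (skel_ball l) {G. rooted_iso G H})
    \<and> (\<forall>(H :: nat rgraph) l. finite_rooted_graph H \<longrightarrow>
       (\<lambda>n. prob_S n (m n) l H) \<longlonglongrightarrow> measure_pmf.prob (gw_ball 1 l) {G. rooted_iso G H})
    \<and> (\<forall>(H :: nat rgraph) l. finite_rooted_graph H \<longrightarrow>
       (\<lambda>n. prob_P n (m n) l H) \<longlonglongrightarrow> measure_pmf.prob (gw_ball 1 l) {G. rooted_iso G H})"
proof -
 note lim = filterlim_crit[OF m_def s_small]
 have "(%n. prob_L n (m n) l H) \<longlonglongrightarrow> measure_pmf.prob (skel_ball l) {G. rooted_iso G H}" for l and H :: "nat rgraph"
  using filterlim_compose[OF prob_L_limit[of l H] lim] by simp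
 moreover have "(%n. prob_S n (m n) l H) \<longlonglongrightarrow> measure_pmf.prob (gw_ball 1 l) {G. rooted_iso G H}" for l and H :: "nat rgraph"
  using filterlim_compose[OF prob_S_limit[of l H] lim] by simp
 moreover have "(%n. prob_P n (m n) l H) \<longlonglongrightarrow> measure_pmf.prob (gw_ball 1 l) {G. rooted_iso G H}" for l and H :: "nat rgraph"
  using filterlim_compose[OF prob_P_limit[of l H] lim] by simp
 ultimately show ?thesis by blast
qed

end
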